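(* Let $k$ be an algebraically closed field of characteristic $p \geqslant 0$, let $\Lambda$ be a finite dimensional $k$-algebra, and let $G$ be a finite group whose elements act on $\Lambda$ as algebra automorphisms. Let $S \leqslant G$ be a Sylow $p$-subgroup, and let $E$ be a complete set of primitive orthogonal idempotents of $\Lambda$ which is closed under the action of $S$. Suppose that $S$ acts freely on $E$, and that $\Lambda \cong \Lambda^S \oplus B$ as $\Lambda^S$-bimodules for some $\Lambda^S$-bimodule $B$, where $\Lambda^S$ is the subalgebra of elements of $\Lambda$ fixed by $S$. Then $\Lambda$ and the skew group algebra $\Lambda S$ have the same strong global dimension.
   Context: If $p = 0$ or $p \nmid |G|$, the Sylow $p$-subgroup $S$ is understood to be the trivial group. Skew group algebra: $\Lambda S$ is the vector space $\Lambda \otimes_k kS$ with product determined by $(\lambda \otimes g)(\mu \otimes h) = \lambda g(\mu) \otimes gh$ for $\lambda,\mu\in\Lambda$, $g,h\in S$, where $g(\mu)$ is the image of $\mu$ under the action of $g$. A finite set $E=\{e_i\}$ of primitive orthogonal idempotents of $\Lambda$ is complete if $\sum_i e_i = 1_\Lambda$. It is closed under the action of $S$ if $g(e)\in E$ for all $e\in E$, $g \in S$. The action of $S$ on $E$ is free if no non-identity element of $S$ fixes an element of $E$. Strong global dimension of a finite dimensional algebra $A$: let ${}_A\mathcal{P}$ be the category of finitely generated projective left $A$-modules and $K^b({}_A\mathcal{P})$ the homotopy category of bounded complexes over it. Each nonzero indecomposable object $P^\bullet$ of $K^b({}_A\mathcal{P})$ is represented by a bounded complex of finitely generated projectives, unique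 up to isomorphism, that is minimal, i.e. each differential sends its source into the radical of the next term. If $r\leqslant s$ are such that the minimal representative satisfies $P^r\neq 0\neq P^s$ and $P^n=0$ for $n<r$ or $n>s$, the length is $l(P^\bullet)=s-r$. The strong global dimension of $A$ is $\sup\{l(P^\bullet) : P^\bullet\in K^b({}_A\mathcal{P}) \text{ nonzero indecomposable}\}\in\mathbb{N}\cup\{\infty\}$. (The definition is usually given for $A$ of finite global dimension; the strong global dimension is at least the global dimension, so an algebra of infinite global dimension has infinite strong global dimension.) *)

theory Defs
  imports "HOL-Algebra.Algebra" "HOL-Library.Extended_Nat"
begin

section \<open>Algebras over a field\<close>

definition has_characteristic :: "('k, 'x) ring_scheme \<Rightarrow> nat \<Rightarrow> bool" where
  "has_characteristic K p \<longleftrightarrow>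
     (\<forall>n::nat. [n] \<cdot>\<^bsub>K\<^esub> \<one>\<^bsub>K\<^esub> = \<zero>\<^bsub>K\<^esub> \<longleftrightarrow> p dvd n)"

text \<open>The library locale \<^locale>\<open>algebra\<close> is restricted to commutative algebras.\<close>

locale assoc_algebra = module K A + ring A for K (structure) and A (structure) +
  assumes smult_mult_left:
      "\<lbrakk>c \<in> carrier K; x \<in> carrier A; y \<in> carrier A\<rbrakk> \<Longrightarrow>
        (c \<odot>\<^bsub>A\<^esub> x) \<otimes>\<^bsub>A\<^esub> y = c \<odot>\<^bsub>A\<^esub> (x \<otimes>\<^bsub>A\<^esub> y)"
    and smult_mult_right:
      "\<lbrakk>c \<in> carrier K; x \<in> carrier A; y \<in> carrier A\<rbrakk> \<Longrightarrow>
        x \<otimes>\<^bsub>A\<^esub> (c \<odot>\<^bsub>A\<^esub> y) = c \<odot>\<^bsub>A\<^esub> (x \<otimes>\<^bsub>A\<^esub> y)"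

definition acts_by_automorphisms ::
  "('k, 'x) ring_scheme \<Rightarrow> ('k, 'a) module \<Rightarrow> ('g, 'y) monoid_scheme \<Rightarrow> ('g \<Rightarrow> 'a \<Rightarrow> 'a) \<Rightarrow> bool"
where
  "acts_by_automorphisms K A G \<phi> \<longleftrightarrow>
     group_action G (carrier A) \<phi> \<and>
     (\<forall>g\<in>carrier G. \<phi> g \<in> ring_hom A A \<and>
        (\<forall>c\<in>carrier K. \<forall>x\<in>carrier A. \<phi> g (c \<odot>\<^bsub>A\<^esub> x) = c \<odot>\<^bsub>A\<^esub> \<phi> g x))"

text \<open>For \<open>p = 0\<close> the Sylow \<open>p\<close>-subgroup is by convention the trivial group; for a prime \<open>p\<close>
  not dividing the order of \<open>G\<close> the cardinality condition already forces this.\<close>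

definition sylow_subgroup :: "nat \<Rightarrow> 'g set \<Rightarrow> ('g, 'y) monoid_scheme \<Rightarrow> bool" where
  "sylow_subgroup p S G \<longleftrightarrow> subgroup S G \<and>
     (if p = 0 then S = {\<one>\<^bsub>G\<^esub>} else card S = p ^ multiplicity p (order G))"

definition fixed_subalgebra :: "('k, 'a) module \<Rightarrow> 'g set \<Rightarrow> ('g \<Rightarrow> 'a \<Rightarrow> 'a) \<Rightarrow> ('k, 'a) module" where
  "fixed_subalgebra A S \<phi> = A\<lparr>carrier := {x \<in> carrier A. \<forall>g\<in>S. \<phi> g x = x}\<rparr>"

text \<open>An element \<open>\<Sum>\<^sub>g \<lambda>\<^sub>g \<otimes> g\<close> of \<open>A \<otimes> kH\<close> is encoded as the function \<open>g \<mapsto> \<lambda>\<^sub>g\<close>, extended by zero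
  outside the finite group \<open>H\<close>. The product is the bilinear extension of
  \<open>(\<lambda> \<otimes> g)(\<mu> \<otimes> h) = \<lambda> g(\<mu>) \<otimes> gh\<close>.\<close>

definition skew_group_algebra ::
  "('k, 'a) module \<Rightarrow> ('g, 'y) monoid_scheme \<Rightarrow> ('g \<Rightarrow> 'a \<Rightarrow> 'a) \<Rightarrow> ('k, 'g \<Rightarrow> 'a) module"
where
  "skew_group_algebra A H \<phi> =
    \<lparr>carrier = {f. (\<forall>g\<in>carrier H. f g \<in> carrier A) \<and> (\<forall>g. g \<notin> carrier H \<longrightarrow> f g = \<zero>\<^bsub>A\<^esub>)},
     monoid.mult = (\<lambda>f1 f2 x.
       (\<Oplus>\<^bsub>A\<^esub>q\<in>{q \<in> carrier H \<times> carrier H. fst q \<otimes>\<^bsub>H\<^esub> snd q = x}.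
          f1 (fst q) \<otimes>\<^bsub>A\<^esub> \<phi> (fst q) (f2 (snd q)))),
     one = (\<lambda>x. if x = \<one>\<^bsub>H\<^esub> then \<one>\<^bsub>A\<^esub> else \<zero>\<^bsub>A\<^esub>),
     ring.zero = (\<lambda>x. \<zero>\<^bsub>A\<^esub>),
     add = (\<lambda>f1 f2 x. f1 x \<oplus>\<^bsub>A\<^esub> f2 x),
     smult = (\<lambda>c f x. if x \<in> carrier H then c \<odot>\<^bsub>A\<^esub> f x else \<zero>\<^bsub>A\<^esub>)\<rparr>"

section \<open>Idempotents\<close>

definition idempotent_elem :: "('a, 'x) ring_scheme \<Rightarrow> 'a \<Rightarrow> bool" where
  "idempotent_elem R e \<longleftrightarrow> e \<in> carrier R \<and> e \<otimes>\<^bsub>R\<^esub> e = e"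

definition orthogonal_elems :: "('a, 'x) ring_scheme \<Rightarrow> 'a \<Rightarrow> 'a \<Rightarrow> bool" where
  "orthogonal_elems R e f \<longleftrightarrow> e \<otimes>\<^bsub>R\<^esub> f = \<zero>\<^bsub>R\<^esub> \<and> f \<otimes>\<^bsub>R\<^esub> e = \<zero>\<^bsub>R\<^esub>"

definition primitive_idempotent :: "('a, 'x) ring_scheme \<Rightarrow> 'a \<Rightarrow> bool" where
  "primitive_idempotent R e \<longleftrightarrow> idempotent_elem R e \<and> e \<noteq> \<zero>\<^bsub>R\<^esub> \<and>
     (\<forall>f1 f2. idempotent_elem R f1 \<and> idempotent_elem R f2 \<and> orthogonal_elems R f1 f2 \<and>
        e = f1 \<oplus>\<^bsub>R\<^esub> f2 \<longrightarrow> f1 = \<zero>\<^bsub>R\<^esub> \<or> f2 = \<zero>\<^bsub>R\<^esub>)"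

definition complete_primitive_idempotents :: "('a, 'x) ring_scheme \<Rightarrow> 'a set \<Rightarrow> bool" where
  "complete_primitive_idempotents R E \<longleftrightarrow> finite E \<and>
     (\<forall>e\<in>E. primitive_idempotent R e) \<and>
     (\<forall>e\<in>E. \<forall>f\<in>E. e \<noteq> f \<longrightarrow> orthogonal_elems R e f) \<and>
     (\<Oplus>\<^bsub>R\<^esub>e\<in>E. e) = \<one>\<^bsub>R\<^esub>"

definition acts_freely_on :: "('g, 'y) monoid_scheme \<Rightarrow> 'g set \<Rightarrow> ('g \<Rightarrow> 'a \<Rightarrow> 'a) \<Rightarrow> 'a set \<Rightarrow> bool" where
  "acts_freely_on G S \<phi> E \<longleftrightarrow> (\<forall>g\<in>S. \<forall>e\<in>E. \<phi> g e = e \<longrightarrow> g = \<one>\<^bsub>G\<^esub>)"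

section \<open>Modules over a not necessarily commutative ring\<close>

text \<open>Modules use the library record \<^type>\<open>module\<close>, whose fields \<open>mult\<close> and \<open>one\<close> are ignored for
  modules. The library locale \<^locale>\<open>module\<close> requires a commutative ring of scalars, but
  \<^locale>\<open>submodule\<close> does not.\<close>

locale left_module = R?: ring R + M?: abelian_group M
  for R :: "('a, 'x) ring_scheme" (structure) and M :: "('a, 'm, 'y) module_scheme" (structure) +
  assumes lsmult_closed: "\<lbrakk>a \<in> carrier R; x \<in> carrier M\<rbrakk> \<Longrightarrow> a \<odot>\<^bsub>M\<^esub> x \<in> carrier M"
    and lsmult_l_distr: "\<lbrakk>a \<in> carrier R; b \<in> carrier R; x \<in> carrier M\<rbrakk> \<Longrightarrow>
      (a \<oplus>\<^bsub>R\<^esub> b) \<odot>\<^bsub>M\<^esub> x = a \<odot>\<^bsub>M\<^esub> x \<oplus>\<^bsub>M\<^esub> b \<odot>\<^bsub>M\<^esub> x"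
    and lsmult_r_distr: "\<lbrakk>a \<in> carrier R; x \<in> carrier M; y \<in> carrier M\<rbrakk> \<Longrightarrow>
      a \<odot>\<^bsub>M\<^esub> (x \<oplus>\<^bsub>M\<^esub> y) = a \<odot>\<^bsub>M\<^esub> x \<oplus>\<^bsub>M\<^esub> a \<odot>\<^bsub>M\<^esub> y"
    and lsmult_assoc: "\<lbrakk>a \<in> carrier R; b \<in> carrier R; x \<in> carrier M\<rbrakk> \<Longrightarrow>
      (a \<otimes>\<^bsub>R\<^esub> b) \<odot>\<^bsub>M\<^esub> x = a \<odot>\<^bsub>M\<^esub> (b \<odot>\<^bsub>M\<^esub> x)"
    and lsmult_one: "x \<in> carrier M \<Longrightarrow> \<one>\<^bsub>R\<^esub> \<odot>\<^bsub>M\<^esub> x = x"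

definition mod_hom ::
  "('a, 'x) ring_scheme \<Rightarrow> ('a, 'm, 'y) module_scheme \<Rightarrow> ('a, 'n, 'z) module_scheme \<Rightarrow> ('m \<Rightarrow> 'n) set"
where
  "mod_hom R M N = {f \<in> carrier M \<rightarrow> carrier N.
     (\<forall>x\<in>carrier M. \<forall>y\<in>carrier M. f (x \<oplus>\<^bsub>M\<^esub> y) = f x \<oplus>\<^bsub>N\<^esub> f y) \<and>
     (\<forall>a\<in>carrier R. \<forall>x\<in>carrier M. f (a \<odot>\<^bsub>M\<^esub> x) = a \<odot>\<^bsub>N\<^esub> f x)}"

definition finitely_generated :: "('a, 'x) ring_scheme \<Rightarrow> ('a, 'm, 'y) module_scheme \<Rightarrow> bool" where
  "finitely_generated R M \<longleftrightarrow> (\<exists>B. finite B \<and> B \<subseteq> carrier M \<and>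
     (\<forall>N. submodule N R M \<and> B \<subseteq> N \<longrightarrow> N = carrier M))"

definition free_module :: "('a, 'x) ring_scheme \<Rightarrow> 'i set \<Rightarrow> ('a, 'i \<Rightarrow> 'a) module" where
  "free_module R I =
    \<lparr>carrier = {f. (\<forall>i\<in>I. f i \<in> carrier R) \<and> (\<forall>i. i \<notin> I \<longrightarrow> f i = \<zero>\<^bsub>R\<^esub>) \<and>
                   finite {i. f i \<noteq> \<zero>\<^bsub>R\<^esub>}},
     monoid.mult = undefined, one = undefined,
     ring.zero = (\<lambda>i. \<zero>\<^bsub>R\<^esub>),
     add = (\<lambda>f g i. f i \<oplus>\<^bsub>R\<^esub> g i),
     smult = (\<lambda>a f i. if i \<in> I then a \<otimes>\<^bsub>R\<^esub> f i else \<zero>\<^bsub>R\<^esub>)\<rparr>"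

text \<open>Projective: isomorphic to a direct summand (i.e. a retract) of a free module. Bases indexed by
  subsets of the element type of \<open>P\<close> suffice, because \<open>P\<close> is projective iff the canonical
  epimorphism from the free module on the set \<open>carrier P\<close> splits.\<close>

definition projective_module :: "('a, 'x) ring_scheme \<Rightarrow> ('a, 'm) module \<Rightarrow> bool" where
  "projective_module R P \<longleftrightarrow> left_module R P \<and>
     (\<exists>I :: 'm set. \<exists>\<iota> \<in> mod_hom R P (free_module R I). \<exists>\<pi> \<in> mod_hom R (free_module R I) P.
        \<forall>x\<in>carrier P. \<pi> (\<iota> x) = x)"

definition maximal_submodule :: "('a, 'x) ring_scheme \<Rightarrow> ('a, 'm) module \<Rightarrow> 'm set \<Rightarrow> bool" where
  "maximal_submodule R M N \<longleftrightarrow> submodule N R M \<and> N \<noteq> carrier M \<and>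
     (\<forall>N'. submodule N' R M \<and> N \<subseteq> N' \<longrightarrow> N' = N \<or> N' = carrier M)"

definition radical :: "('a, 'x) ring_scheme \<Rightarrow> ('a, 'm) module \<Rightarrow> 'm set" where
  "radical R M = carrier M \<inter> \<Inter>{N. maximal_submodule R M N}"

section \<open>Bimodules\<close>

record ('a, 'b) bimodule = "('a, 'b) module" +
  rsmult :: "'b \<Rightarrow> 'a \<Rightarrow> 'b"

definition bimodule_over :: "('a, 'x) ring_scheme \<Rightarrow> ('a, 'b) bimodule \<Rightarrow> bool" where
  "bimodule_over R M \<longleftrightarrow> left_module R M \<and>
     (\<forall>x\<in>carrier M. \<forall>a\<in>carrier R. rsmult M x a \<in> carrier M) \<and>
     (\<forall>x\<in>carrier M. \<forall>y\<in>carrier M. \<forall>a\<in>carrier R.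
        rsmult M (x \<oplus>\<^bsub>M\<^esub> y) a = rsmult M x a \<oplus>\<^bsub>M\<^esub> rsmult M y a) \<and>
     (\<forall>x\<in>carrier M. \<forall>a\<in>carrier R. \<forall>b\<in>carrier R.
        rsmult M x (a \<oplus>\<^bsub>R\<^esub> b) = rsmult M x a \<oplus>\<^bsub>M\<^esub> rsmult M x b) \<and>
     (\<forall>x\<in>carrier M. \<forall>a\<in>carrier R. \<forall>b\<in>carrier R.
        rsmult M x (a \<otimes>\<^bsub>R\<^esub> b) = rsmult M (rsmult M x a) b) \<and>
     (\<forall>x\<in>carrier M. rsmult M x \<one>\<^bsub>R\<^esub> = x) \<and>
     (\<forall>x\<in>carrier M. \<forall>a\<in>carrier R. \<forall>b\<in>carrier R.
        rsmult M (a \<odot>\<^bsub>M\<^esub> x) b = a \<odot>\<^bsub>M\<^esub> rsmult M x b)"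

text \<open>A ring as a bimodule over any of its subrings, via multiplication.\<close>

definition mult_bimodule :: "('a, 'x) ring_scheme \<Rightarrow> ('a, 'a) bimodule" where
  "mult_bimodule A =
    \<lparr>carrier = carrier A, monoid.mult = monoid.mult A, one = one A, ring.zero = ring.zero A, add = add A,
     smult = monoid.mult A, rsmult = monoid.mult A\<rparr>"

definition bimodule_sum :: "('a, 'b) bimodule \<Rightarrow> ('a, 'c) bimodule \<Rightarrow> ('a, 'b \<times> 'c) bimodule" where
  "bimodule_sum M N =
    \<lparr>carrier = carrier M \<times> carrier N,
     monoid.mult = undefined, one = undefined,
     ring.zero = (\<zero>\<^bsub>M\<^esub>, \<zero>\<^bsub>N\<^esub>),
     add = (\<lambda>x y. (fst x \<oplus>\<^bsub>M\<^esub> fst y, snd x \<oplus>\<^bsub>N\<^esub> snd y)),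
     smult = (\<lambda>a x. (a \<odot>\<^bsub>M\<^esub> fst x, a \<odot>\<^bsub>N\<^esub> snd x)),
     rsmult = (\<lambda>x a. (rsmult M (fst x) a, rsmult N (snd x) a))\<rparr>"

definition bimodule_iso ::
  "('a, 'x) ring_scheme \<Rightarrow> ('a, 'b) bimodule \<Rightarrow> ('a, 'c) bimodule \<Rightarrow> bool" where
  "bimodule_iso R M N \<longleftrightarrow> (\<exists>f \<in> mod_hom R M N. bij_betw f (carrier M) (carrier N) \<and>
     (\<forall>x\<in>carrier M. \<forall>a\<in>carrier R. f (rsmult M x a) = rsmult N (f x) a))"

section \<open>The homotopy category of bounded complexes of projectives\<close>

record ('a, 'm) cochain_complex =
  obj :: "int \<Rightarrow> ('a, 'm) module"
  dif :: "int \<Rightarrow> 'm \<Rightarrow> 'm"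

definition zero_outside :: "('a, 'm) cochain_complex \<Rightarrow> int \<Rightarrow> int \<Rightarrow> bool" where
  "zero_outside P r s \<longleftrightarrow> (\<forall>n. n < r \<or> n > s \<longrightarrow> carrier (obj P n) = {\<zero>\<^bsub>obj P n\<^esub>})"

definition Kb_object :: "('a, 'x) ring_scheme \<Rightarrow> ('a, 'm) cochain_complex \<Rightarrow> bool" where
  "Kb_object R P \<longleftrightarrow>
     (\<forall>n. finitely_generated R (obj P n) \<and> projective_module R (obj P n)) \<and>
     (\<forall>n. dif P n \<in> mod_hom R (obj P n) (obj P (n + 1))) \<and>
     (\<forall>n. \<forall>x\<in>carrier (obj P n). dif P (n + 1) (dif P n x) = \<zero>\<^bsub>obj P (n + 2)\<^esub>) \<and>
     (\<exists>r s. zero_outside P r s)"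

definition chain_map ::
  "('a, 'x) ring_scheme \<Rightarrow> ('a, 'm) cochain_complex \<Rightarrow> ('a, 'm) cochain_complex \<Rightarrow> (int \<Rightarrow> 'm \<Rightarrow> 'm) set"
where
  "chain_map R P Q = {f. \<forall>n. f n \<in> mod_hom R (obj P n) (obj Q n) \<and>
     (\<forall>x\<in>carrier (obj P n). f (n + 1) (dif P n x) = dif Q n (f n x))}"

definition homotopic ::
  "('a, 'x) ring_scheme \<Rightarrow> ('a, 'm) cochain_complex \<Rightarrow> ('a, 'm) cochain_complex \<Rightarrow>
     (int \<Rightarrow> 'm \<Rightarrow> 'm) \<Rightarrow> (int \<Rightarrow> 'm \<Rightarrow> 'm) \<Rightarrow> bool"
where
  "homotopic R P Q f g \<longleftrightarrow> (\<exists>h. (\<forall>n. h n \<in> mod_hom R (obj P n) (obj Q (n - 1))) \<and>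
     (\<forall>n. \<forall>x\<in>carrier (obj P n).
        f n x = g n x \<oplus>\<^bsub>obj Q n\<^esub> (dif Q (n - 1) (h n x) \<oplus>\<^bsub>obj Q n\<^esub> h (n + 1) (dif P n x))))"

definition id_map :: "int \<Rightarrow> 'm \<Rightarrow> 'm" where
  "id_map n x = x"

definition zero_map :: "('a, 'm) cochain_complex \<Rightarrow> int \<Rightarrow> 'm \<Rightarrow> 'm" where
  "zero_map Q n x = \<zero>\<^bsub>obj Q n\<^esub>"

definition comp_map :: "(int \<Rightarrow> 'm \<Rightarrow> 'm) \<Rightarrow> (int \<Rightarrow> 'm \<Rightarrow> 'm) \<Rightarrow> int \<Rightarrow> 'm \<Rightarrow> 'm" where
  "comp_map g f n x = g n (f n x)"

definition add_map ::
  "('a, 'm) cochain_complex \<Rightarrow> (int \<Rightarrow> 'm \<Rightarrow> 'm) \<Rightarrow> (int \<Rightarrow> 'm \<Rightarrow> 'm) \<Rightarrow> int \<Rightarrow> 'm \<Rightarrow> 'm" where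
  "add_map Q f g n x = f n x \<oplus>\<^bsub>obj Q n\<^esub> g n x"

definition Kb_zero :: "('a, 'x) ring_scheme \<Rightarrow> ('a, 'm) cochain_complex \<Rightarrow> bool" where
  "Kb_zero R P \<longleftrightarrow> homotopic R P P id_map (zero_map P)"

definition Kb_iso ::
  "('a, 'x) ring_scheme \<Rightarrow> ('a, 'm) cochain_complex \<Rightarrow> ('a, 'm) cochain_complex \<Rightarrow> bool" where
  "Kb_iso R P Q \<longleftrightarrow> (\<exists>f \<in> chain_map R P Q. \<exists>g \<in> chain_map R Q P.
     homotopic R P P (comp_map g f) id_map \<and> homotopic R Q Q (comp_map f g) id_map)"

text \<open>\<open>P \<cong> U \<oplus> V\<close> in the homotopy category, expressed by the biproduct identities.\<close>

definition Kb_biproduct ::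
  "('a, 'x) ring_scheme \<Rightarrow> ('a, 'm) cochain_complex \<Rightarrow> ('a, 'm) cochain_complex \<Rightarrow>
     ('a, 'm) cochain_complex \<Rightarrow> bool"
where
  "Kb_biproduct R P U V \<longleftrightarrow>
     (\<exists>i1 \<in> chain_map R U P. \<exists>p1 \<in> chain_map R P U. \<exists>i2 \<in> chain_map R V P. \<exists>p2 \<in> chain_map R P V.
        homotopic R U U (comp_map p1 i1) id_map \<and>
        homotopic R V V (comp_map p2 i2) id_map \<and>
        homotopic R U V (comp_map p2 i1) (zero_map V) \<and>
        homotopic R V U (comp_map p1 i2) (zero_map U) \<and>
        homotopic R P P (add_map P (comp_map i1 p1) (comp_map i2 p2)) id_map)"

definition Kb_indecomposable :: "('a, 'x) ring_scheme \<Rightarrow> ('a, 'm) cochain_complex \<Rightarrow> bool" where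
  "Kb_indecomposable R P \<longleftrightarrow> Kb_object R P \<and> \<not> Kb_zero R P \<and>
     (\<forall>U V. Kb_object R U \<and> Kb_object R V \<and> Kb_biproduct R P U V \<longrightarrow> Kb_zero R U \<or> Kb_zero R V)"

definition minimal_complex :: "('a, 'x) ring_scheme \<Rightarrow> ('a, 'm) cochain_complex \<Rightarrow> bool" where
  "minimal_complex R P \<longleftrightarrow>
     (\<forall>n. dif P n ` carrier (obj P n) \<subseteq> radical R (obj P (n + 1)))"

text \<open>\<open>Kb_length R P l\<close>: the complex \<open>P\<close> has length \<open>l\<close>, measured on a minimal representative \<open>Q\<close> of
  \<open>P\<close> in the homotopy category. Over a finite dimensional algebra such a \<open>Q\<close> exists and is unique up
  to isomorphism of complexes.\<close>

definition Kb_length :: "('a, 'x) ring_scheme \<Rightarrow> ('a, 'm) cochain_complex \<Rightarrow> nat \<Rightarrow> bool" where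
  "Kb_length R P l \<longleftrightarrow> (\<exists>Q r s. Kb_object R Q \<and> Kb_iso R P Q \<and> minimal_complex R Q \<and>
     r \<le> s \<and> zero_outside Q r s \<and>
     carrier (obj Q r) \<noteq> {\<zero>\<^bsub>obj Q r\<^esub>} \<and> carrier (obj Q s) \<noteq> {\<zero>\<^bsub>obj Q s\<^esub>} \<and>
     l = nat (s - r))"

text \<open>The supremum ranges over complexes of modules whose elements have type \<^typ>\<open>nat \<Rightarrow> 'a\<close>.
  Every finitely generated \<open>R\<close>-module is isomorphic to one of these: \<open>R\<^sup>n\<close> embeds into this type, and
  a quotient of \<open>R\<^sup>n\<close> can be carried by a set of coset representatives. So up to equivalence this is
  the full homotopy category.\<close>

definition strong_global_dimension :: "('a, 'x) ring_scheme \<Rightarrow> enat" where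
  "strong_global_dimension R =
     Sup {enat l | l. \<exists>P :: ('a, nat \<Rightarrow> 'a) cochain_complex. Kb_indecomposable R P \<and> Kb_length R P l}"

end

theory Submission
  imports Defs
begin

text \<open>Let \<open>e\<close> be the sum of representatives of the \<open>S\<close>-orbits on \<open>E\<close>. Since the action is free, the
  idempotents \<open>e\<^sub>h = h(e)\<close> for \<open>h\<close> in \<open>S\<close> are orthogonal with sum \<open>1\<close>. With the bimodule projection
  \<open>\<pi>\<close> of \<open>\<Lambda>\<close> onto \<open>\<Lambda>\<^sup>S\<close>, the element \<open>z = \<Sum>\<^sub>h e\<^sub>h \<pi>(e\<^sub>h) e\<^sub>h\<close> is central in \<open>\<Lambda>\<close> and has trace \<open>1\<close>, so
  \<open>\<Lambda>S\<close> is separable over \<open>\<Lambda>\<close>: every complex over \<open>\<Lambda>S\<close> is a retract of one induced from \<open>\<Lambda>\<close>. Conversely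
  every complex over \<open>\<Lambda>\<close> is a retract of the restriction of the complex it induces over \<open>\<Lambda>S\<close>.

  Let an indecomposable \<open>P\<close> be a retract of \<open>F(Y)\<close>, where \<open>F\<close> is induction or restriction. Since the
  endomorphism ring of \<open>P\<close> is local, \<open>Y\<close> may be replaced by a direct summand, and one of least total
  length is indecomposable and minimal. If \<open>Y\<close> vanishes in some degree, then on the minimal
  representative of \<open>P\<close> the identity is null-homotopic in that degree, hence has its image in the radical there,
  so the representative vanishes in that degree as well. Thus \<open>l(P) \<le> l(Y)\<close>.\<close>

section \<open>Finite sums and additive maps\<close>

text \<open>When the characteristic divides \<open>|S|\<close>, the average with factor
  \<open>1/|S|\<close>, which usually makes a linear map equivariant, does not exist. The central
  element \<open>z\<close> replaces this factor: centrality keeps multiplication by \<open>z\<close>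
  linear over \<Lambda>, and its conjugates under \<open>S\<close> add up to the identity on every
  module over the skew group algebra. Both comparisons are instances of one transfer statement. It
  relates \<open>P\<close> to \<open>Y\<close> by a factorisation over the common subring \<Lambda>:
  the identity of \<open>P\<close> is homotopic to an average of a \<Lambda>-linear map that passes
  through \<open>Y\<close>. Towards \<Lambda> the average is the sum over \<open>S\<close>; towards
  the skew group algebra it has a single term. Idempotents up to homotopy are awkward to split.
  Fitting's lemma is therefore applied to actual chain endomorphisms, where kernels and images of
  powers stabilise in each of the finitely many nonzero degrees. It yields idempotent chain maps,
  whose images are honest subcomplexes with the same element type; homotopies enter only
  afterwards.\<close>

lemma (in abelian_monoid) finsum_swap:
  assumes "finite A" "finite B" "\<And>i j. i \<in> A \<Longrightarrow> j \<in> B \<Longrightarrow> f i j \<in> carrier G"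
  shows "(\<Oplus>i\<in>A. \<Oplus>j\<in>B. f i j) = (\<Oplus>j\<in>B. \<Oplus>i\<in>A. f i j)"
  using assms(1,3)
proof (induction A)
  case empty
  then show ?case by simp
next
  case (insert a A)
  have "(\<Oplus>i\<in>insert a A. \<Oplus>j\<in>B. f i j) = (\<Oplus>j\<in>B. f a j) \<oplus> (\<Oplus>j\<in>B. \<Oplus>i\<in>A. f i j)"
    using insert by (subst finsum_insert) (auto intro!: finsum_closed)
  also have "\<dots> = (\<Oplus>j\<in>B. f a j \<oplus> (\<Oplus>i\<in>A. f i j))"
    using insert by (intro finsum_addf[symmetric]) (auto intro!: finsum_closed)
  also have "\<dots> = (\<Oplus>j\<in>B. \<Oplus>i\<in>insert a A. f i j)"
    using insert by (intro finsum_cong') (auto intro!: finsum_closed)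
  finally show ?case .
qed

lemma (in abelian_monoid) finsum_single:
  assumes "finite A" "a \<in> A" "f a \<in> carrier G" "\<And>i. i \<in> A \<Longrightarrow> i \<noteq> a \<Longrightarrow> f i = \<zero>"
  shows "(\<Oplus>i\<in>A. f i) = f a"
proof -
  have "(\<Oplus>i\<in>A. f i) = (\<Oplus>i\<in>A. if a = i then f i else \<zero>)"
    using assms by (intro finsum_cong') auto
  also have "\<dots> = f a"
    using finsum_singleton[of a A f] assms
    by (metis (no_types, lifting) Pi_I add.finprod_singleton assms(3) finsum_cong' zero_closed
        finsum_Un_disjoint finsum_insert finsum_zero insert_Diff finite_Diff Diff_iff insertI1 r_zero)
  finally show ?thesis .
qed

lemma additive_map_zero:
  assumes "abelian_group M" "abelian_group N" "f \<in> carrier M \<rightarrow> carrier N"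
    "\<And>x y. x \<in> carrier M \<Longrightarrow> y \<in> carrier M \<Longrightarrow> f (x \<oplus>\<^bsub>M\<^esub> y) = f x \<oplus>\<^bsub>N\<^esub> f y"
  shows "f \<zero>\<^bsub>M\<^esub> = \<zero>\<^bsub>N\<^esub>"
proof -
  interpret M: abelian_group M by fact
  interpret N: abelian_group N by fact
  have "f \<zero>\<^bsub>M\<^esub> \<oplus>\<^bsub>N\<^esub> f \<zero>\<^bsub>M\<^esub> = f \<zero>\<^bsub>M\<^esub>"
    using assms(4)[of "\<zero>\<^bsub>M\<^esub>" "\<zero>\<^bsub>M\<^esub>"] by simp
  then show ?thesis
    using assms(3) by (metis M.zero_closed N.add.r_cancel_one' PiE)
qed

lemma additive_map_minus:
  assumes "abelian_group M" "abelian_group N" "f \<in> carrier M \<rightarrow> carrier N"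
    "\<And>x y. x \<in> carrier M \<Longrightarrow> y \<in> carrier M \<Longrightarrow> f (x \<oplus>\<^bsub>M\<^esub> y) = f x \<oplus>\<^bsub>N\<^esub> f y"
    "x \<in> carrier M"
  shows "f (\<ominus>\<^bsub>M\<^esub> x) = \<ominus>\<^bsub>N\<^esub> f x"
proof -
  interpret M: abelian_group M by fact
  interpret N: abelian_group N by fact
  have "f (\<ominus>\<^bsub>M\<^esub> x) \<oplus>\<^bsub>N\<^esub> f x = \<zero>\<^bsub>N\<^esub>"
    using assms(4)[of "\<ominus>\<^bsub>M\<^esub> x" x] additive_map_zero[OF assms(1-4)] assms(5) by (simp add: M.l_neg)
  then show ?thesis
    using assms(3,5) by (intro N.minus_equality[symmetric]) auto
qed

lemma additive_map_finsum:
  assumes "abelian_group M" "abelian_group N" "f \<in> carrier M \<rightarrow> carrier N"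
    "\<And>x y. x \<in> carrier M \<Longrightarrow> y \<in> carrier M \<Longrightarrow> f (x \<oplus>\<^bsub>M\<^esub> y) = f x \<oplus>\<^bsub>N\<^esub> f y"
    "g \<in> A \<rightarrow> carrier M"
  shows "f (\<Oplus>\<^bsub>M\<^esub>i\<in>A. g i) = (\<Oplus>\<^bsub>N\<^esub>i\<in>A. f (g i))"
proof -
  interpret M: abelian_group M by fact
  interpret N: abelian_group N by fact
  show ?thesis
  proof (cases "finite A")
    case True
    then show ?thesis using assms(5)
    proof (induction A)
      case empty
      then show ?case using additive_map_zero[OF assms(1-4)] by simp
    next
      case (insert a A)
      then have g: "g a \<in> carrier M" "g \<in> A \<rightarrow> carrier M" by auto
      then have "f (g a \<oplus>\<^bsub>M\<^esub> finsum M g A) = f (g a) \<oplus>\<^bsub>N\<^esub> f (finsum M g A)"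
        by (intro assms(4)) (auto intro!: M.finsum_closed)
      moreover have "(\<lambda>i. f (g i)) \<in> insert a A \<rightarrow> carrier N"
        using insert.prems assms(3) by auto
      ultimately show ?case using insert g by auto
    qed
  next
    case False
    then show ?thesis using additive_map_zero[OF assms(1-4)] by simp
  qed
qed

section \<open>Modules and linear maps\<close>

context left_module
begin

lemma abelian_group_self: "abelian_group M" ..

lemma lsmult_finsum_right:
  assumes "a \<in> carrier R" "f \<in> A \<rightarrow> carrier M"
  shows "a \<odot>\<^bsub>M\<^esub> (\<Oplus>\<^bsub>M\<^esub>i\<in>A. f i) = (\<Oplus>\<^bsub>M\<^esub>i\<in>A. a \<odot>\<^bsub>M\<^esub> f i)"
  using assms by (intro additive_map_finsum[where f="\<lambda>x. a \<odot>\<^bsub>M\<^esub> x"])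
    (auto intro: lsmult_closed lsmult_r_distr abelian_group_self)

lemma lsmult_finsum_left:
  assumes "x \<in> carrier M" "f \<in> A \<rightarrow> carrier R"
  shows "(\<Oplus>\<^bsub>R\<^esub>i\<in>A. f i) \<odot>\<^bsub>M\<^esub> x = (\<Oplus>\<^bsub>M\<^esub>i\<in>A. f i \<odot>\<^bsub>M\<^esub> x)"
  using assms by (intro additive_map_finsum[where f="\<lambda>a. a \<odot>\<^bsub>M\<^esub> x"])
    (auto intro: lsmult_closed lsmult_l_distr abelian_group_self R.abelian_group_axioms)

lemma lsmult_zero_right: "a \<in> carrier R \<Longrightarrow> a \<odot>\<^bsub>M\<^esub> \<zero>\<^bsub>M\<^esub> = \<zero>\<^bsub>M\<^esub>"
  by (intro additive_map_zero[where f="\<lambda>x. a \<odot>\<^bsub>M\<^esub> x"])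
    (auto intro: lsmult_closed lsmult_r_distr abelian_group_self)

lemma lsmult_zero_left: "x \<in> carrier M \<Longrightarrow> \<zero>\<^bsub>R\<^esub> \<odot>\<^bsub>M\<^esub> x = \<zero>\<^bsub>M\<^esub>"
  by (intro additive_map_zero[where f="\<lambda>a. a \<odot>\<^bsub>M\<^esub> x"])
    (auto intro: lsmult_closed lsmult_l_distr abelian_group_self R.abelian_group_axioms)

lemma lsmult_minus_right:
  "a \<in> carrier R \<Longrightarrow> x \<in> carrier M \<Longrightarrow> a \<odot>\<^bsub>M\<^esub> (\<ominus>\<^bsub>M\<^esub> x) = \<ominus>\<^bsub>M\<^esub> (a \<odot>\<^bsub>M\<^esub> x)"
  by (intro additive_map_minus[where f="\<lambda>x. a \<odot>\<^bsub>M\<^esub> x"])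
    (auto intro: lsmult_closed lsmult_r_distr abelian_group_self)

text \<open>Negatives are multiples by the negative of the unit, so closure under addition and
  scalars covers them.\<close>

lemma lsubmoduleI:
  assumes "N \<subseteq> carrier M" "\<zero>\<^bsub>M\<^esub> \<in> N"
    "\<And>x y. x \<in> N \<Longrightarrow> y \<in> N \<Longrightarrow> x \<oplus>\<^bsub>M\<^esub> y \<in> N"
    "\<And>a x. a \<in> carrier R \<Longrightarrow> x \<in> N \<Longrightarrow> a \<odot>\<^bsub>M\<^esub> x \<in> N"
  shows "submodule N R M"
proof -
  have "\<ominus>\<^bsub>M\<^esub> x \<in> N" if "x \<in> N" for x
  proof -
    have x: "x \<in> carrier M" using that assms(1) by auto
    have "(\<ominus>\<^bsub>R\<^esub> \<one>\<^bsub>R\<^esub>) \<odot>\<^bsub>M\<^esub> x = \<ominus>\<^bsub>M\<^esub> (\<one>\<^bsub>R\<^esub> \<odot>\<^bsub>M\<^esub> x)"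
      using x by (intro additive_map_minus[where f="\<lambda>a. a \<odot>\<^bsub>M\<^esub> x"])
        (auto intro: lsmult_closed lsmult_l_distr abelian_group_self R.abelian_group_axioms)
    then show ?thesis
      using assms(4)[of "\<ominus>\<^bsub>R\<^esub> \<one>\<^bsub>R\<^esub>" x] that x by (simp add: lsmult_one)
  qed
  then show ?thesis
    using assms by (intro submodule.intro subgroup.intro submodule_axioms.intro) (auto simp: a_inv_def)
qed

end

context
  fixes N :: "'m set" and R :: "('a, 'x) ring_scheme" and M :: "('a, 'm, 'y) module_scheme"
  assumes N: "submodule N R M"
begin

lemma submodule_subset: "N \<subseteq> carrier M"
  using subgroup.subset[OF submodule.axioms(1)[OF N]] by simp

lemma submodule_zero: "\<zero>\<^bsub>M\<^esub> \<in> N"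
  using subgroup.one_closed[OF submodule.axioms(1)[OF N]] by simp

lemma submodule_add: "x \<in> N \<Longrightarrow> y \<in> N \<Longrightarrow> x \<oplus>\<^bsub>M\<^esub> y \<in> N"
  using subgroup.m_closed[OF submodule.axioms(1)[OF N]] by simp

lemma submodule_minus: "x \<in> N \<Longrightarrow> \<ominus>\<^bsub>M\<^esub> x \<in> N"
  using subgroup.m_inv_closed[OF submodule.axioms(1)[OF N]] by (simp add: a_inv_def)

lemma submodule_smult: "a \<in> carrier R \<Longrightarrow> x \<in> N \<Longrightarrow> a \<odot>\<^bsub>M\<^esub> x \<in> N"
  using submodule.smult_closed[OF N] .

end

lemma (in abelian_group) abelian_group_restrict:
  assumes "H \<subseteq> carrier G" "\<zero> \<in> H" "\<And>x y. x \<in> H \<Longrightarrow> y \<in> H \<Longrightarrow> x \<oplus> y \<in> H" "\<And>x. x \<in> H \<Longrightarrow> \<ominus> x \<in> H"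
  shows "abelian_group (G\<lparr>carrier := H\<rparr>)"
proof (rule abelian_groupI, goal_cases)
  case (6 x)
  then show ?case using assms by (auto intro!: bexI[of _ "\<ominus> x"] simp: l_neg)
qed (use assms in \<open>auto simp: a_ac subset_iff\<close>)

lemma left_module_submodule:
  assumes M: "left_module R M" and N: "submodule N R M"
  shows "left_module R (M\<lparr>carrier := N\<rparr>)"
proof -
  interpret M: left_module R M by fact
  have "abelian_group (M\<lparr>carrier := N\<rparr>)"
    using submodule_subset[OF N] submodule_zero[OF N] submodule_add[OF N] submodule_minus[OF N]
    by (intro M.M.abelian_group_restrict)
  then show ?thesis
    using submodule_subset[OF N] submodule_smult[OF N]
    by (intro left_module.intro left_module_axioms.intro M.R.ring_axioms)
      (auto simp: subset_iff M.lsmult_l_distr M.lsmult_r_distr M.lsmult_assoc M.lsmult_one)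
qed

lemma submodule_trans:
  assumes M: "left_module R M" and N: "submodule N R M" and L: "submodule L R (M\<lparr>carrier := N\<rparr>)"
  shows "submodule L R M"
proof -
  interpret M: left_module R M by fact
  show ?thesis
    using submodule_subset[OF L] submodule_zero[OF L] submodule_add[OF L] submodule_smult[OF L]
      submodule_subset[OF N]
    by (intro M.lsubmoduleI) auto
qed

lemma submodule_carrier: "left_module R M \<Longrightarrow> submodule (carrier M) R M"
  by (intro left_module.lsubmoduleI)
    (auto intro: left_module.lsmult_closed abelian_monoid.a_closed abelian_monoid.zero_closed
      abelian_group.axioms left_module.axioms)

lemma submodule_zero_set: "left_module R M \<Longrightarrow> submodule {\<zero>\<^bsub>M\<^esub>} R M"
  by (intro left_module.lsubmoduleI)
    (auto simp: left_module.lsmult_zero_right abelian_monoid.l_zero abelian_monoid.zero_closed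
      abelian_group.axioms left_module.axioms)

section \<open>Linear maps, their kernels, images and preimages\<close>

lemma mod_homI:
  assumes "\<And>x. x \<in> carrier M \<Longrightarrow> f x \<in> carrier N"
    "\<And>x y. x \<in> carrier M \<Longrightarrow> y \<in> carrier M \<Longrightarrow> f (x \<oplus>\<^bsub>M\<^esub> y) = f x \<oplus>\<^bsub>N\<^esub> f y"
    "\<And>a x. a \<in> carrier R \<Longrightarrow> x \<in> carrier M \<Longrightarrow> f (a \<odot>\<^bsub>M\<^esub> x) = a \<odot>\<^bsub>N\<^esub> f x"
  shows "f \<in> mod_hom R M N"
  using assms by (auto simp: mod_hom_def)

lemma mod_hom_closed: "f \<in> mod_hom R M N \<Longrightarrow> x \<in> carrier M \<Longrightarrow> f x \<in> carrier N"
  by (auto simp: mod_hom_def)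

lemma mod_hom_add:
  "f \<in> mod_hom R M N \<Longrightarrow> x \<in> carrier M \<Longrightarrow> y \<in> carrier M \<Longrightarrow> f (x \<oplus>\<^bsub>M\<^esub> y) = f x \<oplus>\<^bsub>N\<^esub> f y"
  by (auto simp: mod_hom_def)

lemma mod_hom_smult:
  "f \<in> mod_hom R M N \<Longrightarrow> a \<in> carrier R \<Longrightarrow> x \<in> carrier M \<Longrightarrow> f (a \<odot>\<^bsub>M\<^esub> x) = a \<odot>\<^bsub>N\<^esub> f x"
  by (auto simp: mod_hom_def)

lemma mod_hom_zero:
  "left_module R M \<Longrightarrow> left_module R N \<Longrightarrow> f \<in> mod_hom R M N \<Longrightarrow> f \<zero>\<^bsub>M\<^esub> = \<zero>\<^bsub>N\<^esub>"
  by (intro additive_map_zero)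
    (auto simp: mod_hom_add intro: left_module.abelian_group_self mod_hom_closed)

lemma mod_hom_minus:
  "left_module R M \<Longrightarrow> left_module R N \<Longrightarrow> f \<in> mod_hom R M N \<Longrightarrow> x \<in> carrier M \<Longrightarrow>
    f (\<ominus>\<^bsub>M\<^esub> x) = \<ominus>\<^bsub>N\<^esub> f x"
  by (intro additive_map_minus)
    (auto simp: mod_hom_add intro: left_module.abelian_group_self mod_hom_closed)

lemma mod_hom_finsum:
  "left_module R M \<Longrightarrow> left_module R N \<Longrightarrow> f \<in> mod_hom R M N \<Longrightarrow> g \<in> A \<rightarrow> carrier M \<Longrightarrow>
    f (\<Oplus>\<^bsub>M\<^esub>i\<in>A. g i) = (\<Oplus>\<^bsub>N\<^esub>i\<in>A. f (g i))"
  by (intro additive_map_finsum)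
    (auto simp: mod_hom_add intro: left_module.abelian_group_self mod_hom_closed)

lemma mod_hom_id: "(\<lambda>x. x) \<in> mod_hom R M M"
  by (auto simp: mod_hom_def)

lemma mod_hom_comp:
  "f \<in> mod_hom R M N \<Longrightarrow> g \<in> mod_hom R N L \<Longrightarrow> (\<lambda>x. g (f x)) \<in> mod_hom R M L"
  by (intro mod_homI) (metis mod_hom_closed mod_hom_add mod_hom_smult)+

lemma mod_hom_const_zero:
  assumes "left_module R N"
  shows "(\<lambda>x. \<zero>\<^bsub>N\<^esub>) \<in> mod_hom R M N"
proof -
  interpret left_module R N by fact
  show ?thesis by (intro mod_homI) (auto simp: lsmult_zero_right)
qed

lemma mod_hom_plus:
  assumes "left_module R N" "f \<in> mod_hom R M N" "g \<in> mod_hom R M N"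
  shows "(\<lambda>x. f x \<oplus>\<^bsub>N\<^esub> g x) \<in> mod_hom R M N"
proof -
  interpret left_module R N by fact
  note [simp] = mod_hom_closed[OF assms(2)] mod_hom_closed[OF assms(3)]
  show ?thesis
    using mod_hom_add[OF assms(2)] mod_hom_add[OF assms(3)]
      mod_hom_smult[OF assms(2)] mod_hom_smult[OF assms(3)]
    by (intro mod_homI) (simp_all add: lsmult_r_distr M.a_ac)
qed

lemma mod_hom_uminus:
  assumes "left_module R N" "f \<in> mod_hom R M N"
  shows "(\<lambda>x. \<ominus>\<^bsub>N\<^esub> f x) \<in> mod_hom R M N"
proof -
  interpret left_module R N by fact
  note [simp] = mod_hom_closed[OF assms(2)]
  show ?thesis
    using mod_hom_add[OF assms(2)] mod_hom_smult[OF assms(2)]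
    by (intro mod_homI) (simp_all add: lsmult_minus_right M.minus_add)
qed

lemma submodule_kernel:
  assumes "left_module R M" "left_module R N" "f \<in> mod_hom R M N"
  shows "submodule {x \<in> carrier M. f x = \<zero>\<^bsub>N\<^esub>} R M"
proof -
  interpret M: left_module R M by fact
  interpret N: left_module R N by fact
  show ?thesis
    using mod_hom_add[OF assms(3)] mod_hom_smult[OF assms(3)] mod_hom_zero[OF assms]
    by (intro M.lsubmoduleI) (auto simp: M.lsmult_closed N.lsmult_zero_right)
qed

lemma submodule_vimage:
  assumes "left_module R M" "left_module R N" "f \<in> mod_hom R M N" "submodule L R N"
  shows "submodule {x \<in> carrier M. f x \<in> L} R M"
proof -
  interpret M: left_module R M by fact
  show ?thesis
    using mod_hom_add[OF assms(3)] mod_hom_smult[OF assms(3)] mod_hom_zero[OF assms(1-3)]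
      submodule_zero[OF assms(4)] submodule_add[OF assms(4)] submodule_smult[OF assms(4)]
    by (intro M.lsubmoduleI) (auto simp: M.lsmult_closed)
qed

lemma submodule_image:
  assumes "left_module R M" "left_module R N" "f \<in> mod_hom R M N" "submodule L R M"
  shows "submodule (f ` L) R N"
proof -
  interpret N: left_module R N by fact
  have L: "x \<in> carrier M" if "x \<in> L" for x using submodule_subset[OF assms(4)] that by auto
  show ?thesis
  proof (rule N.lsubmoduleI)
    show "f ` L \<subseteq> carrier N" using L mod_hom_closed[OF assms(3)] by auto
    show "\<zero>\<^bsub>N\<^esub> \<in> f ` L"
      using mod_hom_zero[OF assms(1-3)] submodule_zero[OF assms(4)] by force
  next
    fix x y assume "x \<in> f ` L" "y \<in> f ` L"
    then obtain x' y' where "x = f x'" "y = f y'" "x' \<in> L" "y' \<in> L" by auto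
    then show "x \<oplus>\<^bsub>N\<^esub> y \<in> f ` L"
      using mod_hom_add[OF assms(3), of x' y'] L submodule_add[OF assms(4), of x' y'] by (metis imageI)
  next
    fix a x assume "a \<in> carrier R" "x \<in> f ` L"
    then obtain x' where "x = f x'" "x' \<in> L" by auto
    then show "a \<odot>\<^bsub>N\<^esub> x \<in> f ` L"
      using mod_hom_smult[OF assms(3) \<open>a \<in> carrier R\<close>, of x'] L
        submodule_smult[OF assms(4) \<open>a \<in> carrier R\<close>, of x'] by (metis imageI)
  qed
qed

lemma submodule_sum:
  assumes "left_module R M" "submodule L R M" "submodule N R M"
  shows "submodule {x \<oplus>\<^bsub>M\<^esub> y |x y. x \<in> L \<and> y \<in> N} R M"
proof -
  interpret M: left_module R M by fact
  have L: "x \<in> carrier M" if "x \<in> L" for x using submodule_subset[OF assms(2)] that by auto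
  have N: "x \<in> carrier M" if "x \<in> N" for x using submodule_subset[OF assms(3)] that by auto
  show ?thesis
  proof (rule M.lsubmoduleI)
    show "{x \<oplus>\<^bsub>M\<^esub> y |x y. x \<in> L \<and> y \<in> N} \<subseteq> carrier M" using L N by auto
    show "\<zero>\<^bsub>M\<^esub> \<in> {x \<oplus>\<^bsub>M\<^esub> y |x y. x \<in> L \<and> y \<in> N}"
      using submodule_zero[OF assms(2)] submodule_zero[OF assms(3)]
      by (auto intro!: exI[of _ "\<zero>\<^bsub>M\<^esub>"])
  next
    fix u v assume "u \<in> {x \<oplus>\<^bsub>M\<^esub> y |x y. x \<in> L \<and> y \<in> N}" "v \<in> {x \<oplus>\<^bsub>M\<^esub> y |x y. x \<in> L \<and> y \<in> N}"
    then obtain x y x' y' where *: "u = x \<oplus>\<^bsub>M\<^esub> y" "v = x' \<oplus>\<^bsub>M\<^esub> y'" "x \<in> L" "x' \<in> L" "y \<in> N" "y' \<in> N"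
      by auto
    then have "u \<oplus>\<^bsub>M\<^esub> v = (x \<oplus>\<^bsub>M\<^esub> x') \<oplus>\<^bsub>M\<^esub> (y \<oplus>\<^bsub>M\<^esub> y')"
      using L N by (simp add: M.a_ac)
    then show "u \<oplus>\<^bsub>M\<^esub> v \<in> {x \<oplus>\<^bsub>M\<^esub> y |x y. x \<in> L \<and> y \<in> N}"
      using submodule_add[OF assms(2) *(3,4)] submodule_add[OF assms(3) *(5,6)] by blast
  next
    fix a u assume a: "a \<in> carrier R" and "u \<in> {x \<oplus>\<^bsub>M\<^esub> y |x y. x \<in> L \<and> y \<in> N}"
    then obtain x y where *: "u = x \<oplus>\<^bsub>M\<^esub> y" "x \<in> L" "y \<in> N" by auto
    then have "a \<odot>\<^bsub>M\<^esub> u = a \<odot>\<^bsub>M\<^esub> x \<oplus>\<^bsub>M\<^esub> a \<odot>\<^bsub>M\<^esub> y" using a L N by (simp add: M.lsmult_r_distr)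
    then show "a \<odot>\<^bsub>M\<^esub> u \<in> {x \<oplus>\<^bsub>M\<^esub> y |x y. x \<in> L \<and> y \<in> N}"
      using submodule_smult[OF assms(2) a *(2)] submodule_smult[OF assms(3) a *(3)] by blast
  qed
qed

lemma (in abelian_monoid) finsum_Sigma:
  assumes "finite A" "\<And>i. i \<in> A \<Longrightarrow> finite (B i)" "\<And>i j. i \<in> A \<Longrightarrow> j \<in> B i \<Longrightarrow> f i j \<in> carrier G"
  shows "(\<Oplus>i\<in>A. \<Oplus>j\<in>B i. f i j) = (\<Oplus>p\<in>Sigma A B. f (fst p) (snd p))"
  using assms
proof (induction A)
  case (insert a A)
  have split: "Sigma (insert a A) B = Pair a ` B a \<union> Sigma A B" by auto
  have "(\<Oplus>p\<in>Pair a ` B a \<union> Sigma A B. f (fst p) (snd p)) =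
      (\<Oplus>p\<in>Pair a ` B a. f (fst p) (snd p)) \<oplus> (\<Oplus>p\<in>Sigma A B. f (fst p) (snd p))"
    using insert by (intro finsum_Un_disjoint) auto
  moreover have "(\<Oplus>p\<in>Pair a ` B a. f (fst p) (snd p)) = (\<Oplus>j\<in>B a. f a j)"
    using insert by (subst finsum_reindex) (auto simp: inj_on_def)
  ultimately show ?case
    using insert unfolding split by (subst finsum_insert) (auto intro!: finsum_closed)
qed simp

section \<open>Finitely generated projective modules\<close>

text \<open>Vectors \<open>b\<close> and coordinates \<open>f\<close> together amount to a
  retraction of a free module of finite rank onto \<open>M\<close>. The index type is left open
  because restriction to a subring produces pairs as indices.\<close>

definition dual_basis ::
  "('a, 'x) ring_scheme \<Rightarrow> ('a, 'm, 'y) module_scheme \<Rightarrow> 'i set \<Rightarrow> ('i \<Rightarrow> 'm) \<Rightarrow> ('i \<Rightarrow> 'm \<Rightarrow> 'a) \<Rightarrow> bool"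
where
  "dual_basis R M J b f \<longleftrightarrow> finite J \<and>
     (\<forall>j\<in>J. b j \<in> carrier M \<and> f j \<in> mod_hom R M (mult_bimodule R)) \<and>
     (\<forall>x\<in>carrier M. x = (\<Oplus>\<^bsub>M\<^esub>j\<in>J. f j x \<odot>\<^bsub>M\<^esub> b j))"

text \<open>Equivalent to \<open>projective_module\<close> together with finite generation, but
  without a free module indexed by elements of \<open>M\<close>. This form passes directly to
  summands, restricted modules and coinduced modules.\<close>

definition fg_projective :: "('a, 'x) ring_scheme \<Rightarrow> ('a, 'm, 'y) module_scheme \<Rightarrow> bool" where
  "fg_projective R M \<longleftrightarrow> left_module R M \<and> (\<exists>(n::nat) b f. dual_basis R M {..<n} b f)"

lemma fg_projective_left_module: "fg_projective R M \<Longrightarrow> left_module R M"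
  by (simp add: fg_projective_def)

lemma left_module_regular:
  assumes "ring R"
  shows "left_module R (mult_bimodule R)"
proof -
  interpret ring R by fact
  have "abelian_group (mult_bimodule R)"
  proof (rule abelian_groupI, goal_cases)
    case (6 x)
    then show ?case by (auto simp: mult_bimodule_def intro!: bexI[of _ "\<ominus>\<^bsub>R\<^esub> x"] l_neg)
  qed (auto simp: mult_bimodule_def a_ac)
  then show ?thesis
    by (intro left_module.intro left_module_axioms.intro ring_axioms)
      (auto simp: mult_bimodule_def l_distr r_distr m_assoc)
qed

lemma mult_bimodule_simps [simp]:
  "carrier (mult_bimodule R) = carrier R" "\<zero>\<^bsub>mult_bimodule R\<^esub> = \<zero>\<^bsub>R\<^esub>"
  "x \<oplus>\<^bsub>mult_bimodule R\<^esub> y = x \<oplus>\<^bsub>R\<^esub> y" "x \<odot>\<^bsub>mult_bimodule R\<^esub> y = x \<otimes>\<^bsub>R\<^esub> y"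
  "rsmult (mult_bimodule R) x y = x \<otimes>\<^bsub>R\<^esub> y"
  by (simp_all add: mult_bimodule_def)

lemma dual_basis_expand:
  "dual_basis R M J b f \<Longrightarrow> x \<in> carrier M \<Longrightarrow> x = (\<Oplus>\<^bsub>M\<^esub>j\<in>J. f j x \<odot>\<^bsub>M\<^esub> b j)"
  by (simp add: dual_basis_def)

lemma dual_basis_closed:
  assumes "dual_basis R M J b f" "j \<in> J"
  shows "b j \<in> carrier M" "x \<in> carrier M \<Longrightarrow> f j x \<in> carrier R"
    "f j \<in> mod_hom R M (mult_bimodule R)"
  using assms mod_hom_closed[of "f j" R M "mult_bimodule R" x] by (auto simp: dual_basis_def)

lemma fg_projectiveI:
  assumes M: "left_module R M" and b: "dual_basis R M J b f"
  shows "fg_projective R M"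
proof -
  interpret left_module R M by fact
  have fin: "finite J" using b by (simp add: dual_basis_def)
  obtain h where h: "bij_betw h {..<card J} J"
    using ex_bij_betw_nat_finite[OF fin] by (auto simp: lessThan_atLeast0)
  have "dual_basis R M {..<card J} (\<lambda>i. b (h i)) (\<lambda>i. f (h i))"
    unfolding dual_basis_def
  proof (intro conjI ballI)
    fix j assume "j \<in> {..<card J}"
    then have "h j \<in> J" using h by (auto simp: bij_betw_def)
    then show "b (h j) \<in> carrier M" "f (h j) \<in> mod_hom R M (mult_bimodule R)"
      using dual_basis_closed[OF b] by auto
  next
    fix x assume x: "x \<in> carrier M"
    have "(\<Oplus>\<^bsub>M\<^esub>j\<in>h ` {..<card J}. f j x \<odot>\<^bsub>M\<^esub> b j) = (\<Oplus>\<^bsub>M\<^esub>i\<in>{..<card J}. f (h i) x \<odot>\<^bsub>M\<^esub> b (h i))"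
      using h x dual_basis_closed[OF b]
      by (intro finsum_reindex) (auto simp: bij_betw_def intro!: lsmult_closed)
    then show "x = (\<Oplus>\<^bsub>M\<^esub>i\<in>{..<card J}. f (h i) x \<odot>\<^bsub>M\<^esub> b (h i))"
      using dual_basis_expand[OF b x] h by (simp add: bij_betw_def)
  qed simp
  then show ?thesis using M by (auto simp: fg_projective_def)
qed

text \<open>The vectors are pushed forward along \<open>p\<close> and the coordinates are pulled
  back along \<open>i\<close>.\<close>

lemma fg_projective_retract:
  assumes M: "fg_projective R M" and N: "left_module R N"
    and i: "i \<in> mod_hom R N M" and p: "p \<in> mod_hom R M N" and pi: "\<And>x. x \<in> carrier N \<Longrightarrow> p (i x) = x"
  shows "fg_projective R N"
proof -
  obtain n b f where b: "dual_basis R M {..<n::nat} b f" and lM: "left_module R M"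
    using M by (auto simp: fg_projective_def)
  interpret M: left_module R M by fact
  interpret N: left_module R N by fact
  have "dual_basis R N {..<n} (\<lambda>j. p (b j)) (\<lambda>j x. f j (i x))"
    unfolding dual_basis_def
  proof (intro conjI ballI)
    fix j assume "j \<in> {..<n}"
    then show "p (b j) \<in> carrier N" "(\<lambda>x. f j (i x)) \<in> mod_hom R N (mult_bimodule R)"
      using dual_basis_closed[OF b] by (auto intro: mod_hom_closed[OF p] mod_hom_comp[OF i])
  next
    fix x assume x: "x \<in> carrier N"
    then have "x = p (\<Oplus>\<^bsub>M\<^esub>j\<in>{..<n}. f j (i x) \<odot>\<^bsub>M\<^esub> b j)"
      using pi dual_basis_expand[OF b, of "i x"] mod_hom_closed[OF i] by simp
    also have "\<dots> = (\<Oplus>\<^bsub>N\<^esub>j\<in>{..<n}. p (f j (i x) \<odot>\<^bsub>M\<^esub> b j))"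
      using dual_basis_closed[OF b] mod_hom_closed[OF i x]
      by (intro mod_hom_finsum[OF lM N p]) (auto intro!: M.lsmult_closed)
    also have "\<dots> = (\<Oplus>\<^bsub>N\<^esub>j\<in>{..<n}. f j (i x) \<odot>\<^bsub>N\<^esub> p (b j))"
      using dual_basis_closed[OF b] mod_hom_closed[OF i x] mod_hom_smult[OF p] mod_hom_closed[OF p]
      by (intro N.finsum_cong') (auto intro!: N.lsmult_closed)
    finally show "x = (\<Oplus>\<^bsub>N\<^esub>j\<in>{..<n}. f j (i x) \<odot>\<^bsub>N\<^esub> p (b j))" .
  qed simp
  then show ?thesis using N by (auto simp: fg_projective_def)
qed

text \<open>This is how projectivity is used to construct maps. The map need not send
  \<open>b j\<close> to \<open>c j\<close>, since the \<open>b j\<close> may satisfy relations; it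
  only combines the \<open>c j\<close> with the coordinates of the argument.\<close>

lemma mod_hom_from_dual_basis:
  assumes M: "left_module R M" and b: "dual_basis R M J b f" and N: "left_module R N"
    and c: "\<And>j. j \<in> J \<Longrightarrow> c j \<in> carrier N"
  shows "(\<lambda>x. \<Oplus>\<^bsub>N\<^esub>j\<in>J. f j x \<odot>\<^bsub>N\<^esub> c j) \<in> mod_hom R M N"
proof -
  interpret M: left_module R M by fact
  interpret N: left_module R N by fact
  have f: "f j x \<in> carrier R" if "j \<in> J" "x \<in> carrier M" for j x
    using dual_basis_closed[OF b] that by auto
  show ?thesis
  proof (rule mod_homI)
    show "(\<Oplus>\<^bsub>N\<^esub>j\<in>J. f j x \<odot>\<^bsub>N\<^esub> c j) \<in> carrier N" if "x \<in> carrier M" for x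
      using f c that by (auto intro!: N.finsum_closed N.lsmult_closed)
  next
    fix x y assume xy: "x \<in> carrier M" "y \<in> carrier M"
    have "(\<Oplus>\<^bsub>N\<^esub>j\<in>J. f j (x \<oplus>\<^bsub>M\<^esub> y) \<odot>\<^bsub>N\<^esub> c j) = (\<Oplus>\<^bsub>N\<^esub>j\<in>J. f j x \<odot>\<^bsub>N\<^esub> c j \<oplus>\<^bsub>N\<^esub> f j y \<odot>\<^bsub>N\<^esub> c j)"
      using f c xy mod_hom_add[OF dual_basis_closed(3)[OF b] xy]
      by (intro N.finsum_cong') (auto intro!: N.lsmult_closed simp: N.lsmult_l_distr)
    then show "(\<Oplus>\<^bsub>N\<^esub>j\<in>J. f j (x \<oplus>\<^bsub>M\<^esub> y) \<odot>\<^bsub>N\<^esub> c j) =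
      (\<Oplus>\<^bsub>N\<^esub>j\<in>J. f j x \<odot>\<^bsub>N\<^esub> c j) \<oplus>\<^bsub>N\<^esub> (\<Oplus>\<^bsub>N\<^esub>j\<in>J. f j y \<odot>\<^bsub>N\<^esub> c j)"
      using f c xy by (subst N.finsum_addf[symmetric]) (auto intro!: N.lsmult_closed)
  next
    fix a x assume ax: "a \<in> carrier R" "x \<in> carrier M"
    have "(\<Oplus>\<^bsub>N\<^esub>j\<in>J. f j (a \<odot>\<^bsub>M\<^esub> x) \<odot>\<^bsub>N\<^esub> c j) = (\<Oplus>\<^bsub>N\<^esub>j\<in>J. a \<odot>\<^bsub>N\<^esub> (f j x \<odot>\<^bsub>N\<^esub> c j))"
      using f c ax mod_hom_smult[OF dual_basis_closed(3)[OF b] ax]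
      by (intro N.finsum_cong') (auto intro!: N.lsmult_closed simp: N.lsmult_assoc)
    then show "(\<Oplus>\<^bsub>N\<^esub>j\<in>J. f j (a \<odot>\<^bsub>M\<^esub> x) \<odot>\<^bsub>N\<^esub> c j) = a \<odot>\<^bsub>N\<^esub> (\<Oplus>\<^bsub>N\<^esub>j\<in>J. f j x \<odot>\<^bsub>N\<^esub> c j)"
      using f c ax by (subst N.lsmult_finsum_right) (auto intro!: N.lsmult_closed)
  qed
qed

lemma free_module_simps:
  "f \<in> carrier (free_module R I) \<longleftrightarrow>
    (\<forall>i\<in>I. f i \<in> carrier R) \<and> (\<forall>i. i \<notin> I \<longrightarrow> f i = \<zero>\<^bsub>R\<^esub>) \<and> finite {i. f i \<noteq> \<zero>\<^bsub>R\<^esub>}"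
  "f \<oplus>\<^bsub>free_module R I\<^esub> g = (\<lambda>i. f i \<oplus>\<^bsub>R\<^esub> g i)"
  "a \<odot>\<^bsub>free_module R I\<^esub> f = (\<lambda>i. if i \<in> I then a \<otimes>\<^bsub>R\<^esub> f i else \<zero>\<^bsub>R\<^esub>)"
  "\<zero>\<^bsub>free_module R I\<^esub> = (\<lambda>i. \<zero>\<^bsub>R\<^esub>)"
  by (simp_all add: free_module_def)

lemma free_module_hom_expand:
  assumes M: "left_module R M" and p: "p \<in> mod_hom R (free_module R I) M"
    and J: "finite J" "J \<subseteq> I"
    and u: "u \<in> carrier (free_module R I)" "\<And>i. i \<notin> J \<Longrightarrow> u i = \<zero>\<^bsub>R\<^esub>"
  defines "\<delta> \<equiv> \<lambda>j i. if i = j then \<one>\<^bsub>R\<^esub> else \<zero>\<^bsub>R\<^esub>"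
  shows "p u = (\<Oplus>\<^bsub>M\<^esub>j\<in>J. u j \<odot>\<^bsub>M\<^esub> p (\<delta> j))"
proof -
  interpret left_module R M by fact
  have \<delta>: "\<delta> j \<in> carrier (free_module R I)" if "j \<in> I" for j
    using that by (auto simp: free_module_simps \<delta>_def)
  show ?thesis
    using J u
  proof (induction J arbitrary: u)
    case empty
    \<comment> \<open>The zero function is a zero multiple of itself, so linearity of
      \<open>p\<close> alone gives \<open>p u = 0\<close>, without the module laws of the free
      module.\<close>
    then have "u = \<zero>\<^bsub>R\<^esub> \<odot>\<^bsub>free_module R I\<^esub> u" by (auto simp: free_module_simps)
    then have "p u = \<zero>\<^bsub>R\<^esub> \<odot>\<^bsub>M\<^esub> p u" using mod_hom_smult[OF p R.zero_closed empty(2)] by metis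
    then have "p u = \<zero>\<^bsub>M\<^esub>" using lsmult_zero_left[OF mod_hom_closed[OF p empty(2)]] by metis
    then show ?case by simp
  next
    case (insert j J)
    define v where "v = u(j := \<zero>\<^bsub>R\<^esub>)"
    have v: "v \<in> carrier (free_module R I)"
      using insert.prems by (auto simp: free_module_simps v_def elim: rev_finite_subset)
    have j: "j \<in> I" and uR: "u i \<in> carrier R" for i
      using insert.prems by (auto simp: free_module_simps)
    have "p v = (\<Oplus>\<^bsub>M\<^esub>j\<in>J. v j \<odot>\<^bsub>M\<^esub> p (\<delta> j))"
      using insert by (intro insert.IH v) (auto simp: v_def)
    also have "\<dots> = (\<Oplus>\<^bsub>M\<^esub>j\<in>J. u j \<odot>\<^bsub>M\<^esub> p (\<delta> j))"
      using insert uR mod_hom_closed[OF p \<delta>]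
      by (intro finsum_cong') (auto simp: v_def intro!: lsmult_closed)
    finally have pv: "p v = (\<Oplus>\<^bsub>M\<^esub>j\<in>J. u j \<odot>\<^bsub>M\<^esub> p (\<delta> j))" .
    have "u = u j \<odot>\<^bsub>free_module R I\<^esub> \<delta> j \<oplus>\<^bsub>free_module R I\<^esub> v"
      using insert.prems uR by (auto simp: free_module_simps v_def \<delta>_def fun_eq_iff)
    moreover have "u j \<odot>\<^bsub>free_module R I\<^esub> \<delta> j \<in> carrier (free_module R I)"
      using uR by (auto simp: free_module_simps \<delta>_def)
    ultimately have "p u = u j \<odot>\<^bsub>M\<^esub> p (\<delta> j) \<oplus>\<^bsub>M\<^esub> p v"
      using mod_hom_add[OF p _ v] mod_hom_smult[OF p uR \<delta>[OF j]] by metis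
    also have "\<dots> = (\<Oplus>\<^bsub>M\<^esub>j\<in>insert j J. u j \<odot>\<^bsub>M\<^esub> p (\<delta> j))"
      using insert uR mod_hom_closed[OF p \<delta>]
      by (subst finsum_insert) (auto simp: pv intro!: lsmult_closed)
    finally show ?case .
  qed
qed

text \<open>The images of finitely many generators have a finite common support \<open>J\<close>.
  The elements whose image is supported in \<open>J\<close> form a submodule that contains the
  generators, so the coordinates in \<open>J\<close> suffice for all of \<open>M\<close>.\<close>

lemma projective_module_imp_fg_projective:
  fixes M :: "('a, 'm) module"
  assumes fg: "finitely_generated R M" and proj: "projective_module R M"
  shows "fg_projective R M"
proof -
  obtain I \<iota> \<pi> where M: "left_module R M" and \<iota>: "\<iota> \<in> mod_hom R M (free_module R (I :: 'm set))"
    and \<pi>: "\<pi> \<in> mod_hom R (free_module R I) M" and \<pi>\<iota>: "\<And>x. x \<in> carrier M \<Longrightarrow> \<pi> (\<iota> x) = x"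
    using proj unfolding projective_module_def by blast
  interpret left_module R M by fact
  obtain C where C: "finite C" "C \<subseteq> carrier M" "\<And>N. submodule N R M \<Longrightarrow> C \<subseteq> N \<Longrightarrow> N = carrier M"
    using fg unfolding finitely_generated_def by blast
  define J where "J = (\<Union>c\<in>C. {i. \<iota> c i \<noteq> \<zero>\<^bsub>R\<^esub>})"
  have \<iota>_closed: "\<iota> x \<in> carrier (free_module R I)" if "x \<in> carrier M" for x
    using mod_hom_closed[OF \<iota> that] .
  have J: "finite J" "J \<subseteq> I"
    using C(1,2) \<iota>_closed unfolding J_def by (auto simp: free_module_simps subset_iff)
  have "\<iota> \<zero>\<^bsub>M\<^esub> i = \<zero>\<^bsub>R\<^esub>" for i
  proof -
    have "\<iota> \<zero>\<^bsub>M\<^esub> = \<zero>\<^bsub>R\<^esub> \<odot>\<^bsub>free_module R I\<^esub> \<iota> \<zero>\<^bsub>M\<^esub>"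
      using mod_hom_smult[OF \<iota> R.zero_closed M.zero_closed] by (simp add: lsmult_zero_left)
    then have "\<iota> \<zero>\<^bsub>M\<^esub> i = (if i \<in> I then \<zero>\<^bsub>R\<^esub> \<otimes>\<^bsub>R\<^esub> \<iota> \<zero>\<^bsub>M\<^esub> i else \<zero>\<^bsub>R\<^esub>)"
      by (metis free_module_simps(3))
    then show ?thesis using \<iota>_closed[of "\<zero>\<^bsub>M\<^esub>"] by (auto simp: free_module_simps split: if_splits)
  qed
  then have "submodule {x \<in> carrier M. \<forall>i. i \<notin> J \<longrightarrow> \<iota> x i = \<zero>\<^bsub>R\<^esub>} R M"
    using mod_hom_add[OF \<iota>] mod_hom_smult[OF \<iota>]
    by (intro lsubmoduleI) (auto simp: free_module_simps lsmult_closed)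
  moreover have "C \<subseteq> {x \<in> carrier M. \<forall>i. i \<notin> J \<longrightarrow> \<iota> x i = \<zero>\<^bsub>R\<^esub>}"
    using C(2) by (auto simp: J_def)
  ultimately have supp: "\<iota> x i = \<zero>\<^bsub>R\<^esub>" if "x \<in> carrier M" "i \<notin> J" for x i
    using C(3) that by blast
  define \<delta> where "\<delta> = (\<lambda>(j::'m) i. if i = j then \<one>\<^bsub>R\<^esub> else \<zero>\<^bsub>R\<^esub>)"
  have "dual_basis R M J (\<lambda>j. \<pi> (\<delta> j)) (\<lambda>j x. \<iota> x j)"
    unfolding dual_basis_def
  proof (intro conjI ballI)
    fix j assume j: "j \<in> J"
    then have "\<delta> j \<in> carrier (free_module R I)" using J by (auto simp: free_module_simps \<delta>_def)
    then show "\<pi> (\<delta> j) \<in> carrier M" by (rule mod_hom_closed[OF \<pi>])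
    show "(\<lambda>x. \<iota> x j) \<in> mod_hom R M (mult_bimodule R)"
      using j J \<iota>_closed mod_hom_add[OF \<iota>] mod_hom_smult[OF \<iota>]
      by (intro mod_homI) (auto simp: free_module_simps)
  next
    fix x assume x: "x \<in> carrier M"
    show "x = (\<Oplus>\<^bsub>M\<^esub>j\<in>J. \<iota> x j \<odot>\<^bsub>M\<^esub> \<pi> (\<delta> j))"
      using free_module_hom_expand[OF M \<pi> J \<iota>_closed[OF x] supp[OF x]] \<pi>\<iota>[OF x] by (simp add: \<delta>_def)
  qed (use J in simp)
  then show ?thesis using M fg_projectiveI by blast
qed

lemma submodule_finsum:
  assumes M: "left_module R M" and N: "submodule N R M" and g: "g \<in> A \<rightarrow> N"
  shows "(\<Oplus>\<^bsub>M\<^esub>i\<in>A. g i) \<in> N"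
proof -
  interpret left_module R M by fact
  show ?thesis
  proof (cases "finite A")
    case True
    then show ?thesis using g
    proof (induction A)
      case (insert a A)
      then have "g \<in> A \<rightarrow> carrier M" "g a \<in> carrier M" using submodule_subset[OF N] by auto
      then show ?case using insert submodule_add[OF N] by (subst finsum_insert) auto
    qed (simp add: submodule_zero[OF N])
  qed (simp add: submodule_zero[OF N])
qed

lemma fg_projective_imp_finitely_generated:
  assumes "fg_projective R M"
  shows "finitely_generated R M"
proof -
  obtain n b f where b: "dual_basis R M {..<n::nat} b f" and M: "left_module R M"
    using assms by (auto simp: fg_projective_def)
  have "N = carrier M" if N: "submodule N R M" "b ` {..<n} \<subseteq> N" for N
  proof -
    have "x \<in> N" if x: "x \<in> carrier M" for x
      using dual_basis_closed(2)[OF b _ x] N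
      by (subst dual_basis_expand[OF b x]) (auto intro!: submodule_finsum[OF M N(1)] submodule_smult[OF N(1)])
    then show ?thesis using submodule_subset[OF N(1)] by blast
  qed
  then show ?thesis
    using dual_basis_closed(1)[OF b] unfolding finitely_generated_def
    by (intro exI[of _ "b ` {..<n}"]) auto
qed

text \<open>The free module has to be indexed by elements of \<open>M\<close>, so it is taken on the
  set \<open>I\<close> of values of \<open>b\<close>. As \<open>b\<close> may repeat a value, the
  coordinate at \<open>m\<close> collects all \<open>f i x\<close> with
  \<open>b i = m\<close>.\<close>

lemma fg_projective_imp_projective_module:
  fixes M :: "('a, 'm) module"
  assumes "fg_projective R M"
  shows "projective_module R M"
proof -
  obtain n b f where b: "dual_basis R M {..<n::nat} b f" and M: "left_module R M"
    using assms by (auto simp: fg_projective_def)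
  interpret left_module R M by fact
  define I where "I = b ` {..<n}"
  have I: "finite I" "I \<subseteq> carrier M" using dual_basis_closed(1)[OF b] by (auto simp: I_def)
  define \<iota> where
    "\<iota> = (\<lambda>x m. if m \<in> I then \<Oplus>\<^bsub>R\<^esub>i\<in>{..<n}. (if b i = m then f i x else \<zero>\<^bsub>R\<^esub>) else \<zero>\<^bsub>R\<^esub>)"
  define \<pi> where "\<pi> = (\<lambda>u. \<Oplus>\<^bsub>M\<^esub>m\<in>I. u m \<odot>\<^bsub>M\<^esub> m)"
  note fc = dual_basis_closed(2)[OF b]
  have sc: "(\<lambda>i. if b i = m then f i x else \<zero>\<^bsub>R\<^esub>) \<in> {..<n} \<rightarrow> carrier R" if "x \<in> carrier M" for x m
    using fc that by auto
  have "\<iota> \<in> mod_hom R M (free_module R I)"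
  proof (rule mod_homI)
    fix x assume x: "x \<in> carrier M"
    have "finite {i. \<iota> x i \<noteq> \<zero>\<^bsub>R\<^esub>}" by (rule finite_subset[OF _ I(1)]) (auto simp: \<iota>_def)
    then show "\<iota> x \<in> carrier (free_module R I)"
      using R.finsum_closed[OF sc[OF x]] by (auto simp: free_module_simps \<iota>_def)
  next
    fix x y assume xy: "x \<in> carrier M" "y \<in> carrier M"
    have "(\<Oplus>\<^bsub>R\<^esub>i\<in>{..<n}. if b i = m then f i (x \<oplus>\<^bsub>M\<^esub> y) else \<zero>\<^bsub>R\<^esub>) =
       (\<Oplus>\<^bsub>R\<^esub>i\<in>{..<n}. if b i = m then f i x else \<zero>\<^bsub>R\<^esub>) \<oplus>\<^bsub>R\<^esub> (\<Oplus>\<^bsub>R\<^esub>i\<in>{..<n}. if b i = m then f i y else \<zero>\<^bsub>R\<^esub>)"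
      for m
      using xy mod_hom_add[OF dual_basis_closed(3)[OF b] xy] fc
      by (intro trans[OF _ R.finsum_addf[OF sc[OF xy(1)] sc[OF xy(2)]]] R.finsum_cong') auto
    then show "\<iota> (x \<oplus>\<^bsub>M\<^esub> y) = \<iota> x \<oplus>\<^bsub>free_module R I\<^esub> \<iota> y"
      by (auto simp: free_module_simps \<iota>_def fun_eq_iff)
  next
    fix a x assume ax: "a \<in> carrier R" "x \<in> carrier M"
    have "(\<Oplus>\<^bsub>R\<^esub>i\<in>{..<n}. if b i = m then f i (a \<odot>\<^bsub>M\<^esub> x) else \<zero>\<^bsub>R\<^esub>) =
       a \<otimes>\<^bsub>R\<^esub> (\<Oplus>\<^bsub>R\<^esub>i\<in>{..<n}. if b i = m then f i x else \<zero>\<^bsub>R\<^esub>)" for m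
      using ax mod_hom_smult[OF dual_basis_closed(3)[OF b] ax] fc
      by (subst R.finsum_rdistr[OF _ ax(1) sc[OF ax(2)]]) (auto intro!: R.finsum_cong')
    then show "\<iota> (a \<odot>\<^bsub>M\<^esub> x) = a \<odot>\<^bsub>free_module R I\<^esub> \<iota> x"
      by (auto simp: free_module_simps \<iota>_def fun_eq_iff)
  qed
  moreover have "\<pi> \<in> mod_hom R (free_module R I) M"
  proof (rule mod_homI)
    fix u assume u: "u \<in> carrier (free_module R I)"
    then show "\<pi> u \<in> carrier M"
      using I by (auto simp: \<pi>_def free_module_simps subset_iff intro!: finsum_closed lsmult_closed)
  next
    fix u v assume u: "u \<in> carrier (free_module R I)" and v: "v \<in> carrier (free_module R I)"
    have "\<pi> (u \<oplus>\<^bsub>free_module R I\<^esub> v) = (\<Oplus>\<^bsub>M\<^esub>m\<in>I. u m \<odot>\<^bsub>M\<^esub> m \<oplus>\<^bsub>M\<^esub> v m \<odot>\<^bsub>M\<^esub> m)"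
      using I u v unfolding \<pi>_def
      by (intro finsum_cong') (auto simp: free_module_simps subset_iff lsmult_l_distr intro!: lsmult_closed)
    also have "\<dots> = \<pi> u \<oplus>\<^bsub>M\<^esub> \<pi> v"
      using I u v unfolding \<pi>_def
      by (intro finsum_addf) (auto simp: free_module_simps subset_iff intro!: lsmult_closed)
    finally show "\<pi> (u \<oplus>\<^bsub>free_module R I\<^esub> v) = \<pi> u \<oplus>\<^bsub>M\<^esub> \<pi> v" .
  next
    fix a u assume a: "a \<in> carrier R" and u: "u \<in> carrier (free_module R I)"
    have "\<pi> (a \<odot>\<^bsub>free_module R I\<^esub> u) = (\<Oplus>\<^bsub>M\<^esub>m\<in>I. a \<odot>\<^bsub>M\<^esub> (u m \<odot>\<^bsub>M\<^esub> m))"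
      using I u a unfolding \<pi>_def
      by (intro finsum_cong') (auto simp: free_module_simps subset_iff lsmult_assoc intro!: lsmult_closed)
    also have "\<dots> = a \<odot>\<^bsub>M\<^esub> \<pi> u"
      using I u a unfolding \<pi>_def
      by (intro lsmult_finsum_right[symmetric]) (auto simp: free_module_simps subset_iff intro!: lsmult_closed)
    finally show "\<pi> (a \<odot>\<^bsub>free_module R I\<^esub> u) = a \<odot>\<^bsub>M\<^esub> \<pi> u" .
  qed
  moreover have "\<pi> (\<iota> x) = x" if x: "x \<in> carrier M" for x
  proof -
    define t where "t = (\<lambda>m i. if b i = m then f i x \<odot>\<^bsub>M\<^esub> b i else \<zero>\<^bsub>M\<^esub>)"
    have t: "t m i \<in> carrier M" if "i < n" for m i
      using that fc x dual_basis_closed(1)[OF b] by (auto simp: t_def intro!: lsmult_closed)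
    have "\<pi> (\<iota> x) = (\<Oplus>\<^bsub>M\<^esub>m\<in>I. \<Oplus>\<^bsub>M\<^esub>i\<in>{..<n}. t m i)"
      unfolding \<pi>_def
    proof (intro finsum_cong' refl)
      fix m assume m: "m \<in> I"
      then have mM: "m \<in> carrier M" using I by auto
      have "\<iota> x m \<odot>\<^bsub>M\<^esub> m = (\<Oplus>\<^bsub>M\<^esub>i\<in>{..<n}. (if b i = m then f i x else \<zero>\<^bsub>R\<^esub>) \<odot>\<^bsub>M\<^esub> m)"
        using m lsmult_finsum_left[OF mM sc[OF x]] by (simp add: \<iota>_def)
      also have "\<dots> = (\<Oplus>\<^bsub>M\<^esub>i\<in>{..<n}. t m i)"
        using t mM by (intro finsum_cong') (auto simp: t_def lsmult_zero_left)
      finally show "\<iota> x m \<odot>\<^bsub>M\<^esub> m = (\<Oplus>\<^bsub>M\<^esub>i\<in>{..<n}. t m i)" .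
    qed (use t in \<open>auto intro!: finsum_closed\<close>)
    also have "\<dots> = (\<Oplus>\<^bsub>M\<^esub>i\<in>{..<n}. \<Oplus>\<^bsub>M\<^esub>m\<in>I. t m i)"
      using I t by (intro finsum_swap) auto
    also have "\<dots> = (\<Oplus>\<^bsub>M\<^esub>i\<in>{..<n}. f i x \<odot>\<^bsub>M\<^esub> b i)"
    proof (intro finsum_cong' refl)
      fix i assume i: "i \<in> {..<n}"
      then have c: "f i x \<odot>\<^bsub>M\<^esub> b i \<in> carrier M"
        using fc x dual_basis_closed(1)[OF b] by (auto intro!: lsmult_closed)
      have "(\<Oplus>\<^bsub>M\<^esub>m\<in>I. t m i) = t (b i) i"
        using I i c by (intro finsum_single) (auto simp: I_def t_def)
      then show "(\<Oplus>\<^bsub>M\<^esub>m\<in>I. t m i) = f i x \<odot>\<^bsub>M\<^esub> b i" by (simp add: t_def)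
    qed (use fc x dual_basis_closed(1)[OF b] in \<open>auto intro!: lsmult_closed\<close>)
    also have "\<dots> = x" using dual_basis_expand[OF b x] by simp
    finally show ?thesis .
  qed
  ultimately show ?thesis
    unfolding projective_module_def using M by blast
qed

lemma (in abelian_group) add_diff_add:
  assumes "a \<in> carrier G" "x \<in> carrier G" "y \<in> carrier G"
  shows "(a \<oplus> x) \<oplus> \<ominus> (a \<oplus> y) = x \<oplus> \<ominus> y"
proof -
  have "(a \<oplus> x) \<oplus> \<ominus> (a \<oplus> y) = x \<oplus> (a \<oplus> (\<ominus> a \<oplus> \<ominus> y))"
    using assms by (simp add: minus_add a_assoc a_lcomm[of a x])
  then show ?thesis using assms by (simp add: r_neg2)
qed

section \<open>Modules of finite length\<close>

text \<open>A stand-in for composition length. Strict monotonicity bounds every chain of submodules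
  by the value at the whole module, and the same function can be kept for all submodules, so that
  the sizes of successive summands stay comparable.\<close>

definition length_function :: "('a, 'x) ring_scheme \<Rightarrow> ('a, 'm, 'y) module_scheme \<Rightarrow> ('m set \<Rightarrow> nat) \<Rightarrow> bool" where
  "length_function R M \<delta> \<longleftrightarrow>
     (\<forall>N N'. submodule N R M \<and> submodule N' R M \<and> N \<subset> N' \<longrightarrow> \<delta> N < \<delta> N')"

lemma length_functionD:
  "length_function R M \<delta> \<Longrightarrow> submodule N R M \<Longrightarrow> submodule N' R M \<Longrightarrow> N \<subset> N' \<Longrightarrow> \<delta> N < \<delta> N'"
  by (simp add: length_function_def)

lemma length_function_submodule:
  "left_module R M \<Longrightarrow> submodule N R M \<Longrightarrow> length_function R M \<delta> \<Longrightarrow> length_function R (M\<lparr>carrier := N\<rparr>) \<delta>"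
  unfolding length_function_def using submodule_trans by blast

section \<open>Dimension counts for subspaces over the ground field\<close>

definition span_set :: "('k, 'v, 'y) module_scheme \<Rightarrow> ('k, 'z) ring_scheme \<Rightarrow> 'i set \<Rightarrow> ('i \<Rightarrow> 'v) \<Rightarrow> 'v set" where
  "span_set V K J b = {(\<Oplus>\<^bsub>V\<^esub>j\<in>J. c j \<odot>\<^bsub>V\<^esub> b j) |c. c \<in> J \<rightarrow> carrier K}"

lemma submodule_span_set:
  assumes V: "left_module K V" and bJ: "b \<in> J \<rightarrow> carrier V"
  shows "submodule (span_set V K J b) K V"
proof -
  interpret V: left_module K V by fact
  have Uin: "(\<Oplus>\<^bsub>V\<^esub>j\<in>J. c j \<odot>\<^bsub>V\<^esub> b j) \<in> carrier V" if "c \<in> J \<rightarrow> carrier K" for c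
    using that bJ by (intro V.finsum_closed) (auto intro!: V.lsmult_closed)
  show ?thesis
  proof (rule V.lsubmoduleI)
    show "span_set V K J b \<subseteq> carrier V" using Uin by (auto simp: span_set_def)
    have "(\<Oplus>\<^bsub>V\<^esub>j\<in>J. \<zero>\<^bsub>K\<^esub> \<odot>\<^bsub>V\<^esub> b j) = \<zero>\<^bsub>V\<^esub>"
      using bJ by (intro V.add.finprod_one_eqI) (auto simp: Pi_iff V.lsmult_zero_left)
    then show "\<zero>\<^bsub>V\<^esub> \<in> span_set V K J b" by (force simp: span_set_def)
  next
    fix x y assume "x \<in> span_set V K J b" "y \<in> span_set V K J b"
    then obtain c d where c: "c \<in> J \<rightarrow> carrier K" "x = (\<Oplus>\<^bsub>V\<^esub>j\<in>J. c j \<odot>\<^bsub>V\<^esub> b j)"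
      and d: "d \<in> J \<rightarrow> carrier K" "y = (\<Oplus>\<^bsub>V\<^esub>j\<in>J. d j \<odot>\<^bsub>V\<^esub> b j)" by (auto simp: span_set_def)
    have "x \<oplus>\<^bsub>V\<^esub> y = (\<Oplus>\<^bsub>V\<^esub>j\<in>J. c j \<odot>\<^bsub>V\<^esub> b j \<oplus>\<^bsub>V\<^esub> d j \<odot>\<^bsub>V\<^esub> b j)"
      using bJ c d by (subst V.finsum_addf) (auto intro!: V.lsmult_closed)
    also have "\<dots> = (\<Oplus>\<^bsub>V\<^esub>j\<in>J. (c j \<oplus>\<^bsub>K\<^esub> d j) \<odot>\<^bsub>V\<^esub> b j)"
      using bJ c d by (intro V.finsum_cong' refl) (auto simp: Pi_iff V.lsmult_l_distr intro!: V.lsmult_closed)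
    finally show "x \<oplus>\<^bsub>V\<^esub> y \<in> span_set V K J b" using c d by (auto simp: span_set_def intro!: exI[of _ "\<lambda>j. c j \<oplus>\<^bsub>K\<^esub> d j"])
  next
    fix a x assume a: "a \<in> carrier K" and "x \<in> span_set V K J b"
    then obtain c where c: "c \<in> J \<rightarrow> carrier K" "x = (\<Oplus>\<^bsub>V\<^esub>j\<in>J. c j \<odot>\<^bsub>V\<^esub> b j)" by (auto simp: span_set_def)
    have "a \<odot>\<^bsub>V\<^esub> x = (\<Oplus>\<^bsub>V\<^esub>j\<in>J. a \<odot>\<^bsub>V\<^esub> (c j \<odot>\<^bsub>V\<^esub> b j))"
      using bJ c a by (subst c(2), intro V.lsmult_finsum_right) (auto intro!: V.lsmult_closed)
    also have "\<dots> = (\<Oplus>\<^bsub>V\<^esub>j\<in>J. (a \<otimes>\<^bsub>K\<^esub> c j) \<odot>\<^bsub>V\<^esub> b j)"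
      using bJ c a by (intro V.finsum_cong' refl) (auto simp: Pi_iff V.lsmult_assoc intro!: V.lsmult_closed)
    finally show "a \<odot>\<^bsub>V\<^esub> x \<in> span_set V K J b" using c a by (auto simp: span_set_def intro!: exI[of _ "\<lambda>j. a \<otimes>\<^bsub>K\<^esub> c j"])
  qed
qed

text \<open>\<open>\<delta>\<close> counts the leading positions of the elements of a subspace, as in a row echelon form.\<close>

lemma length_function_span:
  fixes K :: "('k, 'z) ring_scheme"
  assumes K: "field K" and V: "left_module K V" and J: "finite J" and b: "b \<in> J \<rightarrow> carrier V"
  defines "U \<equiv> \<lambda>J. span_set V K J b"
  shows "\<exists>\<delta>::_ \<Rightarrow> nat. \<forall>N N'. submodule N K V \<and> submodule N' K V \<and> N \<subset> N' \<and> N' \<subseteq> U J \<longrightarrow> \<delta> N < \<delta> N'"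
  using J b
proof (induction J)
  case empty
  interpret V: left_module K V by fact
  have "\<not> N \<subset> N'" if "submodule N K V" "N' \<subseteq> U {}" for N N'
    using submodule_zero[OF that(1)] that(2) by (auto simp: U_def span_set_def)
  then show ?case by blast
next
  case (insert j J)
  interpret K: field K by fact
  interpret V: left_module K V by fact
  have bj: "b j \<in> carrier V" and bJ: "b \<in> J \<rightarrow> carrier V" using insert.prems by auto
  obtain \<delta> :: "_ \<Rightarrow> nat" where \<delta>: "\<And>N N'. submodule N K V \<Longrightarrow> submodule N' K V \<Longrightarrow> N \<subset> N' \<Longrightarrow> N' \<subseteq> U J \<Longrightarrow> \<delta> N < \<delta> N'"
    using insert.IH[OF bJ] by metis
  have U: "submodule (U J) K V" unfolding U_def by (rule submodule_span_set[OF V bJ])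
  have inter: "submodule (N \<inter> U J) K V" if "submodule N K V" for N
    using submodule_subset[OF that] submodule_zero[OF that] submodule_zero[OF U]
      submodule_add[OF that] submodule_add[OF U] submodule_smult[OF that] submodule_smult[OF U]
    by (intro V.lsubmoduleI) auto
  \<comment> \<open>Over a field an element with nonzero coefficient at \<open>j\<close> can be
    scaled to coefficient 1. For \<open>N\<close> inside the larger span, \<open>lead\<close>
    therefore tells whether \<open>N\<close> leaves the span of \<open>J\<close>.\<close>
  define lead where "lead N \<longleftrightarrow> (\<exists>y\<in>U J. b j \<oplus>\<^bsub>V\<^esub> y \<in> N)" for N
  define \<delta>' where "\<delta>' N = \<delta> (N \<inter> U J) + (if lead N then 1 else 0)" for N
  have "\<delta>' N < \<delta>' N'" if N: "submodule N K V" and N': "submodule N' K V" and lt: "N \<subset> N'" and sub: "N' \<subseteq> U (insert j J)" for N N'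
  proof -
    have lead_mono: "lead N \<Longrightarrow> lead N'" using lt by (auto simp: lead_def)
    have \<delta>_lt: "\<delta> (N \<inter> U J) < \<delta> (N' \<inter> U J)" if "N \<inter> U J \<noteq> N' \<inter> U J"
      using that lt by (intro \<delta> inter N N') auto
    have "N \<inter> U J \<noteq> N' \<inter> U J \<or> lead N' \<and> \<not> lead N"
    proof (rule ccontr)
      assume "\<not> ?thesis"
      then have eq: "N \<inter> U J = N' \<inter> U J" and le: "lead N' \<Longrightarrow> lead N" by auto
      obtain x where x: "x \<in> N'" "x \<notin> N" using lt by auto
      obtain c where c: "c \<in> insert j J \<rightarrow> carrier K" "x = (\<Oplus>\<^bsub>V\<^esub>j\<in>insert j J. c j \<odot>\<^bsub>V\<^esub> b j)"
        using x sub by (auto simp: U_def span_set_def)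
      define y where "y = (\<Oplus>\<^bsub>V\<^esub>j\<in>J. c j \<odot>\<^bsub>V\<^esub> b j)"
      have y: "y \<in> U J" using c by (auto simp: y_def U_def span_set_def)
      have yV: "y \<in> carrier V" using y submodule_subset[OF U] by auto
      have cj: "c j \<in> carrier K" using c by auto
      have xy: "x = c j \<odot>\<^bsub>V\<^esub> b j \<oplus>\<^bsub>V\<^esub> y"
        using insert c bj bJ unfolding c(2) y_def by (subst V.finsum_insert) (auto intro!: V.lsmult_closed)
      show False
      proof (cases "c j = \<zero>\<^bsub>K\<^esub>")
        case True
        then have "x = y" using xy bj yV by (simp add: V.lsmult_zero_left)
        then show False using x y eq by auto
      next
        case False
        define d where "d = inv\<^bsub>K\<^esub> (c j)"
        have d: "d \<in> carrier K" "c j \<otimes>\<^bsub>K\<^esub> d = \<one>\<^bsub>K\<^esub>" "d \<otimes>\<^bsub>K\<^esub> c j = \<one>\<^bsub>K\<^esub>"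
          using False cj K.field_Units by (auto simp: d_def)
        have "d \<odot>\<^bsub>V\<^esub> x = b j \<oplus>\<^bsub>V\<^esub> d \<odot>\<^bsub>V\<^esub> y"
          using d cj bj yV by (simp add: xy V.lsmult_r_distr V.lsmult_closed V.lsmult_assoc[symmetric] V.lsmult_one)
        then have "lead N'"
          using submodule_smult[OF N' d(1) x(1)] submodule_smult[OF U d(1) y] by (auto simp: lead_def)
        then obtain z where z: "z \<in> U J" "b j \<oplus>\<^bsub>V\<^esub> z \<in> N" using le by (auto simp: lead_def)
        have zV: "z \<in> carrier V" using z submodule_subset[OF U] by auto
        \<comment> \<open>\<open>w\<close> lies in \<open>N\<close> and has the same coefficient at
          \<open>j\<close> as \<open>x\<close>. The difference \<open>x - w\<close> falls into the
          span of \<open>J\<close>, where \<open>N\<close> and \<open>N'\<close> agree.\<close>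
        define w where "w = c j \<odot>\<^bsub>V\<^esub> (b j \<oplus>\<^bsub>V\<^esub> z)"
        have w: "w \<in> N" using z cj submodule_smult[OF N] by (auto simp: w_def)
        have wV: "w \<in> carrier V" "x \<in> carrier V" using w x submodule_subset[OF N] submodule_subset[OF N'] by auto
        have "x \<oplus>\<^bsub>V\<^esub> \<ominus>\<^bsub>V\<^esub> w = y \<oplus>\<^bsub>V\<^esub> \<ominus>\<^bsub>V\<^esub> (c j \<odot>\<^bsub>V\<^esub> z)"
        proof -
          have "w = c j \<odot>\<^bsub>V\<^esub> b j \<oplus>\<^bsub>V\<^esub> c j \<odot>\<^bsub>V\<^esub> z" using cj bj zV by (simp add: w_def V.lsmult_r_distr)
          moreover have "c j \<odot>\<^bsub>V\<^esub> b j \<in> carrier V" "c j \<odot>\<^bsub>V\<^esub> z \<in> carrier V"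
            using cj bj zV by (auto intro: V.lsmult_closed)
          ultimately show ?thesis using yV
            by (simp add: xy V.add_diff_add)
        qed
        moreover have "y \<oplus>\<^bsub>V\<^esub> \<ominus>\<^bsub>V\<^esub> (c j \<odot>\<^bsub>V\<^esub> z) \<in> U J"
          using y z cj by (intro submodule_add[OF U] submodule_minus[OF U] submodule_smult[OF U])
        moreover have "x \<oplus>\<^bsub>V\<^esub> \<ominus>\<^bsub>V\<^esub> w \<in> N'"
          using x w lt by (intro submodule_add[OF N'] submodule_minus[OF N']) auto
        ultimately have "x \<oplus>\<^bsub>V\<^esub> \<ominus>\<^bsub>V\<^esub> w \<in> N" using eq by auto
        then have "(x \<oplus>\<^bsub>V\<^esub> \<ominus>\<^bsub>V\<^esub> w) \<oplus>\<^bsub>V\<^esub> w \<in> N" using w by (rule submodule_add[OF N])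
        then show False using x wV by (simp add: V.a_assoc V.l_neg)
      qed
    qed
    then show ?thesis
      using lead_mono \<delta>_lt unfolding \<delta>'_def by (cases "N \<inter> U J = N' \<inter> U J") auto
  qed
  then show ?case by blast
qed

text \<open>The scalar type changes, which a record update cannot express, so the record is rebuilt.
  Carrier and addition stay literally the same, hence so do all finite sums.\<close>

definition restrict_scalars ::
  "('c \<Rightarrow> 'a) \<Rightarrow> ('a, 'm) module \<Rightarrow> ('c, 'm) module" where
  "restrict_scalars \<kappa> M = \<lparr>carrier = carrier M, monoid.mult = monoid.mult M, one = one M,
     ring.zero = ring.zero M, add = add M, smult = (\<lambda>c x. \<kappa> c \<odot>\<^bsub>M\<^esub> x)\<rparr>"

lemma restrict_scalars_simps [simp]:
  "carrier (restrict_scalars \<kappa> M) = carrier M" "\<zero>\<^bsub>restrict_scalars \<kappa> M\<^esub> = \<zero>\<^bsub>M\<^esub>"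
  "x \<oplus>\<^bsub>restrict_scalars \<kappa> M\<^esub> y = x \<oplus>\<^bsub>M\<^esub> y" "c \<odot>\<^bsub>restrict_scalars \<kappa> M\<^esub> x = \<kappa> c \<odot>\<^bsub>M\<^esub> x"
  by (simp_all add: restrict_scalars_def)

lemma finsum_restrict_scalars [simp]: "finsum (restrict_scalars \<kappa> M) = finsum M"
  by (simp add: finsum_def finprod_def restrict_scalars_def fun_eq_iff)

lemma left_module_restrict_scalars:
  assumes "ring C" "\<kappa> \<in> ring_hom C R" "left_module R M"
  shows "left_module C (restrict_scalars \<kappa> M)"
proof -
  interpret C: ring C by fact
  interpret M: left_module R M by fact
  note \<kappa> = ring_hom_closed[OF assms(2)] ring_hom_mult[OF assms(2)] ring_hom_add[OF assms(2)] ring_hom_one[OF assms(2)]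
  have "abelian_group (restrict_scalars \<kappa> M)"
    by (rule abelian_groupI) (auto simp: M.M.a_ac intro!: bexI[of _ "\<ominus>\<^bsub>M\<^esub> x" for x] M.M.l_neg)
  then show ?thesis
    using \<kappa> by (intro left_module.intro left_module_axioms.intro C.ring_axioms)
      (auto simp: M.lsmult_closed M.lsmult_l_distr M.lsmult_r_distr M.lsmult_assoc M.lsmult_one)
qed

lemma submodule_restrict_scalars:
  assumes "ring C" "\<kappa> \<in> ring_hom C R" "left_module R M" "submodule N R M"
  shows "submodule N C (restrict_scalars \<kappa> M)"
  using submodule_subset[OF assms(4)] submodule_zero[OF assms(4)] submodule_add[OF assms(4)]
    submodule_smult[OF assms(4)] ring_hom_closed[OF assms(2)]
  by (intro left_module.lsubmoduleI[OF left_module_restrict_scalars[OF assms(1-3)]]) auto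

lemma mod_hom_restrict_scalars:
  assumes "\<kappa> \<in> ring_hom C R" "f \<in> mod_hom R M N"
  shows "f \<in> mod_hom C (restrict_scalars \<kappa> M) (restrict_scalars \<kappa> N)"
  using assms(2) ring_hom_closed[OF assms(1)] by (auto simp: mod_hom_def)

text \<open>Only a left \<open>K\<close>-basis is needed: the image of \<open>\<kappa>\<close> need not be central here.\<close>

definition fd_over ::
  "('k, 'z) ring_scheme \<Rightarrow> ('a, 'x) ring_scheme \<Rightarrow> ('k \<Rightarrow> 'a) \<Rightarrow> 'i set \<Rightarrow> ('i \<Rightarrow> 'a) \<Rightarrow> bool" where
  "fd_over K R \<kappa> I r \<longleftrightarrow> field K \<and> ring R \<and> \<kappa> \<in> ring_hom K R \<and> finite I \<and> r \<in> I \<rightarrow> carrier R \<and>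
     (\<forall>x\<in>carrier R. \<exists>c\<in>I \<rightarrow> carrier K. x = (\<Oplus>\<^bsub>R\<^esub>i\<in>I. \<kappa> (c i) \<otimes>\<^bsub>R\<^esub> r i))"

text \<open>The finitely many products of the spanning elements \<open>r i\<close> with the vectors
  \<open>b j\<close> span \<open>M\<close> over the field, and submodules over \<open>R\<close> are
  subspaces. The dimension count for subspaces therefore restricts to submodules.\<close>

lemma fg_projective_length_function:
  fixes M :: "('a, 'm) module"
  assumes fd: "fd_over K R \<kappa> I r" and M: "fg_projective R M"
  shows "\<exists>\<delta>. length_function R M \<delta>"
proof -
  have K: "field K" and R: "ring R" and \<kappa>: "\<kappa> \<in> ring_hom K R" and I: "finite I" and r: "r \<in> I \<rightarrow> carrier R"
    and rspan: "\<And>x. x \<in> carrier R \<Longrightarrow> \<exists>c\<in>I \<rightarrow> carrier K. x = (\<Oplus>\<^bsub>R\<^esub>i\<in>I. \<kappa> (c i) \<otimes>\<^bsub>R\<^esub> r i)"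
    using fd by (auto simp: fd_over_def)
  obtain n b f where b: "dual_basis R M {..<n::nat} b f" and lM: "left_module R M"
    using M by (auto simp: fg_projective_def)
  interpret K: field K by fact
  interpret left_module R M by fact
  define V where "V = restrict_scalars \<kappa> M"
  have V: "left_module K V"
    unfolding V_def by (rule left_module_restrict_scalars[OF K.ring_axioms \<kappa> lM])
  define b' where "b' = (\<lambda>(j, i). r i \<odot>\<^bsub>M\<^esub> b j)"
  have b': "b' \<in> {..<n} \<times> I \<rightarrow> carrier V"
    using r dual_basis_closed(1)[OF b] by (auto simp: b'_def V_def intro!: lsmult_closed)
  define U where "U = span_set V K ({..<n} \<times> I) b'"
  have "finite ({..<n} \<times> I)" using I by simp
  from length_function_span[OF K V this b', folded U_def]
  obtain \<delta> :: "_ \<Rightarrow> nat"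
    where \<delta>: "\<forall>N N'. submodule N K V \<and> submodule N' K V \<and> N \<subset> N' \<and> N' \<subseteq> U \<longrightarrow> \<delta> N < \<delta> N'"
    by (rule exE)
  have span: "x \<in> U"
    if x: "x \<in> carrier M" for x
  proof -
    have "\<exists>c. \<forall>j\<in>{..<n}. c j \<in> I \<rightarrow> carrier K \<and> f j x = (\<Oplus>\<^bsub>R\<^esub>i\<in>I. \<kappa> (c j i) \<otimes>\<^bsub>R\<^esub> r i)"
      using rspan dual_basis_closed(2)[OF b _ x] by (intro bchoice) blast
    then obtain c where
      c': "\<forall>j\<in>{..<n}. c j \<in> I \<rightarrow> carrier K \<and> f j x = (\<Oplus>\<^bsub>R\<^esub>i\<in>I. \<kappa> (c j i) \<otimes>\<^bsub>R\<^esub> r i)" ..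
    have c: "c j i \<in> carrier K" if "j < n" "i \<in> I" for j i
      using c' that by (auto simp: Pi_iff)
    have fc: "f j x = (\<Oplus>\<^bsub>R\<^esub>i\<in>I. \<kappa> (c j i) \<otimes>\<^bsub>R\<^esub> r i)" if "j < n" for j
      using c' that by simp
    have \<kappa>c: "\<kappa> (c j i) \<in> carrier R" if "j < n" "i \<in> I" for j i
      using ring_hom_closed[OF \<kappa> c[OF that]] .
    have rI: "r i \<in> carrier R" if "i \<in> I" for i using that r by auto
    have bM: "b j \<in> carrier M" if "j < n" for j using that dual_basis_closed(1)[OF b] by auto
    have "x = (\<Oplus>\<^bsub>M\<^esub>j\<in>{..<n}. f j x \<odot>\<^bsub>M\<^esub> b j)" by (rule dual_basis_expand[OF b x])
    also have "\<dots> = (\<Oplus>\<^bsub>M\<^esub>j\<in>{..<n}. \<Oplus>\<^bsub>M\<^esub>i\<in>I. \<kappa> (c j i) \<odot>\<^bsub>M\<^esub> (r i \<odot>\<^bsub>M\<^esub> b j))"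
    proof (intro finsum_cong' refl)
      fix j assume "j \<in> {..<n}"
      then have j: "j < n" by simp
      have "f j x \<odot>\<^bsub>M\<^esub> b j = (\<Oplus>\<^bsub>M\<^esub>i\<in>I. (\<kappa> (c j i) \<otimes>\<^bsub>R\<^esub> r i) \<odot>\<^bsub>M\<^esub> b j)"
        using \<kappa>c[OF j] rI bM[OF j] by (subst fc[OF j], intro lsmult_finsum_left) auto
      also have "\<dots> = (\<Oplus>\<^bsub>M\<^esub>i\<in>I. \<kappa> (c j i) \<odot>\<^bsub>M\<^esub> (r i \<odot>\<^bsub>M\<^esub> b j))"
        using \<kappa>c[OF j] rI bM[OF j] by (intro finsum_cong' refl) (auto intro!: lsmult_closed simp: lsmult_assoc)
      finally show "f j x \<odot>\<^bsub>M\<^esub> b j = (\<Oplus>\<^bsub>M\<^esub>i\<in>I. \<kappa> (c j i) \<odot>\<^bsub>M\<^esub> (r i \<odot>\<^bsub>M\<^esub> b j))" .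
    qed (use \<kappa>c rI bM in \<open>auto intro!: lsmult_closed finsum_closed\<close>)
    also have "\<dots> = (\<Oplus>\<^bsub>M\<^esub>j\<in>{..<n} \<times> I. \<kappa> (case j of (j, i) \<Rightarrow> c j i) \<odot>\<^bsub>M\<^esub> b' j)"
      using finsum_Sigma[of "{..<n}" "\<lambda>_. I" "\<lambda>j i. \<kappa> (c j i) \<odot>\<^bsub>M\<^esub> (r i \<odot>\<^bsub>M\<^esub> b j)"] I \<kappa>c rI bM
      by (simp add: b'_def case_prod_unfold lsmult_closed)
    finally have "x = (\<Oplus>\<^bsub>V\<^esub>j\<in>{..<n} \<times> I. (case j of (j, i) \<Rightarrow> c j i) \<odot>\<^bsub>V\<^esub> b' j)" by (simp add: V_def)
    moreover have "(\<lambda>(j, i). c j i) \<in> {..<n} \<times> I \<rightarrow> carrier K" using c by auto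
    ultimately show ?thesis unfolding U_def span_set_def by blast
  qed
  have "length_function R M \<delta>"
    unfolding length_function_def
  proof (intro allI impI, elim conjE)
    fix N N' assume N: "submodule N R M" "submodule N' R M" "N \<subset> N'"
    show "\<delta> N < \<delta> N'"
      using N span submodule_subset[OF N(2)]
      by (intro \<delta>[rule_format] conjI)
        (auto simp: V_def intro: submodule_restrict_scalars[OF K.ring_axioms \<kappa> lM])
  qed
  then show ?thesis by blast
qed

text \<open>A proper submodule with the largest value of \<open>\<delta>\<close> is maximal, so a
  nonzero module of finite length cannot equal its radical. This plays the part of Nakayama's
  lemma.\<close>

lemma carrier_subset_radical_imp_zero:
  fixes M :: "('a, 'm) module"
  assumes M: "left_module R M" and \<delta>: "length_function R M \<delta>" and rad: "carrier M \<subseteq> radical R M"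
  shows "carrier M = {\<zero>\<^bsub>M\<^esub>}"
proof (rule ccontr)
  assume nz: "carrier M \<noteq> {\<zero>\<^bsub>M\<^esub>}"
  define P where "P N \<longleftrightarrow> submodule N R M \<and> N \<noteq> carrier M" for N
  have P0: "P {\<zero>\<^bsub>M\<^esub>}" using nz submodule_zero_set[OF M] by (simp add: P_def)
  have bound: "\<delta> N \<le> \<delta> (carrier M)" if "P N" for N
  proof -
    have "N \<subset> carrier M" using that submodule_subset[of N R M] unfolding P_def by blast
    then show ?thesis
      using that length_functionD[OF \<delta> _ submodule_carrier[OF M]] by (simp add: P_def less_imp_le)
  qed
  from ex_has_greatest_nat[of P "{\<zero>\<^bsub>M\<^esub>}" \<delta> "Suc (\<delta> (carrier M))", OF P0]
  have "\<exists>N. P N \<and> (\<forall>N'. P N' \<longrightarrow> \<delta> N' \<le> \<delta> N)" using bound by (simp add: less_Suc_eq_le)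
  then obtain N where N: "P N" "\<forall>N'. P N' \<longrightarrow> \<delta> N' \<le> \<delta> N" by (elim exE conjE)
  have "N' = N \<or> N' = carrier M" if "submodule N' R M" "N \<subseteq> N'" for N'
  proof (rule ccontr)
    assume *: "\<not> ?thesis"
    then have "\<delta> N < \<delta> N'" using N(1) that by (intro length_functionD[OF \<delta>]) (auto simp: P_def)
    moreover have "P N'" using * that by (simp add: P_def)
    ultimately show False using N(2) by (meson linorder_not_le)
  qed
  then have "maximal_submodule R M N"
    using N(1) unfolding maximal_submodule_def P_def by simp
  then have "carrier M \<subseteq> N" using rad by (auto simp: radical_def)
  then show False using N(1) submodule_subset[of N R M] by (auto simp: P_def)
qed

text \<open>The preimage \<open>L'\<close> of a maximal submodule \<open>L\<close> is either
  everything or maximal again: for \<open>H\<close> above \<open>L'\<close>, the sum of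
  \<open>L\<close> and \<open>f H\<close> is \<open>L\<close> or \<open>N\<close>, which forces
  \<open>H = L'\<close> or \<open>H = M\<close>.\<close>

lemma mod_hom_radical:
  assumes M: "left_module R M" and N: "left_module R N" and f: "f \<in> mod_hom R M N"
    and x: "x \<in> radical R M"
  shows "f x \<in> radical R N"
proof -
  have xM: "x \<in> carrier M" using x by (simp add: radical_def)
  have "f x \<in> L" if L: "maximal_submodule R N L" for L
  proof -
    have sL: "submodule L R N" using L by (simp add: maximal_submodule_def)
    interpret N: left_module R N by fact
    interpret M: left_module R M by fact
    define L' where "L' = {x \<in> carrier M. f x \<in> L}"
    have L': "submodule L' R M" unfolding L'_def by (rule submodule_vimage[OF M N f sL])
    have "maximal_submodule R M L'" if ne: "L' \<noteq> carrier M"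
      unfolding maximal_submodule_def
    proof (intro conjI allI impI L' ne)
      fix H assume H: "submodule H R M \<and> L' \<subseteq> H"
      have fH: "submodule (f ` H) R N" using submodule_image[OF M N f] H by auto
      let ?S = "{x \<oplus>\<^bsub>N\<^esub> y |x y. x \<in> L \<and> y \<in> f ` H}"
      have S: "submodule ?S R N" by (rule submodule_sum[OF N sL fH])
      have "L \<subseteq> ?S"
      proof
        fix y assume y: "y \<in> L"
        then have "y = y \<oplus>\<^bsub>N\<^esub> \<zero>\<^bsub>N\<^esub>" using submodule_subset[OF sL] by auto
        then show "y \<in> ?S" using y submodule_zero[OF fH] by blast
      qed
      then consider "?S = L" | "?S = carrier N" using L S by (auto simp: maximal_submodule_def)
      then show "H = L' \<or> H = carrier M"
      proof cases
        case 1
        have "y \<in> L'" if y: "y \<in> H" for y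
        proof -
          have yM: "y \<in> carrier M" using y H submodule_subset[of H R M] by auto
          have "f y = \<zero>\<^bsub>N\<^esub> \<oplus>\<^bsub>N\<^esub> f y" using mod_hom_closed[OF f yM] by simp
          then have "f y \<in> ?S" using submodule_zero[OF sL] y by blast
          then show ?thesis using 1 yM by (simp add: L'_def)
        qed
        then show ?thesis using H by auto
      next
        case 2
        have "y \<in> H" if y: "y \<in> carrier M" for y
        proof -
          have "f y \<in> ?S" using 2 mod_hom_closed[OF f y] by auto
          then obtain l h where lh: "f y = l \<oplus>\<^bsub>N\<^esub> f h" "l \<in> L" "h \<in> H" by auto
          have hM: "h \<in> carrier M" using lh H submodule_subset[of H R M] by auto
          have lN: "l \<in> carrier N" using lh submodule_subset[OF sL] by auto
          \<comment> \<open>Subtracting \<open>h\<close> moves \<open>y\<close> into the preimage of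
            \<open>L\<close>, which is contained in \<open>H\<close>.\<close>
          have "f (y \<oplus>\<^bsub>M\<^esub> \<ominus>\<^bsub>M\<^esub> h) = l"
            using lN mod_hom_closed[OF f hM] y hM
            by (simp add: mod_hom_add[OF f] mod_hom_minus[OF M N f] lh(1) N.a_assoc N.r_neg)
          then have "y \<oplus>\<^bsub>M\<^esub> \<ominus>\<^bsub>M\<^esub> h \<in> H" using lh H y hM by (auto simp: L'_def)
          then have "(y \<oplus>\<^bsub>M\<^esub> \<ominus>\<^bsub>M\<^esub> h) \<oplus>\<^bsub>M\<^esub> h \<in> H" using lh H by (auto intro: submodule_add[of H R M])
          then show ?thesis using y hM by (simp add: M.a_assoc M.l_neg)
        qed
        then show ?thesis using H submodule_subset[of H R M] by auto
      qed
    qed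
    then have "x \<in> L'" using x xM by (auto simp: radical_def)
    then show ?thesis by (simp add: L'_def)
  qed
  then show ?thesis using mod_hom_closed[OF f xM] by (auto simp: radical_def)
qed

section \<open>Complexes and homotopies\<close>

text \<open>Projectivity and boundedness are left out, so that restriction along an arbitrary ring
  homomorphism stays within this notion even where it does not preserve projectives.\<close>

definition cochain :: "('a, 'x) ring_scheme \<Rightarrow> ('a, 'm) cochain_complex \<Rightarrow> bool" where
  "cochain R P \<longleftrightarrow> (\<forall>n. left_module R (obj P n)) \<and>
     (\<forall>n. dif P n \<in> mod_hom R (obj P n) (obj P (n + 1))) \<and>
     (\<forall>n. \<forall>x\<in>carrier (obj P n). dif P (n + 1) (dif P n x) = \<zero>\<^bsub>obj P (n + 2)\<^esub>)"

text \<open>The clauses at \<open>n - 1\<close> have target index \<open>n\<close> instead of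
  \<open>n - 1 + 1\<close>; this is the form in which homotopies meet the differential.\<close>

lemma cochainD:
  assumes "cochain R P"
  shows "left_module R (obj P n)" "dif P n \<in> mod_hom R (obj P n) (obj P (n + 1))"
    "dif P (n - 1) \<in> mod_hom R (obj P (n - 1)) (obj P n)"
    "x \<in> carrier (obj P n) \<Longrightarrow> dif P n x \<in> carrier (obj P (n + 1))"
    "x \<in> carrier (obj P (n - 1)) \<Longrightarrow> dif P (n - 1) x \<in> carrier (obj P n)"
    "x \<in> carrier (obj P n) \<Longrightarrow> dif P (n + 1) (dif P n x) = \<zero>\<^bsub>obj P (n + 2)\<^esub>"
    "x \<in> carrier (obj P (n - 1)) \<Longrightarrow> dif P n (dif P (n - 1) x) = \<zero>\<^bsub>obj P (n + 1)\<^esub>"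
proof -
  show *: "left_module R (obj P n)" "dif P n \<in> mod_hom R (obj P n) (obj P (n + 1))" for n
    using assms by (auto simp: cochain_def)
  show "dif P (n - 1) \<in> mod_hom R (obj P (n - 1)) (obj P n)" using *(2)[of "n - 1"] by simp
  show "x \<in> carrier (obj P n) \<Longrightarrow> dif P n x \<in> carrier (obj P (n + 1))"
    using mod_hom_closed[OF *(2)] .
  show "x \<in> carrier (obj P (n - 1)) \<Longrightarrow> dif P (n - 1) x \<in> carrier (obj P n)"
    using mod_hom_closed[OF *(2)[of "n - 1"]] by simp
  show **: "x \<in> carrier (obj P n) \<Longrightarrow> dif P (n + 1) (dif P n x) = \<zero>\<^bsub>obj P (n + 2)\<^esub>" for n
    using assms by (simp add: cochain_def)
  have "n - 1 + 2 = n + 1" by simp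
  then show "x \<in> carrier (obj P (n - 1)) \<Longrightarrow> dif P n (dif P (n - 1) x) = \<zero>\<^bsub>obj P (n + 1)\<^esub>"
    using **[of "n - 1"] by (metis diff_add_cancel)
qed

lemma cochain_abelian_group:
  "cochain R P \<Longrightarrow> abelian_group (obj P n)"
  using cochainD(1) left_module.abelian_group_self by blast

text \<open>The differential \<open>d h + h d\<close> of the Hom complex on maps of degree -1.
  Homotopic chain maps are those that differ by such a term.\<close>

definition boundary ::
  "('a, 'm) cochain_complex \<Rightarrow> ('a, 'n) cochain_complex \<Rightarrow> (int \<Rightarrow> 'm \<Rightarrow> 'n) \<Rightarrow> int \<Rightarrow> 'm \<Rightarrow> 'n" where
  "boundary P Q h n x = dif Q (n - 1) (h n x) \<oplus>\<^bsub>obj Q n\<^esub> h (n + 1) (dif P n x)"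

definition degree_minus1 ::
  "('a, 'x) ring_scheme \<Rightarrow> ('a, 'm) cochain_complex \<Rightarrow> ('a, 'n) cochain_complex \<Rightarrow> (int \<Rightarrow> 'm \<Rightarrow> 'n) set" where
  "degree_minus1 R P Q = {h. \<forall>n. h n \<in> mod_hom R (obj P n) (obj Q (n - 1))}"

text \<open>\<open>chain_map\<close> with independent element types for source and target, as
  required for maps into restricted, coinduced and re-encoded complexes.\<close>

definition chain_hom ::
  "('a, 'x) ring_scheme \<Rightarrow> ('a, 'm) cochain_complex \<Rightarrow> ('a, 'n) cochain_complex \<Rightarrow> (int \<Rightarrow> 'm \<Rightarrow> 'n) set"
where
  "chain_hom R P Q = {f. \<forall>n. f n \<in> mod_hom R (obj P n) (obj Q n) \<and>
     (\<forall>x\<in>carrier (obj P n). f (n + 1) (dif P n x) = dif Q n (f n x))}"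

lemma chain_map_eq_chain_hom: "chain_map R P Q = chain_hom R P Q"
  by (simp add: chain_map_def chain_hom_def)

lemma chain_homD:
  assumes "f \<in> chain_hom R P Q"
  shows "f n \<in> mod_hom R (obj P n) (obj Q n)"
    "x \<in> carrier (obj P n) \<Longrightarrow> f n x \<in> carrier (obj Q n)"
    "x \<in> carrier (obj P n) \<Longrightarrow> f (n + 1) (dif P n x) = dif Q n (f n x)"
    "x \<in> carrier (obj P (n - 1)) \<Longrightarrow> f n (dif P (n - 1) x) = dif Q (n - 1) (f (n - 1) x)"
proof -
  show *: "f n \<in> mod_hom R (obj P n) (obj Q n)" for n using assms by (simp add: chain_hom_def)
  show "x \<in> carrier (obj P n) \<Longrightarrow> f n x \<in> carrier (obj Q n)" using mod_hom_closed[OF *] .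
  show **: "x \<in> carrier (obj P n) \<Longrightarrow> f (n + 1) (dif P n x) = dif Q n (f n x)" for n
    using assms by (simp add: chain_hom_def)
  show "x \<in> carrier (obj P (n - 1)) \<Longrightarrow> f n (dif P (n - 1) x) = dif Q (n - 1) (f (n - 1) x)"
    using **[of "n - 1"] by simp
qed

lemma degree_minus1D:
  assumes "h \<in> degree_minus1 R P Q"
  shows "h n \<in> mod_hom R (obj P n) (obj Q (n - 1))" "h (n + 1) \<in> mod_hom R (obj P (n + 1)) (obj Q n)"
    "x \<in> carrier (obj P n) \<Longrightarrow> h n x \<in> carrier (obj Q (n - 1))"
    "x \<in> carrier (obj P (n + 1)) \<Longrightarrow> h (n + 1) x \<in> carrier (obj Q n)"
proof -
  show *: "h n \<in> mod_hom R (obj P n) (obj Q (n - 1))" for n using assms by (simp add: degree_minus1_def)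
  show **: "h (n + 1) \<in> mod_hom R (obj P (n + 1)) (obj Q n)" using *[of "n + 1"] by simp
  show "x \<in> carrier (obj P n) \<Longrightarrow> h n x \<in> carrier (obj Q (n - 1))" using mod_hom_closed[OF *] .
  show "x \<in> carrier (obj P (n + 1)) \<Longrightarrow> h (n + 1) x \<in> carrier (obj Q n)" using mod_hom_closed[OF **] .
qed

lemma chain_homI:
  assumes "\<And>n. f n \<in> mod_hom R (obj P n) (obj Q n)"
    "\<And>n x. x \<in> carrier (obj P n) \<Longrightarrow> f (n + 1) (dif P n x) = dif Q n (f n x)"
  shows "f \<in> chain_hom R P Q"
  using assms by (simp add: chain_hom_def)

lemma chain_hom_comp:
  assumes "f \<in> chain_hom R P Q" "g \<in> chain_hom R Q S"
  shows "(\<lambda>n x. g n (f n x)) \<in> chain_hom R P S"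
  using chain_homD[OF assms(1)] chain_homD[OF assms(2)]
  by (intro chain_homI mod_hom_comp[OF chain_homD(1)[OF assms(1)] chain_homD(1)[OF assms(2)]]) simp

lemma chain_hom_id: "(\<lambda>n x. x) \<in> chain_hom R P P"
  by (intro chain_homI mod_hom_id) simp

lemma chain_hom_add:
  assumes "cochain R Q" "f \<in> chain_hom R P Q" "g \<in> chain_hom R P Q"
  shows "(\<lambda>n x. f n x \<oplus>\<^bsub>obj Q n\<^esub> g n x) \<in> chain_hom R P Q"
  using chain_homD[OF assms(2)] chain_homD[OF assms(3)] mod_hom_add[OF cochainD(2)[OF assms(1)]]
  by (intro chain_homI mod_hom_plus cochainD(1)[OF assms(1)] chain_homD(1)[OF assms(2)] chain_homD(1)[OF assms(3)])
    simp

lemma chain_hom_uminus: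
  assumes "cochain R Q" "f \<in> chain_hom R P Q"
  shows "(\<lambda>n x. \<ominus>\<^bsub>obj Q n\<^esub> f n x) \<in> chain_hom R P Q"
  using chain_homD[OF assms(2)]
    mod_hom_minus[OF cochainD(1)[OF assms(1)] cochainD(1)[OF assms(1)] cochainD(2)[OF assms(1)]]
  by (intro chain_homI mod_hom_uminus cochainD(1)[OF assms(1)] chain_homD(1)[OF assms(2)]) simp

lemma chain_hom_zero:
  assumes "cochain R Q"
  shows "(\<lambda>n x. \<zero>\<^bsub>obj Q n\<^esub>) \<in> chain_hom R P Q"
  using mod_hom_zero[OF cochainD(1)[OF assms] cochainD(1)[OF assms] cochainD(2)[OF assms]]
  by (intro chain_homI mod_hom_const_zero cochainD(1)[OF assms]) simp

lemma chain_hom_funpow: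
  assumes "f \<in> chain_hom R P P"
  shows "(\<lambda>n x. (f n ^^ k) x) \<in> chain_hom R P P"
proof (induction k)
  case (Suc k)
  show ?case using chain_hom_comp[OF Suc assms] by simp
qed (simp add: chain_hom_id)

lemma boundary_closed:
  assumes "cochain R P" "cochain R Q" "h \<in> degree_minus1 R P Q" "x \<in> carrier (obj P n)"
  shows "boundary P Q h n x \<in> carrier (obj Q n)"
proof -
  interpret abelian_group "obj Q n" by (rule cochain_abelian_group[OF assms(2)])
  show ?thesis
    using degree_minus1D[OF assms(3)] cochainD[OF assms(1)] cochainD[OF assms(2)] assms(4)
    by (simp add: boundary_def)
qed

text \<open>Since \<open>d d = 0\<close>, both \<open>d (d h + h d)\<close> and
  \<open>(d h + h d) d\<close> are equal to \<open>d h d\<close>.\<close>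

lemma boundary_chain_hom:
  assumes P: "cochain R P" and Q: "cochain R Q" and h: "h \<in> degree_minus1 R P Q"
  shows "boundary P Q h \<in> chain_hom R P Q"
proof (rule chain_homI)
  fix n
  have "(\<lambda>x. dif Q (n - 1) (h n x) \<oplus>\<^bsub>obj Q n\<^esub> h (n + 1) (dif P n x)) \<in> mod_hom R (obj P n) (obj Q n)"
    by (intro mod_hom_plus cochainD(1)[OF Q] mod_hom_comp[OF degree_minus1D(1)[OF h] cochainD(3)[OF Q]]
        mod_hom_comp[OF cochainD(2)[OF P] degree_minus1D(2)[OF h]])
  then show "boundary P Q h n \<in> mod_hom R (obj P n) (obj Q n)"
    unfolding boundary_def .
  fix x assume x: "x \<in> carrier (obj P n)"
  interpret Qn: abelian_group "obj Q n" by (rule cochain_abelian_group[OF Q])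
  interpret Qm: abelian_group "obj Q (n + 1)" by (rule cochain_abelian_group[OF Q])
  have n: "n + 1 + 1 = n + 2" by simp
  have z: "h (n + 2) \<zero>\<^bsub>obj P (n + 2)\<^esub> = \<zero>\<^bsub>obj Q (n + 1)\<^esub>"
    using mod_hom_zero[OF cochainD(1)[OF P] cochainD(1)[OF Q] degree_minus1D(2)[OF h], of "n + 1"]
    by (simp add: add.commute)
  have hd: "h (n + 1) (dif P n x) \<in> carrier (obj Q n)"
    using degree_minus1D(4)[OF h cochainD(4)[OF P x]] .
  have "boundary P Q h (n + 1) (dif P n x) = dif Q n (h (n + 1) (dif P n x))"
    unfolding boundary_def using cochainD(6)[OF P x] z cochainD(4)[OF Q hd]
    by (simp add: n)
  also have "\<dots> = dif Q n (dif Q (n - 1) (h n x)) \<oplus>\<^bsub>obj Q (n + 1)\<^esub> dif Q n (h (n + 1) (dif P n x))"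
    using cochainD(7)[OF Q degree_minus1D(3)[OF h x]] cochainD(4)[OF Q hd] by simp
  also have "\<dots> = dif Q n (boundary P Q h n x)"
    unfolding boundary_def using mod_hom_add[OF cochainD(2)[OF Q] cochainD(5)[OF Q degree_minus1D(3)[OF h x]] hd] by simp
  finally show "boundary P Q h (n + 1) (dif P n x) = dif Q n (boundary P Q h n x)" .
qed

lemma homotopicI:
  assumes "h \<in> degree_minus1 R P Q"
    "\<And>n x. x \<in> carrier (obj P n) \<Longrightarrow> f n x = g n x \<oplus>\<^bsub>obj Q n\<^esub> boundary P Q h n x"
  shows "homotopic R P Q f g"
  using assms unfolding homotopic_def degree_minus1_def boundary_def by blast

lemma homotopicE:
  assumes "homotopic R P Q f g"
  obtains h where "h \<in> degree_minus1 R P Q"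
    "\<And>n x. x \<in> carrier (obj P n) \<Longrightarrow> f n x = g n x \<oplus>\<^bsub>obj Q n\<^esub> boundary P Q h n x"
  using assms unfolding homotopic_def degree_minus1_def boundary_def by blast

text \<open>Maps are total functions, so identities between them usually hold on carriers only; this
  lets such identities be used inside homotopies.\<close>

lemma homotopic_cong:
  assumes "homotopic R P Q f g"
    "\<And>n x. x \<in> carrier (obj P n) \<Longrightarrow> f' n x = f n x" "\<And>n x. x \<in> carrier (obj P n) \<Longrightarrow> g' n x = g n x"
  shows "homotopic R P Q f' g'"
  using assms unfolding homotopic_def by metis

lemma degree_minus1_zero:
  assumes "cochain R Q"
  shows "(\<lambda>n x. \<zero>\<^bsub>obj Q (n - 1)\<^esub>) \<in> degree_minus1 R P Q"
  by (auto simp: degree_minus1_def intro: mod_hom_const_zero cochainD(1)[OF assms])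

lemma homotopic_refl:
  assumes Q: "cochain R Q" and "\<And>n x. x \<in> carrier (obj P n) \<Longrightarrow> g n x \<in> carrier (obj Q n)"
    and "\<And>n x. x \<in> carrier (obj P n) \<Longrightarrow> f n x = g n x"
  shows "homotopic R P Q f g"
proof (rule homotopicI[OF degree_minus1_zero[OF Q]])
  fix n x assume x: "x \<in> carrier (obj P n)"
  interpret abelian_group "obj Q n" by (rule cochain_abelian_group[OF Q])
  have "dif Q (n - 1) \<zero>\<^bsub>obj Q (n - 1)\<^esub> = \<zero>\<^bsub>obj Q n\<^esub>"
    using mod_hom_zero[OF cochainD(1)[OF Q] cochainD(1)[OF Q] cochainD(3)[OF Q]] .
  then show "f n x = g n x \<oplus>\<^bsub>obj Q n\<^esub> boundary P Q (\<lambda>n x. \<zero>\<^bsub>obj Q (n - 1)\<^esub>) n x"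
    using assms(2,3)[OF x] by (simp add: boundary_def)
qed

lemma homotopic_sym:
  assumes P: "cochain R P" and Q: "cochain R Q"
    and fg: "homotopic R P Q f g"
    and g: "\<And>n x. x \<in> carrier (obj P n) \<Longrightarrow> g n x \<in> carrier (obj Q n)"
  shows "homotopic R P Q g f"
proof -
  obtain h where h: "h \<in> degree_minus1 R P Q"
    and eq: "\<And>n x. x \<in> carrier (obj P n) \<Longrightarrow> f n x = g n x \<oplus>\<^bsub>obj Q n\<^esub> boundary P Q h n x"
    using homotopicE[OF fg] by metis
  show ?thesis
  proof (rule homotopicI)
    show "(\<lambda>n x. \<ominus>\<^bsub>obj Q (n - 1)\<^esub> h n x) \<in> degree_minus1 R P Q"
      using mod_hom_uminus[OF cochainD(1)[OF Q] degree_minus1D(1)[OF h]] by (simp add: degree_minus1_def)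
    fix n x assume x: "x \<in> carrier (obj P n)"
    interpret abelian_group "obj Q n" by (rule cochain_abelian_group[OF Q])
    have c: "dif Q (n - 1) (h n x) \<in> carrier (obj Q n)" "h (n + 1) (dif P n x) \<in> carrier (obj Q n)"
      using degree_minus1D[OF h] cochainD[OF P] cochainD[OF Q] x by simp_all
    have "boundary P Q (\<lambda>n x. \<ominus>\<^bsub>obj Q (n - 1)\<^esub> h n x) n x = \<ominus>\<^bsub>obj Q n\<^esub> boundary P Q h n x"
      using mod_hom_minus[OF cochainD(1)[OF Q] cochainD(1)[OF Q] cochainD(3)[OF Q] degree_minus1D(3)[OF h x]] c
      by (simp add: boundary_def minus_add)
    then show "g n x = f n x \<oplus>\<^bsub>obj Q n\<^esub> boundary P Q (\<lambda>n x. \<ominus>\<^bsub>obj Q (n - 1)\<^esub> h n x) n x"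
      using eq[OF x] g[OF x] boundary_closed[OF P Q h x] by (simp add: a_assoc r_neg)
  qed
qed

lemma homotopic_add:
  assumes P: "cochain R P" and Q: "cochain R Q"
    and g: "\<And>n x. x \<in> carrier (obj P n) \<Longrightarrow> g n x \<in> carrier (obj Q n)"
    and g': "\<And>n x. x \<in> carrier (obj P n) \<Longrightarrow> g' n x \<in> carrier (obj Q n)"
    and fg: "homotopic R P Q f g" and fg': "homotopic R P Q f' g'"
  shows "homotopic R P Q (\<lambda>n x. f n x \<oplus>\<^bsub>obj Q n\<^esub> f' n x) (\<lambda>n x. g n x \<oplus>\<^bsub>obj Q n\<^esub> g' n x)"
proof -
  obtain h where h: "h \<in> degree_minus1 R P Q"
    and eq: "\<And>n x. x \<in> carrier (obj P n) \<Longrightarrow> f n x = g n x \<oplus>\<^bsub>obj Q n\<^esub> boundary P Q h n x"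
    using homotopicE[OF fg] by metis
  obtain h' where h': "h' \<in> degree_minus1 R P Q"
    and eq': "\<And>n x. x \<in> carrier (obj P n) \<Longrightarrow> f' n x = g' n x \<oplus>\<^bsub>obj Q n\<^esub> boundary P Q h' n x"
    using homotopicE[OF fg'] by metis
  show ?thesis
  proof (rule homotopicI)
    show "(\<lambda>n x. h n x \<oplus>\<^bsub>obj Q (n - 1)\<^esub> h' n x) \<in> degree_minus1 R P Q"
      using mod_hom_plus[OF cochainD(1)[OF Q] degree_minus1D(1)[OF h] degree_minus1D(1)[OF h']]
      by (simp add: degree_minus1_def)
    fix n x assume x: "x \<in> carrier (obj P n)"
    interpret abelian_group "obj Q n" by (rule cochain_abelian_group[OF Q])
    have c: "dif Q (n - 1) (h n x) \<in> carrier (obj Q n)" "h (n + 1) (dif P n x) \<in> carrier (obj Q n)"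
      "dif Q (n - 1) (h' n x) \<in> carrier (obj Q n)" "h' (n + 1) (dif P n x) \<in> carrier (obj Q n)"
      using degree_minus1D[OF h] degree_minus1D[OF h'] cochainD[OF P] cochainD[OF Q] x by simp_all
    have "boundary P Q (\<lambda>n x. h n x \<oplus>\<^bsub>obj Q (n - 1)\<^esub> h' n x) n x =
      boundary P Q h n x \<oplus>\<^bsub>obj Q n\<^esub> boundary P Q h' n x"
      using mod_hom_add[OF cochainD(3)[OF Q] degree_minus1D(3)[OF h x] degree_minus1D(3)[OF h' x]] c
      by (simp add: boundary_def a_ac)
    then show "f n x \<oplus>\<^bsub>obj Q n\<^esub> f' n x = g n x \<oplus>\<^bsub>obj Q n\<^esub> g' n x \<oplus>\<^bsub>obj Q n\<^esub>
        boundary P Q (\<lambda>n x. h n x \<oplus>\<^bsub>obj Q (n - 1)\<^esub> h' n x) n x"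
      using eq[OF x] eq'[OF x] g[OF x] g'[OF x] boundary_closed[OF P Q h x] boundary_closed[OF P Q h' x]
      by (simp add: a_ac)
  qed
qed

text \<open>Reduced to the addition of homotopies: \<open>f\<close> is \<open>g\<close> plus a
  boundary, the map \<open>g\<close> is homotopic to \<open>k\<close>, and the boundary is homotopic
  to zero.\<close>

lemma homotopic_trans:
  assumes P: "cochain R P" and Q: "cochain R Q"
    and fg: "homotopic R P Q f g" and gk: "homotopic R P Q g k"
    and k: "\<And>n x. x \<in> carrier (obj P n) \<Longrightarrow> k n x \<in> carrier (obj Q n)"
  shows "homotopic R P Q f k"
proof -
  obtain h where h: "h \<in> degree_minus1 R P Q"
    and eq: "\<And>n x. x \<in> carrier (obj P n) \<Longrightarrow> f n x = g n x \<oplus>\<^bsub>obj Q n\<^esub> boundary P Q h n x"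
    using homotopicE[OF fg] by metis
  have bd: "homotopic R P Q (boundary P Q h) (\<lambda>n x. \<zero>\<^bsub>obj Q n\<^esub>)"
  proof (rule homotopicI[OF h])
    fix n x assume x: "x \<in> carrier (obj P n)"
    interpret abelian_group "obj Q n" by (rule cochain_abelian_group[OF Q])
    show "boundary P Q h n x = \<zero>\<^bsub>obj Q n\<^esub> \<oplus>\<^bsub>obj Q n\<^esub> boundary P Q h n x"
      using boundary_closed[OF P Q h x] by simp
  qed
  have zero: "\<zero>\<^bsub>obj Q n\<^esub> \<in> carrier (obj Q n)" for n
    using abelian_monoid.zero_closed abelian_group.axioms(1) cochain_abelian_group[OF Q] by blast
  have "homotopic R P Q (\<lambda>n x. g n x \<oplus>\<^bsub>obj Q n\<^esub> boundary P Q h n x) (\<lambda>n x. k n x \<oplus>\<^bsub>obj Q n\<^esub> \<zero>\<^bsub>obj Q n\<^esub>)"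
    using k zero by (intro homotopic_add[OF P Q _ _ gk bd])
  then show ?thesis
  proof (rule homotopic_cong)
    fix n x assume x: "x \<in> carrier (obj P n)"
    interpret abelian_group "obj Q n" by (rule cochain_abelian_group[OF Q])
    show "k n x = k n x \<oplus>\<^bsub>obj Q n\<^esub> \<zero>\<^bsub>obj Q n\<^esub>" using k[OF x] by simp
  qed (rule eq)
qed

lemma boundary_comp_left:
  assumes P: "cochain R P" and Q: "cochain R Q" and h: "h \<in> degree_minus1 R P Q" and k: "k \<in> chain_hom R Q S"
    and x: "x \<in> carrier (obj P n)"
  shows "k n (boundary P Q h n x) = boundary P S (\<lambda>n x. k (n - 1) (h n x)) n x"
proof -
  have "k n (boundary P Q h n x) = k n (dif Q (n - 1) (h n x)) \<oplus>\<^bsub>obj S n\<^esub> k n (h (n + 1) (dif P n x))"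
    unfolding boundary_def
    by (intro mod_hom_add[OF chain_homD(1)[OF k]] cochainD(5)[OF Q] degree_minus1D(3)[OF h x]
        degree_minus1D(4)[OF h] cochainD(4)[OF P x])
  then show ?thesis
    unfolding boundary_def using chain_homD(4)[OF k degree_minus1D(3)[OF h x]] by simp
qed

lemma boundary_comp_right:
  assumes k: "k \<in> chain_hom R S P" and x: "x \<in> carrier (obj S n)"
  shows "boundary P Q h n (k n x) = boundary S Q (\<lambda>n x. h n (k n x)) n x"
  unfolding boundary_def using chain_homD(3)[OF k x] by simp

lemma homotopic_comp_left:
  fixes P Q :: "('a, 'm) cochain_complex"
  assumes P: "cochain R P" and Q: "cochain R Q" and k: "k \<in> chain_hom R Q S"
    and g: "\<And>n x. x \<in> carrier (obj P n) \<Longrightarrow> g n x \<in> carrier (obj Q n)" and fg: "homotopic R P Q f g"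
  shows "homotopic R P S (\<lambda>n x. k n (f n x)) (\<lambda>n x. k n (g n x))"
proof -
  obtain h where h: "h \<in> degree_minus1 R P Q"
    and eq: "\<And>n x. x \<in> carrier (obj P n) \<Longrightarrow> f n x = g n x \<oplus>\<^bsub>obj Q n\<^esub> boundary P Q h n x"
    using homotopicE[OF fg] by metis
  show ?thesis
  proof (rule homotopicI)
    show "(\<lambda>n x. k (n - 1) (h n x)) \<in> degree_minus1 R P S"
      using mod_hom_comp[OF degree_minus1D(1)[OF h] chain_homD(1)[OF k]] by (simp add: degree_minus1_def)
    fix n x assume x: "x \<in> carrier (obj P n)"
    show "k n (f n x) = k n (g n x) \<oplus>\<^bsub>obj S n\<^esub> boundary P S (\<lambda>n x. k (n - 1) (h n x)) n x"
      using eq[OF x] mod_hom_add[OF chain_homD(1)[OF k] g[OF x] boundary_closed[OF P Q h x]]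
        boundary_comp_left[OF P Q h k x] by simp
  qed
qed

lemma homotopic_comp_right:
  fixes P Q :: "('a, 'm) cochain_complex"
  assumes k: "k \<in> chain_hom R S P" and fg: "homotopic R P Q f g"
  shows "homotopic R S Q (\<lambda>n x. f n (k n x)) (\<lambda>n x. g n (k n x))"
proof -
  obtain h where h: "h \<in> degree_minus1 R P Q"
    and eq: "\<And>n x. x \<in> carrier (obj P n) \<Longrightarrow> f n x = g n x \<oplus>\<^bsub>obj Q n\<^esub> boundary P Q h n x"
    using homotopicE[OF fg] by metis
  show ?thesis
  proof (rule homotopicI)
    show "(\<lambda>n x. h n (k n x)) \<in> degree_minus1 R S Q"
      using mod_hom_comp[OF chain_homD(1)[OF k] degree_minus1D(1)[OF h]] by (simp add: degree_minus1_def)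
    fix n x assume x: "x \<in> carrier (obj S n)"
    show "f n (k n x) = g n (k n x) \<oplus>\<^bsub>obj Q n\<^esub> boundary S Q (\<lambda>n x. h n (k n x)) n x"
      using eq[OF chain_homD(2)[OF k x]] boundary_comp_right[OF k x, of Q h] by simp
  qed
qed

definition proj_cochain :: "('a, 'x) ring_scheme \<Rightarrow> ('a, 'm) cochain_complex \<Rightarrow> bool" where
  "proj_cochain R P \<longleftrightarrow> cochain R P \<and> (\<forall>n. fg_projective R (obj P n)) \<and> (\<exists>r s. zero_outside P r s)"

lemma Kb_object_iff: "Kb_object R P \<longleftrightarrow> proj_cochain R P"
proof
  assume P: "Kb_object R P"
  then have fg: "fg_projective R (obj P n)" for n by (auto simp: Kb_object_def intro: projective_module_imp_fg_projective)
  then have "left_module R (obj P n)" for n by (rule fg_projective_left_module)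
  then show "proj_cochain R P" using P fg by (simp add: proj_cochain_def cochain_def Kb_object_def)
next
  assume "proj_cochain R P"
  then show "Kb_object R P"
    by (auto simp: proj_cochain_def cochain_def Kb_object_def
        intro: fg_projective_imp_finitely_generated fg_projective_imp_projective_module)
qed

lemma Kb_object_cochain: "Kb_object R P \<Longrightarrow> cochain R P"
  by (simp add: Kb_object_iff proj_cochain_def)

section \<open>Fitting decompositions\<close>

lemma mod_hom_funpow: "f \<in> mod_hom R M M \<Longrightarrow> f ^^ k \<in> mod_hom R M M"
proof (induction k)
  case (Suc k)
  then show ?case using mod_hom_comp[of "f ^^ k" R M M f M] by (simp add: comp_def)
qed (simp add: mod_hom_id id_def)

text \<open>Kernels of powers grow, images shrink, and \<open>\<delta>\<close> is bounded on
  submodules. The exponents at which the kernel is largest and the image smallest are reached, and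
  beyond both of them nothing can change.\<close>

lemma funpow_ker_im_stable:
  fixes M :: "('a, 'm) module"
  assumes M: "left_module R M" and \<delta>: "length_function R M \<delta>" and \<theta>: "\<theta> \<in> mod_hom R M M"
  shows "\<exists>N. \<forall>k\<ge>N. {x \<in> carrier M. (\<theta> ^^ k) x = \<zero>\<^bsub>M\<^esub>} = {x \<in> carrier M. (\<theta> ^^ N) x = \<zero>\<^bsub>M\<^esub>} \<and>
    (\<theta> ^^ k) ` carrier M = (\<theta> ^^ N) ` carrier M"
proof -
  define A where "A k = {x \<in> carrier M. (\<theta> ^^ k) x = \<zero>\<^bsub>M\<^esub>}" for k
  define B where "B k = (\<theta> ^^ k) ` carrier M" for k
  note pow = mod_hom_funpow[OF \<theta>]
  have A: "submodule (A k) R M" for k unfolding A_def by (rule submodule_kernel[OF M M pow])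
  have B: "submodule (B k) R M" for k
    unfolding B_def by (rule submodule_image[OF M M pow submodule_carrier[OF M]])
  have A_mono: "A k \<subseteq> A l" if "k \<le> l" for k l
  proof
    fix x assume x: "x \<in> A k"
    have "(\<theta> ^^ l) x = (\<theta> ^^ (l - k)) ((\<theta> ^^ k) x)"
      using that by (metis le_add_diff_inverse2 comp_apply funpow_add)
    then show "x \<in> A l" using x mod_hom_zero[OF M M pow] by (simp add: A_def)
  qed
  have B_mono: "B l \<subseteq> B k" if "k \<le> l" for k l
  proof
    fix y assume "y \<in> B l"
    then obtain x where x: "x \<in> carrier M" "y = (\<theta> ^^ l) x" by (auto simp: B_def)
    have "(\<theta> ^^ l) x = (\<theta> ^^ k) ((\<theta> ^^ (l - k)) x)"
      using that by (metis le_add_diff_inverse comp_apply funpow_add)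
    then show "y \<in> B k" using x mod_hom_closed[OF pow x(1)] by (simp add: B_def)
  qed
  have bound: "\<delta> N \<le> \<delta> (carrier M)" if "submodule N R M" for N
    using length_functionD[OF \<delta> that submodule_carrier[OF M]] submodule_subset[OF that]
    by (cases "N = carrier M") (auto simp: less_imp_le psubset_eq)
  have "\<exists>k. True \<and> (\<forall>l. True \<longrightarrow> \<delta> (A l) \<le> \<delta> (A k))"
    using bound[OF A] by (intro ex_has_greatest_nat[of _ 0 _ "Suc (\<delta> (carrier M))"]) (auto simp: less_Suc_eq_le)
  then obtain a where a: "\<And>l. \<delta> (A l) \<le> \<delta> (A a)" by auto
  obtain b where b: "\<And>l. \<delta> (B b) \<le> \<delta> (B l)"
    using ex_has_least_nat[of "\<lambda>_. True" 0 "\<lambda>l. \<delta> (B l)"] by auto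
  have Aeq: "A k = A a" if "a \<le> k" for k
    using A_mono[OF that] a[of k] length_functionD[OF \<delta> A A, of a k] by (metis linorder_not_le psubsetI)
  have Beq: "B k = B b" if "b \<le> k" for k
    using B_mono[OF that] b[of k] length_functionD[OF \<delta> B B, of k b] by (metis linorder_not_le psubsetI)
  show ?thesis
    using Aeq Beq unfolding A_def[symmetric] B_def[symmetric]
    by (intro exI[of _ "max a b"]) (metis max.bounded_iff max.cobounded1 max.cobounded2)
qed

text \<open>Fitting's lemma in terms of maps. With \<phi> the power of \<theta> to the exponent
  \<open>Suc N\<close>, the map \<epsilon> projects onto the stable image along the stable kernel,
  and \<psi> is \<epsilon> followed by the inverse of \<phi> on the stable image.\<close>

lemma fitting:
  fixes P :: "('a, 'm) cochain_complex"
  assumes P: "cochain R P" and bounded: "zero_outside P r s"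
    and \<delta>: "\<And>n. \<exists>\<delta>. length_function R (obj P n) \<delta>" and \<theta>: "\<theta> \<in> chain_hom R P P"
  obtains N \<epsilon> \<psi> where "\<epsilon> \<in> chain_hom R P P" "\<psi> \<in> chain_hom R P P"
    "\<And>n x. x \<in> carrier (obj P n) \<Longrightarrow> \<epsilon> n (\<epsilon> n x) = \<epsilon> n x"
    "\<And>n x. x \<in> carrier (obj P n) \<Longrightarrow> (\<theta> n ^^ Suc N) (\<psi> n x) = \<epsilon> n x"
    "\<And>n x. x \<in> carrier (obj P n) \<Longrightarrow> (\<theta> n ^^ Suc N) (\<epsilon> n x) = (\<theta> n ^^ Suc N) x"
proof -
  let ?ker = "\<lambda>n k. {x \<in> carrier (obj P n). (\<theta> n ^^ k) x = \<zero>\<^bsub>obj P n\<^esub>}"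
  let ?im = "\<lambda>n k. (\<theta> n ^^ k) ` carrier (obj P n)"
  have "\<forall>n. \<exists>N. \<forall>k\<ge>N. ?ker n k = ?ker n N \<and> ?im n k = ?im n N"
  proof
    fix n
    obtain d where "length_function R (obj P n) d" using \<delta>[of n] ..
    then show "\<exists>N. \<forall>k\<ge>N. ?ker n k = ?ker n N \<and> ?im n k = ?im n N"
      by (rule funpow_ker_im_stable[OF cochainD(1)[OF P] _ chain_homD(1)[OF \<theta>]])
  qed
  then obtain N0 where N0': "\<forall>n. \<forall>k\<ge>N0 n. ?ker n k = ?ker n (N0 n) \<and> ?im n k = ?im n (N0 n)"
    using choice[of "\<lambda>n N. \<forall>k\<ge>N. ?ker n k = ?ker n N \<and> ?im n k = ?im n N"] by (elim meta_impE exE)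
  have N0: "?ker n k = ?ker n (N0 n) \<and> ?im n k = ?im n (N0 n)" if "k \<ge> N0 n" for n k
    by (rule N0'[rule_format, OF that])
  \<comment> \<open>Boundedness leaves finitely many degrees, so one exponent works for all of them.
    The power used below is \<open>Suc N\<close>, so that at least one factor \<theta> can always be
    split off.\<close>
  define N where "N = Max (insert 0 (N0 ` {r..s}))"
  define \<phi> where "\<phi> = (\<lambda>n x. (\<theta> n ^^ Suc N) x)"
  have \<phi>: "\<phi> \<in> chain_hom R P P" unfolding \<phi>_def by (rule chain_hom_funpow[OF \<theta>])
  note \<phi>c = chain_homD(2)[OF \<phi>]
  have \<phi>\<phi>: "\<phi> n (\<phi> n x) = (\<theta> n ^^ (Suc N + Suc N)) x" for n x
    unfolding \<phi>_def by (simp only: funpow_add comp_apply)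
  have N: "N0 n \<le> Suc N" "N0 n \<le> Suc N + Suc N" if "n \<in> {r..s}" for n
  proof -
    have "N0 n \<le> N" using that unfolding N_def by (intro Max_ge) auto
    then show "N0 n \<le> Suc N" "N0 n \<le> Suc N + Suc N" by auto
  qed
  have out: "x = \<zero>\<^bsub>obj P n\<^esub>" if "n \<notin> {r..s}" "x \<in> carrier (obj P n)" for n x
    using bounded that by (auto simp: zero_outside_def not_le)
  \<comment> \<open>\<phi> and its square have the same kernel and the same image; hence \<phi> is
    bijective on its image \<open>I\<close>.\<close>
  have inj: "\<phi> n x = \<zero>\<^bsub>obj P n\<^esub>" if x: "x \<in> carrier (obj P n)" and 0: "\<phi> n (\<phi> n x) = \<zero>\<^bsub>obj P n\<^esub>" for n x
  proof (cases "n \<in> {r..s}")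
    case True
    have "x \<in> ?ker n (Suc N + Suc N)" using x 0 by (simp only: \<phi>\<phi> mem_Collect_eq)
    then have "x \<in> ?ker n (Suc N)" using N0[OF N(1)[OF True]] N0[OF N(2)[OF True]] by blast
    then show ?thesis by (simp add: \<phi>_def)
  qed (use out \<phi>c[OF x] in simp)
  have surj: "\<exists>z\<in>carrier (obj P n). \<phi> n (\<phi> n z) = \<phi> n x" if x: "x \<in> carrier (obj P n)" for n x
  proof (cases "n \<in> {r..s}")
    case True
    have "\<phi> n x \<in> ?im n (Suc N)" using x by (simp only: \<phi>_def image_eqI)
    then have "\<phi> n x \<in> ?im n (Suc N + Suc N)" using N0[OF N(1)[OF True]] N0[OF N(2)[OF True]] by blast
    then show ?thesis unfolding \<phi>\<phi> by (metis imageE)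
  next
    case False
    then show ?thesis using out[OF False \<phi>c[OF x]] out[OF False \<phi>c[OF \<phi>c[OF x]]] x by metis
  qed
  define I where "I n = \<phi> n ` carrier (obj P n)" for n
  have I: "submodule (I n) R (obj P n)" for n
    unfolding I_def
    by (rule submodule_image[OF cochainD(1)[OF P] cochainD(1)[OF P] chain_homD(1)[OF \<phi>] submodule_carrier[OF cochainD(1)[OF P]]])
  have Ic: "u \<in> carrier (obj P n)" if "u \<in> I n" for u n using that submodule_subset[OF I] by auto
  have uniq: "u = v" if u: "u \<in> I n" and v: "v \<in> I n" and eq: "\<phi> n u = \<phi> n v" for n u v
  proof -
    interpret abelian_group "obj P n" by (rule cochain_abelian_group[OF P])
    note lm = cochainD(1)[OF P, of n]
    have "u \<oplus>\<^bsub>obj P n\<^esub> \<ominus>\<^bsub>obj P n\<^esub> v \<in> I n"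
      using u v by (intro submodule_add[OF I] submodule_minus[OF I])
    then obtain w where w: "w \<in> carrier (obj P n)" "u \<oplus>\<^bsub>obj P n\<^esub> \<ominus>\<^bsub>obj P n\<^esub> v = \<phi> n w" by (auto simp: I_def)
    have "\<phi> n (u \<oplus>\<^bsub>obj P n\<^esub> \<ominus>\<^bsub>obj P n\<^esub> v) = \<zero>\<^bsub>obj P n\<^esub>"
      using Ic[OF u] Ic[OF v] \<phi>c eq
      by (simp add: mod_hom_add[OF chain_homD(1)[OF \<phi>]] mod_hom_minus[OF lm lm chain_homD(1)[OF \<phi>]] r_neg)
    then have "u \<oplus>\<^bsub>obj P n\<^esub> \<ominus>\<^bsub>obj P n\<^esub> v = \<zero>\<^bsub>obj P n\<^esub>" using inj[OF w(1)] w(2) by simp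
    then show ?thesis using Ic[OF u] Ic[OF v] by (metis a_inv_closed minus_equality minus_minus)
  qed
  \<comment> \<open>A chain map with values in \<open>I\<close> can be divided by \<phi>. The
    quotient is chosen pointwise; linearity and compatibility with the differential then follow from
    uniqueness of preimages in \<open>I\<close>.\<close>
  have lift: "\<exists>g'\<in>chain_hom R P P. \<forall>n. \<forall>x\<in>carrier (obj P n). g' n x \<in> I n \<and> \<phi> n (g' n x) = g n x"
    if g: "g \<in> chain_hom R P P" and gI: "\<And>n x. x \<in> carrier (obj P n) \<Longrightarrow> g n x \<in> I n" for g
  proof -
    have ex: "\<exists>u. u \<in> I n \<and> \<phi> n u = g n x" if x: "x \<in> carrier (obj P n)" for n x
    proof -
      obtain y where y: "y \<in> carrier (obj P n)" "g n x = \<phi> n y" using gI[OF x] by (auto simp: I_def)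
      obtain z where "z \<in> carrier (obj P n)" "\<phi> n (\<phi> n z) = \<phi> n y" using surj[OF y(1)] by auto
      then show ?thesis using y by (intro exI[of _ "\<phi> n z"]) (simp add: I_def)
    qed
    define g' where "g' = (\<lambda>n x. SOME u. u \<in> I n \<and> \<phi> n u = g n x)"
    have g'I: "g' n x \<in> I n" and g'\<phi>: "\<phi> n (g' n x) = g n x" if "x \<in> carrier (obj P n)" for n x
      using someI_ex[OF ex[OF that]] by (simp_all add: g'_def)
    note \<phi>h = chain_homD(1)[OF \<phi>] and gh = chain_homD(1)[OF g]
    have "g' \<in> chain_hom R P P"
    proof (intro chain_homI mod_homI)
      fix n x assume x: "x \<in> carrier (obj P n)"
      show "g' n x \<in> carrier (obj P n)" using Ic[OF g'I[OF x]] .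
      have "dif P n (g' n x) \<in> I (n + 1)"
      proof -
        obtain z where z: "z \<in> carrier (obj P n)" "g' n x = \<phi> n z" using g'I[OF x] by (auto simp: I_def)
        then show ?thesis using chain_homD(3)[OF \<phi> z(1)] cochainD(4)[OF P z(1)] by (metis I_def imageI)
      qed
      then show "g' (n + 1) (dif P n x) = dif P n (g' n x)"
        using g'I[OF cochainD(4)[OF P x]] g'\<phi>[OF cochainD(4)[OF P x]] chain_homD(3)[OF \<phi> Ic[OF g'I[OF x]]]
          chain_homD(3)[OF g x] g'\<phi>[OF x] by (metis uniq)
    next
      fix n x y assume x: "x \<in> carrier (obj P n)" and y: "y \<in> carrier (obj P n)"
      interpret abelian_group "obj P n" by (rule cochain_abelian_group[OF P])
      have xy: "x \<oplus>\<^bsub>obj P n\<^esub> y \<in> carrier (obj P n)" using x y by simp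
      show "g' n (x \<oplus>\<^bsub>obj P n\<^esub> y) = g' n x \<oplus>\<^bsub>obj P n\<^esub> g' n y"
        using g'I[OF xy] submodule_add[OF I g'I[OF x] g'I[OF y]] g'\<phi>[OF xy] g'\<phi>[OF x] g'\<phi>[OF y]
          mod_hom_add[OF \<phi>h Ic[OF g'I[OF x]] Ic[OF g'I[OF y]]] mod_hom_add[OF gh x y]
        by (metis uniq)
    next
      fix n a x assume a: "a \<in> carrier R" and x: "x \<in> carrier (obj P n)"
      have ax: "a \<odot>\<^bsub>obj P n\<^esub> x \<in> carrier (obj P n)" using left_module.lsmult_closed[OF cochainD(1)[OF P] a x] .
      show "g' n (a \<odot>\<^bsub>obj P n\<^esub> x) = a \<odot>\<^bsub>obj P n\<^esub> g' n x"
        using g'I[OF ax] submodule_smult[OF I a g'I[OF x]] g'\<phi>[OF ax] g'\<phi>[OF x]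
          mod_hom_smult[OF \<phi>h a Ic[OF g'I[OF x]]] mod_hom_smult[OF gh a x]
        by (metis uniq)
    qed
    then show ?thesis using g'I g'\<phi> by blast
  qed
  \<comment> \<open>Dividing \<phi> by itself gives the projection \<epsilon>; dividing \<epsilon>
    by \<phi> once more gives \<psi>.\<close>
  obtain \<epsilon> where \<epsilon>: "\<epsilon> \<in> chain_hom R P P"
    "\<forall>n. \<forall>x\<in>carrier (obj P n). \<epsilon> n x \<in> I n \<and> \<phi> n (\<epsilon> n x) = \<phi> n x"
    using lift[OF \<phi>] by (auto simp: I_def)
  obtain \<psi> where \<psi>: "\<psi> \<in> chain_hom R P P"
    "\<forall>n. \<forall>x\<in>carrier (obj P n). \<psi> n x \<in> I n \<and> \<phi> n (\<psi> n x) = \<epsilon> n x"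
    using lift[OF \<epsilon>(1)] \<epsilon>(2) by auto
  show thesis
  proof (rule that[OF \<epsilon>(1) \<psi>(1)])
    fix n x assume x: "x \<in> carrier (obj P n)"
    show "\<epsilon> n (\<epsilon> n x) = \<epsilon> n x"
      using \<epsilon>(2) x chain_homD(2)[OF \<epsilon>(1) x] by - (rule uniq[of _ n], simp_all)
    show "(\<theta> n ^^ Suc N) (\<psi> n x) = \<epsilon> n x" "(\<theta> n ^^ Suc N) (\<epsilon> n x) = (\<theta> n ^^ Suc N) x"
      using \<epsilon>(2) \<psi>(2) x unfolding \<phi>_def by blast+
  qed
qed

section \<open>Direct summands of complexes\<close>

definition idempotent_chain_map ::
  "('a, 'x) ring_scheme \<Rightarrow> ('a, 'm) cochain_complex \<Rightarrow> (int \<Rightarrow> 'm \<Rightarrow> 'm) \<Rightarrow> bool" where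
  "idempotent_chain_map R P \<epsilon> \<longleftrightarrow> \<epsilon> \<in> chain_hom R P P \<and>
     (\<forall>n. \<forall>x\<in>carrier (obj P n). \<epsilon> n (\<epsilon> n x) = \<epsilon> n x)"

definition compl_map :: "('a, 'm) cochain_complex \<Rightarrow> (int \<Rightarrow> 'm \<Rightarrow> 'm) \<Rightarrow> int \<Rightarrow> 'm \<Rightarrow> 'm" where
  "compl_map P \<epsilon> n x = x \<oplus>\<^bsub>obj P n\<^esub> \<ominus>\<^bsub>obj P n\<^esub> \<epsilon> n x"

text \<open>The splitting takes place among complexes, not only up to homotopy. Since the element
  type is kept, the summands fall within the range of the quantifiers in
  \<open>Kb_indecomposable\<close>.\<close>

definition image_complex ::
  "('a, 'm) cochain_complex \<Rightarrow> (int \<Rightarrow> 'm \<Rightarrow> 'm) \<Rightarrow> ('a, 'm) cochain_complex" where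
  "image_complex P \<epsilon> = \<lparr>obj = (\<lambda>n. (obj P n)\<lparr>carrier := \<epsilon> n ` carrier (obj P n)\<rparr>), dif = dif P\<rparr>"

lemma image_complex_simps [simp]:
  "carrier (obj (image_complex P \<epsilon>) n) = \<epsilon> n ` carrier (obj P n)"
  "x \<oplus>\<^bsub>obj (image_complex P \<epsilon>) n\<^esub> y = x \<oplus>\<^bsub>obj P n\<^esub> y"
  "a \<odot>\<^bsub>obj (image_complex P \<epsilon>) n\<^esub> x = a \<odot>\<^bsub>obj P n\<^esub> x"
  "\<zero>\<^bsub>obj (image_complex P \<epsilon>) n\<^esub> = \<zero>\<^bsub>obj P n\<^esub>"
  "dif (image_complex P \<epsilon>) = dif P"
  by (simp_all add: image_complex_def)

lemma idempotent_chain_mapD: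
  assumes "idempotent_chain_map R P \<epsilon>"
  shows "\<epsilon> \<in> chain_hom R P P" "x \<in> carrier (obj P n) \<Longrightarrow> \<epsilon> n (\<epsilon> n x) = \<epsilon> n x"
    "x \<in> \<epsilon> n ` carrier (obj P n) \<longleftrightarrow> x \<in> carrier (obj P n) \<and> \<epsilon> n x = x"
proof -
  show *: "\<epsilon> \<in> chain_hom R P P" and **: "x \<in> carrier (obj P n) \<Longrightarrow> \<epsilon> n (\<epsilon> n x) = \<epsilon> n x" for x
    using assms by (auto simp: idempotent_chain_map_def)
  show "x \<in> \<epsilon> n ` carrier (obj P n) \<longleftrightarrow> x \<in> carrier (obj P n) \<and> \<epsilon> n x = x"
    using ** chain_homD(2)[OF *] by (auto intro: image_eqI[of x "\<epsilon> n" x])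
qed

lemma compl_map_chain_hom:
  assumes P: "cochain R P" and \<epsilon>: "\<epsilon> \<in> chain_hom R P P"
  shows "compl_map P \<epsilon> \<in> chain_hom R P P"
  using chain_hom_add[OF P chain_hom_id chain_hom_uminus[OF P \<epsilon>]] unfolding compl_map_def .

lemma add_compl_map:
  assumes P: "cochain R P" and \<epsilon>: "\<epsilon> \<in> chain_hom R P P" and x: "x \<in> carrier (obj P n)"
  shows "\<epsilon> n x \<oplus>\<^bsub>obj P n\<^esub> compl_map P \<epsilon> n x = x"
proof -
  interpret abelian_group "obj P n" by (rule cochain_abelian_group[OF P])
  show ?thesis
    using x chain_homD(2)[OF \<epsilon> x] by (simp add: compl_map_def a_lcomm[of "\<epsilon> n x" x] r_neg)
qed

lemma idempotent_compl_map:
  assumes P: "cochain R P" and \<epsilon>: "idempotent_chain_map R P \<epsilon>"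
  shows "idempotent_chain_map R P (compl_map P \<epsilon>)"
    "x \<in> carrier (obj P n) \<Longrightarrow> \<epsilon> n (compl_map P \<epsilon> n x) = \<zero>\<^bsub>obj P n\<^esub>"
    "x \<in> carrier (obj P n) \<Longrightarrow> compl_map P \<epsilon> n (\<epsilon> n x) = \<zero>\<^bsub>obj P n\<^esub>"
proof -
  note \<epsilon>D = idempotent_chain_mapD[OF \<epsilon>]
  note lm = cochainD(1)[OF P]
  have *: "\<epsilon> n (compl_map P \<epsilon> n x) = \<zero>\<^bsub>obj P n\<^esub>" if x: "x \<in> carrier (obj P n)" for n x
  proof -
    interpret abelian_group "obj P n" by (rule cochain_abelian_group[OF P])
    show ?thesis
      using x chain_homD(2)[OF \<epsilon>D(1)] \<epsilon>D(2)[OF x]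
      by (simp add: compl_map_def mod_hom_add[OF chain_homD(1)[OF \<epsilon>D(1)]]
          mod_hom_minus[OF lm lm chain_homD(1)[OF \<epsilon>D(1)]] r_neg)
  qed
  then show "x \<in> carrier (obj P n) \<Longrightarrow> \<epsilon> n (compl_map P \<epsilon> n x) = \<zero>\<^bsub>obj P n\<^esub>" .
  show "compl_map P \<epsilon> n (\<epsilon> n x) = \<zero>\<^bsub>obj P n\<^esub>" if x: "x \<in> carrier (obj P n)"
  proof -
    interpret abelian_group "obj P n" by (rule cochain_abelian_group[OF P])
    show ?thesis using x chain_homD(2)[OF \<epsilon>D(1) x] \<epsilon>D(2)[OF x] by (simp add: compl_map_def r_neg)
  qed
  have "compl_map P \<epsilon> n (compl_map P \<epsilon> n x) = compl_map P \<epsilon> n x" if x: "x \<in> carrier (obj P n)" for n x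
  proof -
    interpret abelian_group "obj P n" by (rule cochain_abelian_group[OF P])
    show ?thesis
      using * [OF x] chain_homD(2)[OF compl_map_chain_hom[OF P \<epsilon>D(1)] x]
      by (subst compl_map_def) simp
  qed
  then show "idempotent_chain_map R P (compl_map P \<epsilon>)"
    using compl_map_chain_hom[OF P \<epsilon>D(1)] by (simp add: idempotent_chain_map_def)
qed

lemma image_complex_proj: "idempotent_chain_map R P \<epsilon> \<Longrightarrow> \<epsilon> \<in> chain_hom R P (image_complex P \<epsilon>)"
  using idempotent_chain_mapD(1)[of R P \<epsilon>]
  by (auto simp: chain_hom_def mod_hom_def)

lemma image_complex_incl: "idempotent_chain_map R P \<epsilon> \<Longrightarrow> (\<lambda>n x. x) \<in> chain_hom R (image_complex P \<epsilon>) P"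
  using idempotent_chain_mapD(3)[of R P \<epsilon>]
  by (auto simp: chain_hom_def mod_hom_def)

lemma Kb_object_image_complex:
  fixes P :: "('a, 'm) cochain_complex"
  assumes P: "Kb_object R P" and \<epsilon>: "idempotent_chain_map R P \<epsilon>"
  shows "Kb_object R (image_complex P \<epsilon>)"
proof -
  have cP: "cochain R P" and fg: "\<And>n. fg_projective R (obj P n)" and "\<exists>r s. zero_outside P r s"
    using P by (auto simp: Kb_object_iff proj_cochain_def)
  note \<epsilon>D = idempotent_chain_mapD[OF \<epsilon>]
  have lm: "left_module R (obj (image_complex P \<epsilon>) n)" for n
    unfolding image_complex_def
    using left_module_submodule[OF cochainD(1)[OF cP] submodule_image[OF cochainD(1)[OF cP] cochainD(1)[OF cP]
          chain_homD(1)[OF \<epsilon>D(1)] submodule_carrier[OF cochainD(1)[OF cP]]]] by simp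
  have "fg_projective R (obj (image_complex P \<epsilon>) n)" for n
    by (rule fg_projective_retract[OF fg lm chain_homD(1)[OF image_complex_incl[OF \<epsilon>]]
          chain_homD(1)[OF image_complex_proj[OF \<epsilon>]]]) (use \<epsilon>D(2,3) in auto)
  moreover have "cochain R (image_complex P \<epsilon>)"
    unfolding cochain_def
  proof (intro conjI allI ballI lm)
    fix n
    show "dif (image_complex P \<epsilon>) n \<in> mod_hom R (obj (image_complex P \<epsilon>) n) (obj (image_complex P \<epsilon>) (n + 1))"
      using cochainD(2)[OF cP, of n] \<epsilon>D(3) chain_homD(3)[OF \<epsilon>D(1)] cochainD(4)[OF cP]
      by (intro mod_homI) (auto intro: mod_hom_add mod_hom_smult)
    show "dif (image_complex P \<epsilon>) (n + 1) (dif (image_complex P \<epsilon>) n x) = \<zero>\<^bsub>obj (image_complex P \<epsilon>) (n + 2)\<^esub>"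
      if "x \<in> carrier (obj (image_complex P \<epsilon>) n)" for x
      using that cochainD(6)[OF cP] \<epsilon>D(3) by auto
  qed
  moreover have "zero_outside (image_complex P \<epsilon>) r s" if "zero_outside P r s" for r s
    using that mod_hom_zero[OF cochainD(1)[OF cP] cochainD(1)[OF cP] chain_homD(1)[OF \<epsilon>D(1)]]
    by (simp add: zero_outside_def)
  ultimately show ?thesis using \<open>\<exists>r s. zero_outside P r s\<close> unfolding Kb_object_iff proj_cochain_def by blast
qed

text \<open>A contraction \<open>h\<close> of the image, composed with \<epsilon>, is a
  null-homotopy of \<epsilon> on all of \<open>P\<close>.\<close>

lemma Kb_zero_image_complex:
  fixes P :: "('a, 'm) cochain_complex"
  assumes P: "cochain R P" and \<epsilon>: "idempotent_chain_map R P \<epsilon>" and z: "Kb_zero R (image_complex P \<epsilon>)"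
  shows "homotopic R P P \<epsilon> (\<lambda>n x. \<zero>\<^bsub>obj P n\<^esub>)"
proof -
  note \<epsilon>D = idempotent_chain_mapD[OF \<epsilon>]
  obtain h where h: "h \<in> degree_minus1 R (image_complex P \<epsilon>) (image_complex P \<epsilon>)"
    and eq: "\<And>n x. x \<in> carrier (obj (image_complex P \<epsilon>) n) \<Longrightarrow>
      x = \<zero>\<^bsub>obj P n\<^esub> \<oplus>\<^bsub>obj P n\<^esub> boundary (image_complex P \<epsilon>) (image_complex P \<epsilon>) h n x"
    using homotopicE[OF z[unfolded Kb_zero_def]] unfolding id_map_def zero_map_def image_complex_simps by metis
  show ?thesis
  proof (rule homotopicI)
    have "(\<lambda>n x. h n (\<epsilon> n x)) \<in> degree_minus1 R P (image_complex P \<epsilon>)"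
      using mod_hom_comp[OF chain_homD(1)[OF image_complex_proj[OF \<epsilon>]] degree_minus1D(1)[OF h]]
      by (simp add: degree_minus1_def)
    then show "(\<lambda>n x. h n (\<epsilon> n x)) \<in> degree_minus1 R P P"
      by (auto simp: degree_minus1_def intro: mod_hom_comp[OF _ chain_homD(1)[OF image_complex_incl[OF \<epsilon>]]])
    fix n x assume x: "x \<in> carrier (obj P n)"
    show "\<epsilon> n x = \<zero>\<^bsub>obj P n\<^esub> \<oplus>\<^bsub>obj P n\<^esub> boundary P P (\<lambda>n x. h n (\<epsilon> n x)) n x"
      using eq[of "\<epsilon> n x" n] x chain_homD(3)[OF \<epsilon>D(1) x] by (simp add: boundary_def)
  qed
qed

text \<open>All five biproduct identities hold strictly, so every homotopy involved is zero.\<close>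

lemma Kb_biproduct_image_complex:
  fixes P :: "('a, 'm) cochain_complex"
  assumes P: "Kb_object R P" and \<epsilon>: "idempotent_chain_map R P \<epsilon>"
  shows "Kb_biproduct R P (image_complex P \<epsilon>) (image_complex P (compl_map P \<epsilon>))"
proof -
  have cP: "cochain R P" using P by (rule Kb_object_cochain)
  let ?\<epsilon>' = "compl_map P \<epsilon>"
  note \<epsilon>' = idempotent_compl_map[OF cP \<epsilon>]
  note c1 = Kb_object_cochain[OF Kb_object_image_complex[OF P \<epsilon>]]
  note c2 = Kb_object_cochain[OF Kb_object_image_complex[OF P \<epsilon>'(1)]]
  note D = idempotent_chain_mapD[OF \<epsilon>] and D' = idempotent_chain_mapD[OF \<epsilon>'(1)]
  have zero: "\<zero>\<^bsub>obj P n\<^esub> = e n \<zero>\<^bsub>obj P n\<^esub> \<and> \<zero>\<^bsub>obj P n\<^esub> \<in> carrier (obj P n)" if "e \<in> chain_hom R P P" for n e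
    using mod_hom_zero[OF cochainD(1)[OF cP] cochainD(1)[OF cP] chain_homD(1)[OF that]]
      submodule_zero[OF submodule_carrier[OF cochainD(1)[OF cP]]] by simp
  show ?thesis
    unfolding Kb_biproduct_def chain_map_eq_chain_hom
  proof (rule bexI[of _ "\<lambda>n x. x"], rule bexI[of _ \<epsilon>], rule bexI[of _ "\<lambda>n x. x"], rule bexI[of _ ?\<epsilon>'],
      intro conjI)
    show "homotopic R (image_complex P \<epsilon>) (image_complex P \<epsilon>) (comp_map \<epsilon> (\<lambda>n x. x)) id_map"
      by (rule homotopic_refl[OF c1]) (auto simp: comp_map_def id_map_def D)
    show "homotopic R (image_complex P ?\<epsilon>') (image_complex P ?\<epsilon>') (comp_map ?\<epsilon>' (\<lambda>n x. x)) id_map"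
      by (rule homotopic_refl[OF c2]) (auto simp: comp_map_def id_map_def D')
    show "homotopic R (image_complex P \<epsilon>) (image_complex P ?\<epsilon>') (comp_map ?\<epsilon>' (\<lambda>n x. x)) (zero_map (image_complex P ?\<epsilon>'))"
      by (rule homotopic_refl[OF c2]) (use zero[OF D'(1)] in \<open>auto simp: comp_map_def zero_map_def \<epsilon>'\<close>)
    show "homotopic R (image_complex P ?\<epsilon>') (image_complex P \<epsilon>) (comp_map \<epsilon> (\<lambda>n x. x)) (zero_map (image_complex P \<epsilon>))"
      by (rule homotopic_refl[OF c1]) (use zero[OF D(1)] in \<open>auto simp: comp_map_def zero_map_def \<epsilon>'\<close>)
    show "homotopic R P P (add_map P (comp_map (\<lambda>n x. x) \<epsilon>) (comp_map (\<lambda>n x. x) ?\<epsilon>')) id_map"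
      by (rule homotopic_refl[OF cP]) (auto simp: comp_map_def add_map_def id_map_def add_compl_map[OF cP D(1)])
  qed (use image_complex_incl[OF \<epsilon>] image_complex_incl[OF \<epsilon>'(1)] image_complex_proj[OF \<epsilon>] image_complex_proj[OF \<epsilon>'(1)] in auto)
qed

section \<open>Indecomposable and minimal complexes\<close>

text \<open>A hypothesis cannot quantify over types, so the element type of the modules is passed as
  an argument.\<close>

definition fg_projectives_finite_length :: "('a, 'x) ring_scheme \<Rightarrow> 'm itself \<Rightarrow> bool" where
  "fg_projectives_finite_length R _ \<longleftrightarrow> (\<forall>M :: ('a, 'm) module. fg_projective R M \<longrightarrow> (\<exists>\<delta>. length_function R M \<delta>))"

lemma fg_projectives_finite_length_fd_over: "fd_over K R \<kappa> I r \<Longrightarrow> fg_projectives_finite_length R TYPE('m)"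
  unfolding fg_projectives_finite_length_def using fg_projective_length_function by blast

lemma Kb_object_length_function:
  fixes P :: "('a, 'm) cochain_complex"
  assumes "fg_projectives_finite_length R TYPE('m)" "Kb_object R P"
  shows "\<exists>\<delta>. length_function R (obj P n) \<delta>"
  using assms by (simp add: fg_projectives_finite_length_def Kb_object_iff proj_cochain_def)

lemma Kb_object_bounded:
  assumes "Kb_object R P"
  obtains r s where "zero_outside P r s"
  using assms by (auto simp: Kb_object_def)

lemma Kb_fitting:
  fixes P :: "('a, 'm) cochain_complex"
  assumes fl: "fg_projectives_finite_length R TYPE('m)" and P: "Kb_object R P" and \<theta>: "\<theta> \<in> chain_hom R P P"
  obtains N \<epsilon> \<psi> where "idempotent_chain_map R P \<epsilon>" "\<psi> \<in> chain_hom R P P"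
    "\<And>n x. x \<in> carrier (obj P n) \<Longrightarrow> (\<theta> n ^^ Suc N) (\<psi> n x) = \<epsilon> n x"
    "\<And>n x. x \<in> carrier (obj P n) \<Longrightarrow> (\<theta> n ^^ Suc N) (\<epsilon> n x) = (\<theta> n ^^ Suc N) x"
proof -
  obtain r s where rs: "zero_outside P r s" using P by (rule Kb_object_bounded)
  obtain N \<epsilon> \<psi> where *: "\<epsilon> \<in> chain_hom R P P" "\<psi> \<in> chain_hom R P P"
    "\<And>n x. x \<in> carrier (obj P n) \<Longrightarrow> \<epsilon> n (\<epsilon> n x) = \<epsilon> n x"
    "\<And>n x. x \<in> carrier (obj P n) \<Longrightarrow> (\<theta> n ^^ Suc N) (\<psi> n x) = \<epsilon> n x"
    "\<And>n x. x \<in> carrier (obj P n) \<Longrightarrow> (\<theta> n ^^ Suc N) (\<epsilon> n x) = (\<theta> n ^^ Suc N) x"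
    using fitting[OF Kb_object_cochain[OF P] rs Kb_object_length_function[OF fl P] \<theta>] by metis
  have "idempotent_chain_map R P \<epsilon>" using *(1,3) by (simp add: idempotent_chain_map_def)
  then show thesis using *(2,4,5) by (rule that)
qed

lemma obj_zero_closed: "cochain R P \<Longrightarrow> \<zero>\<^bsub>obj P n\<^esub> \<in> carrier (obj P n)"
  using submodule_zero[OF submodule_carrier[OF cochainD(1)]] .

lemma homotopic_zero_compl:
  assumes P: "cochain R P" and \<epsilon>: "\<epsilon> \<in> chain_hom R P P"
  shows "homotopic R P P \<epsilon> (\<lambda>n x. \<zero>\<^bsub>obj P n\<^esub>) \<Longrightarrow> homotopic R P P (compl_map P \<epsilon>) id_map" (is "?A \<Longrightarrow> _")
    "homotopic R P P (compl_map P \<epsilon>) (\<lambda>n x. \<zero>\<^bsub>obj P n\<^esub>) \<Longrightarrow> homotopic R P P \<epsilon> id_map" (is "?B \<Longrightarrow> _")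
proof -
  note \<epsilon>c = chain_homD(2)[OF \<epsilon>] and \<epsilon>'c = chain_homD(2)[OF compl_map_chain_hom[OF P \<epsilon>]]
  note z = obj_zero_closed[OF P]
  have ab: "abelian_monoid (obj P n)" for n
    using cochain_abelian_group[OF P] by (rule abelian_group.axioms)
  have r1: "homotopic R P P \<epsilon> \<epsilon>" using \<epsilon>c by (intro homotopic_refl[OF P]) auto
  have r2: "homotopic R P P (compl_map P \<epsilon>) (compl_map P \<epsilon>)"
    using \<epsilon>'c by (intro homotopic_refl[OF P]) auto
  show "homotopic R P P (compl_map P \<epsilon>) id_map" if ?A
  proof -
    have "homotopic R P P (\<lambda>n x. \<epsilon> n x \<oplus>\<^bsub>obj P n\<^esub> compl_map P \<epsilon> n x)
        (\<lambda>n x. \<zero>\<^bsub>obj P n\<^esub> \<oplus>\<^bsub>obj P n\<^esub> compl_map P \<epsilon> n x)"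
      by (rule homotopic_add[OF P P z \<epsilon>'c that r2])
    then have "homotopic R P P id_map (compl_map P \<epsilon>)"
      by (rule homotopic_cong) (use add_compl_map[OF P \<epsilon>] \<epsilon>'c in \<open>auto simp: id_map_def abelian_monoid.l_zero[OF ab]\<close>)
    then show ?thesis by (rule homotopic_sym[OF P P]) (rule \<epsilon>'c)
  qed
  show "homotopic R P P \<epsilon> id_map" if ?B
  proof -
    have "homotopic R P P (\<lambda>n x. \<epsilon> n x \<oplus>\<^bsub>obj P n\<^esub> compl_map P \<epsilon> n x)
        (\<lambda>n x. \<epsilon> n x \<oplus>\<^bsub>obj P n\<^esub> \<zero>\<^bsub>obj P n\<^esub>)"
      by (rule homotopic_add[OF P P \<epsilon>c z r1 that])
    then have "homotopic R P P id_map \<epsilon>"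
      by (rule homotopic_cong) (use add_compl_map[OF P \<epsilon>] \<epsilon>c in \<open>auto simp: id_map_def abelian_monoid.r_zero[OF ab]\<close>)
    then show ?thesis by (rule homotopic_sym[OF P P]) (rule \<epsilon>c)
  qed
qed

text \<open>The geometric series: up to homotopy \<open>g\<close> is \<open>1 - f\<close>, so with
  \<psi> the sum of the powers of \<open>f\<close> below \<open>k\<close>, the map
  \<open>g \<psi>\<close> is \<open>1 - f^k\<close>. If \<open>f^k\<close> is null-homotopic, then
  \<psi> is a right inverse of \<open>g\<close>.\<close>

lemma homotopic_nilpotent_complement:
  assumes P: "cochain R P" and f: "f \<in> chain_hom R P P" and g: "g \<in> chain_hom R P P"
    and fg: "homotopic R P P (\<lambda>n x. f n x \<oplus>\<^bsub>obj P n\<^esub> g n x) id_map"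
  shows "\<exists>\<psi>\<in>chain_hom R P P. homotopic R P P (\<lambda>n x. g n (\<psi> n x) \<oplus>\<^bsub>obj P n\<^esub> (f n ^^ k) x) id_map"
proof (induction k)
  case 0
  have ab: "abelian_monoid (obj P n)" for n
    using cochain_abelian_group[OF P] by (rule abelian_group.axioms)
  have "homotopic R P P (\<lambda>n x. g n \<zero>\<^bsub>obj P n\<^esub> \<oplus>\<^bsub>obj P n\<^esub> (f n ^^ 0) x) id_map"
    using mod_hom_zero[OF cochainD(1)[OF P] cochainD(1)[OF P] chain_homD(1)[OF g]]
    by (intro homotopic_refl[OF P]) (auto simp: id_map_def abelian_monoid.l_zero[OF ab])
  then show ?case using chain_hom_zero[OF P] by (intro bexI[of _ "\<lambda>n x. \<zero>\<^bsub>obj P n\<^esub>"])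
next
  case (Suc k)
  then obtain \<psi> where \<psi>: "\<psi> \<in> chain_hom R P P"
    and h: "homotopic R P P (\<lambda>n x. g n (\<psi> n x) \<oplus>\<^bsub>obj P n\<^esub> (f n ^^ k) x) id_map" by auto
  have fk: "(\<lambda>n x. (f n ^^ k) x) \<in> chain_hom R P P" by (rule chain_hom_funpow[OF f])
  note gc = chain_homD(2)[OF g] and \<psi>c = chain_homD(2)[OF \<psi>] and fkc = chain_homD(2)[OF fk] and fc = chain_homD(2)[OF f]
  define \<psi>' where "\<psi>' = (\<lambda>n x. \<psi> n x \<oplus>\<^bsub>obj P n\<^esub> (f n ^^ k) x)"
  have \<psi>': "\<psi>' \<in> chain_hom R P P" unfolding \<psi>'_def by (rule chain_hom_add[OF P \<psi> fk])
  have "homotopic R P P (\<lambda>n x. f n ((f n ^^ k) x) \<oplus>\<^bsub>obj P n\<^esub> g n ((f n ^^ k) x)) (\<lambda>n x. id_map n ((f n ^^ k) x))"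
    by (rule homotopic_comp_right[OF fk fg])
  moreover have "homotopic R P P (\<lambda>n x. g n (\<psi> n x)) (\<lambda>n x. g n (\<psi> n x))"
    using gc \<psi>c by (intro homotopic_refl[OF P]) auto
  ultimately have "homotopic R P P
      (\<lambda>n x. g n (\<psi> n x) \<oplus>\<^bsub>obj P n\<^esub> (f n ((f n ^^ k) x) \<oplus>\<^bsub>obj P n\<^esub> g n ((f n ^^ k) x)))
      (\<lambda>n x. g n (\<psi> n x) \<oplus>\<^bsub>obj P n\<^esub> id_map n ((f n ^^ k) x))"
    using gc \<psi>c fkc by (intro homotopic_add[OF P P]) (auto simp: id_map_def)
  moreover have "homotopic R P P (\<lambda>n x. g n (\<psi> n x) \<oplus>\<^bsub>obj P n\<^esub> id_map n ((f n ^^ k) x)) id_map"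
    by (rule homotopic_cong[OF h]) (auto simp: id_map_def)
  ultimately have "homotopic R P P
      (\<lambda>n x. g n (\<psi> n x) \<oplus>\<^bsub>obj P n\<^esub> (f n ((f n ^^ k) x) \<oplus>\<^bsub>obj P n\<^esub> g n ((f n ^^ k) x))) id_map"
    by (rule homotopic_trans[OF P P]) (auto simp: id_map_def)
  then have "homotopic R P P (\<lambda>n x. g n (\<psi>' n x) \<oplus>\<^bsub>obj P n\<^esub> (f n ^^ Suc k) x) id_map"
  proof (rule homotopic_cong)
    fix n x assume x: "x \<in> carrier (obj P n)"
    interpret abelian_group "obj P n" by (rule cochain_abelian_group[OF P])
    show "g n (\<psi>' n x) \<oplus>\<^bsub>obj P n\<^esub> (f n ^^ Suc k) x =
      g n (\<psi> n x) \<oplus>\<^bsub>obj P n\<^esub> (f n ((f n ^^ k) x) \<oplus>\<^bsub>obj P n\<^esub> g n ((f n ^^ k) x))"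
      using mod_hom_add[OF chain_homD(1)[OF g] \<psi>c[OF x] fkc[OF x]] gc \<psi>c fkc fc x
      by (simp add: \<psi>'_def a_ac)
  qed simp
  then show ?case using \<psi>' by auto
qed

text \<open>Locality of the endomorphism ring, stated with right inverses. Fitting's projection for
  \<open>f\<close> splits \<open>P\<close> into two summands, one of which is contractible. If it is
  the complement of the stable image, \<open>f\<close> has a right inverse. If it is the stable
  image, a power of \<open>f\<close> is null-homotopic and the geometric series inverts
  \<open>g\<close>.\<close>

lemma Kb_indecomposable_local:
  fixes P :: "('a, 'm) cochain_complex"
  assumes fl: "fg_projectives_finite_length R TYPE('m)" and P: "Kb_indecomposable R P"
    and f: "f \<in> chain_hom R P P" and g: "g \<in> chain_hom R P P"
    and fg: "homotopic R P P (\<lambda>n x. f n x \<oplus>\<^bsub>obj P n\<^esub> g n x) id_map"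
  obtains \<psi> where "\<psi> \<in> chain_hom R P P" "homotopic R P P (\<lambda>n x. f n (\<psi> n x)) id_map"
  | \<psi> where "\<psi> \<in> chain_hom R P P" "homotopic R P P (\<lambda>n x. g n (\<psi> n x)) id_map"
proof -
  have oP: "Kb_object R P" using P by (simp add: Kb_indecomposable_def)
  have cP: "cochain R P" using oP by (rule Kb_object_cochain)
  obtain N \<epsilon> \<psi> where \<epsilon>: "idempotent_chain_map R P \<epsilon>" and \<psi>: "\<psi> \<in> chain_hom R P P"
    and f\<psi>: "\<And>n x. x \<in> carrier (obj P n) \<Longrightarrow> (f n ^^ Suc N) (\<psi> n x) = \<epsilon> n x"
    and f\<epsilon>: "\<And>n x. x \<in> carrier (obj P n) \<Longrightarrow> (f n ^^ Suc N) (\<epsilon> n x) = (f n ^^ Suc N) x"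
    using Kb_fitting[OF fl oP f] by metis
  note \<epsilon>' = idempotent_compl_map[OF cP \<epsilon>] and \<epsilon>D = idempotent_chain_mapD[OF \<epsilon>]
  have "Kb_zero R (image_complex P \<epsilon>) \<or> Kb_zero R (image_complex P (compl_map P \<epsilon>))"
    using P Kb_object_image_complex[OF oP \<epsilon>] Kb_object_image_complex[OF oP \<epsilon>'(1)]
      Kb_biproduct_image_complex[OF oP \<epsilon>] by (simp add: Kb_indecomposable_def)
  then show thesis
  proof
    assume "Kb_zero R (image_complex P (compl_map P \<epsilon>))"
    then have "homotopic R P P (compl_map P \<epsilon>) (\<lambda>n x. \<zero>\<^bsub>obj P n\<^esub>)"
      by (rule Kb_zero_image_complex[OF cP \<epsilon>'(1)])
    then have "homotopic R P P \<epsilon> id_map" by (rule homotopic_zero_compl(2)[OF cP \<epsilon>D(1)])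
    then have "homotopic R P P (\<lambda>n x. f n ((f n ^^ N) (\<psi> n x))) id_map"
      by (rule homotopic_cong) (use f\<psi> in auto)
    moreover have "(\<lambda>n x. (f n ^^ N) (\<psi> n x)) \<in> chain_hom R P P"
      by (rule chain_hom_comp[OF \<psi> chain_hom_funpow[OF f]])
    ultimately show thesis using that(1) by blast
  next
    assume "Kb_zero R (image_complex P \<epsilon>)"
    then have \<epsilon>0: "homotopic R P P \<epsilon> (\<lambda>n x. \<zero>\<^bsub>obj P n\<^esub>)"
      by (rule Kb_zero_image_complex[OF cP \<epsilon>])
    have fN: "(\<lambda>n x. (f n ^^ Suc N) x) \<in> chain_hom R P P" by (rule chain_hom_funpow[OF f])
    have "homotopic R P P (\<lambda>n x. (f n ^^ Suc N) (\<epsilon> n x)) (\<lambda>n x. (f n ^^ Suc N) \<zero>\<^bsub>obj P n\<^esub>)"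
      by (rule homotopic_comp_left[OF cP cP fN obj_zero_closed[OF cP] \<epsilon>0])
    then have fN0: "homotopic R P P (\<lambda>n x. (f n ^^ Suc N) x) (\<lambda>n x. \<zero>\<^bsub>obj P n\<^esub>)"
      by (rule homotopic_cong)
        (use f\<epsilon> mod_hom_zero[OF cochainD(1)[OF cP] cochainD(1)[OF cP] chain_homD(1)[OF fN]] in auto)
    obtain \<psi> where \<psi>: "\<psi> \<in> chain_hom R P P"
      and h: "homotopic R P P (\<lambda>n x. g n (\<psi> n x) \<oplus>\<^bsub>obj P n\<^esub> (f n ^^ Suc N) x) id_map"
      using homotopic_nilpotent_complement[OF cP f g fg, of "Suc N"] by auto
    have g\<psi>: "g n (\<psi> n x) \<in> carrier (obj P n)" if "x \<in> carrier (obj P n)" for n x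
      using chain_homD(2)[OF g chain_homD(2)[OF \<psi> that]] .
    have ab: "abelian_monoid (obj P n)" for n
      using cochain_abelian_group[OF cP] by (rule abelian_group.axioms)
    have r: "homotopic R P P (\<lambda>n x. g n (\<psi> n x)) (\<lambda>n x. g n (\<psi> n x))"
      using g\<psi> by (intro homotopic_refl[OF cP]) auto
    have "homotopic R P P (\<lambda>n x. g n (\<psi> n x) \<oplus>\<^bsub>obj P n\<^esub> (f n ^^ Suc N) x)
       (\<lambda>n x. g n (\<psi> n x) \<oplus>\<^bsub>obj P n\<^esub> \<zero>\<^bsub>obj P n\<^esub>)"
      by (rule homotopic_add[OF cP cP g\<psi> obj_zero_closed[OF cP] r fN0])
    then have "homotopic R P P (\<lambda>n x. g n (\<psi> n x) \<oplus>\<^bsub>obj P n\<^esub> (f n ^^ Suc N) x) (\<lambda>n x. g n (\<psi> n x))"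
      by (rule homotopic_cong) (use g\<psi> in \<open>auto simp: abelian_monoid.r_zero[OF ab]\<close>)
    then have "homotopic R P P (\<lambda>n x. g n (\<psi> n x)) (\<lambda>n x. g n (\<psi> n x) \<oplus>\<^bsub>obj P n\<^esub> (f n ^^ Suc N) x)"
      by (rule homotopic_sym[OF cP cP]) (rule g\<psi>)
    then have "homotopic R P P (\<lambda>n x. g n (\<psi> n x)) id_map"
      by (rule homotopic_trans[OF cP cP _ h]) (auto simp: id_map_def)
    then show thesis using that(2)[OF \<psi>] by blast
  qed
qed

text \<open>A differential with image outside the radical has a component that is an isomorphism between
  nonzero summands. The null-homotopic map \<open>\<theta> = dh + hd\<close> below detects it, and its Fitting
  decomposition splits off a contractible summand.\<close>

lemma not_minimal_split:
  fixes Y :: "('a, 'm) cochain_complex"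
  assumes fl: "fg_projectives_finite_length R TYPE('m)" and Y: "Kb_object R Y" and nm: "\<not> minimal_complex R Y"
  obtains \<epsilon> n y where "idempotent_chain_map R Y \<epsilon>" "homotopic R Y Y \<epsilon> id_map"
    "y \<in> carrier (obj Y n)" "\<epsilon> n y \<noteq> y"
proof -
  have cY: "cochain R Y" using Y by (rule Kb_object_cochain)
  obtain n x where x: "x \<in> carrier (obj Y n)" and xr: "dif Y n x \<notin> radical R (obj Y (n + 1))"
    using nm by (auto simp: minimal_complex_def)
  let ?M = "obj Y n" and ?M' = "obj Y (n + 1)"
  note M = cochainD(1)[OF cY, of n] and M' = cochainD(1)[OF cY, of "n + 1"]
  interpret M: left_module R ?M by (rule M)
  interpret M': left_module R ?M' by (rule M')
  note d = cochainD(2)[OF cY, of n]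
  have dx: "dif Y n x \<in> carrier ?M'" using mod_hom_closed[OF d x] .
  obtain L where L: "maximal_submodule R ?M' L" and dxL: "dif Y n x \<notin> L"
    using xr dx by (auto simp: radical_def)
  have sL: "submodule L R ?M'" using L by (simp add: maximal_submodule_def)
  have Lc: "l \<in> carrier ?M'" if "l \<in> L" for l using submodule_subset[OF sL] that by auto
  have im: "submodule (dif Y n ` carrier ?M) R ?M'"
    by (rule submodule_image[OF M M' d submodule_carrier[OF M]])
  \<comment> \<open>Maximality of \<open>L\<close>, together with an element of the image of
    \<open>d\<close> outside \<open>L\<close>, makes this sum the whole module: modulo
    \<open>L\<close> the differential is onto.\<close>
  define S where "S = {l \<oplus>\<^bsub>?M'\<^esub> y |l y. l \<in> L \<and> y \<in> dif Y n ` carrier ?M}"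
  have S: "submodule S R ?M'" unfolding S_def by (rule submodule_sum[OF M' sL im])
  have "L \<subseteq> S"
  proof
    fix l assume l: "l \<in> L"
    then have "l = l \<oplus>\<^bsub>?M'\<^esub> \<zero>\<^bsub>?M'\<^esub>" using Lc by simp
    then show "l \<in> S" unfolding S_def using l submodule_zero[OF im] by blast
  qed
  moreover have "dif Y n x \<in> S"
  proof -
    have "dif Y n x = \<zero>\<^bsub>?M'\<^esub> \<oplus>\<^bsub>?M'\<^esub> dif Y n x" using dx by simp
    then show ?thesis unfolding S_def using submodule_zero[OF sL] x by blast
  qed
  ultimately have S_all: "S = carrier ?M'"
    using L S dxL unfolding maximal_submodule_def by auto
  obtain m b f where b: "dual_basis R ?M' {..<m::nat} b f"
    using Y unfolding Kb_object_iff proj_cochain_def fg_projective_def by metis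
  have bc: "b j \<in> carrier ?M'" if "j < m" for j using dual_basis_closed(1)[OF b] that by simp
  have "\<exists>l a. l \<in> L \<and> a \<in> carrier ?M \<and> b j = l \<oplus>\<^bsub>?M'\<^esub> dif Y n a" if "j < m" for j
  proof -
    have "b j \<in> S" using bc[OF that] S_all by simp
    then show ?thesis by (auto simp: S_def)
  qed
  then obtain l a where la: "\<And>j. j < m \<Longrightarrow> l j \<in> L" "\<And>j. j < m \<Longrightarrow> a j \<in> carrier ?M"
    "\<And>j. j < m \<Longrightarrow> b j = l j \<oplus>\<^bsub>?M'\<^esub> dif Y n (a j)"
    by metis
  \<comment> \<open>By projectivity, a lift of the identity modulo \<open>L\<close>: each
    \<open>y\<close> differs from \<open>d (h0 y)\<close> by an element of \<open>L\<close>.\<close>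
  define h0 where "h0 = (\<lambda>y. \<Oplus>\<^bsub>?M\<^esub>j\<in>{..<m}. f j y \<odot>\<^bsub>?M\<^esub> a j)"
  have h0: "h0 \<in> mod_hom R ?M' ?M"
    unfolding h0_def by (rule mod_hom_from_dual_basis[OF M' b M]) (use la in auto)
  have split: "\<exists>l\<in>L. y = l \<oplus>\<^bsub>?M'\<^esub> dif Y n (h0 y)" if y: "y \<in> carrier ?M'" for y
  proof -
    have fc: "f j y \<in> carrier R" if "j < m" for j using dual_basis_closed(2)[OF b _ y] that by simp
    have dac: "dif Y n (a j) \<in> carrier ?M'" if "j < m" for j using mod_hom_closed[OF d la(2)[OF that]] .
    have "dif Y n (h0 y) = (\<Oplus>\<^bsub>?M'\<^esub>j\<in>{..<m}. dif Y n (f j y \<odot>\<^bsub>?M\<^esub> a j))"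
      unfolding h0_def using fc la by (intro mod_hom_finsum[OF M M' d]) (auto intro!: M.lsmult_closed)
    also have "\<dots> = (\<Oplus>\<^bsub>?M'\<^esub>j\<in>{..<m}. f j y \<odot>\<^bsub>?M'\<^esub> dif Y n (a j))"
      using fc la dac mod_hom_smult[OF d] by (intro M'.finsum_cong') (auto intro!: M'.lsmult_closed)
    finally have dh: "dif Y n (h0 y) = (\<Oplus>\<^bsub>?M'\<^esub>j\<in>{..<m}. f j y \<odot>\<^bsub>?M'\<^esub> dif Y n (a j))" .
    have "y = (\<Oplus>\<^bsub>?M'\<^esub>j\<in>{..<m}. f j y \<odot>\<^bsub>?M'\<^esub> b j)" by (rule dual_basis_expand[OF b y])
    also have "\<dots> = (\<Oplus>\<^bsub>?M'\<^esub>j\<in>{..<m}. f j y \<odot>\<^bsub>?M'\<^esub> l j \<oplus>\<^bsub>?M'\<^esub> f j y \<odot>\<^bsub>?M'\<^esub> dif Y n (a j))"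
      using fc la Lc dac by (intro M'.finsum_cong') (auto intro!: M'.lsmult_closed simp: M'.lsmult_r_distr)
    also have "\<dots> = (\<Oplus>\<^bsub>?M'\<^esub>j\<in>{..<m}. f j y \<odot>\<^bsub>?M'\<^esub> l j) \<oplus>\<^bsub>?M'\<^esub> dif Y n (h0 y)"
      unfolding dh using fc la Lc dac by (intro M'.finsum_addf) (auto intro!: M'.lsmult_closed)
    finally have "y = (\<Oplus>\<^bsub>?M'\<^esub>j\<in>{..<m}. f j y \<odot>\<^bsub>?M'\<^esub> l j) \<oplus>\<^bsub>?M'\<^esub> dif Y n (h0 y)" .
    moreover have "(\<Oplus>\<^bsub>?M'\<^esub>j\<in>{..<m}. f j y \<odot>\<^bsub>?M'\<^esub> l j) \<in> L"
      using fc la by (intro submodule_finsum[OF M' sL]) (auto intro!: submodule_smult[OF sL])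
    ultimately show ?thesis by blast
  qed
  define h where "h = (\<lambda>k y. if k = n + 1 then h0 y else \<zero>\<^bsub>obj Y (k - 1)\<^esub>)"
  have h: "h \<in> degree_minus1 R Y Y"
    unfolding degree_minus1_def
  proof (intro CollectI allI)
    fix k show "h k \<in> mod_hom R (obj Y k) (obj Y (k - 1))"
      using h0 mod_hom_const_zero[OF cochainD(1)[OF cY, of "k - 1"], where M="obj Y k"]
      by (cases "k = n + 1") (simp_all add: h_def)
  qed
  define \<theta> where "\<theta> = boundary Y Y h"
  have \<theta>: "\<theta> \<in> chain_hom R Y Y" unfolding \<theta>_def by (rule boundary_chain_hom[OF cY cY h])
  have \<theta>0: "homotopic R Y Y \<theta> (\<lambda>n x. \<zero>\<^bsub>obj Y n\<^esub>)"
  proof (rule homotopicI[OF h])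
    fix k y assume y: "y \<in> carrier (obj Y k)"
    interpret abelian_group "obj Y k" by (rule cochain_abelian_group[OF cY])
    show "\<theta> k y = \<zero>\<^bsub>obj Y k\<^esub> \<oplus>\<^bsub>obj Y k\<^esub> boundary Y Y h k y"
      using boundary_closed[OF cY cY h y] by (simp add: \<theta>_def)
  qed
  have "h k z = \<zero>\<^bsub>obj Y (k - 1)\<^esub>" if "k \<noteq> n + 1" for k z using that by (simp add: h_def)
  \<comment> \<open>\<open>h\<close> vanishes away from degree \<open>n + 1\<close>, so in that
    degree the boundary consists of the term \<open>d h0\<close> alone.\<close>
  from this[of "n + 1 + 1"] have hz: "h (n + 1 + 1) z = \<zero>\<^bsub>?M'\<^esub>" for z
    by (simp only: add_diff_cancel_right')
  have \<theta>n: "\<theta> (n + 1) y = dif Y n (h0 y)" if y: "y \<in> carrier ?M'" for y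
    unfolding \<theta>_def boundary_def hz using mod_hom_closed[OF d mod_hom_closed[OF h0 y]] by (simp add: h_def)
  \<comment> \<open>Modulo \<open>L\<close>, the map \<theta> fixes every element, so no power of it
    can send \<open>d x\<close> into \<open>L\<close>, let alone to zero.\<close>
  have \<theta>L: "(\<theta> (n + 1) ^^ k) (dif Y n x) \<notin> L \<and> (\<theta> (n + 1) ^^ k) (dif Y n x) \<in> carrier ?M'" for k
  proof (induction k)
    case (Suc k)
    define z where "z = (\<theta> (n + 1) ^^ k) (dif Y n x)"
    have z: "z \<notin> L" "z \<in> carrier ?M'" using Suc by (auto simp: z_def)
    obtain l where l: "l \<in> L" "z = l \<oplus>\<^bsub>?M'\<^esub> \<theta> (n + 1) z" using split[OF z(2)] \<theta>n[OF z(2)] by auto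
    then have "\<theta> (n + 1) z \<notin> L" using z(1) submodule_add[OF sL l(1)] by metis
    then show ?case using chain_homD(2)[OF \<theta> z(2)] by (simp add: z_def)
  qed (use dxL dx in simp)
  obtain N \<epsilon> \<psi> where \<epsilon>: "idempotent_chain_map R Y \<epsilon>" and \<psi>: "\<psi> \<in> chain_hom R Y Y"
    and \<theta>\<psi>: "\<And>n x. x \<in> carrier (obj Y n) \<Longrightarrow> (\<theta> n ^^ Suc N) (\<psi> n x) = \<epsilon> n x"
    and \<theta>\<epsilon>: "\<And>n x. x \<in> carrier (obj Y n) \<Longrightarrow> (\<theta> n ^^ Suc N) (\<epsilon> n x) = (\<theta> n ^^ Suc N) x"
    using Kb_fitting[OF fl Y \<theta>] by metis
  note \<epsilon>D = idempotent_chain_mapD[OF \<epsilon>]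
  \<comment> \<open>Splitting one factor \<theta> off the power shows that \<epsilon> factors
    through the null-homotopic map \<theta>.\<close>
  have "(\<lambda>n x. (\<theta> n ^^ N) (\<psi> n x)) \<in> chain_hom R Y Y" by (rule chain_hom_comp[OF \<psi> chain_hom_funpow[OF \<theta>]])
  from homotopic_comp_right[OF this \<theta>0]
  have "homotopic R Y Y \<epsilon> (\<lambda>n x. \<zero>\<^bsub>obj Y n\<^esub>)" by (rule homotopic_cong) (use \<theta>\<psi> in auto)
  \<comment> \<open>\<epsilon> projects onto the contractible part, so the idempotent returned is
    its complement. That part is not zero, because \<epsilon> cannot kill
    \<open>d x\<close>.\<close>
  then have "homotopic R Y Y (compl_map Y \<epsilon>) id_map" by (rule homotopic_zero_compl(1)[OF cY \<epsilon>D(1)])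
  moreover have "compl_map Y \<epsilon> (n + 1) (dif Y n x) \<noteq> dif Y n x"
  proof
    assume eq: "compl_map Y \<epsilon> (n + 1) (dif Y n x) = dif Y n x"
    have z: "\<epsilon> (n + 1) (dif Y n x) = \<zero>\<^bsub>?M'\<^esub>" using idempotent_compl_map(2)[OF cY \<epsilon> dx] eq by simp
    have "(\<theta> (n + 1) ^^ Suc N) (dif Y n x) = (\<theta> (n + 1) ^^ Suc N) \<zero>\<^bsub>?M'\<^esub>"
      using \<theta>\<epsilon>[OF dx] z by metis
    also have "\<dots> = \<zero>\<^bsub>?M'\<^esub>"
      by (rule mod_hom_zero[OF M' M' chain_homD(1)[OF chain_hom_funpow[OF \<theta>]]])
    finally have "(\<theta> (n + 1) ^^ Suc N) (dif Y n x) \<in> L" using submodule_zero[OF sL] by metis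
    then show False using \<theta>L[of "Suc N"] by blast
  qed
  ultimately show thesis using that[OF idempotent_compl_map(1)[OF cY \<epsilon>] _ dx] by blast
qed

lemma homotopic_funpow_id:
  assumes P: "cochain R P" and f: "f \<in> chain_hom R P P" and h: "homotopic R P P f id_map"
  shows "homotopic R P P (\<lambda>n x. (f n ^^ k) x) id_map"
proof (induction k)
  case 0
  show ?case by (rule homotopic_refl[OF P]) (auto simp: id_map_def)
next
  case (Suc k)
  have "homotopic R P P (\<lambda>n x. f n ((f n ^^ k) x)) (\<lambda>n x. id_map n ((f n ^^ k) x))"
    by (rule homotopic_comp_right[OF chain_hom_funpow[OF f] h])
  then have "homotopic R P P (\<lambda>n x. (f n ^^ Suc k) x) (\<lambda>n x. (f n ^^ k) x)"
    by (rule homotopic_cong) (auto simp: id_map_def)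
  then show ?case by (rule homotopic_trans[OF P P _ Suc]) (auto simp: id_map_def)
qed

text \<open>The given decomposition lives in the homotopy category, while the descent on length
  needs a strictly idempotent chain map that is neither the identity nor zero. Fitting's projection
  for \<open>e = i1 p1\<close> is one. If it were the identity, \<open>i1\<close> would have a right
  inverse, so \<open>p2\<close> would be null-homotopic and \<open>V\<close> contractible. If it
  were zero, \<open>e\<close> would be nilpotent, and so would \<open>p1 i1\<close>, which is
  homotopic to the identity of \<open>U\<close>.\<close>

lemma decomposable_split:
  fixes Y :: "('a, 'm) cochain_complex"
  assumes fl: "fg_projectives_finite_length R TYPE('m)" and Y: "Kb_object R Y" and nz: "\<not> Kb_zero R Y"
    and dec: "\<not> Kb_indecomposable R Y"
  obtains \<epsilon> n x m y where "idempotent_chain_map R Y \<epsilon>"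
    "x \<in> carrier (obj Y n)" "\<epsilon> n x \<noteq> x" "y \<in> carrier (obj Y m)" "compl_map Y \<epsilon> m y \<noteq> y"
proof -
  have cY: "cochain R Y" using Y by (rule Kb_object_cochain)
  obtain U V where U: "Kb_object R U" and V: "Kb_object R V" and bp: "Kb_biproduct R Y U V"
    and nU: "\<not> Kb_zero R U" and nV: "\<not> Kb_zero R V"
    using Y nz dec by (auto simp: Kb_indecomposable_def)
  have cU: "cochain R U" and cV: "cochain R V" using U V Kb_object_cochain by auto
  obtain i1 p1 i2 p2 where i1: "i1 \<in> chain_hom R U Y" and p1: "p1 \<in> chain_hom R Y U"
    and i2: "i2 \<in> chain_hom R V Y" and p2: "p2 \<in> chain_hom R Y V"
    and pi1: "homotopic R U U (comp_map p1 i1) id_map"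
    and pi2: "homotopic R V V (comp_map p2 i2) id_map"
    and p2i1: "homotopic R U V (comp_map p2 i1) (zero_map V)"
    using bp unfolding Kb_biproduct_def chain_map_eq_chain_hom by blast
  define e where "e = (\<lambda>n x. i1 n (p1 n x))"
  have e: "e \<in> chain_hom R Y Y" unfolding e_def by (rule chain_hom_comp[OF p1 i1])
  obtain N \<epsilon> \<psi> where \<epsilon>: "idempotent_chain_map R Y \<epsilon>" and \<psi>: "\<psi> \<in> chain_hom R Y Y"
    and e\<psi>: "\<And>n x. x \<in> carrier (obj Y n) \<Longrightarrow> (e n ^^ Suc N) (\<psi> n x) = \<epsilon> n x"
    and e\<epsilon>: "\<And>n x. x \<in> carrier (obj Y n) \<Longrightarrow> (e n ^^ Suc N) (\<epsilon> n x) = (e n ^^ Suc N) x"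
    using Kb_fitting[OF fl Y e] by metis
  note \<epsilon>D = idempotent_chain_mapD[OF \<epsilon>]
  note zc = obj_zero_closed
  have "\<exists>n x. x \<in> carrier (obj Y n) \<and> \<epsilon> n x \<noteq> x"
  proof (rule ccontr)
    assume "\<not> ?thesis"
    then have \<epsilon>1: "\<epsilon> n x = x" if "x \<in> carrier (obj Y n)" for n x using that by auto
    define k where "k = (\<lambda>n x. p1 n ((e n ^^ N) (\<psi> n x)))"
    have k: "k \<in> chain_hom R Y U"
      unfolding k_def by (rule chain_hom_comp[OF chain_hom_comp[OF \<psi> chain_hom_funpow[OF e]] p1])
    have ik: "i1 n (k n x) = x" if "x \<in> carrier (obj Y n)" for n x
      using e\<psi>[OF that] \<epsilon>1[OF that] by (simp add: k_def e_def)
    have "homotopic R Y V p2 (\<lambda>n x. \<zero>\<^bsub>obj V n\<^esub>)"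
      by (rule homotopic_cong[OF homotopic_comp_right[OF k p2i1]]) (simp_all add: comp_map_def zero_map_def ik)
    then have p2i2: "homotopic R V V (\<lambda>n x. p2 n (i2 n x)) (\<lambda>n x. \<zero>\<^bsub>obj V n\<^esub>)"
      by (rule homotopic_comp_right[OF i2])
    have "homotopic R V V id_map (\<lambda>n x. p2 n (i2 n x))"
    proof (rule homotopic_sym[OF cV cV])
      show "homotopic R V V (\<lambda>n x. p2 n (i2 n x)) id_map" using pi2 by (simp add: comp_map_def[abs_def])
    qed (simp add: id_map_def)
    then have "homotopic R V V id_map (\<lambda>n x. \<zero>\<^bsub>obj V n\<^esub>)"
      by (rule homotopic_trans[OF cV cV _ p2i2]) (rule zc[OF cV])
    then show False using nV by (simp add: Kb_zero_def zero_map_def[abs_def])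
  qed
  moreover have "\<exists>n x. x \<in> carrier (obj Y n) \<and> compl_map Y \<epsilon> n x \<noteq> x"
  proof (rule ccontr)
    assume "\<not> ?thesis"
    then have "compl_map Y \<epsilon> n x = x" if "x \<in> carrier (obj Y n)" for n x using that by auto
    then have \<epsilon>0: "\<epsilon> n x = \<zero>\<^bsub>obj Y n\<^esub>" if "x \<in> carrier (obj Y n)" for n x
      using idempotent_compl_map(2)[OF cY \<epsilon> that] that by metis
    have eN: "(e n ^^ Suc N) x = \<zero>\<^bsub>obj Y n\<^esub>" if x: "x \<in> carrier (obj Y n)" for n x
    proof -
      have "(e n ^^ Suc N) x = (e n ^^ Suc N) \<zero>\<^bsub>obj Y n\<^esub>" using e\<epsilon>[OF x] \<epsilon>0[OF x] by metis
      then show ?thesis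
        using mod_hom_zero[OF cochainD(1)[OF cY] cochainD(1)[OF cY] chain_homD(1)[OF chain_hom_funpow[OF e]]]
        by metis
    qed
    define w where "w = (\<lambda>n x. p1 n (i1 n x))"
    have w: "w \<in> chain_hom R U U" unfolding w_def by (rule chain_hom_comp[OF i1 p1])
    have w1: "homotopic R U U w id_map" using pi1 by (simp add: comp_map_def[abs_def] w_def)
    \<comment> \<open>Regrouping \<open>(p1 i1)^(k+1)\<close> as \<open>p1 (i1 p1)^k i1\<close>
      transfers nilpotency from \<open>e\<close> to \<open>w\<close> at the cost of one more
      factor.\<close>
    have we: "(w n ^^ Suc k) x = p1 n ((e n ^^ k) (i1 n x))" for n k x
      by (induction k) (simp_all add: w_def e_def)
    have w0: "(w n ^^ Suc (Suc N)) x = \<zero>\<^bsub>obj U n\<^esub>" if "x \<in> carrier (obj U n)" for n x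
      using eN[OF chain_homD(2)[OF i1 that]] mod_hom_zero[OF cochainD(1)[OF cY] cochainD(1)[OF cU] chain_homD(1)[OF p1]]
      unfolding we by metis
    have "homotopic R U U (\<lambda>n x. (w n ^^ Suc (Suc N)) x) id_map" by (rule homotopic_funpow_id[OF cU w w1])
    then have "homotopic R U U (\<lambda>n x. \<zero>\<^bsub>obj U n\<^esub>) id_map"
      by (rule homotopic_cong) (use w0 in auto)
    then have "homotopic R U U id_map (\<lambda>n x. \<zero>\<^bsub>obj U n\<^esub>)"
      by (rule homotopic_sym[OF cU cU]) (simp add: id_map_def)
    then show False using nU by (simp add: Kb_zero_def zero_map_def[abs_def])
  qed
  ultimately show thesis using that \<epsilon> by metis
qed

text \<open>A complex of least total length among those satisfying \<open>W\<close> is minimal, because a contractible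
  summand could be discarded, and indecomposable, because \<open>W\<close> passes to one of two summands.\<close>

lemma minimal_indecomposable_exists:
  fixes Y0 :: "('a, 'm) cochain_complex"
  assumes fl: "fg_projectives_finite_length R TYPE('m)"
    and W1: "\<And>Y \<epsilon>. Kb_object R Y \<Longrightarrow> W Y \<Longrightarrow> idempotent_chain_map R Y \<epsilon> \<Longrightarrow>
      W (image_complex Y \<epsilon>) \<or> W (image_complex Y (compl_map Y \<epsilon>))"
    and W2: "\<And>Y \<epsilon>. Kb_object R Y \<Longrightarrow> W Y \<Longrightarrow> idempotent_chain_map R Y \<epsilon> \<Longrightarrow>
      homotopic R Y Y \<epsilon> id_map \<Longrightarrow> W (image_complex Y \<epsilon>)"
    and W3: "\<And>Y. Kb_object R Y \<Longrightarrow> W Y \<Longrightarrow> \<exists>n. carrier (obj Y n) \<noteq> {\<zero>\<^bsub>obj Y n\<^esub>}"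
    and Y0: "Kb_object R Y0" "W Y0"
  shows "\<exists>Y. Kb_object R Y \<and> W Y \<and> minimal_complex R Y \<and> Kb_indecomposable R Y"
proof -
  obtain r s where rs0: "zero_outside Y0 r s" using Y0(1) by (rule Kb_object_bounded)
  obtain \<delta> where \<delta>0: "\<And>n. length_function R (obj Y0 n) (\<delta> n)"
    using Kb_object_length_function[OF fl Y0(1)] by metis
  \<comment> \<open>The range of degrees and the functions \<open>\<delta> n\<close> are fixed once,
    for \<open>Y0\<close>, and inherited by summands. So \<mu> compares all complexes that occur in
    the descent.\<close>
  define \<mu> where "\<mu> Y = (\<Sum>n\<in>{r..s}. \<delta> n (carrier (obj Y n)))" for Y :: "('a, 'm) cochain_complex"
  define G where "G Y \<longleftrightarrow> Kb_object R Y \<and> W Y \<and> zero_outside Y r s \<and> (\<forall>n. length_function R (obj Y n) (\<delta> n))"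
    for Y :: "('a, 'm) cochain_complex"
  have smaller: "zero_outside (image_complex Y \<epsilon>) r s \<and> Kb_object R (image_complex Y \<epsilon>) \<and>
      (\<forall>n. length_function R (obj (image_complex Y \<epsilon>) n) (\<delta> n)) \<and> \<mu> (image_complex Y \<epsilon>) < \<mu> Y"
    if Y: "G Y" and \<epsilon>: "idempotent_chain_map R Y \<epsilon>" and x: "x \<in> carrier (obj Y m)" "\<epsilon> m x \<noteq> x" for Y \<epsilon> m x
  proof -
    have oY: "Kb_object R Y" and cY: "cochain R Y" and rs: "zero_outside Y r s"
      and \<delta>: "\<And>n. length_function R (obj Y n) (\<delta> n)"
      using Y Kb_object_cochain by (auto simp: G_def)
    note \<epsilon>D = idempotent_chain_mapD[OF \<epsilon>]
    have e0: "\<epsilon> n \<zero>\<^bsub>obj Y n\<^esub> = \<zero>\<^bsub>obj Y n\<^esub>" for n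
      by (rule mod_hom_zero[OF cochainD(1)[OF cY] cochainD(1)[OF cY] chain_homD(1)[OF \<epsilon>D(1)]])
    have zo: "zero_outside (image_complex Y \<epsilon>) r s"
      using rs e0 by (auto simp: zero_outside_def)
    have sub: "submodule (\<epsilon> n ` carrier (obj Y n)) R (obj Y n)" for n
      by (rule submodule_image[OF cochainD(1)[OF cY] cochainD(1)[OF cY] chain_homD(1)[OF \<epsilon>D(1)]
            submodule_carrier[OF cochainD(1)[OF cY]]])
    have lf: "length_function R (obj (image_complex Y \<epsilon>) n) (\<delta> n)" for n
      unfolding image_complex_def by (simp add: length_function_submodule[OF cochainD(1)[OF cY] sub \<delta>])
    have le: "\<delta> n (\<epsilon> n ` carrier (obj Y n)) \<le> \<delta> n (carrier (obj Y n))" for n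
      using length_functionD[OF \<delta> sub submodule_carrier[OF cochainD(1)[OF cY]], of n] submodule_subset[OF sub, of n]
      by (cases "\<epsilon> n ` carrier (obj Y n) = carrier (obj Y n)") (auto simp: psubset_eq less_imp_le)
    have m: "m \<in> {r..s}"
    proof (rule ccontr)
      assume "m \<notin> {r..s}"
      then have "x = \<zero>\<^bsub>obj Y m\<^esub>" using rs x(1) by (auto simp: zero_outside_def not_le)
      then show False using x(2) e0 by simp
    qed
    have "\<epsilon> m ` carrier (obj Y m) \<subset> carrier (obj Y m)"
      using submodule_subset[OF sub] \<epsilon>D(3)[of x m] x by (intro psubsetI) metis+
    then have lt: "\<delta> m (\<epsilon> m ` carrier (obj Y m)) < \<delta> m (carrier (obj Y m))"
      by (rule length_functionD[OF \<delta> sub submodule_carrier[OF cochainD(1)[OF cY]]])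
    have "\<mu> (image_complex Y \<epsilon>) < \<mu> Y"
      unfolding \<mu>_def image_complex_simps by (rule sum_strict_mono_ex1) (use le lt m in auto)
    then show ?thesis using zo lf Kb_object_image_complex[OF oY \<epsilon>] by simp
  qed
  have "G Y \<Longrightarrow> ?thesis" for Y
  proof (induction "\<mu> Y" arbitrary: Y rule: less_induct)
    case less
    have oY: "Kb_object R Y" and WY: "W Y" and rs: "zero_outside Y r s" using less.prems by (auto simp: G_def)
    have cY: "cochain R Y" using oY by (rule Kb_object_cochain)
    have IH: ?thesis if "idempotent_chain_map R Y \<epsilon>" "x \<in> carrier (obj Y m)" "\<epsilon> m x \<noteq> x" "W (image_complex Y \<epsilon>)"
      for \<epsilon> m x
      using smaller[OF less.prems that(1-3)] that(4) by (intro less.hyps[of "image_complex Y \<epsilon>"]) (auto simp: G_def)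
    \<comment> \<open>If \<open>Y\<close> were contractible, the zero map would be an idempotent
      homotopic to the identity, and by \<open>W2\<close> the property \<open>W\<close> would hold
      for a zero complex, against \<open>W3\<close>.\<close>
    have nz: "\<not> Kb_zero R Y"
    proof
      assume "Kb_zero R Y"
      then have "homotopic R Y Y (\<lambda>n x. \<zero>\<^bsub>obj Y n\<^esub>) id_map"
        unfolding Kb_zero_def zero_map_def[abs_def]
        by (rule homotopic_sym[OF cY cY]) (rule obj_zero_closed[OF cY])
      moreover have z: "idempotent_chain_map R Y (\<lambda>n x. \<zero>\<^bsub>obj Y n\<^esub>)"
        using chain_hom_zero[OF cY] by (simp add: idempotent_chain_map_def)
      ultimately have "W (image_complex Y (\<lambda>n x. \<zero>\<^bsub>obj Y n\<^esub>))" by (intro W2[OF oY WY])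
      then show False using W3[OF Kb_object_image_complex[OF oY z]] obj_zero_closed[OF cY] by auto
    qed
    show ?case
    proof (cases "minimal_complex R Y")
      case False
      then obtain \<epsilon> n y where "idempotent_chain_map R Y \<epsilon>" "homotopic R Y Y \<epsilon> id_map"
        "y \<in> carrier (obj Y n)" "\<epsilon> n y \<noteq> y"
        using not_minimal_split[OF fl oY] by metis
      then show ?thesis using IH W2[OF oY WY] by metis
    next
      case True
      show ?thesis
      proof (cases "Kb_indecomposable R Y")
        case False
        obtain \<epsilon> n x m y where "idempotent_chain_map R Y \<epsilon>"
          "x \<in> carrier (obj Y n)" "\<epsilon> n x \<noteq> x" "y \<in> carrier (obj Y m)" "compl_map Y \<epsilon> m y \<noteq> y"
          using decomposable_split[OF fl oY nz False] by metis
        then show ?thesis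
          using IH[of \<epsilon>] IH[of "compl_map Y \<epsilon>"] W1[OF oY WY] idempotent_compl_map(1)[OF cY] by metis
      qed (use True oY WY in auto)
    qed
  qed
  moreover have "G Y0" using Y0 rs0 \<delta>0 by (simp add: G_def)
  ultimately show ?thesis by blast
qed

text \<open>A minimal complex is its own minimal representative. Its length is the distance between
  its extreme nonzero degrees, and any two nonzero degrees bound this from below.\<close>

lemma Kb_length_minimal:
  assumes Y: "Kb_object R Y" and m: "minimal_complex R Y"
    and n: "carrier (obj Y n1) \<noteq> {\<zero>\<^bsub>obj Y n1\<^esub>}" "carrier (obj Y n2) \<noteq> {\<zero>\<^bsub>obj Y n2\<^esub>}"
  shows "\<exists>l. Kb_length R Y l \<and> nat (n2 - n1) \<le> l"
proof -
  have cY: "cochain R Y" using Y by (rule Kb_object_cochain)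
  obtain r s where rs: "zero_outside Y r s" using Y by (rule Kb_object_bounded)
  define A where "A = {k. carrier (obj Y k) \<noteq> {\<zero>\<^bsub>obj Y k\<^esub>}}"
  have "A \<subseteq> {r..s}"
  proof
    fix k assume "k \<in> A"
    then have "\<not> (k < r \<or> k > s)" using rs unfolding A_def zero_outside_def by blast
    then show "k \<in> {r..s}" by auto
  qed
  then have fin: "finite A" using finite_subset by blast
  have n1: "n1 \<in> A" "n2 \<in> A" using n by (auto simp: A_def)
  have ends: "Min A \<in> A" "Max A \<in> A" using fin n1 Min_in Max_in by auto
  have zo: "zero_outside Y (Min A) (Max A)"
    unfolding zero_outside_def
  proof (intro allI impI)
    fix k assume "k < Min A \<or> Max A < k"
    then have "k \<notin> A" using fin Min_le Max_ge by (meson linorder_not_le)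
    then show "carrier (obj Y k) = {\<zero>\<^bsub>obj Y k\<^esub>}" by (simp add: A_def)
  qed
  have "homotopic R Y Y (comp_map (\<lambda>n x. x) (\<lambda>n x. x)) id_map"
    by (rule homotopic_refl[OF cY]) (auto simp: comp_map_def id_map_def)
  then have iso: "Kb_iso R Y Y"
    unfolding Kb_iso_def chain_map_eq_chain_hom using chain_hom_id by blast
  have "Min A \<le> n1" "n2 \<le> Max A" "Min A \<le> n2" using fin n1 by auto
  then have "nat (n2 - n1) \<le> nat (Max A - Min A)" "Min A \<le> Max A" by auto
  then show ?thesis
    using Y m iso zo ends unfolding Kb_length_def A_def by blast
qed

section \<open>Transfer of indecomposables along a separable extension\<close>

definition restrict_complex :: "('c \<Rightarrow> 'a) \<Rightarrow> ('a, 'm) cochain_complex \<Rightarrow> ('c, 'm) cochain_complex" where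
  "restrict_complex \<kappa> P = \<lparr>obj = (\<lambda>n. restrict_scalars \<kappa> (obj P n)), dif = dif P\<rparr>"

lemma restrict_complex_simps [simp]:
  "obj (restrict_complex \<kappa> P) n = restrict_scalars \<kappa> (obj P n)"
  "dif (restrict_complex \<kappa> P) = dif P"
  by (simp_all add: restrict_complex_def)

lemma cochain_restrict_complex:
  assumes "ring C" "\<kappa> \<in> ring_hom C R" "cochain R P"
  shows "cochain C (restrict_complex \<kappa> P)"
  using left_module_restrict_scalars[OF assms(1,2) cochainD(1)[OF assms(3)]]
    mod_hom_restrict_scalars[OF assms(2) cochainD(2)[OF assms(3)]] cochainD(6)[OF assms(3)]
  by (simp add: cochain_def)

lemma chain_hom_restrict_complex:
  assumes "\<kappa> \<in> ring_hom C R" "f \<in> chain_hom R P Q"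
  shows "f \<in> chain_hom C (restrict_complex \<kappa> P) (restrict_complex \<kappa> Q)"
  using mod_hom_restrict_scalars[OF assms(1) chain_homD(1)[OF assms(2)]] chain_homD(3)[OF assms(2)]
  by (intro chain_homI) auto

lemma boundary_restrict_complex [simp]:
  "boundary (restrict_complex \<kappa> P) (restrict_complex \<kappa>' Q) h = boundary P Q h"
  by (simp add: boundary_def fun_eq_iff)

text \<open>The action of the tensor with terms \<open>u i\<close>, \<open>v i\<close> on maps from
  \<open>M\<close> to \<open>N\<close>. For group elements and their inverses it is the sum of the
  conjugates of \<open>f\<close>. If the tensor commutes with all scalars of \<open>R\<close>, that
  is, if it is a Casimir element, maps linear over a subring become linear over
  \<open>R\<close>.\<close>

definition casimir_map ::
  "'i set \<Rightarrow> ('i \<Rightarrow> 'a) \<Rightarrow> ('i \<Rightarrow> 'a) \<Rightarrow> ('a, 'm) module \<Rightarrow> ('a, 'n) module \<Rightarrow> ('m \<Rightarrow> 'n) \<Rightarrow> 'm \<Rightarrow> 'n" where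
  "casimir_map I u v M N f x = (\<Oplus>\<^bsub>N\<^esub>i\<in>I. u i \<odot>\<^bsub>N\<^esub> f (v i \<odot>\<^bsub>M\<^esub> x))"

lemma radical_add:
  assumes M: "left_module R M" and x: "x \<in> radical R M" and y: "y \<in> radical R M"
  shows "x \<oplus>\<^bsub>M\<^esub> y \<in> radical R M"
proof -
  interpret left_module R M by fact
  have "x \<oplus>\<^bsub>M\<^esub> y \<in> N" if "maximal_submodule R M N" for N
    using x y that unfolding radical_def maximal_submodule_def by (auto intro: submodule_add[of N R M])
  then show ?thesis using x y by (auto simp: radical_def)
qed

text \<open>\<open>P\<close> is a retract of \<open>Y\<close> after averaging. The factors
  \<open>a\<close> and \<open>b\<close> are linear over the common ring \<open>C\<close> only, so
  \<open>P\<close> and \<open>Y\<close> may live over different rings; the homotopy is linear over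
  \<open>R\<close>. For \<open>Y\<close> over \<open>C\<close> this stands for being a retract of an
  induced complex, expressed without tensor products.\<close>

definition casimir_retract ::
  "('a, 'x) ring_scheme \<Rightarrow> ('c, 'z) ring_scheme \<Rightarrow> ('c \<Rightarrow> 'a) \<Rightarrow> ('c \<Rightarrow> 'b) \<Rightarrow>
     'i set \<Rightarrow> ('i \<Rightarrow> 'a) \<Rightarrow> ('i \<Rightarrow> 'a) \<Rightarrow> ('a, 'm) cochain_complex \<Rightarrow> ('b, 'n) cochain_complex \<Rightarrow> bool"
where
  "casimir_retract R C \<kappa> \<kappa>' I u v P Y \<longleftrightarrow>
     (\<exists>a\<in>chain_hom C (restrict_complex \<kappa> P) (restrict_complex \<kappa>' Y).
      \<exists>b\<in>chain_hom C (restrict_complex \<kappa>' Y) (restrict_complex \<kappa> P).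
        homotopic R P P (\<lambda>n. casimir_map I u v (obj P n) (obj P n) (\<lambda>x. b n (a n x))) id_map)"

section \<open>Averaged factorisations of the identity of an indecomposable complex\<close>

context
  fixes R :: "('a, 'x) ring_scheme" and T :: "('b, 'y) ring_scheme" and C :: "('c, 'z) ring_scheme"
    and \<kappa> :: "'c \<Rightarrow> 'a" and \<kappa>' :: "'c \<Rightarrow> 'b" and I :: "'i set" and u v :: "'i \<Rightarrow> 'a"
    and P :: "('a, 'm) cochain_complex"
  assumes C: "ring C" and \<kappa>: "\<kappa> \<in> ring_hom C R" and \<kappa>': "\<kappa>' \<in> ring_hom C T"
    and u: "u \<in> I \<rightarrow> carrier R" and v: "v \<in> I \<rightarrow> carrier R"
    and casimir: "\<And>(M :: ('a, 'm) module) (N :: ('a, 'm) module) f. left_module R M \<Longrightarrow> left_module R N \<Longrightarrow>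
      f \<in> mod_hom C (restrict_scalars \<kappa> M) (restrict_scalars \<kappa> N) \<Longrightarrow> casimir_map I u v M N f \<in> mod_hom R M N"
    and flR: "fg_projectives_finite_length R TYPE('m)"
    and P: "Kb_indecomposable R P"
begin

private abbreviation "tau M N f \<equiv> casimir_map I u v M N f"

private abbreviation "tau0 f \<equiv> (\<lambda>n. casimir_map I u v (obj P n) (obj P n) (f n))"

private abbreviation "cretract \<equiv> casimir_retract R C \<kappa> \<kappa>' I u v P"

private lemma oP: "Kb_object R P" using P by (simp add: Kb_indecomposable_def)

private lemma cP: "cochain R P" using oP by (rule Kb_object_cochain)

private lemma terms_closed:
  assumes M: "left_module R M" and N: "left_module R N"
    and f: "f \<in> carrier M \<rightarrow> carrier N" and x: "x \<in> carrier M"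
  shows "i \<in> I \<Longrightarrow> v i \<odot>\<^bsub>M\<^esub> x \<in> carrier M" "(\<lambda>i. u i \<odot>\<^bsub>N\<^esub> f (v i \<odot>\<^bsub>M\<^esub> x)) \<in> I \<rightarrow> carrier N"
  using left_module.lsmult_closed[OF M _ x] left_module.lsmult_closed[OF N] u v f by (auto simp: Pi_iff)

private lemma tau_cong:
  assumes M: "left_module R M" and N: "left_module R N"
    and g: "g \<in> carrier M \<rightarrow> carrier N" and fg: "\<And>x. x \<in> carrier M \<Longrightarrow> f x = g x"
    and x: "x \<in> carrier M"
  shows "tau M N f x = tau M N g x"
proof -
  interpret N: left_module R N by fact
  show ?thesis
    unfolding casimir_map_def
    using terms_closed[OF M N g x] fg by (intro N.finsum_cong') (auto simp: Pi_iff)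
qed

private lemma tau_add:
  assumes M: "left_module R M" and N: "left_module R N"
    and f: "f \<in> carrier M \<rightarrow> carrier N" and g: "g \<in> carrier M \<rightarrow> carrier N"
    and x: "x \<in> carrier M"
  shows "tau M N (\<lambda>x. f x \<oplus>\<^bsub>N\<^esub> g x) x = tau M N f x \<oplus>\<^bsub>N\<^esub> tau M N g x"
proof -
  interpret N: left_module R N by fact
  note cf = terms_closed[OF M N f x] and cg = terms_closed[OF M N g x]
  have "tau M N (\<lambda>x. f x \<oplus>\<^bsub>N\<^esub> g x) x =
      (\<Oplus>\<^bsub>N\<^esub>i\<in>I. u i \<odot>\<^bsub>N\<^esub> f (v i \<odot>\<^bsub>M\<^esub> x) \<oplus>\<^bsub>N\<^esub> u i \<odot>\<^bsub>N\<^esub> g (v i \<odot>\<^bsub>M\<^esub> x))"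
    unfolding casimir_map_def
  proof (intro N.finsum_cong' refl)
    show "(\<lambda>i. u i \<odot>\<^bsub>N\<^esub> f (v i \<odot>\<^bsub>M\<^esub> x) \<oplus>\<^bsub>N\<^esub> u i \<odot>\<^bsub>N\<^esub> g (v i \<odot>\<^bsub>M\<^esub> x)) \<in> I \<rightarrow> carrier N"
      using cf(2) cg(2) by (auto simp: Pi_iff)
    fix i assume "i \<in> I"
    then show "u i \<odot>\<^bsub>N\<^esub> (f (v i \<odot>\<^bsub>M\<^esub> x) \<oplus>\<^bsub>N\<^esub> g (v i \<odot>\<^bsub>M\<^esub> x)) =
        u i \<odot>\<^bsub>N\<^esub> f (v i \<odot>\<^bsub>M\<^esub> x) \<oplus>\<^bsub>N\<^esub> u i \<odot>\<^bsub>N\<^esub> g (v i \<odot>\<^bsub>M\<^esub> x)"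
      using u f g cf(1) by (intro N.lsmult_r_distr) (auto simp: Pi_iff)
  qed
  also have "\<dots> = tau M N f x \<oplus>\<^bsub>N\<^esub> tau M N g x"
    unfolding casimir_map_def by (rule N.finsum_addf[OF cf(2) cg(2)])
  finally show ?thesis .
qed

text \<open>An \<open>R\<close>-linear map commutes with the scalars \<open>v i\<close>, so it can
  be pulled out of the average on the right; the companion below pulls maps out on the left through
  the \<open>u i\<close>.\<close>

private lemma tau_comp_right:
  assumes k: "k \<in> mod_hom R M M'" and M: "left_module R M" and M': "left_module R M'" and N: "left_module R N"
    and f: "f \<in> carrier M' \<rightarrow> carrier N"
    and x: "x \<in> carrier M"
  shows "tau M N (\<lambda>x. f (k x)) x = tau M' N f (k x)"
proof -
  interpret N: left_module R N by fact
  show ?thesis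
    unfolding casimir_map_def
    using terms_closed[OF M' N f mod_hom_closed[OF k x]] mod_hom_smult[OF k _ x] v
    by (intro N.finsum_cong') (auto simp: Pi_iff)
qed

private lemma tau_comp_left:
  assumes k: "k \<in> mod_hom R N N'" and M: "left_module R M" and N: "left_module R N" and N': "left_module R N'"
    and f: "f \<in> carrier M \<rightarrow> carrier N"
    and x: "x \<in> carrier M"
  shows "tau M N' (\<lambda>x. k (f x)) x = k (tau M N f x)"
proof -
  interpret N: left_module R N by fact
  interpret N': left_module R N' by fact
  note c = terms_closed[OF M N f x]
  have "k (tau M N f x) = (\<Oplus>\<^bsub>N'\<^esub>i\<in>I. k (u i \<odot>\<^bsub>N\<^esub> f (v i \<odot>\<^bsub>M\<^esub> x)))"
    unfolding casimir_map_def by (rule mod_hom_finsum[OF N N' k c(2)])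
  also have "\<dots> = tau M N' (\<lambda>x. k (f x)) x"
    unfolding casimir_map_def
    using c f u mod_hom_smult[OF k] mod_hom_closed[OF k]
    by (intro N'.finsum_cong') (auto simp: Pi_iff intro!: N'.lsmult_closed)
  finally show ?thesis by simp
qed

text \<open>The differentials of \<open>P\<close> are linear over \<open>R\<close> and therefore
  slide through the average from either side.\<close>

private lemma tau_chain_hom:
  assumes f: "f \<in> chain_hom C (restrict_complex \<kappa> P) (restrict_complex \<kappa> P)"
  shows "tau0 f \<in> chain_hom R P P"
proof (rule chain_homI)
  note lm = cochainD(1)[OF cP]
  have fn: "f n \<in> mod_hom C (restrict_scalars \<kappa> (obj P n)) (restrict_scalars \<kappa> (obj P n))" for n
    using chain_homD(1)[OF f] by simp
  have fc: "f n x \<in> carrier (obj P n)" if "x \<in> carrier (obj P n)" for n x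
    using mod_hom_closed[OF fn] that by simp
  then have fp: "f n \<in> carrier (obj P n) \<rightarrow> carrier (obj P n)" for n by auto
  show "tau0 f n \<in> mod_hom R (obj P n) (obj P n)" for n by (rule casimir[OF lm lm fn])
  fix n x assume x: "x \<in> carrier (obj P n)"
  have "tau0 f (n + 1) (dif P n x) = tau (obj P n) (obj P (n + 1)) (\<lambda>x. f (n + 1) (dif P n x)) x"
    by (rule tau_comp_right[symmetric, OF cochainD(2)[OF cP] lm lm lm fp x])
  also have "\<dots> = tau (obj P n) (obj P (n + 1)) (\<lambda>x. dif P n (f n x)) x"
    using fc cochainD(4)[OF cP] chain_homD(3)[OF f] by (intro tau_cong[OF lm lm _ _ x]) auto
  also have "\<dots> = dif P n (tau0 f n x)"
    by (rule tau_comp_left[OF cochainD(2)[OF cP] lm lm lm fp x])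
  finally show "tau0 f (n + 1) (dif P n x) = dif P n (tau0 f n x)" .
qed

text \<open>The right inverse \<psi> is linear over \<open>R\<close>, so it can be moved under the
  average and absorbed into the map from \<open>P\<close> to the summand.\<close>

private lemma casimir_retract_image:
  assumes \<epsilon>: "idempotent_chain_map T Y \<epsilon>" and \<psi>: "\<psi> \<in> chain_hom R P P"
    and a: "a \<in> chain_hom C (restrict_complex \<kappa> P) (restrict_complex \<kappa>' Y)"
    and b: "b \<in> chain_hom C (restrict_complex \<kappa>' Y) (restrict_complex \<kappa> P)"
    and h: "homotopic R P P (\<lambda>n x. tau0 (\<lambda>n x. b n (\<epsilon> n (a n x))) n (\<psi> n x)) id_map"
  shows "cretract (image_complex Y \<epsilon>)"
  unfolding casimir_retract_def
proof (intro bexI)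
  have ac: "a n x \<in> carrier (obj Y n)" if "x \<in> carrier (obj P n)" for n x
    using chain_homD(2)[OF a, of x n] that by simp
  have bc: "b n x \<in> carrier (obj P n)" if "x \<in> carrier (obj Y n)" for n x
    using chain_homD(2)[OF b, of x n] that by simp
  note \<epsilon>c = chain_homD(2)[OF idempotent_chain_mapD(1)[OF \<epsilon>]] and \<psi>c = chain_homD(2)[OF \<psi>]
  note lm = cochainD(1)[OF cP]
  show "homotopic R P P (tau0 (\<lambda>n x. b n (\<epsilon> n (a n (\<psi> n x))))) id_map"
    by (rule homotopic_cong[OF h])
      (auto intro!: tau_comp_right[OF chain_homD(1)[OF \<psi>] lm lm lm] bc \<epsilon>c ac)
  show "(\<lambda>n x. \<epsilon> n (a n (\<psi> n x))) \<in> chain_hom C (restrict_complex \<kappa> P) (restrict_complex \<kappa>' (image_complex Y \<epsilon>))"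
    by (rule chain_hom_comp[OF chain_hom_comp[OF chain_hom_restrict_complex[OF \<kappa> \<psi>] a]
          chain_hom_restrict_complex[OF \<kappa>' image_complex_proj[OF \<epsilon>]]])
  show "b \<in> chain_hom C (restrict_complex \<kappa>' (image_complex Y \<epsilon>)) (restrict_complex \<kappa> P)"
    by (rule chain_hom_comp[OF chain_hom_restrict_complex[OF \<kappa>' image_complex_incl[OF \<epsilon>]] b])
qed

text \<open>Inserting \<epsilon> and its complement between \<open>a\<close> and \<open>b\<close>
  writes the averaged identity as a sum of two endomorphisms of \<open>P\<close>. By locality one of
  them has a right inverse, and the corresponding summand inherits the factorisation.\<close>

private lemma casimir_retract_summand:
  assumes Y: "Kb_object T Y" and W: "cretract Y" and \<epsilon>: "idempotent_chain_map T Y \<epsilon>"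
  shows "cretract (image_complex Y \<epsilon>) \<or> cretract (image_complex Y (compl_map Y \<epsilon>))"
proof -
  have cY: "cochain T Y" using Y by (rule Kb_object_cochain)
  obtain a b where a: "a \<in> chain_hom C (restrict_complex \<kappa> P) (restrict_complex \<kappa>' Y)"
    and b: "b \<in> chain_hom C (restrict_complex \<kappa>' Y) (restrict_complex \<kappa> P)"
    and h: "homotopic R P P (tau0 (\<lambda>n x. b n (a n x))) id_map"
    using W unfolding casimir_retract_def by blast
  have ac: "a n x \<in> carrier (obj Y n)" if "x \<in> carrier (obj P n)" for n x
    using chain_homD(2)[OF a, of x n] that by simp
  have bc: "b n x \<in> carrier (obj P n)" if "x \<in> carrier (obj Y n)" for n x
    using chain_homD(2)[OF b, of x n] that by simp
  have badd: "b n (x \<oplus>\<^bsub>obj Y n\<^esub> y) = b n x \<oplus>\<^bsub>obj P n\<^esub> b n y"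
    if "x \<in> carrier (obj Y n)" "y \<in> carrier (obj Y n)" for n x y
    using mod_hom_add[OF chain_homD(1)[OF b], of x n y] that by simp
  note \<epsilon>' = idempotent_compl_map(1)[OF cY \<epsilon>]
  note \<epsilon>D = idempotent_chain_mapD(1)[OF \<epsilon>] and \<epsilon>'D = idempotent_chain_mapD(1)[OF \<epsilon>']
  note \<epsilon>c = chain_homD(2)[OF \<epsilon>D] and \<epsilon>'c = chain_homD(2)[OF \<epsilon>'D]
  note lm = cochainD(1)[OF cP]
  define f g where "f = (\<lambda>n x. b n (\<epsilon> n (a n x)))" and "g = (\<lambda>n x. b n (compl_map Y \<epsilon> n (a n x)))"
  have f: "f \<in> chain_hom C (restrict_complex \<kappa> P) (restrict_complex \<kappa> P)"
    unfolding f_def by (rule chain_hom_comp[OF chain_hom_comp[OF a chain_hom_restrict_complex[OF \<kappa>' \<epsilon>D]] b])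
  have g: "g \<in> chain_hom C (restrict_complex \<kappa> P) (restrict_complex \<kappa> P)"
    unfolding g_def by (rule chain_hom_comp[OF chain_hom_comp[OF a chain_hom_restrict_complex[OF \<kappa>' \<epsilon>'D]] b])
  have fc: "f n x \<in> carrier (obj P n)" "g n x \<in> carrier (obj P n)" if "x \<in> carrier (obj P n)" for n x
    using that by (auto simp: f_def g_def intro!: bc \<epsilon>c \<epsilon>'c ac)
  have fp: "f n \<in> carrier (obj P n) \<rightarrow> carrier (obj P n)" "g n \<in> carrier (obj P n) \<rightarrow> carrier (obj P n)" for n
    using fc by auto
  have "tau0 f n x \<oplus>\<^bsub>obj P n\<^esub> tau0 g n x = tau0 (\<lambda>n x. b n (a n x)) n x" if x: "x \<in> carrier (obj P n)" for n x
  proof -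
    have "tau0 f n x \<oplus>\<^bsub>obj P n\<^esub> tau0 g n x = tau (obj P n) (obj P n) (\<lambda>x. f n x \<oplus>\<^bsub>obj P n\<^esub> g n x) x"
      by (rule tau_add[symmetric, OF lm lm fp x])
    also have "\<dots> = tau0 (\<lambda>n x. b n (a n x)) n x"
    proof (rule tau_cong[OF lm lm _ _ x])
      show "(\<lambda>y. b n (a n y)) \<in> carrier (obj P n) \<rightarrow> carrier (obj P n)" using bc ac by auto
      fix y assume y: "y \<in> carrier (obj P n)"
      show "f n y \<oplus>\<^bsub>obj P n\<^esub> g n y = b n (a n y)"
        using badd[OF \<epsilon>c[OF ac[OF y]] \<epsilon>'c[OF ac[OF y]]] add_compl_map[OF cY \<epsilon>D ac[OF y]]
        by (simp add: f_def g_def)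
    qed
    finally show ?thesis .
  qed
  then have "homotopic R P P (\<lambda>n x. tau0 f n x \<oplus>\<^bsub>obj P n\<^esub> tau0 g n x) id_map"
    by (intro homotopic_cong[OF h]) auto
  from Kb_indecomposable_local[OF flR P tau_chain_hom[OF f] tau_chain_hom[OF g] this]
  show ?thesis
  proof cases
    case (1 \<psi>)
    then show ?thesis using casimir_retract_image[OF \<epsilon> 1(1) a b] by (simp add: f_def)
  next
    case (2 \<psi>)
    then show ?thesis using casimir_retract_image[OF \<epsilon>' 2(1) a b] by (simp add: g_def)
  qed
qed

text \<open>If \<epsilon> is the identity plus the boundary of \<open>k\<close>, inserting it
  between \<open>a\<close> and \<open>b\<close> changes the average by the average of the boundary
  of \<open>b k a\<close>. This is the boundary of the averaged homotopy \<open>k3\<close>, because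
  the differentials of \<open>P\<close> pass through the average.\<close>

private lemma casimir_retract_homotopic:
  assumes Y: "Kb_object T Y" and W: "cretract Y" and \<epsilon>: "idempotent_chain_map T Y \<epsilon>"
    and \<epsilon>1: "homotopic T Y Y \<epsilon> id_map"
  shows "cretract (image_complex Y \<epsilon>)"
proof -
  have cY: "cochain T Y" using Y by (rule Kb_object_cochain)
  obtain a b where a: "a \<in> chain_hom C (restrict_complex \<kappa> P) (restrict_complex \<kappa>' Y)"
    and b: "b \<in> chain_hom C (restrict_complex \<kappa>' Y) (restrict_complex \<kappa> P)"
    and h: "homotopic R P P (tau0 (\<lambda>n x. b n (a n x))) id_map"
    using W unfolding casimir_retract_def by blast
  have ac: "a n x \<in> carrier (obj Y n)" if "x \<in> carrier (obj P n)" for n x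
    using chain_homD(2)[OF a, of x n] that by simp
  have bc: "b n x \<in> carrier (obj P n)" if "x \<in> carrier (obj Y n)" for n x
    using chain_homD(2)[OF b, of x n] that by simp
  have badd: "b n (x \<oplus>\<^bsub>obj Y n\<^esub> y) = b n x \<oplus>\<^bsub>obj P n\<^esub> b n y"
    if "x \<in> carrier (obj Y n)" "y \<in> carrier (obj Y n)" for n x y
    using mod_hom_add[OF chain_homD(1)[OF b], of x n y] that by simp
  note lm = cochainD(1)[OF cP]
  obtain k where k: "k \<in> degree_minus1 T Y Y"
    and eq: "\<And>n x. x \<in> carrier (obj Y n) \<Longrightarrow> \<epsilon> n x = id_map n x \<oplus>\<^bsub>obj Y n\<^esub> boundary Y Y k n x"
    using homotopicE[OF \<epsilon>1] by metis
  have cP': "cochain C (restrict_complex \<kappa> P)" by (rule cochain_restrict_complex[OF C \<kappa> cP])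
  have cY': "cochain C (restrict_complex \<kappa>' Y)" by (rule cochain_restrict_complex[OF C \<kappa>' cY])
  have k': "k \<in> degree_minus1 C (restrict_complex \<kappa>' Y) (restrict_complex \<kappa>' Y)"
    using mod_hom_restrict_scalars[OF \<kappa>' degree_minus1D(1)[OF k]] by (simp add: degree_minus1_def)
  define k1 where "k1 = (\<lambda>n x. b (n - 1) (k n x))"
  have k1: "k1 \<in> degree_minus1 C (restrict_complex \<kappa>' Y) (restrict_complex \<kappa> P)"
    using mod_hom_comp[OF degree_minus1D(1)[OF k'] chain_homD(1)[OF b]] by (simp add: degree_minus1_def k1_def)
  define k2 where "k2 = (\<lambda>n x. k1 n (a n x))"
  have k2: "k2 \<in> degree_minus1 C (restrict_complex \<kappa> P) (restrict_complex \<kappa> P)"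
    using mod_hom_comp[OF chain_homD(1)[OF a] degree_minus1D(1)[OF k1]] by (simp add: degree_minus1_def k2_def)
  have k2c: "k2 n x \<in> carrier (obj P (n - 1))" if "x \<in> carrier (obj P n)" for n x
    using degree_minus1D(3)[OF k2, of x n] that by simp
  have k2c': "k2 (n + 1) x \<in> carrier (obj P n)" if "x \<in> carrier (obj P (n + 1))" for n x
    using degree_minus1D(4)[OF k2, of x n] that by simp
  have bk: "b n (boundary Y Y k n (a n x)) = boundary P P k2 n x" if x: "x \<in> carrier (obj P n)" for n x
    using boundary_comp_left[OF cY' cY' k' b, of "a n x" n] ac[OF x]
      boundary_comp_right[OF a, of x n "restrict_complex \<kappa> P" k1] x by (simp add: k1_def k2_def)
  define k3 where "k3 = (\<lambda>n. tau (obj P n) (obj P (n - 1)) (k2 n))"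
  have k3: "k3 \<in> degree_minus1 R P P"
    using casimir[OF lm lm degree_minus1D(1)[OF k2, simplified]] by (simp add: degree_minus1_def k3_def)
  have "homotopic R P P (tau0 (\<lambda>n x. b n (\<epsilon> n (a n x)))) (tau0 (\<lambda>n x. b n (a n x)))"
  proof (rule homotopicI[OF k3])
    fix n x assume x: "x \<in> carrier (obj P n)"
    interpret Pn: left_module R "obj P n" by (rule lm)
    have dk2: "dif P (n - 1) (k2 n y) \<in> carrier (obj P n)" if "y \<in> carrier (obj P n)" for y
      by (rule cochainD(5)[OF cP k2c[OF that]])
    have k2d: "k2 (n + 1) (dif P n y) \<in> carrier (obj P n)" if "y \<in> carrier (obj P n)" for y
      by (rule k2c'[OF cochainD(4)[OF cP that]])
    have k2p: "k2 (n + 1) \<in> carrier (obj P (n + 1)) \<rightarrow> carrier (obj P n)" using k2c' by auto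
    have bd: "boundary P P k2 n y \<in> carrier (obj P n)" if "y \<in> carrier (obj P n)" for y
      using dk2[OF that] k2d[OF that] by (simp add: boundary_def)
    have bac: "b n (a n y) \<in> carrier (obj P n)" if "y \<in> carrier (obj P n)" for y
      by (rule bc[OF ac[OF that]])
    have "tau0 (\<lambda>n x. b n (\<epsilon> n (a n x))) n x =
        tau (obj P n) (obj P n) (\<lambda>x. b n (a n x) \<oplus>\<^bsub>obj P n\<^esub> boundary P P k2 n x) x"
    proof (rule tau_cong[OF lm lm _ _ x])
      show "(\<lambda>y. b n (a n y) \<oplus>\<^bsub>obj P n\<^esub> boundary P P k2 n y) \<in> carrier (obj P n) \<rightarrow> carrier (obj P n)"
        using bac bd by auto
      fix y assume y: "y \<in> carrier (obj P n)"
      show "b n (\<epsilon> n (a n y)) = b n (a n y) \<oplus>\<^bsub>obj P n\<^esub> boundary P P k2 n y"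
        using eq[OF ac[OF y]] badd[OF ac[OF y] boundary_closed[OF cY cY k ac[OF y]]] bk[OF y]
        by (simp add: id_map_def)
    qed
    also have "\<dots> = tau0 (\<lambda>n x. b n (a n x)) n x \<oplus>\<^bsub>obj P n\<^esub> tau (obj P n) (obj P n) (boundary P P k2 n) x"
      by (rule tau_add[OF lm lm _ _ x]) (use bac bd in auto)
    also have "tau (obj P n) (obj P n) (boundary P P k2 n) x =
        tau (obj P n) (obj P n) (\<lambda>x. dif P (n - 1) (k2 n x) \<oplus>\<^bsub>obj P n\<^esub> k2 (n + 1) (dif P n x)) x"
      by (simp add: boundary_def[abs_def])
    also have "\<dots> = tau (obj P n) (obj P n) (\<lambda>x. dif P (n - 1) (k2 n x)) x \<oplus>\<^bsub>obj P n\<^esub>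
        tau (obj P n) (obj P n) (\<lambda>x. k2 (n + 1) (dif P n x)) x"
      by (rule tau_add[OF lm lm _ _ x]) (use dk2 k2d in auto)
    also have "tau (obj P n) (obj P n) (\<lambda>x. dif P (n - 1) (k2 n x)) x = dif P (n - 1) (k3 n x)"
      unfolding k3_def by (rule tau_comp_left[OF cochainD(3)[OF cP] lm lm lm _ x]) (use k2c in auto)
    also have "tau (obj P n) (obj P n) (\<lambda>x. k2 (n + 1) (dif P n x)) x = k3 (n + 1) (dif P n x)"
      using tau_comp_right[OF cochainD(2)[OF cP] lm lm lm k2p x] by (simp add: k3_def)
    finally show "tau0 (\<lambda>n x. b n (\<epsilon> n (a n x))) n x =
        tau0 (\<lambda>n x. b n (a n x)) n x \<oplus>\<^bsub>obj P n\<^esub> boundary P P k3 n x"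
      by (simp add: boundary_def)
  qed
  then have "homotopic R P P (tau0 (\<lambda>n x. b n (\<epsilon> n (a n x)))) id_map"
    by (rule homotopic_trans[OF cP cP _ h]) (simp add: id_map_def)
  then show ?thesis by (intro casimir_retract_image[OF \<epsilon> chain_hom_id a b])
qed

text \<open>Every term of the average in degree \<open>n\<close> passes through the zero module
  \<open>obj Y n\<close>.\<close>

private lemma tau0_zero:
  assumes a: "a \<in> chain_hom C (restrict_complex \<kappa> P) (restrict_complex \<kappa>' Y)"
    and b: "b \<in> chain_hom C (restrict_complex \<kappa>' Y) (restrict_complex \<kappa> P)"
    and cY: "cochain T Y" and z: "carrier (obj Y n) = {\<zero>\<^bsub>obj Y n\<^esub>}" and x: "x \<in> carrier (obj P n)"
  shows "tau0 (\<lambda>n x. b n (a n x)) n x = \<zero>\<^bsub>obj P n\<^esub>"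
proof -
  note lm = cochainD(1)[OF cP]
  interpret Pn: left_module R "obj P n" by (rule lm)
  have "b n \<zero>\<^bsub>obj Y n\<^esub> = \<zero>\<^bsub>obj P n\<^esub>"
    using mod_hom_zero[OF cochainD(1)[OF cochain_restrict_complex[OF C \<kappa>' cY]]
        cochainD(1)[OF cochain_restrict_complex[OF C \<kappa> cP]] chain_homD(1)[OF b]] by simp
  then have ba: "b n (a n y) = \<zero>\<^bsub>obj P n\<^esub>" if "y \<in> carrier (obj P n)" for y
    using chain_homD(2)[OF a, of y n] that z by simp
  have "u i \<odot>\<^bsub>obj P n\<^esub> b n (a n (v i \<odot>\<^bsub>obj P n\<^esub> x)) = \<zero>\<^bsub>obj P n\<^esub>" if "i \<in> I" for i
    using that u v x by (subst ba) (auto simp: Pi_iff intro!: Pn.lsmult_closed Pn.lsmult_zero_right)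
  then show ?thesis unfolding casimir_map_def by (intro Pn.add.finprod_one_eqI)
qed

text \<open>A factorisation through zero modules in all degrees would make the identity of
  \<open>P\<close> null-homotopic, whereas an indecomposable object is nonzero.\<close>

private lemma casimir_retract_nonzero:
  assumes Y: "Kb_object T Y" and W: "cretract Y"
  shows "\<exists>n. carrier (obj Y n) \<noteq> {\<zero>\<^bsub>obj Y n\<^esub>}"
proof (rule ccontr)
  assume "\<not> ?thesis"
  then have z: "carrier (obj Y n) = {\<zero>\<^bsub>obj Y n\<^esub>}" for n by simp
  have cY: "cochain T Y" using Y by (rule Kb_object_cochain)
  obtain a b where a: "a \<in> chain_hom C (restrict_complex \<kappa> P) (restrict_complex \<kappa>' Y)"
    and b: "b \<in> chain_hom C (restrict_complex \<kappa>' Y) (restrict_complex \<kappa> P)"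
    and h: "homotopic R P P (tau0 (\<lambda>n x. b n (a n x))) id_map"
    using W unfolding casimir_retract_def by blast
  have "homotopic R P P (\<lambda>n x. \<zero>\<^bsub>obj P n\<^esub>) id_map"
    using tau0_zero[OF a b cY z] by (intro homotopic_cong[OF h]) auto
  then have "homotopic R P P id_map (\<lambda>n x. \<zero>\<^bsub>obj P n\<^esub>)"
    by (rule homotopic_sym[OF cP cP]) (simp add: id_map_def)
  then show False using P by (simp add: Kb_indecomposable_def Kb_zero_def zero_map_def[abs_def])
qed

private lemma casimir_retract_support:
  assumes Y: "Kb_object T Y" and W: "cretract Y"
    and Q: "Kb_object R Q" and m: "minimal_complex R Q" and PQ: "Kb_iso R P Q"
    and z: "carrier (obj Y n) = {\<zero>\<^bsub>obj Y n\<^esub>}"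
  shows "carrier (obj Q n) = {\<zero>\<^bsub>obj Q n\<^esub>}"
proof -
  have cY: "cochain T Y" and cQ: "cochain R Q" using Y Q by (auto intro: Kb_object_cochain)
  obtain a b where a: "a \<in> chain_hom C (restrict_complex \<kappa> P) (restrict_complex \<kappa>' Y)"
    and b: "b \<in> chain_hom C (restrict_complex \<kappa>' Y) (restrict_complex \<kappa> P)"
    and h: "homotopic R P P (tau0 (\<lambda>n x. b n (a n x))) id_map"
    using W unfolding casimir_retract_def by blast
  obtain \<alpha> \<beta> where \<alpha>: "\<alpha> \<in> chain_hom R P Q" and \<beta>: "\<beta> \<in> chain_hom R Q P"
    and \<alpha>\<beta>: "homotopic R Q Q (comp_map \<alpha> \<beta>) id_map"
    using PQ unfolding Kb_iso_def chain_map_eq_chain_hom by blast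
  define t where "t = tau0 (\<lambda>n x. b n (a n x))"
  have ba: "(\<lambda>n x. b n (a n x)) \<in> chain_hom C (restrict_complex \<kappa> P) (restrict_complex \<kappa> P)"
    by (rule chain_hom_comp[OF a b])
  have t: "t \<in> chain_hom R P P" unfolding t_def by (rule tau_chain_hom[OF ba])
  have "homotopic R P P id_map t"
    by (rule homotopic_sym[OF cP cP h[folded t_def]]) (simp add: id_map_def)
  then have "homotopic R Q P (\<lambda>n x. id_map n (\<beta> n x)) (\<lambda>n x. t n (\<beta> n x))"
    by (rule homotopic_comp_right[OF \<beta>])
  then have t2: "homotopic R Q Q (\<lambda>n x. \<alpha> n (id_map n (\<beta> n x))) (\<lambda>n x. \<alpha> n (t n (\<beta> n x)))"
    by (intro homotopic_comp_left[OF cQ cP \<alpha>]) (auto intro: chain_homD(2)[OF t] chain_homD(2)[OF \<beta>])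
  have "homotopic R Q Q id_map (comp_map \<alpha> \<beta>)"
    by (rule homotopic_sym[OF cQ cQ \<alpha>\<beta>]) (simp add: id_map_def)
  then have "homotopic R Q Q id_map (\<lambda>n x. \<alpha> n (id_map n (\<beta> n x)))"
    by (rule homotopic_cong) (simp_all add: comp_map_def id_map_def)
  \<comment> \<open>The averaged factorisation through \<open>Y\<close>, carried over to the minimal
    representative \<open>Q\<close> by the homotopy equivalence.\<close>
  then have idt: "homotopic R Q Q id_map (\<lambda>n x. \<alpha> n (t n (\<beta> n x)))"
    by (rule homotopic_trans[OF cQ cQ _ t2]) (auto intro: chain_homD(2)[OF t] chain_homD(2)[OF \<alpha>] chain_homD(2)[OF \<beta>])
  obtain k where k: "k \<in> degree_minus1 R Q Q"
    and eq: "\<And>n x. x \<in> carrier (obj Q n) \<Longrightarrow> id_map n x = \<alpha> n (t n (\<beta> n x)) \<oplus>\<^bsub>obj Q n\<^esub> boundary Q Q k n x"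
    using homotopicE[OF idt] by metis
  interpret Qn: left_module R "obj Q n" by (rule cochainD(1)[OF cQ])
  have min: "dif Q k x \<in> radical R (obj Q (k + 1))" if "x \<in> carrier (obj Q k)" for k x
    using m that unfolding minimal_complex_def by auto
  have min': "dif Q (n - 1) x \<in> radical R (obj Q n)" if "x \<in> carrier (obj Q (n - 1))" for x
    using min[OF that] by simp
  have "x \<in> radical R (obj Q n)" if x: "x \<in> carrier (obj Q n)" for x
  proof -
    have "t n (\<beta> n x) = \<zero>\<^bsub>obj P n\<^esub>"
      unfolding t_def by (rule tau0_zero[OF a b cY z chain_homD(2)[OF \<beta> x]])
    then have "x = boundary Q Q k n x"
      using eq[OF x] mod_hom_zero[OF cochainD(1)[OF cP] cochainD(1)[OF cQ] chain_homD(1)[OF \<alpha>]]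
        boundary_closed[OF cQ cQ k x] by (simp add: id_map_def)
    \<comment> \<open>The term \<open>d k\<close> lands in the radical because \<open>Q\<close> is
      minimal, the term \<open>k d\<close> because linear maps also preserve radicals.\<close>
    moreover have "boundary Q Q k n x \<in> radical R (obj Q n)"
      unfolding boundary_def
      by (rule radical_add[OF cochainD(1)[OF cQ] min'[OF degree_minus1D(3)[OF k x]]
            mod_hom_radical[OF cochainD(1)[OF cQ] cochainD(1)[OF cQ] degree_minus1D(2)[OF k] min[OF x]]])
    ultimately show ?thesis by simp
  qed
  moreover obtain \<delta> where "length_function R (obj Q n) \<delta>" using Kb_object_length_function[OF flR Q] by auto
  ultimately show ?thesis using carrier_subset_radical_imp_zero[OF cochainD(1)[OF cQ]] by blast
qed

lemma casimir_transfer: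
  fixes Y0 :: "('b, 'n) cochain_complex"
  assumes flT: "fg_projectives_finite_length T TYPE('n)" and l: "Kb_length R P l"
    and Y0: "Kb_object T Y0" and W0: "cretract Y0"
  shows "\<exists>(Y :: ('b, 'n) cochain_complex) l'. Kb_indecomposable T Y \<and> Kb_length T Y l' \<and> l \<le> l'"
proof -
  have "\<exists>Y :: ('b, 'n) cochain_complex.
      Kb_object T Y \<and> cretract Y \<and> minimal_complex T Y \<and> Kb_indecomposable T Y"
  proof (rule minimal_indecomposable_exists[where W=cretract, OF flT _ _ _ Y0 W0], goal_cases)
    case (1 Y \<epsilon>) then show ?case by (rule casimir_retract_summand)
  next
    case (2 Y \<epsilon>) then show ?case by (rule casimir_retract_homotopic)
  next
    case (3 Y) then show ?case by (rule casimir_retract_nonzero)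
  qed
  then obtain Y :: "('b, 'n) cochain_complex" where Y: "Kb_object T Y" "cretract Y"
    "minimal_complex T Y" "Kb_indecomposable T Y" by blast
  obtain Q r s where Q: "Kb_object R Q" "Kb_iso R P Q" "minimal_complex R Q"
    "carrier (obj Q r) \<noteq> {\<zero>\<^bsub>obj Q r\<^esub>}" "carrier (obj Q s) \<noteq> {\<zero>\<^bsub>obj Q s\<^esub>}" "l = nat (s - r)"
    using l unfolding Kb_length_def by metis
  \<comment> \<open>By contraposition: \<open>Q\<close> is nonzero at both of its end degrees, so
    \<open>Y\<close> must be nonzero there as well.\<close>
  have "carrier (obj Y r) \<noteq> {\<zero>\<^bsub>obj Y r\<^esub>}" "carrier (obj Y s) \<noteq> {\<zero>\<^bsub>obj Y s\<^esub>}"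
    using casimir_retract_support[OF Y(1,2) Q(1,3,2)] Q(4,5) by metis+
  then show ?thesis using Kb_length_minimal[OF Y(1,3)] Q(6) Y(4) by metis
qed

end

text \<open>The coordinates with respect to a dual basis determine an element, so \<open>M\<close>
  can be carried by functions from natural numbers to the ring, which is the element type fixed in
  \<open>strong_global_dimension\<close>. Restriction and coinduction lead out of this type, and
  this lemma leads back.\<close>

lemma fg_projective_encode:
  fixes M :: "('a, 'm) module"
  assumes M: "fg_projective R M"
  shows "\<exists>(N :: ('a, nat \<Rightarrow> 'a) module) \<sigma> \<rho>. left_module R N \<and> \<sigma> \<in> mod_hom R M N \<and> \<rho> \<in> mod_hom R N M \<and>
    (\<forall>x\<in>carrier M. \<rho> (\<sigma> x) = x) \<and> (\<forall>y\<in>carrier N. \<sigma> (\<rho> y) = y)"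
proof -
  obtain n b f where b: "dual_basis R M {..<n::nat} b f" and lM: "left_module R M"
    using M by (auto simp: fg_projective_def)
  interpret M: left_module R M by fact
  \<comment> \<open>Only the first \<open>n\<close> entries distinguish elements; the tail is one
    constant value for all of them.\<close>
  define \<sigma> where "\<sigma> = (\<lambda>x i. if i < n then f i x else undefined)"
  define \<rho> where "\<rho> = inv_into (carrier M) \<sigma>"
  have "inj_on \<sigma> (carrier M)"
  proof (rule inj_onI)
    fix x y assume x: "x \<in> carrier M" and y: "y \<in> carrier M" and eq: "\<sigma> x = \<sigma> y"
    have "f i x = f i y" if "i < n" for i using fun_cong[OF eq, of i] that by (simp add: \<sigma>_def)
    then have "(\<Oplus>\<^bsub>M\<^esub>j\<in>{..<n}. f j x \<odot>\<^bsub>M\<^esub> b j) = (\<Oplus>\<^bsub>M\<^esub>j\<in>{..<n}. f j y \<odot>\<^bsub>M\<^esub> b j)"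
      using dual_basis_closed[OF b] y by (intro M.finsum_cong') (auto intro!: M.lsmult_closed)
    then show "x = y" using dual_basis_expand[OF b x] dual_basis_expand[OF b y] by simp
  qed
  then have \<rho>\<sigma>: "\<rho> (\<sigma> x) = x" if "x \<in> carrier M" for x using that by (simp add: \<rho>_def)
  define N :: "('a, nat \<Rightarrow> 'a) module" where
    "N = \<lparr>carrier = \<sigma> ` carrier M, monoid.mult = undefined, one = undefined, ring.zero = \<sigma> \<zero>\<^bsub>M\<^esub>,
      add = (\<lambda>x y. \<sigma> (\<rho> x \<oplus>\<^bsub>M\<^esub> \<rho> y)), smult = (\<lambda>a x. \<sigma> (a \<odot>\<^bsub>M\<^esub> \<rho> x))\<rparr>"
  have N: "carrier N = \<sigma> ` carrier M" "\<zero>\<^bsub>N\<^esub> = \<sigma> \<zero>\<^bsub>M\<^esub>" "\<And>x y. x \<oplus>\<^bsub>N\<^esub> y = \<sigma> (\<rho> x \<oplus>\<^bsub>M\<^esub> \<rho> y)"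
    "\<And>a x. a \<odot>\<^bsub>N\<^esub> x = \<sigma> (a \<odot>\<^bsub>M\<^esub> \<rho> x)"
    by (simp_all add: N_def)
  have "abelian_group N"
  proof (rule abelian_groupI, goal_cases)
    case (6 x)
    then obtain y where "y \<in> carrier M" "x = \<sigma> y" by (auto simp: N)
    then show ?case by (intro bexI[of _ "\<sigma> (\<ominus>\<^bsub>M\<^esub> y)"]) (auto simp: N \<rho>\<sigma> M.l_neg)
  qed (auto simp: N \<rho>\<sigma> M.a_ac)
  then have "left_module R N"
    by (intro left_module.intro left_module_axioms.intro M.R.ring_axioms)
      (auto simp: N \<rho>\<sigma> M.lsmult_closed M.lsmult_l_distr M.lsmult_r_distr M.lsmult_assoc M.lsmult_one)
  moreover have "\<sigma> \<in> mod_hom R M N" by (rule mod_homI) (auto simp: N \<rho>\<sigma>)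
  moreover have "\<rho> \<in> mod_hom R N M" by (rule mod_homI) (auto simp: N \<rho>\<sigma> M.lsmult_closed)
  moreover have "\<forall>y\<in>carrier N. \<sigma> (\<rho> y) = y" by (auto simp: N \<rho>\<sigma>)
  ultimately show ?thesis using \<rho>\<sigma> by blast
qed

lemma proj_cochain_encode:
  fixes Z :: "('a, 'm) cochain_complex"
  assumes Z: "proj_cochain R Z"
  shows "\<exists>(Y :: ('a, nat \<Rightarrow> 'a) cochain_complex) \<sigma> \<rho>. Kb_object R Y \<and> \<sigma> \<in> chain_hom R Z Y \<and>
    \<rho> \<in> chain_hom R Y Z \<and> (\<forall>n. \<forall>x\<in>carrier (obj Z n). \<rho> n (\<sigma> n x) = x)"
proof -
  have cZ: "cochain R Z" and fg: "\<And>n. fg_projective R (obj Z n)" and "\<exists>r s. zero_outside Z r s"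
    using Z by (auto simp: proj_cochain_def)
  have "\<forall>n. \<exists>(N :: ('a, nat \<Rightarrow> 'a) module) \<sigma> \<rho>. left_module R N \<and> \<sigma> \<in> mod_hom R (obj Z n) N \<and>
      \<rho> \<in> mod_hom R N (obj Z n) \<and> (\<forall>x\<in>carrier (obj Z n). \<rho> (\<sigma> x) = x) \<and> (\<forall>y\<in>carrier N. \<sigma> (\<rho> y) = y)"
    using fg_projective_encode[OF fg] by blast
  then obtain N :: "int \<Rightarrow> ('a, nat \<Rightarrow> 'a) module" and \<sigma> \<rho> where
    *: "\<And>n. left_module R (N n) \<and> \<sigma> n \<in> mod_hom R (obj Z n) (N n) \<and>
      \<rho> n \<in> mod_hom R (N n) (obj Z n) \<and> (\<forall>x\<in>carrier (obj Z n). \<rho> n (\<sigma> n x) = x) \<and>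
      (\<forall>y\<in>carrier (N n). \<sigma> n (\<rho> n y) = y)"
    by metis
  have lN: "left_module R (N n)" and \<sigma>: "\<sigma> n \<in> mod_hom R (obj Z n) (N n)" and \<rho>: "\<rho> n \<in> mod_hom R (N n) (obj Z n)"
    and \<rho>\<sigma>: "x \<in> carrier (obj Z n) \<Longrightarrow> \<rho> n (\<sigma> n x) = x" and \<sigma>\<rho>: "y \<in> carrier (N n) \<Longrightarrow> \<sigma> n (\<rho> n y) = y" for n x y
    using *[of n] by auto
  define Y where "Y = \<lparr>obj = N, dif = (\<lambda>n y. \<sigma> (n + 1) (dif Z n (\<rho> n y)))\<rparr>"
  have Y: "obj Y = N" "dif Y = (\<lambda>n y. \<sigma> (n + 1) (dif Z n (\<rho> n y)))" by (simp_all add: Y_def)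
  have dc: "dif Z n (\<rho> n y) \<in> carrier (obj Z (n + 1))" if "y \<in> carrier (N n)" for n y
    using cochainD(4)[OF cZ mod_hom_closed[OF \<rho> that]] .
  have "fg_projective R (N n)" for n
    by (rule fg_projective_retract[OF fg lN \<rho> \<sigma> \<sigma>\<rho>])
  moreover have "cochain R Y"
    unfolding cochain_def Y
  proof (intro conjI allI ballI lN)
    fix n
    show "(\<lambda>y. \<sigma> (n + 1) (dif Z n (\<rho> n y))) \<in> mod_hom R (N n) (N (n + 1))"
      by (rule mod_hom_comp[OF mod_hom_comp[OF \<rho> cochainD(2)[OF cZ]] \<sigma>])
    fix x assume x: "x \<in> carrier (N n)"
    have z: "\<sigma> (n + 2) \<zero>\<^bsub>obj Z (n + 2)\<^esub> = \<zero>\<^bsub>N (n + 2)\<^esub>"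
      by (rule mod_hom_zero[OF cochainD(1)[OF cZ] lN \<sigma>])
    have n: "n + 1 + 1 = n + 2" by simp
    show "\<sigma> (n + 1 + 1) (dif Z (n + 1) (\<rho> (n + 1) (\<sigma> (n + 1) (dif Z n (\<rho> n x))))) = \<zero>\<^bsub>N (n + 2)\<^esub>"
      unfolding \<rho>\<sigma>[OF dc[OF x]] cochainD(6)[OF cZ mod_hom_closed[OF \<rho> x]] n by (rule z)
  qed
  moreover have "zero_outside Y r s" if "zero_outside Z r s" for r s
    unfolding zero_outside_def Y
  proof (intro allI impI)
    fix n assume n: "n < r \<or> s < n"
    have "\<zero>\<^bsub>N n\<^esub> \<in> carrier (N n)" using submodule_zero[OF submodule_carrier[OF lN]] .
    moreover have "y = \<zero>\<^bsub>N n\<^esub>" if y: "y \<in> carrier (N n)" for y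
    proof -
      have "\<rho> n y = \<zero>\<^bsub>obj Z n\<^esub>" using \<open>zero_outside Z r s\<close> n mod_hom_closed[OF \<rho> y] by (auto simp: zero_outside_def)
      then show ?thesis using \<sigma>\<rho>[OF y] mod_hom_zero[OF cochainD(1)[OF cZ] lN \<sigma>, of n] by simp
    qed
    ultimately show "carrier (N n) = {\<zero>\<^bsub>N n\<^esub>}" by blast
  qed
  ultimately have "Kb_object R Y"
    using \<open>\<exists>r s. zero_outside Z r s\<close> unfolding Kb_object_iff proj_cochain_def Y by blast
  moreover have "\<sigma> \<in> chain_hom R Z Y"
    using \<sigma> by (intro chain_homI) (auto simp: Y \<rho>\<sigma>)
  moreover have "\<rho> \<in> chain_hom R Y Z"
    using \<rho> dc by (intro chain_homI) (auto simp: Y \<rho>\<sigma>)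
  ultimately show ?thesis using \<rho>\<sigma> by blast
qed

section \<open>Skew group extensions\<close>

text \<open>The ring \<open>T\<close> is a free left \<open>L\<close>-module on the units \<open>t g\<close>, with coordinate functions \<open>c g\<close>.\<close>

locale skew_extension =
  fixes L :: "('a, 'x) ring_scheme" and T :: "('b, 'y) ring_scheme" (structure) and H :: "('g, 'z) monoid_scheme"
    and act :: "'g \<Rightarrow> 'a \<Rightarrow> 'a" and \<eta> :: "'a \<Rightarrow> 'b" and t :: "'g \<Rightarrow> 'b" and c :: "'g \<Rightarrow> 'b \<Rightarrow> 'a"
  assumes L: "ring L" and T: "ring T" and H: "group H" and fin: "finite (carrier H)"
    and \<eta>: "\<eta> \<in> ring_hom L T"
    and act_closed: "\<lbrakk>g \<in> carrier H; x \<in> carrier L\<rbrakk> \<Longrightarrow> act g x \<in> carrier L"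
    and act_inv: "\<lbrakk>g \<in> carrier H; x \<in> carrier L\<rbrakk> \<Longrightarrow> act g (act (inv\<^bsub>H\<^esub> g) x) = x"
    and t_closed: "g \<in> carrier H \<Longrightarrow> t g \<in> carrier T"
    and t_one: "t \<one>\<^bsub>H\<^esub> = \<one>"
    and t_mult: "\<lbrakk>g \<in> carrier H; h \<in> carrier H\<rbrakk> \<Longrightarrow> t (g \<otimes>\<^bsub>H\<^esub> h) = t g \<otimes> t h"
    and t_\<eta>: "\<lbrakk>g \<in> carrier H; x \<in> carrier L\<rbrakk> \<Longrightarrow> t g \<otimes> \<eta> x = \<eta> (act g x) \<otimes> t g"
    and c_closed: "\<lbrakk>g \<in> carrier H; s \<in> carrier T\<rbrakk> \<Longrightarrow> c g s \<in> carrier L"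
    and c_add: "\<lbrakk>g \<in> carrier H; r \<in> carrier T; s \<in> carrier T\<rbrakk> \<Longrightarrow> c g (r \<oplus> s) = c g r \<oplus>\<^bsub>L\<^esub> c g s"
    and c_mult: "\<lbrakk>g \<in> carrier H; x \<in> carrier L; s \<in> carrier T\<rbrakk> \<Longrightarrow> c g (\<eta> x \<otimes> s) = x \<otimes>\<^bsub>L\<^esub> c g s"
    and c_one_mult: "\<lbrakk>x \<in> carrier L; s \<in> carrier T\<rbrakk> \<Longrightarrow> c \<one>\<^bsub>H\<^esub> (s \<otimes> \<eta> x) = c \<one>\<^bsub>H\<^esub> s \<otimes>\<^bsub>L\<^esub> x"
    and c_t: "\<lbrakk>g \<in> carrier H; h \<in> carrier H\<rbrakk> \<Longrightarrow> c g (t h) = (if g = h then \<one>\<^bsub>L\<^esub> else \<zero>\<^bsub>L\<^esub>)"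
    and expand: "s \<in> carrier T \<Longrightarrow> s = (\<Oplus>g\<in>carrier H. \<eta> (c g s) \<otimes> t g)"
begin

sublocale L: ring L by (rule L)
sublocale T: ring T by (rule T)
sublocale H: group H by (rule H)

lemma \<eta>_closed: "x \<in> carrier L \<Longrightarrow> \<eta> x \<in> carrier T"
  using ring_hom_closed[OF \<eta>] .

text \<open>By \<open>expand\<close>, every element of \<open>T\<close> is a sum of products of some
  \<open>\<eta> a\<close> with some \<open>t g\<close>, so linearity need only be tested on these
  two kinds of scalars.\<close>

lemma linearI:
  assumes M: "left_module T M" and N: "left_module T N"
    and closed: "\<And>x. x \<in> carrier M \<Longrightarrow> f x \<in> carrier N"
    and add: "\<And>x y. x \<in> carrier M \<Longrightarrow> y \<in> carrier M \<Longrightarrow> f (x \<oplus>\<^bsub>M\<^esub> y) = f x \<oplus>\<^bsub>N\<^esub> f y"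
    and \<eta>l: "\<And>a x. a \<in> carrier L \<Longrightarrow> x \<in> carrier M \<Longrightarrow> f (\<eta> a \<odot>\<^bsub>M\<^esub> x) = \<eta> a \<odot>\<^bsub>N\<^esub> f x"
    and tl: "\<And>g x. g \<in> carrier H \<Longrightarrow> x \<in> carrier M \<Longrightarrow> f (t g \<odot>\<^bsub>M\<^esub> x) = t g \<odot>\<^bsub>N\<^esub> f x"
  shows "f \<in> mod_hom T M N"
proof (rule mod_homI[OF closed add])
  interpret M: left_module T M by fact
  interpret N: left_module T N by fact
  fix s x assume s: "s \<in> carrier T" and x: "x \<in> carrier M"
  have ct: "\<eta> (c g s) \<in> carrier T" "t g \<in> carrier T" if "g \<in> carrier H" for g
    using that s by (auto intro: \<eta>_closed c_closed t_closed)
  have tx: "t g \<odot>\<^bsub>M\<^esub> x \<in> carrier M" if "g \<in> carrier H" for g using ct[OF that] x by (simp add: M.lsmult_closed)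
  have "f (s \<odot>\<^bsub>M\<^esub> x) = f ((\<Oplus>g\<in>carrier H. \<eta> (c g s) \<otimes> t g) \<odot>\<^bsub>M\<^esub> x)"
    using expand[OF s] by simp
  also have "\<dots> = f (\<Oplus>\<^bsub>M\<^esub>g\<in>carrier H. (\<eta> (c g s) \<otimes> t g) \<odot>\<^bsub>M\<^esub> x)"
    using ct x by (subst M.lsmult_finsum_left) auto
  also have "\<dots> = (\<Oplus>\<^bsub>N\<^esub>g\<in>carrier H. f ((\<eta> (c g s) \<otimes> t g) \<odot>\<^bsub>M\<^esub> x))"
    using ct x closed add
    by (intro additive_map_finsum[OF M.abelian_group_self N.abelian_group_self]) (auto intro!: M.lsmult_closed)
  also have "\<dots> = (\<Oplus>\<^bsub>N\<^esub>g\<in>carrier H. (\<eta> (c g s) \<otimes> t g) \<odot>\<^bsub>N\<^esub> f x)"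
    using ct x closed tx s
    by (intro N.finsum_cong') (auto intro!: N.lsmult_closed simp: M.lsmult_assoc N.lsmult_assoc \<eta>l tl c_closed)
  also have "\<dots> = s \<odot>\<^bsub>N\<^esub> f x"
    using ct x closed by (subst expand[OF s]) (subst N.lsmult_finsum_left, auto)
  finally show "f (s \<odot>\<^bsub>M\<^esub> x) = s \<odot>\<^bsub>N\<^esub> f x" .
qed

lemma t_inv: "g \<in> carrier H \<Longrightarrow> t g \<otimes> t (inv\<^bsub>H\<^esub> g) = \<one>"
  using t_mult[of g "inv\<^bsub>H\<^esub> g"] t_one by simp

text \<open>Makes the chain conditions available over \<open>T\<close> too: each coordinate of an
  element of \<open>T\<close> is expanded over the field, and there are finitely many
  coordinates.\<close>

lemma fd_over_extension:
  assumes "fd_over K L \<kappa> I r"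
  shows "fd_over K T (\<lambda>x. \<eta> (\<kappa> x)) (carrier H \<times> I) (\<lambda>(g, i). \<eta> (r i) \<otimes> t g)"
proof -
  have K: "field K" and \<kappa>: "\<kappa> \<in> ring_hom K L" and I: "finite I" and r: "r \<in> I \<rightarrow> carrier L"
    and span: "\<And>x. x \<in> carrier L \<Longrightarrow> \<exists>k\<in>I \<rightarrow> carrier K. x = (\<Oplus>\<^bsub>L\<^esub>i\<in>I. \<kappa> (k i) \<otimes>\<^bsub>L\<^esub> r i)"
    using assms by (auto simp: fd_over_def)
  have hom: "(\<lambda>x. \<eta> (\<kappa> x)) \<in> ring_hom K T"
    using ring_hom_trans[OF \<kappa> \<eta>] by (simp add: comp_def)
  have rI: "\<eta> (r i) \<in> carrier T" "r i \<in> carrier L" if "i \<in> I" for i using that r \<eta>_closed by auto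
  have "\<exists>k\<in>carrier H \<times> I \<rightarrow> carrier K.
      s = (\<Oplus>p\<in>carrier H \<times> I. \<eta> (\<kappa> (k p)) \<otimes> (case p of (g, i) \<Rightarrow> \<eta> (r i) \<otimes> t g))"
    if s: "s \<in> carrier T" for s
  proof -
    have "\<forall>g\<in>carrier H. \<exists>k. k \<in> I \<rightarrow> carrier K \<and> c g s = (\<Oplus>\<^bsub>L\<^esub>i\<in>I. \<kappa> (k i) \<otimes>\<^bsub>L\<^esub> r i)"
      using span c_closed[OF _ s] by blast
    from bchoice[OF this] obtain k where
      k: "\<forall>g\<in>carrier H. k g \<in> I \<rightarrow> carrier K \<and> c g s = (\<Oplus>\<^bsub>L\<^esub>i\<in>I. \<kappa> (k g i) \<otimes>\<^bsub>L\<^esub> r i)" ..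
    have kc: "k g i \<in> carrier K" if "g \<in> carrier H" "i \<in> I" for g i using k that by (auto simp: Pi_iff)
    have \<kappa>c: "\<kappa> (k g i) \<in> carrier L" if "g \<in> carrier H" "i \<in> I" for g i
      using ring_hom_closed[OF \<kappa> kc[OF that]] .
    have \<eta>c: "\<eta> (\<kappa> (k g i)) \<in> carrier T" if "g \<in> carrier H" "i \<in> I" for g i
      using \<eta>_closed[OF \<kappa>c[OF that]] .
    have summand: "\<eta> (c g s) \<otimes> t g = (\<Oplus>i\<in>I. \<eta> (\<kappa> (k g i)) \<otimes> (\<eta> (r i) \<otimes> t g))"
      if g: "g \<in> carrier H" for g
    proof -
      have "\<eta> (c g s) = \<eta> (\<Oplus>\<^bsub>L\<^esub>i\<in>I. \<kappa> (k g i) \<otimes>\<^bsub>L\<^esub> r i)" using k g by simp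
      also have "\<dots> = (\<Oplus>i\<in>I. \<eta> (\<kappa> (k g i) \<otimes>\<^bsub>L\<^esub> r i))"
        using \<kappa>c[OF g] rI \<eta>_closed ring_hom_add[OF \<eta>]
        by (intro additive_map_finsum[OF L.abelian_group_axioms T.abelian_group_axioms]) auto
      also have "\<dots> = (\<Oplus>i\<in>I. \<eta> (\<kappa> (k g i)) \<otimes> \<eta> (r i))"
        using \<kappa>c[OF g] rI \<eta>c[OF g] ring_hom_mult[OF \<eta>] by (intro T.finsum_cong') auto
      finally have "\<eta> (c g s) \<otimes> t g = (\<Oplus>i\<in>I. \<eta> (\<kappa> (k g i)) \<otimes> \<eta> (r i)) \<otimes> t g" by simp
      also have "\<dots> = (\<Oplus>i\<in>I. (\<eta> (\<kappa> (k g i)) \<otimes> \<eta> (r i)) \<otimes> t g)"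
        using \<eta>c[OF g] rI t_closed[OF g] I by (intro T.finsum_ldistr) auto
      also have "\<dots> = (\<Oplus>i\<in>I. \<eta> (\<kappa> (k g i)) \<otimes> (\<eta> (r i) \<otimes> t g))"
        using \<eta>c[OF g] rI t_closed[OF g] by (intro T.finsum_cong') (auto simp: T.m_assoc)
      finally show ?thesis .
    qed
    have "s = (\<Oplus>g\<in>carrier H. \<eta> (c g s) \<otimes> t g)" by (rule expand[OF s])
    also have "\<dots> = (\<Oplus>g\<in>carrier H. \<Oplus>i\<in>I. \<eta> (\<kappa> (k g i)) \<otimes> (\<eta> (r i) \<otimes> t g))"
      using \<eta>c rI t_closed by (intro T.finsum_cong') (auto simp: summand intro!: T.finsum_closed)
    also have "\<dots> = (\<Oplus>p\<in>carrier H \<times> I. \<eta> (\<kappa> (k (fst p) (snd p))) \<otimes> (\<eta> (r (snd p)) \<otimes> t (fst p)))"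
      using \<eta>c rI t_closed fin I by (intro T.finsum_Sigma) auto
    finally show ?thesis
      using kc by (intro bexI[of _ "\<lambda>p. k (fst p) (snd p)"]) (auto simp: case_prod_unfold)
  qed
  moreover have "(\<lambda>(g, i). \<eta> (r i) \<otimes> t g) \<in> carrier H \<times> I \<rightarrow> carrier T"
    using rI t_closed by auto
  ultimately show ?thesis using K T hom fin I unfolding fd_over_def by blast
qed

text \<open>\<open>T\<close> is free over \<open>L\<close> on the \<open>t g\<close>. A dual basis
  over \<open>T\<close> is refined by multiplying its vectors by the \<open>t g\<close> and by
  taking the coordinates of its coordinates.\<close>

lemma restrict_fg_projective:
  fixes M :: "('b, 'm) module"
  assumes "fg_projective T M"
  shows "fg_projective L (restrict_scalars \<eta> M)"
proof -
  obtain n b f where b: "dual_basis T M {..<n::nat} b f" and M: "left_module T M"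
    using assms by (auto simp: fg_projective_def)
  interpret M: left_module T M by fact
  have bc: "b j \<in> carrier M" if "j < n" for j using dual_basis_closed(1)[OF b] that by simp
  have fc: "f j x \<in> carrier T" if "j < n" "x \<in> carrier M" for j x using dual_basis_closed(2)[OF b] that by simp
  have "dual_basis L (restrict_scalars \<eta> M) ({..<n} \<times> carrier H) (\<lambda>(j, g). t g \<odot>\<^bsub>M\<^esub> b j) (\<lambda>(j, g) x. c g (f j x))"
    unfolding dual_basis_def
  proof (intro conjI ballI)
    fix p assume "p \<in> {..<n} \<times> carrier H"
    then obtain j g where p: "p = (j, g)" "j < n" "g \<in> carrier H" by auto
    show "(case p of (j, g) \<Rightarrow> t g \<odot>\<^bsub>M\<^esub> b j) \<in> carrier (restrict_scalars \<eta> M)"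
      using p bc t_closed by (simp add: M.lsmult_closed)
    have "f j \<in> mod_hom T M (mult_bimodule T)" using dual_basis_closed(3)[OF b] p by simp
    then show "(case p of (j, g) \<Rightarrow> \<lambda>x. c g (f j x)) \<in> mod_hom L (restrict_scalars \<eta> M) (mult_bimodule L)"
      using p fc c_closed mod_hom_add[of "f j" T M "mult_bimodule T"] mod_hom_smult[of "f j" T M "mult_bimodule T"]
      by (intro mod_homI) (auto simp: c_add c_mult \<eta>_closed)
  next
    fix x assume "x \<in> carrier (restrict_scalars \<eta> M)"
    then have x: "x \<in> carrier M" by simp
    have \<eta>c: "\<eta> (c g (f j x)) \<in> carrier T" if "j < n" "g \<in> carrier H" for j g
      using that fc x by (intro \<eta>_closed c_closed)
    have "x = (\<Oplus>\<^bsub>M\<^esub>j\<in>{..<n}. f j x \<odot>\<^bsub>M\<^esub> b j)" by (rule dual_basis_expand[OF b x])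
    also have "\<dots> = (\<Oplus>\<^bsub>M\<^esub>j\<in>{..<n}. \<Oplus>\<^bsub>M\<^esub>g\<in>carrier H. \<eta> (c g (f j x)) \<odot>\<^bsub>M\<^esub> (t g \<odot>\<^bsub>M\<^esub> b j))"
    proof (intro M.finsum_cong' refl)
      fix j assume "j \<in> {..<n}"
      then have j: "j < n" by simp
      have "f j x \<odot>\<^bsub>M\<^esub> b j = (\<Oplus>g\<in>carrier H. \<eta> (c g (f j x)) \<otimes> t g) \<odot>\<^bsub>M\<^esub> b j"
        using expand[OF fc[OF j x]] by simp
      also have "\<dots> = (\<Oplus>\<^bsub>M\<^esub>g\<in>carrier H. (\<eta> (c g (f j x)) \<otimes> t g) \<odot>\<^bsub>M\<^esub> b j)"
        using \<eta>c[OF j] t_closed bc[OF j] by (intro M.lsmult_finsum_left) auto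
      also have "\<dots> = (\<Oplus>\<^bsub>M\<^esub>g\<in>carrier H. \<eta> (c g (f j x)) \<odot>\<^bsub>M\<^esub> (t g \<odot>\<^bsub>M\<^esub> b j))"
        using \<eta>c[OF j] t_closed bc[OF j] by (intro M.finsum_cong') (auto simp: M.lsmult_assoc intro!: M.lsmult_closed)
      finally show "f j x \<odot>\<^bsub>M\<^esub> b j = (\<Oplus>\<^bsub>M\<^esub>g\<in>carrier H. \<eta> (c g (f j x)) \<odot>\<^bsub>M\<^esub> (t g \<odot>\<^bsub>M\<^esub> b j))" .
    qed (use \<eta>c t_closed bc in \<open>auto intro!: M.finsum_closed M.lsmult_closed\<close>)
    also have "\<dots> = (\<Oplus>\<^bsub>M\<^esub>p\<in>{..<n} \<times> carrier H. \<eta> (c (snd p) (f (fst p) x)) \<odot>\<^bsub>M\<^esub> (t (snd p) \<odot>\<^bsub>M\<^esub> b (fst p)))"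
      using \<eta>c t_closed bc fin by (intro M.finsum_Sigma) (auto intro!: M.lsmult_closed)
    finally show "x = (\<Oplus>\<^bsub>restrict_scalars \<eta> M\<^esub>p\<in>{..<n} \<times> carrier H.
        (case p of (j, g) \<Rightarrow> \<lambda>x. c g (f j x)) x \<odot>\<^bsub>restrict_scalars \<eta> M\<^esub> (case p of (j, g) \<Rightarrow> t g \<odot>\<^bsub>M\<^esub> b j))"
      by (simp add: case_prod_unfold)
  qed (use fin in simp)
  then show ?thesis by (rule fg_projectiveI[OF left_module_restrict_scalars[OF L \<eta> M]])
qed

lemma restrict_proj_cochain:
  assumes "proj_cochain T P"
  shows "proj_cochain L (restrict_complex \<eta> P)"
  using assms cochain_restrict_complex[OF L \<eta>] restrict_fg_projective
  by (auto simp: proj_cochain_def zero_outside_def)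

text \<open>The units \<open>t g\<close> and their inverses form a Casimir tensor of
  \<open>T\<close> over \<open>L\<close>. A factor \<open>\<eta> a\<close> turns into the image of
  \<open>act (inv g) a\<close> when it passes \<open>t (inv g)\<close>, and back into
  \<open>\<eta> a\<close> when it passes \<open>t g\<close>; a factor \<open>t h\<close> permutes
  the terms by left translation.\<close>

lemma casimir_linear:
  fixes M :: "('b, 'm) module" and N :: "('b, 'n) module"
  assumes M: "left_module T M" and N: "left_module T N"
    and f: "f \<in> mod_hom L (restrict_scalars \<eta> M) (restrict_scalars \<eta> N)"
  shows "casimir_map (carrier H) t (\<lambda>g. t (inv\<^bsub>H\<^esub> g)) M N f \<in> mod_hom T M N"
proof (rule linearI[OF M N])
  interpret M: left_module T M by fact
  interpret N: left_module T N by fact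
  let ?F = "casimir_map (carrier H) t (\<lambda>g. t (inv\<^bsub>H\<^esub> g)) M N f"
  have fc: "f x \<in> carrier N" if "x \<in> carrier M" for x using mod_hom_closed[OF f] that by simp
  have fadd: "f (x \<oplus>\<^bsub>M\<^esub> y) = f x \<oplus>\<^bsub>N\<^esub> f y" if "x \<in> carrier M" "y \<in> carrier M" for x y
    using mod_hom_add[OF f, of x y] that by simp
  have f\<eta>: "f (\<eta> a \<odot>\<^bsub>M\<^esub> x) = \<eta> a \<odot>\<^bsub>N\<^esub> f x" if "a \<in> carrier L" "x \<in> carrier M" for a x
    using mod_hom_smult[OF f that(1), of x] that by simp
  have tc: "t g \<odot>\<^bsub>N\<^esub> f (t (inv\<^bsub>H\<^esub> g) \<odot>\<^bsub>M\<^esub> x) \<in> carrier N" if "g \<in> carrier H" "x \<in> carrier M" for g x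
    using that by (intro N.lsmult_closed fc M.lsmult_closed t_closed) auto
  show "?F x \<in> carrier N" if "x \<in> carrier M" for x
    unfolding casimir_map_def using that tc by (intro N.finsum_closed) auto
  show "?F (x \<oplus>\<^bsub>M\<^esub> y) = ?F x \<oplus>\<^bsub>N\<^esub> ?F y" if x: "x \<in> carrier M" and y: "y \<in> carrier M" for x y
  proof -
    have "?F (x \<oplus>\<^bsub>M\<^esub> y) = (\<Oplus>\<^bsub>N\<^esub>g\<in>carrier H. t g \<odot>\<^bsub>N\<^esub> f (t (inv\<^bsub>H\<^esub> g) \<odot>\<^bsub>M\<^esub> x) \<oplus>\<^bsub>N\<^esub> t g \<odot>\<^bsub>N\<^esub> f (t (inv\<^bsub>H\<^esub> g) \<odot>\<^bsub>M\<^esub> y))"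
      unfolding casimir_map_def
      using x y tc by (intro N.finsum_cong')
        (auto simp: M.lsmult_r_distr t_closed fadd M.lsmult_closed N.lsmult_r_distr fc)
    then show ?thesis
      unfolding casimir_map_def using x y tc by (subst N.finsum_addf[symmetric]) auto
  qed
  show "?F (\<eta> a \<odot>\<^bsub>M\<^esub> x) = \<eta> a \<odot>\<^bsub>N\<^esub> ?F x" if a: "a \<in> carrier L" and x: "x \<in> carrier M" for a x
  proof -
    have "t g \<odot>\<^bsub>N\<^esub> f (t (inv\<^bsub>H\<^esub> g) \<odot>\<^bsub>M\<^esub> (\<eta> a \<odot>\<^bsub>M\<^esub> x)) = \<eta> a \<odot>\<^bsub>N\<^esub> (t g \<odot>\<^bsub>N\<^esub> f (t (inv\<^bsub>H\<^esub> g) \<odot>\<^bsub>M\<^esub> x))"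
      if g: "g \<in> carrier H" for g
    proof -
      define a' where "a' = act (inv\<^bsub>H\<^esub> g) a"
      have a': "a' \<in> carrier L" using a g by (simp add: a'_def act_closed)
      note cl = t_closed[OF g] t_closed[OF H.inv_closed[OF g]] \<eta>_closed[OF a] \<eta>_closed[OF a'] x
      define y where "y = t (inv\<^bsub>H\<^esub> g) \<odot>\<^bsub>M\<^esub> x"
      have y: "y \<in> carrier M" using cl by (simp add: y_def M.lsmult_closed)
      have "t (inv\<^bsub>H\<^esub> g) \<odot>\<^bsub>M\<^esub> (\<eta> a \<odot>\<^bsub>M\<^esub> x) = \<eta> a' \<odot>\<^bsub>M\<^esub> y"
        using cl t_\<eta>[OF H.inv_closed[OF g] a] by (simp add: M.lsmult_assoc[symmetric] a'_def y_def)
      then have "t g \<odot>\<^bsub>N\<^esub> f (t (inv\<^bsub>H\<^esub> g) \<odot>\<^bsub>M\<^esub> (\<eta> a \<odot>\<^bsub>M\<^esub> x)) = (t g \<otimes> \<eta> a') \<odot>\<^bsub>N\<^esub> f y"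
        using cl fc[OF y] by (simp add: f\<eta>[OF a' y] N.lsmult_assoc)
      also have "\<dots> = (\<eta> a \<otimes> t g) \<odot>\<^bsub>N\<^esub> f y"
        using t_\<eta>[OF g a'] act_inv[OF g a] by (simp add: a'_def)
      finally show ?thesis using cl fc[OF y] by (simp add: N.lsmult_assoc y_def)
    qed
    then have "?F (\<eta> a \<odot>\<^bsub>M\<^esub> x) = (\<Oplus>\<^bsub>N\<^esub>g\<in>carrier H. \<eta> a \<odot>\<^bsub>N\<^esub> (t g \<odot>\<^bsub>N\<^esub> f (t (inv\<^bsub>H\<^esub> g) \<odot>\<^bsub>M\<^esub> x)))"
      unfolding casimir_map_def
      using x by (intro N.finsum_cong') (auto intro!: N.lsmult_closed[OF \<eta>_closed[OF a]] tc)
    then show ?thesis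
      unfolding casimir_map_def using x a tc by (subst N.lsmult_finsum_right) (auto intro!: \<eta>_closed)
  qed
  show "?F (t h \<odot>\<^bsub>M\<^esub> x) = t h \<odot>\<^bsub>N\<^esub> ?F x" if h: "h \<in> carrier H" and x: "x \<in> carrier M" for h x
  proof -
    have bij: "(\<otimes>\<^bsub>H\<^esub>) h ` carrier H = carrier H" using H.surj_const_mult[OF h] .
    have inj: "inj_on ((\<otimes>\<^bsub>H\<^esub>) h) (carrier H)" using H.inj_on_cmult[OF h] .
    have hx: "t h \<odot>\<^bsub>M\<^esub> x \<in> carrier M" using h x by (simp add: M.lsmult_closed t_closed)
    have "?F (t h \<odot>\<^bsub>M\<^esub> x) = (\<Oplus>\<^bsub>N\<^esub>g\<in>(\<otimes>\<^bsub>H\<^esub>) h ` carrier H. t g \<odot>\<^bsub>N\<^esub> f (t (inv\<^bsub>H\<^esub> g) \<odot>\<^bsub>M\<^esub> (t h \<odot>\<^bsub>M\<^esub> x)))"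
      unfolding casimir_map_def bij ..
    also have "\<dots> = (\<Oplus>\<^bsub>N\<^esub>g\<in>carrier H. t (h \<otimes>\<^bsub>H\<^esub> g) \<odot>\<^bsub>N\<^esub> f (t (inv\<^bsub>H\<^esub> (h \<otimes>\<^bsub>H\<^esub> g)) \<odot>\<^bsub>M\<^esub> (t h \<odot>\<^bsub>M\<^esub> x)))"
      using h hx tc by (intro N.finsum_reindex inj) auto
    also have "\<dots> = (\<Oplus>\<^bsub>N\<^esub>g\<in>carrier H. t h \<odot>\<^bsub>N\<^esub> (t g \<odot>\<^bsub>N\<^esub> f (t (inv\<^bsub>H\<^esub> g) \<odot>\<^bsub>M\<^esub> x)))"
    proof (intro N.finsum_cong' refl)
      fix g assume g: "g \<in> carrier H"
      note cl = t_closed[OF g] t_closed[OF h] t_closed[OF H.inv_closed[OF g]] t_closed[OF H.inv_closed[OF h]] x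
      have "t (inv\<^bsub>H\<^esub> (h \<otimes>\<^bsub>H\<^esub> g)) \<otimes> t h = t (inv\<^bsub>H\<^esub> (h \<otimes>\<^bsub>H\<^esub> g) \<otimes>\<^bsub>H\<^esub> h)"
        using g h by (simp add: t_mult)
      also have "inv\<^bsub>H\<^esub> (h \<otimes>\<^bsub>H\<^esub> g) \<otimes>\<^bsub>H\<^esub> h = inv\<^bsub>H\<^esub> g"
        using g h by (simp add: H.inv_mult_group H.m_assoc)
      finally have "t (inv\<^bsub>H\<^esub> (h \<otimes>\<^bsub>H\<^esub> g)) \<odot>\<^bsub>M\<^esub> (t h \<odot>\<^bsub>M\<^esub> x) = t (inv\<^bsub>H\<^esub> g) \<odot>\<^bsub>M\<^esub> x"
        using g h x t_closed[of "inv\<^bsub>H\<^esub> (h \<otimes>\<^bsub>H\<^esub> g)"] t_closed[OF h] by (simp add: M.lsmult_assoc[symmetric])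
      then show "t (h \<otimes>\<^bsub>H\<^esub> g) \<odot>\<^bsub>N\<^esub> f (t (inv\<^bsub>H\<^esub> (h \<otimes>\<^bsub>H\<^esub> g)) \<odot>\<^bsub>M\<^esub> (t h \<odot>\<^bsub>M\<^esub> x)) =
          t h \<odot>\<^bsub>N\<^esub> (t g \<odot>\<^bsub>N\<^esub> f (t (inv\<^bsub>H\<^esub> g) \<odot>\<^bsub>M\<^esub> x))"
        using cl fc M.lsmult_closed by (simp add: t_mult[OF h g] N.lsmult_assoc)
    qed (use x in \<open>auto intro!: N.lsmult_closed[OF t_closed[OF h]] tc\<close>)
    also have "\<dots> = t h \<odot>\<^bsub>N\<^esub> ?F x"
      unfolding casimir_map_def using x h tc by (subst N.lsmult_finsum_right) (auto intro!: t_closed)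
    finally show ?thesis .
  qed
qed

text \<open>The transfer lemma expects restricted complexes on both sides. When the common ring is
  \<open>L\<close> itself, one side is a restriction along the identity.\<close>

lemma chain_hom_into_restrict_id:
  "f \<in> chain_hom C Z Y \<Longrightarrow> f \<in> chain_hom C Z (restrict_complex (\<lambda>x. x) Y)"
  "g \<in> chain_hom C Y Z \<Longrightarrow> g \<in> chain_hom C (restrict_complex (\<lambda>x. x) Y) Z"
  by (simp_all add: chain_hom_def mod_hom_def)

lemma ring_hom_identity: "(\<lambda>x. x) \<in> ring_hom R R"
  by (simp add: ring_hom_def)

text \<open>Separability: a central \<open>z\<close> of trace \<open>1\<close> splits the counit from induced to original modules.\<close>

theorem extension_to_base:
  fixes P :: "('b, 'm) cochain_complex"
  assumes fd: "fd_over K L \<kappa> J r"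
    and z: "z \<in> carrier L" "\<And>x. x \<in> carrier L \<Longrightarrow> z \<otimes>\<^bsub>L\<^esub> x = x \<otimes>\<^bsub>L\<^esub> z"
      "(\<Oplus>\<^bsub>L\<^esub>g\<in>carrier H. act g z) = \<one>\<^bsub>L\<^esub>"
    and P: "Kb_indecomposable T P" and l: "Kb_length T P l"
  shows "\<exists>(Y :: ('a, nat \<Rightarrow> 'a) cochain_complex) l'. Kb_indecomposable L Y \<and> Kb_length L Y l' \<and> l \<le> l'"
proof -
  have flT: "fg_projectives_finite_length T TYPE('m)" by (rule fg_projectives_finite_length_fd_over[OF fd_over_extension[OF fd]])
  have flL: "fg_projectives_finite_length L TYPE(nat \<Rightarrow> 'a)" by (rule fg_projectives_finite_length_fd_over[OF fd])
  have oP: "Kb_object T P" using P by (simp add: Kb_indecomposable_def)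
  have cP: "cochain T P" using oP by (rule Kb_object_cochain)
  have pP: "proj_cochain L (restrict_complex \<eta> P)"
    using oP restrict_proj_cochain by (simp add: Kb_object_iff)
  obtain Y0 :: "('a, nat \<Rightarrow> 'a) cochain_complex" and \<sigma> \<rho> where Y0: "Kb_object L Y0"
    and \<sigma>: "\<sigma> \<in> chain_hom L (restrict_complex \<eta> P) Y0" and \<rho>: "\<rho> \<in> chain_hom L Y0 (restrict_complex \<eta> P)"
    and \<rho>\<sigma>: "\<forall>n. \<forall>x\<in>carrier (obj (restrict_complex \<eta> P) n). \<rho> n (\<sigma> n x) = x"
    using proj_cochain_encode[OF pP] by (elim exE conjE)
  note z\<eta> = \<eta>_closed[OF z(1)]
  have comm: "\<eta> z \<otimes> \<eta> a = \<eta> a \<otimes> \<eta> z" if "a \<in> carrier L" for a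
    using z(2)[OF that] ring_hom_mult[OF \<eta> z(1) that] ring_hom_mult[OF \<eta> that z(1)] by simp
  \<comment> \<open>The differentials commute with \<open>\<eta> z\<close> because they are
    \<open>T\<close>-linear; linearity over \<open>L\<close> is where centrality of \<open>z\<close>
    in \<open>L\<close> is used.\<close>
  have mz: "(\<lambda>n x. \<eta> z \<odot>\<^bsub>obj P n\<^esub> x) \<in> chain_hom L (restrict_complex \<eta> P) (restrict_complex \<eta> P)"
  proof (intro chain_homI mod_homI)
    fix n x assume "x \<in> carrier (obj (restrict_complex \<eta> P) n)"
    then have x: "x \<in> carrier (obj P n)" by simp
    interpret Pn: left_module T "obj P n" by (rule cochainD(1)[OF cP])
    show "\<eta> z \<odot>\<^bsub>obj P n\<^esub> x \<in> carrier (obj (restrict_complex \<eta> P) n)"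
      using x z\<eta> by (simp add: Pn.lsmult_closed)
    show "\<eta> z \<odot>\<^bsub>obj P (n + 1)\<^esub> dif (restrict_complex \<eta> P) n x = dif (restrict_complex \<eta> P) n (\<eta> z \<odot>\<^bsub>obj P n\<^esub> x)"
      using mod_hom_smult[OF cochainD(2)[OF cP] z\<eta> x] by simp
    show "\<eta> z \<odot>\<^bsub>obj P n\<^esub> (a \<odot>\<^bsub>obj (restrict_complex \<eta> P) n\<^esub> x) =
        a \<odot>\<^bsub>obj (restrict_complex \<eta> P) n\<^esub> (\<eta> z \<odot>\<^bsub>obj P n\<^esub> x)" if "a \<in> carrier L" for a
      using comm[OF that] x z\<eta> \<eta>_closed[OF that] by (simp add: Pn.lsmult_assoc[symmetric])
    show "\<eta> z \<odot>\<^bsub>obj P n\<^esub> (x \<oplus>\<^bsub>obj (restrict_complex \<eta> P) n\<^esub> y) =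
        \<eta> z \<odot>\<^bsub>obj P n\<^esub> x \<oplus>\<^bsub>obj (restrict_complex \<eta> P) n\<^esub> \<eta> z \<odot>\<^bsub>obj P n\<^esub> y"
      if "y \<in> carrier (obj (restrict_complex \<eta> P) n)" for y
      using that x z\<eta> by (simp add: Pn.lsmult_r_distr)
  qed
  have u: "t \<in> carrier H \<rightarrow> carrier T" and v: "(\<lambda>g. t (inv\<^bsub>H\<^esub> g)) \<in> carrier H \<rightarrow> carrier T"
    using t_closed by auto
  have "casimir_retract T L \<eta> (\<lambda>x. x) (carrier H) t (\<lambda>g. t (inv\<^bsub>H\<^esub> g)) P Y0"
    unfolding casimir_retract_def
  proof (intro bexI)
    show "\<sigma> \<in> chain_hom L (restrict_complex \<eta> P) (restrict_complex (\<lambda>x. x) Y0)"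
      by (rule chain_hom_into_restrict_id(1)[OF \<sigma>])
    \<comment> \<open>With \<open>\<eta> z\<close> inserted, each term of the average becomes the
      conjugate \<open>t g \<eta> z t (inv g)\<close>, which is the image of \<open>act g z\<close>.
      These add up to 1 by the trace condition.\<close>
    show "(\<lambda>n y. \<eta> z \<odot>\<^bsub>obj P n\<^esub> \<rho> n y) \<in> chain_hom L (restrict_complex (\<lambda>x. x) Y0) (restrict_complex \<eta> P)"
      by (rule chain_hom_into_restrict_id(2)[OF chain_hom_comp[OF \<rho> mz]])
    show "homotopic T P P (\<lambda>n. casimir_map (carrier H) t (\<lambda>g. t (inv\<^bsub>H\<^esub> g)) (obj P n) (obj P n)
        (\<lambda>x. \<eta> z \<odot>\<^bsub>obj P n\<^esub> \<rho> n (\<sigma> n x))) id_map"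
    proof (rule homotopic_refl[OF cP])
      fix n x assume x: "x \<in> carrier (obj P n)"
      interpret Pn: left_module T "obj P n" by (rule cochainD(1)[OF cP])
      have tz: "act g z \<in> carrier L" if "g \<in> carrier H" for g using act_closed[OF that z(1)] .
      have "t g \<odot>\<^bsub>obj P n\<^esub> (\<eta> z \<odot>\<^bsub>obj P n\<^esub> \<rho> n (\<sigma> n (t (inv\<^bsub>H\<^esub> g) \<odot>\<^bsub>obj P n\<^esub> x))) = \<eta> (act g z) \<odot>\<^bsub>obj P n\<^esub> x"
        if g: "g \<in> carrier H" for g
      proof -
        note cl = t_closed[OF g] t_closed[OF H.inv_closed[OF g]] z\<eta> x \<eta>_closed[OF tz[OF g]]
        have "t g \<odot>\<^bsub>obj P n\<^esub> (\<eta> z \<odot>\<^bsub>obj P n\<^esub> \<rho> n (\<sigma> n (t (inv\<^bsub>H\<^esub> g) \<odot>\<^bsub>obj P n\<^esub> x))) =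
            t g \<odot>\<^bsub>obj P n\<^esub> (\<eta> z \<odot>\<^bsub>obj P n\<^esub> (t (inv\<^bsub>H\<^esub> g) \<odot>\<^bsub>obj P n\<^esub> x))"
          using cl by (subst \<rho>\<sigma>[rule_format]) (simp_all add: Pn.lsmult_closed)
        also have "\<dots> = ((t g \<otimes> \<eta> z) \<otimes> t (inv\<^bsub>H\<^esub> g)) \<odot>\<^bsub>obj P n\<^esub> x"
          using cl by (simp add: Pn.lsmult_assoc Pn.lsmult_closed)
        also have "(t g \<otimes> \<eta> z) \<otimes> t (inv\<^bsub>H\<^esub> g) = \<eta> (act g z)"
          using cl t_\<eta>[OF g z(1)] t_inv[OF g] by (simp add: T.m_assoc)
        finally show ?thesis .
      qed
      then have "casimir_map (carrier H) t (\<lambda>g. t (inv\<^bsub>H\<^esub> g)) (obj P n) (obj P n)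
          (\<lambda>x. \<eta> z \<odot>\<^bsub>obj P n\<^esub> \<rho> n (\<sigma> n x)) x = (\<Oplus>\<^bsub>obj P n\<^esub>g\<in>carrier H. \<eta> (act g z) \<odot>\<^bsub>obj P n\<^esub> x)"
        unfolding casimir_map_def
        using x tz by (intro Pn.finsum_cong') (auto intro!: Pn.lsmult_closed \<eta>_closed)
      also have "\<dots> = (\<Oplus>g\<in>carrier H. \<eta> (act g z)) \<odot>\<^bsub>obj P n\<^esub> x"
        using x tz by (intro Pn.lsmult_finsum_left[symmetric]) (auto intro: \<eta>_closed)
      also have "(\<Oplus>g\<in>carrier H. \<eta> (act g z)) = \<eta> (\<Oplus>\<^bsub>L\<^esub>g\<in>carrier H. act g z)"
        using tz \<eta>_closed ring_hom_add[OF \<eta>]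
        by (intro additive_map_finsum[OF L.abelian_group_axioms T.abelian_group_axioms, symmetric]) auto
      finally show "casimir_map (carrier H) t (\<lambda>g. t (inv\<^bsub>H\<^esub> g)) (obj P n) (obj P n)
          (\<lambda>x. \<eta> z \<odot>\<^bsub>obj P n\<^esub> \<rho> n (\<sigma> n x)) x = id_map n x"
        using z(3) ring_hom_one[OF \<eta>] x by (simp add: Pn.lsmult_one id_map_def)
    qed (simp add: id_map_def)
  qed
  from casimir_transfer[OF L \<eta> ring_hom_identity u v casimir_linear flT P flL l Y0 this]
  show ?thesis .
qed

text \<open>The coinduced module \<open>Hom\<^sub>L(T, M)\<close>, which is isomorphic to \<open>T \<otimes>\<^sub>L M\<close>.\<close>

definition coind :: "('a, 'm) module \<Rightarrow> ('b, 'b \<Rightarrow> 'm) module" where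
  "coind M = \<lparr>carrier = {F \<in> extensional (carrier T). (\<forall>s\<in>carrier T. F s \<in> carrier M) \<and>
       (\<forall>r\<in>carrier T. \<forall>s\<in>carrier T. F (r \<oplus> s) = F r \<oplus>\<^bsub>M\<^esub> F s) \<and>
       (\<forall>a\<in>carrier L. \<forall>s\<in>carrier T. F (\<eta> a \<otimes> s) = a \<odot>\<^bsub>M\<^esub> F s)},
     monoid.mult = undefined, one = undefined, ring.zero = (\<lambda>s\<in>carrier T. \<zero>\<^bsub>M\<^esub>),
     add = (\<lambda>F G. \<lambda>s\<in>carrier T. F s \<oplus>\<^bsub>M\<^esub> G s), smult = (\<lambda>r F. \<lambda>s\<in>carrier T. F (s \<otimes> r))\<rparr>"

lemma coindI:
  assumes "F \<in> extensional (carrier T)" "\<And>s. s \<in> carrier T \<Longrightarrow> F s \<in> carrier M"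
    "\<And>r s. r \<in> carrier T \<Longrightarrow> s \<in> carrier T \<Longrightarrow> F (r \<oplus> s) = F r \<oplus>\<^bsub>M\<^esub> F s"
    "\<And>a s. a \<in> carrier L \<Longrightarrow> s \<in> carrier T \<Longrightarrow> F (\<eta> a \<otimes> s) = a \<odot>\<^bsub>M\<^esub> F s"
  shows "F \<in> carrier (coind M)"
  using assms by (simp add: coind_def)

lemma coindD:
  assumes "F \<in> carrier (coind M)"
  shows "F \<in> extensional (carrier T)" "s \<in> carrier T \<Longrightarrow> F s \<in> carrier M"
    "r \<in> carrier T \<Longrightarrow> s \<in> carrier T \<Longrightarrow> F (r \<oplus> s) = F r \<oplus>\<^bsub>M\<^esub> F s"
    "a \<in> carrier L \<Longrightarrow> s \<in> carrier T \<Longrightarrow> F (\<eta> a \<otimes> s) = a \<odot>\<^bsub>M\<^esub> F s"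
  using assms by (auto simp: coind_def)

lemma coind_simps:
  "s \<in> carrier T \<Longrightarrow> (F \<oplus>\<^bsub>coind M\<^esub> G) s = F s \<oplus>\<^bsub>M\<^esub> G s"
  "s \<in> carrier T \<Longrightarrow> (r \<odot>\<^bsub>coind M\<^esub> F) s = F (s \<otimes> r)"
  "s \<in> carrier T \<Longrightarrow> \<zero>\<^bsub>coind M\<^esub> s = \<zero>\<^bsub>M\<^esub>"
  "F \<oplus>\<^bsub>coind M\<^esub> G \<in> extensional (carrier T)"
  "r \<odot>\<^bsub>coind M\<^esub> F \<in> extensional (carrier T)"
  "\<zero>\<^bsub>coind M\<^esub> \<in> extensional (carrier T)"
  by (simp_all add: coind_def)

lemma coind_ext:
  assumes "F \<in> extensional (carrier T)" "G \<in> extensional (carrier T)" "\<And>s. s \<in> carrier T \<Longrightarrow> F s = G s"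
  shows "F = G"
  using extensionalityI[OF assms] .

text \<open>Right multiplication of the argument by \<open>r\<close> becomes a left action on
  functions.\<close>

lemma left_module_coind:
  fixes M :: "('a, 'm) module"
  assumes M: "left_module L M"
  shows "left_module T (coind M)"
proof -
  interpret M: left_module L M by fact
  have add: "F \<oplus>\<^bsub>coind M\<^esub> G \<in> carrier (coind M)" if F: "F \<in> carrier (coind M)" and G: "G \<in> carrier (coind M)" for F G
    using coindD[OF F] coindD[OF G]
    by (intro coindI) (simp_all add: coind_simps M.M.a_ac M.lsmult_r_distr \<eta>_closed)
  have smult: "r \<odot>\<^bsub>coind M\<^esub> F \<in> carrier (coind M)" if F: "F \<in> carrier (coind M)" and r: "r \<in> carrier T" for F r
    using coindD[OF F] r
    by (intro coindI) (simp_all add: coind_simps T.l_distr T.m_assoc \<eta>_closed)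
  have zero: "\<zero>\<^bsub>coind M\<^esub> \<in> carrier (coind M)"
    by (intro coindI) (simp_all add: coind_simps M.lsmult_zero_right \<eta>_closed)
  have "abelian_group (coind M)"
  proof (rule abelian_groupI)
    fix F assume F: "F \<in> carrier (coind M)"
    show "\<zero>\<^bsub>coind M\<^esub> \<oplus>\<^bsub>coind M\<^esub> F = F"
      using coindD[OF F] by (intro coind_ext) (simp_all add: coind_simps)
    show "\<exists>G\<in>carrier (coind M). G \<oplus>\<^bsub>coind M\<^esub> F = \<zero>\<^bsub>coind M\<^esub>"
    proof
      show "(\<lambda>s\<in>carrier T. \<ominus>\<^bsub>M\<^esub> F s) \<in> carrier (coind M)"
        using coindD[OF F] by (intro coindI) (simp_all add: M.M.minus_add M.lsmult_minus_right \<eta>_closed)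
      show "(\<lambda>s\<in>carrier T. \<ominus>\<^bsub>M\<^esub> F s) \<oplus>\<^bsub>coind M\<^esub> F = \<zero>\<^bsub>coind M\<^esub>"
        using coindD[OF F] by (intro coind_ext) (simp_all add: coind_simps M.M.l_neg)
    qed
  next
    fix F G assume "F \<in> carrier (coind M)" "G \<in> carrier (coind M)"
    then show "F \<oplus>\<^bsub>coind M\<^esub> G = G \<oplus>\<^bsub>coind M\<^esub> F"
      by (intro coind_ext) (simp_all add: coind_simps coindD M.M.a_comm)
  next
    fix F G E assume "F \<in> carrier (coind M)" "G \<in> carrier (coind M)" "E \<in> carrier (coind M)"
    then show "F \<oplus>\<^bsub>coind M\<^esub> G \<oplus>\<^bsub>coind M\<^esub> E = F \<oplus>\<^bsub>coind M\<^esub> (G \<oplus>\<^bsub>coind M\<^esub> E)"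
      by (intro coind_ext) (simp_all add: coind_simps coindD M.M.a_assoc)
  qed (fact add zero)+
  then show ?thesis
  proof (intro left_module.intro left_module_axioms.intro T)
    fix r F assume r: "r \<in> carrier T" and F: "F \<in> carrier (coind M)"
    show "r \<odot>\<^bsub>coind M\<^esub> F \<in> carrier (coind M)" by (rule smult[OF F r])
    fix s assume s: "s \<in> carrier T"
    show "(r \<oplus> s) \<odot>\<^bsub>coind M\<^esub> F = r \<odot>\<^bsub>coind M\<^esub> F \<oplus>\<^bsub>coind M\<^esub> s \<odot>\<^bsub>coind M\<^esub> F"
      using coindD[OF F] r s by (intro coind_ext) (simp_all add: coind_simps T.r_distr)
    show "(r \<otimes> s) \<odot>\<^bsub>coind M\<^esub> F = r \<odot>\<^bsub>coind M\<^esub> (s \<odot>\<^bsub>coind M\<^esub> F)"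
      using coindD[OF F] r s by (intro coind_ext) (simp_all add: coind_simps T.m_assoc)
  next
    fix r F G assume r: "r \<in> carrier T" and F: "F \<in> carrier (coind M)" and G: "G \<in> carrier (coind M)"
    show "r \<odot>\<^bsub>coind M\<^esub> (F \<oplus>\<^bsub>coind M\<^esub> G) = r \<odot>\<^bsub>coind M\<^esub> F \<oplus>\<^bsub>coind M\<^esub> r \<odot>\<^bsub>coind M\<^esub> G"
      using r by (intro coind_ext) (simp_all add: coind_simps)
  next
    fix F assume F: "F \<in> carrier (coind M)"
    show "\<one> \<odot>\<^bsub>coind M\<^esub> F = F"
      using coindD[OF F] by (intro coind_ext) (simp_all add: coind_simps)
  qed
qed

text \<open>Elements of the coinduced module are \<open>L\<close>-linear in their argument, and the
  \<open>t g\<close> span \<open>T\<close> over \<open>L\<close>.\<close>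

lemma coind_eqI:
  fixes M :: "('a, 'm) module"
  assumes M: "left_module L M" and F: "F \<in> carrier (coind M)" and G: "G \<in> carrier (coind M)"
    and eq: "\<And>g. g \<in> carrier H \<Longrightarrow> F (t g) = G (t g)"
  shows "F = G"
proof -
  interpret M: left_module L M by fact
  have eval: "E s = (\<Oplus>\<^bsub>M\<^esub>g\<in>carrier H. c g s \<odot>\<^bsub>M\<^esub> E (t g))" if E: "E \<in> carrier (coind M)" and s: "s \<in> carrier T" for E s
  proof -
    have "E s = E (\<Oplus>g\<in>carrier H. \<eta> (c g s) \<otimes> t g)" using expand[OF s] by simp
    also have "\<dots> = (\<Oplus>\<^bsub>M\<^esub>g\<in>carrier H. E (\<eta> (c g s) \<otimes> t g))"
      using coindD[OF E] c_closed[OF _ s] t_closed \<eta>_closed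
      by (intro additive_map_finsum[OF T.abelian_group_axioms M.abelian_group_self]) auto
    also have "\<dots> = (\<Oplus>\<^bsub>M\<^esub>g\<in>carrier H. c g s \<odot>\<^bsub>M\<^esub> E (t g))"
      using coindD[OF E] c_closed[OF _ s] t_closed by (intro M.M.finsum_cong') (auto intro!: M.lsmult_closed)
    finally show ?thesis .
  qed
  show ?thesis
  proof (rule coind_ext[OF coindD(1)[OF F] coindD(1)[OF G]])
    fix s assume s: "s \<in> carrier T"
    show "F s = G s"
      unfolding eval[OF F s] eval[OF G s]
      using eq coindD(2)[OF G] c_closed[OF _ s] t_closed by (intro M.M.finsum_cong') (auto intro!: M.lsmult_closed)
  qed
qed

text \<open>A tensor \<open>s \<otimes> x\<close> corresponds to the function sending
  \<open>r\<close> to \<open>c 1 (r s) x\<close>. Thus \<open>e j\<close> is the image of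
  \<open>1 \<otimes> b j\<close>, and \<open>F\<close> comes from the sum of the tensors of
  \<open>t (inv g)\<close> with \<open>F (t g)\<close>. Expanding each \<open>F (t g)\<close> in the
  dual basis of \<open>M\<close> leads to the coordinates \<open>\<Phi> j\<close>.\<close>

lemma coind_fg_projective:
  fixes M :: "('a, 'm) module"
  assumes "fg_projective L M"
  shows "fg_projective T (coind M)"
proof -
  obtain n b f where b: "dual_basis L M {..<n::nat} b f" and M: "left_module L M"
    using assms by (auto simp: fg_projective_def)
  interpret M: left_module L M by fact
  have cM: "left_module T (coind M)" by (rule left_module_coind[OF M])
  interpret cM: left_module T "coind M" by (rule cM)
  have bc: "b j \<in> carrier M" if "j < n" for j using dual_basis_closed(1)[OF b] that by simp
  have fc: "f j x \<in> carrier L" if "j < n" "x \<in> carrier M" for j x using dual_basis_closed(2)[OF b] that by simp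
  have fh: "f j \<in> mod_hom L M (mult_bimodule L)" if "j < n" for j using dual_basis_closed(3)[OF b] that by simp
  have fadd: "f j (x \<oplus>\<^bsub>M\<^esub> y) = f j x \<oplus>\<^bsub>L\<^esub> f j y" if "j < n" "x \<in> carrier M" "y \<in> carrier M" for j x y
    using mod_hom_add[OF fh[OF that(1)] that(2,3)] by simp
  have fsm: "f j (a \<odot>\<^bsub>M\<^esub> x) = a \<otimes>\<^bsub>L\<^esub> f j x" if "j < n" "a \<in> carrier L" "x \<in> carrier M" for j a x
    using mod_hom_smult[OF fh[OF that(1)] that(2,3)] by simp
  define e where "e = (\<lambda>j. \<lambda>s\<in>carrier T. c \<one>\<^bsub>H\<^esub> s \<odot>\<^bsub>M\<^esub> b j)"
  have e: "e j \<in> carrier (coind M)" if j: "j < n" for j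
    using bc[OF j] c_closed[OF H.one_closed] \<eta>_closed
    by (intro coindI) (simp_all add: e_def M.lsmult_closed c_add c_mult M.lsmult_l_distr M.lsmult_assoc)
  define \<Phi> where "\<Phi> = (\<lambda>j F. \<Oplus>g\<in>carrier H. t (inv\<^bsub>H\<^esub> g) \<otimes> \<eta> (f j (F (t g))))"
  have \<eta>f: "\<eta> (f j (F (t g))) \<in> carrier T" if "j < n" "F \<in> carrier (coind M)" "g \<in> carrier H" for j F g
    using that by (intro \<eta>_closed fc coindD(2) t_closed)
  have summand: "t (inv\<^bsub>H\<^esub> g) \<otimes> \<eta> (f j (F (t g))) \<in> carrier T" if "j < n" "F \<in> carrier (coind M)" "g \<in> carrier H" for j F g
    using \<eta>f[OF that] t_closed that(3) by simp
  have \<Phi>c: "\<Phi> j F \<in> carrier T" if "j < n" "F \<in> carrier (coind M)" for j F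
    unfolding \<Phi>_def using summand[OF that] by (intro T.finsum_closed) auto
  have \<Phi>: "\<Phi> j \<in> mod_hom T (coind M) (mult_bimodule T)" if j: "j < n" for j
  proof (rule linearI[OF cM left_module_regular[OF T]])
    fix F assume F: "F \<in> carrier (coind M)"
    show "\<Phi> j F \<in> carrier (mult_bimodule T)" using \<Phi>c[OF j F] by simp
    show "\<Phi> j (F \<oplus>\<^bsub>coind M\<^esub> G) = \<Phi> j F \<oplus>\<^bsub>mult_bimodule T\<^esub> \<Phi> j G" if G: "G \<in> carrier (coind M)" for G
    proof -
      have "\<Phi> j (F \<oplus>\<^bsub>coind M\<^esub> G) = (\<Oplus>g\<in>carrier H.
          t (inv\<^bsub>H\<^esub> g) \<otimes> \<eta> (f j (F (t g))) \<oplus> t (inv\<^bsub>H\<^esub> g) \<otimes> \<eta> (f j (G (t g))))"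
        unfolding \<Phi>_def
        using summand[OF j F] summand[OF j G] \<eta>f[OF j F] \<eta>f[OF j G] t_closed coindD(2)[OF F] coindD(2)[OF G] fc[OF j]
        by (intro T.finsum_cong') (auto simp: coind_simps fadd[OF j] ring_hom_add[OF \<eta>] T.r_distr)
      then show ?thesis
        unfolding \<Phi>_def using summand[OF j F] summand[OF j G] by (simp add: T.finsum_addf Pi_iff)
    qed
    show "\<Phi> j (\<eta> a \<odot>\<^bsub>coind M\<^esub> F) = \<eta> a \<odot>\<^bsub>mult_bimodule T\<^esub> \<Phi> j F" if a: "a \<in> carrier L" for a
    proof -
      have "t (inv\<^bsub>H\<^esub> g) \<otimes> \<eta> (f j ((\<eta> a \<odot>\<^bsub>coind M\<^esub> F) (t g))) = \<eta> a \<otimes> (t (inv\<^bsub>H\<^esub> g) \<otimes> \<eta> (f j (F (t g))))"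
        if g: "g \<in> carrier H" for g
      proof -
        have ga: "act g a \<in> carrier L" by (rule act_closed[OF g a])
        have inv: "act (inv\<^bsub>H\<^esub> g) (act g a) = a" using act_inv[OF H.inv_closed[OF g] a] g by simp
        have Fg: "F (t g) \<in> carrier M" by (rule coindD(2)[OF F t_closed[OF g]])
        have "(\<eta> a \<odot>\<^bsub>coind M\<^esub> F) (t g) = act g a \<odot>\<^bsub>M\<^esub> F (t g)"
          using t_\<eta>[OF g a] coindD(4)[OF F ga t_closed[OF g]] t_closed[OF g] by (simp add: coind_simps)
        then have "t (inv\<^bsub>H\<^esub> g) \<otimes> \<eta> (f j ((\<eta> a \<odot>\<^bsub>coind M\<^esub> F) (t g))) =
            (t (inv\<^bsub>H\<^esub> g) \<otimes> \<eta> (act g a)) \<otimes> \<eta> (f j (F (t g)))"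
          using fsm[OF j ga Fg] ring_hom_mult[OF \<eta> ga fc[OF j Fg]] \<eta>_closed[OF ga] \<eta>f[OF j F g]
            t_closed[OF H.inv_closed[OF g]] by (simp add: T.m_assoc)
        also have "t (inv\<^bsub>H\<^esub> g) \<otimes> \<eta> (act g a) = \<eta> a \<otimes> t (inv\<^bsub>H\<^esub> g)"
          using t_\<eta>[OF H.inv_closed[OF g] ga] inv by simp
        finally show ?thesis
          using \<eta>_closed[OF a] \<eta>f[OF j F g] t_closed[OF H.inv_closed[OF g]] by (simp add: T.m_assoc)
      qed
      then have "\<Phi> j (\<eta> a \<odot>\<^bsub>coind M\<^esub> F) = (\<Oplus>g\<in>carrier H. \<eta> a \<otimes> (t (inv\<^bsub>H\<^esub> g) \<otimes> \<eta> (f j (F (t g)))))"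
        unfolding \<Phi>_def using summand[OF j F] \<eta>_closed[OF a] by (intro T.finsum_cong') auto
      then show ?thesis
        unfolding \<Phi>_def using summand[OF j F] \<eta>_closed[OF a] fin by (simp add: T.finsum_rdistr Pi_iff)
    qed
    show "\<Phi> j (t h \<odot>\<^bsub>coind M\<^esub> F) = t h \<odot>\<^bsub>mult_bimodule T\<^esub> \<Phi> j F" if h: "h \<in> carrier H" for h
    proof -
      have surj: "(\<lambda>g. g \<otimes>\<^bsub>H\<^esub> h) ` carrier H = carrier H"
      proof (intro equalityI subsetI)
        fix x assume x: "x \<in> carrier H"
        then have "x = (x \<otimes>\<^bsub>H\<^esub> inv\<^bsub>H\<^esub> h) \<otimes>\<^bsub>H\<^esub> h" using h by (simp add: H.m_assoc)
        then show "x \<in> (\<lambda>g. g \<otimes>\<^bsub>H\<^esub> h) ` carrier H" using x h by blast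
      qed (use h in auto)
      have inj: "inj_on (\<lambda>g. g \<otimes>\<^bsub>H\<^esub> h) (carrier H)" using h by (auto simp: inj_on_def)
      have "t h \<otimes> \<Phi> j F = (\<Oplus>g\<in>carrier H. t h \<otimes> (t (inv\<^bsub>H\<^esub> g) \<otimes> \<eta> (f j (F (t g)))))"
        unfolding \<Phi>_def using summand[OF j F] t_closed[OF h] fin by (intro T.finsum_rdistr) auto
      \<comment> \<open>Replacing \<open>g\<close> by \<open>g h\<close> absorbs the factor
        \<open>t h\<close> on the left, since \<open>h inv (g h) = inv g\<close>, and shifts the
        argument of \<open>F\<close> by \<open>h\<close>, which is the action of
        \<open>t h\<close>.\<close>
      also have "\<dots> = (\<Oplus>g\<in>(\<lambda>g. g \<otimes>\<^bsub>H\<^esub> h) ` carrier H. t h \<otimes> (t (inv\<^bsub>H\<^esub> g) \<otimes> \<eta> (f j (F (t g)))))"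
        unfolding surj ..
      also have "\<dots> = (\<Oplus>g\<in>carrier H. t h \<otimes> (t (inv\<^bsub>H\<^esub> (g \<otimes>\<^bsub>H\<^esub> h)) \<otimes> \<eta> (f j (F (t (g \<otimes>\<^bsub>H\<^esub> h))))))"
        using summand[OF j F] t_closed[OF h] h by (intro T.finsum_reindex inj) auto
      also have "\<dots> = \<Phi> j (t h \<odot>\<^bsub>coind M\<^esub> F)"
        unfolding \<Phi>_def
      proof (intro T.finsum_cong' refl)
        fix g assume g: "g \<in> carrier H"
        have gh: "g \<otimes>\<^bsub>H\<^esub> h \<in> carrier H" using g h by simp
        have "t h \<otimes> t (inv\<^bsub>H\<^esub> (g \<otimes>\<^bsub>H\<^esub> h)) = t (h \<otimes>\<^bsub>H\<^esub> inv\<^bsub>H\<^esub> (g \<otimes>\<^bsub>H\<^esub> h))"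
          using gh h by (simp add: t_mult)
        also have "h \<otimes>\<^bsub>H\<^esub> inv\<^bsub>H\<^esub> (g \<otimes>\<^bsub>H\<^esub> h) = inv\<^bsub>H\<^esub> g"
          using g h by (simp add: H.inv_mult_group H.m_assoc[symmetric])
        finally have "t h \<otimes> t (inv\<^bsub>H\<^esub> (g \<otimes>\<^bsub>H\<^esub> h)) = t (inv\<^bsub>H\<^esub> g)" .
        moreover have "(t h \<odot>\<^bsub>coind M\<^esub> F) (t g) = F (t (g \<otimes>\<^bsub>H\<^esub> h))"
          using g h by (simp add: coind_simps t_closed t_mult)
        ultimately show "t h \<otimes> (t (inv\<^bsub>H\<^esub> (g \<otimes>\<^bsub>H\<^esub> h)) \<otimes> \<eta> (f j (F (t (g \<otimes>\<^bsub>H\<^esub> h))))) =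
            t (inv\<^bsub>H\<^esub> g) \<otimes> \<eta> (f j ((t h \<odot>\<^bsub>coind M\<^esub> F) (t g)))"
          using \<eta>f[OF j F gh] t_closed[OF h] t_closed[OF H.inv_closed[OF gh]] by (simp add: T.m_assoc[symmetric])
      qed (use summand[OF j cM.lsmult_closed[OF t_closed[OF h] F]] in auto)
      finally show ?thesis by simp
    qed
  qed
  have "dual_basis T (coind M) {..<n} e \<Phi>"
    unfolding dual_basis_def
  proof (intro conjI ballI)
    fix F assume F: "F \<in> carrier (coind M)"
    have \<Phi>e: "\<Phi> j F \<odot>\<^bsub>coind M\<^esub> e j \<in> carrier (coind M)" if "j < n" for j
      using cM.lsmult_closed[OF \<Phi>c[OF that F] e[OF that]] .
    show "F = (\<Oplus>\<^bsub>coind M\<^esub>j\<in>{..<n}. \<Phi> j F \<odot>\<^bsub>coind M\<^esub> e j)"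
    proof (rule coind_eqI[OF M F])
      show "(\<Oplus>\<^bsub>coind M\<^esub>j\<in>{..<n}. \<Phi> j F \<odot>\<^bsub>coind M\<^esub> e j) \<in> carrier (coind M)"
        using \<Phi>e by (intro cM.M.finsum_closed) auto
      fix k assume k: "k \<in> carrier H"
      have Fk: "F (t k) \<in> carrier M" by (rule coindD(2)[OF F t_closed[OF k]])
      \<comment> \<open>The coefficient at the identity of \<open>t k t (inv g)\<close> is 1 for
        \<open>g = k\<close> and 0 otherwise, so only one term of \<open>\<Phi> j F\<close>
        survives.\<close>
      have coord: "c \<one>\<^bsub>H\<^esub> (t k \<otimes> \<Phi> j F) = f j (F (t k))" if j: "j < n" for j
      proof -
        have s2: "t k \<otimes> (t (inv\<^bsub>H\<^esub> g) \<otimes> \<eta> (f j (F (t g)))) \<in> carrier T" if "g \<in> carrier H" for g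
          using summand[OF j F that] t_closed[OF k] by simp
        have fF: "f j (F (t g)) \<in> carrier L" if "g \<in> carrier H" for g
          by (rule fc[OF j coindD(2)[OF F t_closed[OF that]]])
        have "t k \<otimes> \<Phi> j F = (\<Oplus>g\<in>carrier H. t k \<otimes> (t (inv\<^bsub>H\<^esub> g) \<otimes> \<eta> (f j (F (t g)))))"
          unfolding \<Phi>_def using summand[OF j F] t_closed[OF k] fin by (intro T.finsum_rdistr) auto
        then have "c \<one>\<^bsub>H\<^esub> (t k \<otimes> \<Phi> j F) =
            c \<one>\<^bsub>H\<^esub> (\<Oplus>g\<in>carrier H. t k \<otimes> (t (inv\<^bsub>H\<^esub> g) \<otimes> \<eta> (f j (F (t g)))))" by simp
        also have "\<dots> = (\<Oplus>\<^bsub>L\<^esub>g\<in>carrier H. c \<one>\<^bsub>H\<^esub> (t k \<otimes> (t (inv\<^bsub>H\<^esub> g) \<otimes> \<eta> (f j (F (t g))))))"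
          using s2 c_closed c_add
          by (intro additive_map_finsum[OF T.abelian_group_axioms L.abelian_group_axioms]) auto
        also have "\<dots> = (\<Oplus>\<^bsub>L\<^esub>g\<in>carrier H. if g = k then f j (F (t g)) else \<zero>\<^bsub>L\<^esub>)"
        proof (intro L.finsum_cong' refl)
          fix g assume g: "g \<in> carrier H"
          have kg: "k \<otimes>\<^bsub>H\<^esub> inv\<^bsub>H\<^esub> g \<in> carrier H" using g k by simp
          have "t k \<otimes> (t (inv\<^bsub>H\<^esub> g) \<otimes> \<eta> (f j (F (t g)))) = t (k \<otimes>\<^bsub>H\<^esub> inv\<^bsub>H\<^esub> g) \<otimes> \<eta> (f j (F (t g)))"
            using g k \<eta>f[OF j F g] by (simp add: t_mult t_closed T.m_assoc)
          then have "c \<one>\<^bsub>H\<^esub> (t k \<otimes> (t (inv\<^bsub>H\<^esub> g) \<otimes> \<eta> (f j (F (t g))))) =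
              c \<one>\<^bsub>H\<^esub> (t (k \<otimes>\<^bsub>H\<^esub> inv\<^bsub>H\<^esub> g)) \<otimes>\<^bsub>L\<^esub> f j (F (t g))"
            using c_one_mult[OF fF[OF g] t_closed[OF kg]] by simp
          moreover have "\<one>\<^bsub>H\<^esub> = k \<otimes>\<^bsub>H\<^esub> inv\<^bsub>H\<^esub> g \<longleftrightarrow> g = k"
            using g k H.inv_equality[of k "inv\<^bsub>H\<^esub> g"] by auto
          ultimately show "c \<one>\<^bsub>H\<^esub> (t k \<otimes> (t (inv\<^bsub>H\<^esub> g) \<otimes> \<eta> (f j (F (t g))))) =
              (if g = k then f j (F (t g)) else \<zero>\<^bsub>L\<^esub>)"
            using c_t[OF H.one_closed kg] fF[OF g] fF[OF k] by simp
        qed (use fF in auto)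
        also have "\<dots> = f j (F (t k))"
          using fin k fF by (subst L.finsum_single[of _ k]) auto
        finally show ?thesis .
      qed
      have "(\<Oplus>\<^bsub>coind M\<^esub>j\<in>{..<n}. \<Phi> j F \<odot>\<^bsub>coind M\<^esub> e j) (t k) = (\<Oplus>\<^bsub>M\<^esub>j\<in>{..<n}. (\<Phi> j F \<odot>\<^bsub>coind M\<^esub> e j) (t k))"
        using \<Phi>e coindD(2) t_closed[OF k]
        by (intro additive_map_finsum[OF cM.abelian_group_self M.abelian_group_self, where f="\<lambda>F. F (t k)"])
          (auto simp: coind_simps)
      also have "\<dots> = (\<Oplus>\<^bsub>M\<^esub>j\<in>{..<n}. f j (F (t k)) \<odot>\<^bsub>M\<^esub> b j)"
        using \<Phi>c[OF _ F] t_closed[OF k] fc[OF _ Fk] bc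
        by (intro M.M.finsum_cong') (auto simp: coind_simps e_def coord intro!: M.lsmult_closed)
      also have "\<dots> = F (t k)" using dual_basis_expand[OF b Fk] by simp
      finally show "F (t k) = (\<Oplus>\<^bsub>coind M\<^esub>j\<in>{..<n}. \<Phi> j F \<odot>\<^bsub>coind M\<^esub> e j) (t k)" by simp
    qed
  qed (use e \<Phi> in auto)
  then show ?thesis by (rule fg_projectiveI[OF cM])
qed

text \<open>The pointwise differential is cut off outside \<open>carrier T\<close>, since elements
  of coinduced modules are compared as extensional functions.\<close>

definition coind_complex :: "('a, 'm) cochain_complex \<Rightarrow> ('b, 'b \<Rightarrow> 'm) cochain_complex" where
  "coind_complex P = \<lparr>obj = (\<lambda>n. coind (obj P n)), dif = (\<lambda>n F. \<lambda>s\<in>carrier T. dif P n (F s))\<rparr>"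

lemma coind_complex_simps [simp]:
  "obj (coind_complex P) n = coind (obj P n)" "dif (coind_complex P) n F = (\<lambda>s\<in>carrier T. dif P n (F s))"
  by (simp_all add: coind_complex_def)

lemma proj_cochain_coind:
  assumes "proj_cochain L P"
  shows "proj_cochain T (coind_complex P)"
proof -
  have cP: "cochain L P" and fg: "\<And>n. fg_projective L (obj P n)" and "\<exists>r s. zero_outside P r s"
    using assms by (auto simp: proj_cochain_def)
  have dd: "dif (coind_complex P) n \<in> mod_hom T (coind (obj P n)) (coind (obj P (n + 1)))" for n
  proof -
    note d = cochainD(2)[OF cP, of n]
    have dc: "(\<lambda>s\<in>carrier T. dif P n (F s)) \<in> carrier (coind (obj P (n + 1)))" if F: "F \<in> carrier (coind (obj P n))" for F
      using coindD[OF F] mod_hom_closed[OF d] mod_hom_add[OF d] mod_hom_smult[OF d] \<eta>_closed by (intro coindI) auto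
    show ?thesis
    proof (rule mod_homI, unfold coind_complex_simps)
      fix F assume F: "F \<in> carrier (coind (obj P n))"
      show "(\<lambda>s\<in>carrier T. dif P n (F s)) \<in> carrier (coind (obj P (n + 1)))" by (rule dc[OF F])
      show "(\<lambda>s\<in>carrier T. dif P n ((F \<oplus>\<^bsub>coind (obj P n)\<^esub> G) s)) =
          (\<lambda>s\<in>carrier T. dif P n (F s)) \<oplus>\<^bsub>coind (obj P (n + 1))\<^esub> (\<lambda>s\<in>carrier T. dif P n (G s))"
        if G: "G \<in> carrier (coind (obj P n))" for G
        using mod_hom_add[OF d] coindD(2)[OF F] coindD(2)[OF G] by (intro coind_ext) (simp_all add: coind_simps)
      show "(\<lambda>s\<in>carrier T. dif P n ((r \<odot>\<^bsub>coind (obj P n)\<^esub> F) s)) =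
          r \<odot>\<^bsub>coind (obj P (n + 1))\<^esub> (\<lambda>s\<in>carrier T. dif P n (F s))" if "r \<in> carrier T" for r
        using that by (intro coind_ext) (simp_all add: coind_simps)
    qed
  qed
  have d0: "dif (coind_complex P) (n + 1) (dif (coind_complex P) n F) = \<zero>\<^bsub>coind (obj P (n + 2))\<^esub>"
    if F: "F \<in> carrier (coind (obj P n))" for n F
    using cochainD(6)[OF cP coindD(2)[OF F]] by (intro coind_ext) (simp_all add: coind_simps)
  have "cochain T (coind_complex P)"
    using dd d0 left_module_coind[OF cochainD(1)[OF cP]] by (simp add: cochain_def)
  moreover have "zero_outside (coind_complex P) r s" if z: "zero_outside P r s" for r s
    unfolding zero_outside_def coind_complex_simps
  proof (intro allI impI)
    fix n assume n: "n < r \<or> n > s"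
    interpret left_module T "coind (obj P n)" by (rule left_module_coind[OF cochainD(1)[OF cP]])
    have P0: "carrier (obj P n) = {\<zero>\<^bsub>obj P n\<^esub>}" using z n unfolding zero_outside_def by blast
    have "F = \<zero>\<^bsub>coind (obj P n)\<^esub>" if F: "F \<in> carrier (coind (obj P n))" for F
      using coindD(1,2)[OF F] P0 by (intro coind_ext) (auto simp: coind_simps)
    then show "carrier (coind (obj P n)) = {\<zero>\<^bsub>coind (obj P n)\<^esub>}" by auto
  qed
  ultimately show ?thesis
    using \<open>\<exists>r s. zero_outside P r s\<close> coind_fg_projective[OF fg] by (auto simp: proj_cochain_def)
qed

text \<open>Each module is a retract of the restriction of its coinduced module: \<open>x\<close> is
  sent to the function \<open>s \<mapsto> c 1 s x\<close>, and evaluation at the unit leads back.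
  Both maps are \<open>L\<close>-linear, so no averaging is called for; the transfer lemma is
  applied with a one-point index set and unit scalars, for which the average of a map is the map
  itself.\<close>

theorem base_to_extension:
  fixes P :: "('a, 'm) cochain_complex"
  assumes fd: "fd_over K L \<kappa> J r" and P: "Kb_indecomposable L P" and l: "Kb_length L P l"
  shows "\<exists>(Y :: ('b, nat \<Rightarrow> 'b) cochain_complex) l'. Kb_indecomposable T Y \<and> Kb_length T Y l' \<and> l \<le> l'"
proof -
  have flL: "fg_projectives_finite_length L TYPE('m)" by (rule fg_projectives_finite_length_fd_over[OF fd])
  have flT: "fg_projectives_finite_length T TYPE(nat \<Rightarrow> 'b)" by (rule fg_projectives_finite_length_fd_over[OF fd_over_extension[OF fd]])
  have oP: "Kb_object L P" using P by (simp add: Kb_indecomposable_def)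
  have cP: "cochain L P" using oP by (rule Kb_object_cochain)
  have pP: "proj_cochain T (coind_complex P)"
    using oP proj_cochain_coind by (simp add: Kb_object_iff)
  obtain Y0 :: "('b, nat \<Rightarrow> 'b) cochain_complex" and \<sigma> \<rho> where Y0: "Kb_object T Y0"
    and \<sigma>: "\<sigma> \<in> chain_hom T (coind_complex P) Y0" and \<rho>: "\<rho> \<in> chain_hom T Y0 (coind_complex P)"
    and \<rho>\<sigma>: "\<forall>n. \<forall>x\<in>carrier (obj (coind_complex P) n). \<rho> n (\<sigma> n x) = x"
    using proj_cochain_encode[OF pP] by (elim exE conjE)
  \<comment> \<open>Linearity of this map over \<open>L\<close> rests on the right linearity of the
    coordinate at the identity, \<open>c_one_mult\<close>.\<close>
  define a where "a = (\<lambda>(n::int) x. \<lambda>s\<in>carrier T. c \<one>\<^bsub>H\<^esub> s \<odot>\<^bsub>obj P n\<^esub> x)"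
  have ac: "a n x \<in> carrier (coind (obj P n))" if x: "x \<in> carrier (obj P n)" for n x
  proof -
    interpret Pn: left_module L "obj P n" by (rule cochainD(1)[OF cP])
    show ?thesis
      using x c_closed[OF H.one_closed] \<eta>_closed
      by (intro coindI) (simp_all add: a_def Pn.lsmult_closed c_add c_mult Pn.lsmult_l_distr Pn.lsmult_assoc)
  qed
  have a: "a \<in> chain_hom L (restrict_complex (\<lambda>x. x) P) (restrict_complex \<eta> (coind_complex P))"
  proof (intro chain_homI mod_homI)
    fix n x assume "x \<in> carrier (obj (restrict_complex (\<lambda>x. x) P) n)"
    then have x: "x \<in> carrier (obj P n)" by simp
    interpret Pn: left_module L "obj P n" by (rule cochainD(1)[OF cP])
    show "a n x \<in> carrier (obj (restrict_complex \<eta> (coind_complex P)) n)" using ac[OF x] by simp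
    show "a (n + 1) (dif (restrict_complex (\<lambda>x. x) P) n x) = dif (restrict_complex \<eta> (coind_complex P)) n (a n x)"
      using mod_hom_smult[OF cochainD(2)[OF cP] c_closed[OF H.one_closed] x] by (auto simp: a_def)
    show "a n (x \<oplus>\<^bsub>obj (restrict_complex (\<lambda>x. x) P) n\<^esub> y) =
        a n x \<oplus>\<^bsub>obj (restrict_complex \<eta> (coind_complex P)) n\<^esub> a n y"
      if "y \<in> carrier (obj (restrict_complex (\<lambda>x. x) P) n)" for y
      using that x c_closed[OF H.one_closed]
      by (simp, intro coind_ext) (simp_all add: a_def coind_simps Pn.lsmult_r_distr)
    show "a n (l \<odot>\<^bsub>obj (restrict_complex (\<lambda>x. x) P) n\<^esub> x) =
        l \<odot>\<^bsub>obj (restrict_complex \<eta> (coind_complex P)) n\<^esub> a n x" if "l \<in> carrier L" for l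
      using that x c_closed[OF H.one_closed] \<eta>_closed
      by (simp, intro coind_ext) (simp_all add: a_def coind_simps c_one_mult Pn.lsmult_assoc)
  qed
  have b: "(\<lambda>n F. F \<one>) \<in> chain_hom L (restrict_complex \<eta> (coind_complex P)) (restrict_complex (\<lambda>x. x) P)"
  proof (intro chain_homI mod_homI)
    fix n F assume "F \<in> carrier (obj (restrict_complex \<eta> (coind_complex P)) n)"
    then have F: "F \<in> carrier (coind (obj P n))" by simp
    show "F \<one> \<in> carrier (obj (restrict_complex (\<lambda>x. x) P) n)" using coindD(2)[OF F T.one_closed] by simp
    show "(dif (restrict_complex \<eta> (coind_complex P)) n F) \<one> = dif (restrict_complex (\<lambda>x. x) P) n (F \<one>)" by simp
    show "(F \<oplus>\<^bsub>obj (restrict_complex \<eta> (coind_complex P)) n\<^esub> G) \<one> =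
        F \<one> \<oplus>\<^bsub>obj (restrict_complex (\<lambda>x. x) P) n\<^esub> G \<one>" for G by (simp add: coind_simps)
    show "(l \<odot>\<^bsub>obj (restrict_complex \<eta> (coind_complex P)) n\<^esub> F) \<one> =
        l \<odot>\<^bsub>obj (restrict_complex (\<lambda>x. x) P) n\<^esub> F \<one>" if l: "l \<in> carrier L" for l
      using coindD(4)[OF F l T.one_closed] \<eta>_closed[OF l] by (simp add: coind_simps)
  qed
  have cas: "casimir_map {()} (\<lambda>_. \<one>\<^bsub>L\<^esub>) (\<lambda>_. \<one>\<^bsub>L\<^esub>) M N f x = f x"
    if M: "left_module L M" and N: "left_module L N" and x: "x \<in> carrier M" and fx: "f x \<in> carrier N"
    for M N :: "('a, 'm) module" and f x
  proof -
    interpret N: left_module L N by fact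
    show ?thesis
      using fx left_module.lsmult_one[OF M x] by (simp add: casimir_map_def N.lsmult_one)
  qed
  have casimir: "casimir_map {()} (\<lambda>_. \<one>\<^bsub>L\<^esub>) (\<lambda>_. \<one>\<^bsub>L\<^esub>) M N f \<in> mod_hom L M N"
    if M: "left_module L M" and N: "left_module L N"
      and f: "f \<in> mod_hom L (restrict_scalars (\<lambda>x. x) M) (restrict_scalars (\<lambda>x. x) N)" for M N :: "('a, 'm) module" and f
  proof -
    have f': "f \<in> mod_hom L M N" using f by (simp add: mod_hom_def)
    interpret M: left_module L M by fact
    interpret N: left_module L N by fact
    show ?thesis
      using mod_hom_closed[OF f'] mod_hom_add[OF f'] mod_hom_smult[OF f']
      by (intro mod_homI) (simp_all add: cas[OF M N] M.lsmult_closed N.lsmult_closed)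
  qed
  have retract: "casimir_retract L L (\<lambda>x. x) \<eta> {()} (\<lambda>_. \<one>\<^bsub>L\<^esub>) (\<lambda>_. \<one>\<^bsub>L\<^esub>) P Y0"
    unfolding casimir_retract_def
  proof (intro bexI)
    show "(\<lambda>n x. \<sigma> n (a n x)) \<in> chain_hom L (restrict_complex (\<lambda>x. x) P) (restrict_complex \<eta> Y0)"
      by (rule chain_hom_comp[OF a chain_hom_restrict_complex[OF \<eta> \<sigma>]])
    show "(\<lambda>n y. \<rho> n y \<one>) \<in> chain_hom L (restrict_complex \<eta> Y0) (restrict_complex (\<lambda>x. x) P)"
      by (rule chain_hom_comp[OF chain_hom_restrict_complex[OF \<eta> \<rho>] b])
    show "homotopic L P P (\<lambda>n. casimir_map {()} (\<lambda>_. \<one>\<^bsub>L\<^esub>) (\<lambda>_. \<one>\<^bsub>L\<^esub>) (obj P n) (obj P n)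
        (\<lambda>x. \<rho> n (\<sigma> n (a n x)) \<one>)) id_map"
    proof (rule homotopic_refl[OF cP])
      fix n x assume x: "x \<in> carrier (obj P n)"
      note lm = cochainD(1)[OF cP, of n]
      have "c \<one>\<^bsub>H\<^esub> \<one> = \<one>\<^bsub>L\<^esub>" using c_t[OF H.one_closed H.one_closed] t_one by simp
      then have "\<rho> n (\<sigma> n (a n x)) \<one> = x"
        using \<rho>\<sigma>[rule_format, of "a n x" n] ac[OF x] left_module.lsmult_one[OF lm x] by (simp add: a_def)
      then show "casimir_map {()} (\<lambda>_. \<one>\<^bsub>L\<^esub>) (\<lambda>_. \<one>\<^bsub>L\<^esub>) (obj P n) (obj P n)
          (\<lambda>x. \<rho> n (\<sigma> n (a n x)) \<one>) x = id_map n x"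
        using x by (subst cas[OF lm lm x]) (simp_all add: id_map_def)
    qed (simp add: id_map_def)
  qed
  have one: "(\<lambda>_. \<one>\<^bsub>L\<^esub>) \<in> {()} \<rightarrow> carrier L" by simp
  from casimir_transfer[OF L ring_hom_identity \<eta> one one casimir flL P flT l Y0 retract]
  show ?thesis .
qed

theorem strong_global_dimension_extension:
  assumes fd: "fd_over K L \<kappa> J r"
    and z: "z \<in> carrier L" "\<And>x. x \<in> carrier L \<Longrightarrow> z \<otimes>\<^bsub>L\<^esub> x = x \<otimes>\<^bsub>L\<^esub> z"
      "(\<Oplus>\<^bsub>L\<^esub>g\<in>carrier H. act g z) = \<one>\<^bsub>L\<^esub>"
  shows "strong_global_dimension L = strong_global_dimension T"
proof (rule antisym)
  show "strong_global_dimension L \<le> strong_global_dimension T"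
    unfolding strong_global_dimension_def
  proof (rule Sup_mono, elim CollectE exE conjE)
    fix e l and P :: "('a, nat \<Rightarrow> 'a) cochain_complex"
    assume "e = enat l" "Kb_indecomposable L P" "Kb_length L P l"
    then show "\<exists>e'\<in>{enat l |l. \<exists>P :: ('b, nat \<Rightarrow> 'b) cochain_complex. Kb_indecomposable T P \<and> Kb_length T P l}. e \<le> e'"
      using base_to_extension[OF fd, of P l] by (force simp: enat_ord_simps(1))
  qed
  show "strong_global_dimension T \<le> strong_global_dimension L"
    unfolding strong_global_dimension_def
  proof (rule Sup_mono, elim CollectE exE conjE)
    fix e l and P :: "('b, nat \<Rightarrow> 'b) cochain_complex"
    assume "e = enat l" "Kb_indecomposable T P" "Kb_length T P l"
    then show "\<exists>e'\<in>{enat l |l. \<exists>P :: ('a, nat \<Rightarrow> 'a) cochain_complex. Kb_indecomposable L P \<and> Kb_length L P l}. e \<le> e'"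
      using extension_to_base[OF fd z, of P l] by (force simp: enat_ord_simps(1))
  qed
qed

end

section \<open>Finite group actions on rings\<close>

locale ring_action =
  fixes A :: "('k, 'a) module" (structure) and H :: "('g, 'z) monoid_scheme" and \<phi> :: "'g \<Rightarrow> 'a \<Rightarrow> 'a"
  assumes A: "ring A" and H: "group H" and fin: "finite (carrier H)"
    and \<phi>_hom: "g \<in> carrier H \<Longrightarrow> \<phi> g \<in> ring_hom A A"
    and \<phi>_one: "x \<in> carrier A \<Longrightarrow> \<phi> \<one>\<^bsub>H\<^esub> x = x"
    and \<phi>_comp: "\<lbrakk>g \<in> carrier H; h \<in> carrier H; x \<in> carrier A\<rbrakk> \<Longrightarrow> \<phi> (g \<otimes>\<^bsub>H\<^esub> h) x = \<phi> g (\<phi> h x)"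
begin

sublocale A: ring A by (rule A)
sublocale H: group H by (rule H)

lemma \<phi>_closed: "g \<in> carrier H \<Longrightarrow> x \<in> carrier A \<Longrightarrow> \<phi> g x \<in> carrier A"
  using ring_hom_closed[OF \<phi>_hom] .

lemma \<phi>_add: "g \<in> carrier H \<Longrightarrow> x \<in> carrier A \<Longrightarrow> y \<in> carrier A \<Longrightarrow> \<phi> g (x \<oplus> y) = \<phi> g x \<oplus> \<phi> g y"
  using ring_hom_add[OF \<phi>_hom] .

lemma \<phi>_mult: "g \<in> carrier H \<Longrightarrow> x \<in> carrier A \<Longrightarrow> y \<in> carrier A \<Longrightarrow> \<phi> g (x \<otimes> y) = \<phi> g x \<otimes> \<phi> g y"
  using ring_hom_mult[OF \<phi>_hom] .

lemma \<phi>_zero: "g \<in> carrier H \<Longrightarrow> \<phi> g \<zero> = \<zero>"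
  by (intro additive_map_zero[OF A.abelian_group_axioms A.abelian_group_axioms]) (auto simp: \<phi>_add \<phi>_closed)

lemma \<phi>_finsum:
  "g \<in> carrier H \<Longrightarrow> f \<in> I \<rightarrow> carrier A \<Longrightarrow> \<phi> g (\<Oplus>i\<in>I. f i) = (\<Oplus>i\<in>I. \<phi> g (f i))"
  by (intro additive_map_finsum[OF A.abelian_group_axioms A.abelian_group_axioms]) (auto simp: \<phi>_add \<phi>_closed)

lemma \<phi>_inv: "g \<in> carrier H \<Longrightarrow> x \<in> carrier A \<Longrightarrow> \<phi> g (\<phi> (inv\<^bsub>H\<^esub> g) x) = x"
  using \<phi>_comp[of g "inv\<^bsub>H\<^esub> g" x] \<phi>_one by simp

lemma finsum_left_translate:
  assumes "abelian_group M" "k \<in> carrier H" "f \<in> carrier H \<rightarrow> carrier M"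
  shows "(\<Oplus>\<^bsub>M\<^esub>g\<in>carrier H. f (k \<otimes>\<^bsub>H\<^esub> g)) = (\<Oplus>\<^bsub>M\<^esub>g\<in>carrier H. f g)"
proof -
  interpret M: abelian_group M by fact
  have "(\<Oplus>\<^bsub>M\<^esub>g\<in>(\<otimes>\<^bsub>H\<^esub>) k ` carrier H. f g) = (\<Oplus>\<^bsub>M\<^esub>g\<in>carrier H. f (k \<otimes>\<^bsub>H\<^esub> g))"
    using assms(3) H.surj_const_mult[OF assms(2)] by (intro M.finsum_reindex H.inj_on_cmult[OF assms(2)]) simp
  then show ?thesis unfolding H.surj_const_mult[OF assms(2)] by simp
qed

lemma finsum_right_translate:
  assumes "abelian_group M" "k \<in> carrier H" "f \<in> carrier H \<rightarrow> carrier M"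
  shows "(\<Oplus>\<^bsub>M\<^esub>g\<in>carrier H. f (g \<otimes>\<^bsub>H\<^esub> k)) = (\<Oplus>\<^bsub>M\<^esub>g\<in>carrier H. f g)"
proof -
  interpret M: abelian_group M by fact
  have surj: "(\<lambda>g. g \<otimes>\<^bsub>H\<^esub> k) ` carrier H = carrier H"
  proof (intro equalityI subsetI)
    fix x assume x: "x \<in> carrier H"
    then have "x = (x \<otimes>\<^bsub>H\<^esub> inv\<^bsub>H\<^esub> k) \<otimes>\<^bsub>H\<^esub> k" using assms(2) by (simp add: H.m_assoc)
    then show "x \<in> (\<lambda>g. g \<otimes>\<^bsub>H\<^esub> k) ` carrier H" using x assms(2) by blast
  qed (use assms(2) in auto)
  have "(\<Oplus>\<^bsub>M\<^esub>g\<in>(\<lambda>g. g \<otimes>\<^bsub>H\<^esub> k) ` carrier H. f g) = (\<Oplus>\<^bsub>M\<^esub>g\<in>carrier H. f (g \<otimes>\<^bsub>H\<^esub> k))"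
    using assms(2,3) surj by (intro M.finsum_reindex) (auto simp: inj_on_def)
  then show ?thesis unfolding surj by simp
qed

section \<open>The skew group algebra as a ring\<close>

abbreviation "T \<equiv> skew_group_algebra A H \<phi>"

lemma skew_simps:
  "f \<in> carrier T \<longleftrightarrow> (\<forall>g\<in>carrier H. f g \<in> carrier A) \<and> (\<forall>g. g \<notin> carrier H \<longrightarrow> f g = \<zero>)"
  "(f1 \<oplus>\<^bsub>T\<^esub> f2) x = f1 x \<oplus> f2 x" "\<zero>\<^bsub>T\<^esub> x = \<zero>"
  "\<one>\<^bsub>T\<^esub> x = (if x = \<one>\<^bsub>H\<^esub> then \<one> else \<zero>)"
  by (simp_all add: skew_group_algebra_def)

lemma skew_closed: "f \<in> carrier T \<Longrightarrow> f x \<in> carrier A"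
  by (cases "x \<in> carrier H") (simp_all add: skew_simps)

lemma skew_outside: "f \<in> carrier T \<Longrightarrow> x \<notin> carrier H \<Longrightarrow> f x = \<zero>"
  by (simp add: skew_simps)

text \<open>A pair with product \<open>x\<close> is determined by its first entry, which turns the
  convolution into a sum over one group variable. For \<open>x\<close> outside the group there are
  no such pairs.\<close>

lemma skew_mult:
  assumes f: "f \<in> carrier T" and f': "f' \<in> carrier T"
  shows "(f \<otimes>\<^bsub>T\<^esub> f') x =
    (if x \<in> carrier H then \<Oplus>g\<in>carrier H. f g \<otimes> \<phi> g (f' (inv\<^bsub>H\<^esub> g \<otimes>\<^bsub>H\<^esub> x)) else \<zero>)"
proof -
  define D where "D = {q \<in> carrier H \<times> carrier H. fst q \<otimes>\<^bsub>H\<^esub> snd q = x}"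
  have eq: "(f \<otimes>\<^bsub>T\<^esub> f') x = (\<Oplus>q\<in>D. f (fst q) \<otimes> \<phi> (fst q) (f' (snd q)))"
    by (simp add: skew_group_algebra_def D_def)
  show ?thesis
  proof (cases "x \<in> carrier H")
    case True
    have D: "D = (\<lambda>g. (g, inv\<^bsub>H\<^esub> g \<otimes>\<^bsub>H\<^esub> x)) ` carrier H"
    proof (intro equalityI subsetI)
      fix q assume "q \<in> D"
      then have q: "fst q \<in> carrier H" "snd q \<in> carrier H" "x = fst q \<otimes>\<^bsub>H\<^esub> snd q" by (auto simp: D_def)
      then have "q = (fst q, inv\<^bsub>H\<^esub> (fst q) \<otimes>\<^bsub>H\<^esub> x)" by (simp add: H.m_assoc[symmetric])
      then show "q \<in> (\<lambda>g. (g, inv\<^bsub>H\<^esub> g \<otimes>\<^bsub>H\<^esub> x)) ` carrier H" using q by blast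
    next
      fix q assume "q \<in> (\<lambda>g. (g, inv\<^bsub>H\<^esub> g \<otimes>\<^bsub>H\<^esub> x)) ` carrier H"
      then show "q \<in> D" using True by (auto simp: D_def H.m_assoc[symmetric])
    qed
    have "(\<Oplus>q\<in>D. f (fst q) \<otimes> \<phi> (fst q) (f' (snd q))) =
        (\<Oplus>g\<in>carrier H. f (fst (g, inv\<^bsub>H\<^esub> g \<otimes>\<^bsub>H\<^esub> x)) \<otimes> \<phi> (fst (g, inv\<^bsub>H\<^esub> g \<otimes>\<^bsub>H\<^esub> x)) (f' (snd (g, inv\<^bsub>H\<^esub> g \<otimes>\<^bsub>H\<^esub> x))))"
      unfolding D using skew_closed[OF f] skew_closed[OF f'] True
      by (intro A.finsum_reindex) (auto simp: inj_on_def \<phi>_closed)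
    then show ?thesis using eq True by simp
  next
    case False
    then have "D = {}" by (auto simp: D_def)
    then show ?thesis using eq False by simp
  qed
qed

lemma skew_mult_summand:
  assumes "f \<in> carrier T" "f' \<in> carrier T" "g \<in> carrier H"
  shows "f g \<otimes> \<phi> g (f' y) \<in> carrier A"
  using skew_closed[OF assms(1)] skew_closed[OF assms(2)] assms(3) by (simp add: \<phi>_closed)

lemma skew_mult_closed:
  assumes "f \<in> carrier T" "f' \<in> carrier T"
  shows "f \<otimes>\<^bsub>T\<^esub> f' \<in> carrier T"
  unfolding skew_simps(1) skew_mult[OF assms] using skew_mult_summand[OF assms]
  by (auto intro!: A.finsum_closed)

text \<open>Both sides become double sums of the same terms. After the order of summation is
  exchanged, the substitution of \<open>b a\<close> for \<open>a\<close> makes the twisted arguments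
  agree.\<close>

lemma skew_assoc:
  assumes f: "f \<in> carrier T" and f': "f' \<in> carrier T" and f'': "f'' \<in> carrier T"
  shows "f \<otimes>\<^bsub>T\<^esub> f' \<otimes>\<^bsub>T\<^esub> f'' = f \<otimes>\<^bsub>T\<^esub> (f' \<otimes>\<^bsub>T\<^esub> f'')"
proof
  fix x
  note c = skew_closed[OF f] skew_closed[OF f'] skew_closed[OF f'']
  show "(f \<otimes>\<^bsub>T\<^esub> f' \<otimes>\<^bsub>T\<^esub> f'') x = (f \<otimes>\<^bsub>T\<^esub> (f' \<otimes>\<^bsub>T\<^esub> f'')) x"
  proof (cases "x \<in> carrier H")
    case x: True
    define s where "s = (\<lambda>b a. f b \<otimes> \<phi> b (f' (inv\<^bsub>H\<^esub> b \<otimes>\<^bsub>H\<^esub> a)) \<otimes> \<phi> a (f'' (inv\<^bsub>H\<^esub> a \<otimes>\<^bsub>H\<^esub> x)))"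
    have sc: "s b a \<in> carrier A" if "b \<in> carrier H" "a \<in> carrier H" for a b
      using that c by (simp add: s_def \<phi>_closed)
    have "(f \<otimes>\<^bsub>T\<^esub> f' \<otimes>\<^bsub>T\<^esub> f'') x = (\<Oplus>a\<in>carrier H.
        (\<Oplus>b\<in>carrier H. f b \<otimes> \<phi> b (f' (inv\<^bsub>H\<^esub> b \<otimes>\<^bsub>H\<^esub> a))) \<otimes> \<phi> a (f'' (inv\<^bsub>H\<^esub> a \<otimes>\<^bsub>H\<^esub> x)))"
      using x skew_mult_summand[OF f f'] c
      by (subst skew_mult[OF skew_mult_closed[OF f f'] f''])
        (auto simp: skew_mult[OF f f'] \<phi>_closed intro!: A.finsum_cong' A.m_closed A.finsum_closed)
    also have "\<dots> = (\<Oplus>a\<in>carrier H. \<Oplus>b\<in>carrier H. s b a)"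
    proof (intro A.finsum_cong' refl)
      fix a assume a: "a \<in> carrier H"
      show "(\<Oplus>b\<in>carrier H. f b \<otimes> \<phi> b (f' (inv\<^bsub>H\<^esub> b \<otimes>\<^bsub>H\<^esub> a))) \<otimes> \<phi> a (f'' (inv\<^bsub>H\<^esub> a \<otimes>\<^bsub>H\<^esub> x)) =
          (\<Oplus>b\<in>carrier H. s b a)"
        unfolding s_def using skew_mult_summand[OF f f'] a c fin
        by (intro A.finsum_ldistr) (auto simp: \<phi>_closed)
    qed (use sc in \<open>auto intro!: A.finsum_closed\<close>)
    also have "\<dots> = (\<Oplus>b\<in>carrier H. \<Oplus>a\<in>carrier H. s b a)"
      using sc fin by (intro A.finsum_swap) auto
    also have "\<dots> = (\<Oplus>b\<in>carrier H. f b \<otimes> \<phi> b ((f' \<otimes>\<^bsub>T\<^esub> f'') (inv\<^bsub>H\<^esub> b \<otimes>\<^bsub>H\<^esub> x)))"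
    proof (intro A.finsum_cong' refl)
      fix b assume b: "b \<in> carrier H"
      have bx: "inv\<^bsub>H\<^esub> b \<otimes>\<^bsub>H\<^esub> x \<in> carrier H" using b x by simp
      have "(\<Oplus>a\<in>carrier H. s b a) = (\<Oplus>a\<in>carrier H. s b (b \<otimes>\<^bsub>H\<^esub> a))"
        using sc b by (intro finsum_left_translate[symmetric, OF A.abelian_group_axioms]) auto
      also have "\<dots> = (\<Oplus>a\<in>carrier H. f b \<otimes> \<phi> b (f' a \<otimes> \<phi> a (f'' (inv\<^bsub>H\<^esub> a \<otimes>\<^bsub>H\<^esub> (inv\<^bsub>H\<^esub> b \<otimes>\<^bsub>H\<^esub> x)))))"
        using b x c
        by (intro A.finsum_cong')
          (auto simp: s_def \<phi>_closed \<phi>_mult \<phi>_comp A.m_assoc H.m_assoc[symmetric] H.inv_mult_group)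
      also have "\<dots> = f b \<otimes> (\<Oplus>a\<in>carrier H. \<phi> b (f' a \<otimes> \<phi> a (f'' (inv\<^bsub>H\<^esub> a \<otimes>\<^bsub>H\<^esub> (inv\<^bsub>H\<^esub> b \<otimes>\<^bsub>H\<^esub> x)))))"
        using b x c fin by (intro A.finsum_rdistr[symmetric]) (auto simp: \<phi>_closed)
      also have "(\<Oplus>a\<in>carrier H. \<phi> b (f' a \<otimes> \<phi> a (f'' (inv\<^bsub>H\<^esub> a \<otimes>\<^bsub>H\<^esub> (inv\<^bsub>H\<^esub> b \<otimes>\<^bsub>H\<^esub> x))))) =
          \<phi> b (\<Oplus>a\<in>carrier H. f' a \<otimes> \<phi> a (f'' (inv\<^bsub>H\<^esub> a \<otimes>\<^bsub>H\<^esub> (inv\<^bsub>H\<^esub> b \<otimes>\<^bsub>H\<^esub> x))))"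
        using skew_mult_summand[OF f' f''] by (intro \<phi>_finsum[symmetric, OF b]) auto
      finally show "(\<Oplus>a\<in>carrier H. s b a) = f b \<otimes> \<phi> b ((f' \<otimes>\<^bsub>T\<^esub> f'') (inv\<^bsub>H\<^esub> b \<otimes>\<^bsub>H\<^esub> x))"
        using bx by (simp add: skew_mult[OF f' f''])
    qed (use skew_mult_summand[OF f skew_mult_closed[OF f' f'']] in auto)
    also have "\<dots> = (f \<otimes>\<^bsub>T\<^esub> (f' \<otimes>\<^bsub>T\<^esub> f'')) x"
      using x by (simp add: skew_mult[OF f skew_mult_closed[OF f' f'']])
    finally show ?thesis .
  qed (simp add: skew_mult skew_mult_closed assms)
qed

text \<open>The pure tensor \<open>a \<otimes> g\<close>.\<close>

definition single :: "'g \<Rightarrow> 'a \<Rightarrow> 'g \<Rightarrow> 'a" where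
  "single g a = (\<lambda>x. if x = g then a else \<zero>)"

lemma single_closed: "g \<in> carrier H \<Longrightarrow> a \<in> carrier A \<Longrightarrow> single g a \<in> carrier T"
  by (auto simp: skew_simps single_def)

lemma single_one: "single \<one>\<^bsub>H\<^esub> \<one> = \<one>\<^bsub>T\<^esub>"
  by (auto simp: skew_simps single_def)

lemma single_mult:
  assumes g: "g \<in> carrier H" and a: "a \<in> carrier A" and f: "f \<in> carrier T"
  shows "(single g a \<otimes>\<^bsub>T\<^esub> f) x = (if x \<in> carrier H then a \<otimes> \<phi> g (f (inv\<^bsub>H\<^esub> g \<otimes>\<^bsub>H\<^esub> x)) else \<zero>)"
proof -
  have "(\<Oplus>k\<in>carrier H. single g a k \<otimes> \<phi> k (f (inv\<^bsub>H\<^esub> k \<otimes>\<^bsub>H\<^esub> x))) = single g a g \<otimes> \<phi> g (f (inv\<^bsub>H\<^esub> g \<otimes>\<^bsub>H\<^esub> x))"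
    using fin g skew_mult_summand[OF single_closed[OF g a] f g] skew_closed[OF f]
    by (intro A.finsum_single) (auto simp: single_def \<phi>_closed)
  then show ?thesis unfolding skew_mult[OF single_closed[OF g a] f] by (simp add: single_def)
qed

lemma inv_mult_eq_iff:
  assumes "g \<in> carrier H" "h \<in> carrier H" "x \<in> carrier H"
  shows "inv\<^bsub>H\<^esub> g \<otimes>\<^bsub>H\<^esub> x = h \<longleftrightarrow> x = g \<otimes>\<^bsub>H\<^esub> h"
proof
  assume "inv\<^bsub>H\<^esub> g \<otimes>\<^bsub>H\<^esub> x = h"
  then have "g \<otimes>\<^bsub>H\<^esub> h = g \<otimes>\<^bsub>H\<^esub> (inv\<^bsub>H\<^esub> g \<otimes>\<^bsub>H\<^esub> x)" by simp
  then show "x = g \<otimes>\<^bsub>H\<^esub> h" using assms by (simp add: H.m_assoc[symmetric])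
next
  assume "x = g \<otimes>\<^bsub>H\<^esub> h"
  then show "inv\<^bsub>H\<^esub> g \<otimes>\<^bsub>H\<^esub> x = h" using assms by (simp add: H.m_assoc[symmetric])
qed

lemma single_single:
  assumes "g \<in> carrier H" "a \<in> carrier A" "h \<in> carrier H" "b \<in> carrier A"
  shows "single g a \<otimes>\<^bsub>T\<^esub> single h b = single (g \<otimes>\<^bsub>H\<^esub> h) (a \<otimes> \<phi> g b)"
proof
  fix x
  have "inv\<^bsub>H\<^esub> g \<otimes>\<^bsub>H\<^esub> x = h \<longleftrightarrow> x = g \<otimes>\<^bsub>H\<^esub> h" if "x \<in> carrier H"
    using that assms by (simp add: inv_mult_eq_iff)
  then show "(single g a \<otimes>\<^bsub>T\<^esub> single h b) x = single (g \<otimes>\<^bsub>H\<^esub> h) (a \<otimes> \<phi> g b) x"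
    unfolding single_mult[OF assms(1,2) single_closed[OF assms(3,4)]]
    using assms by (auto simp: single_def \<phi>_zero)
qed

lemma ring_skew: "ring T"
proof (rule ringI)
  show "abelian_group T"
  proof (rule abelian_groupI, goal_cases)
    case (6 f)
    then show ?case
      by (intro bexI[of _ "\<lambda>x. \<ominus> f x"]) (auto simp: skew_simps fun_eq_iff A.l_neg skew_closed)
  qed (auto simp: skew_simps fun_eq_iff A.a_ac skew_closed)
  show "monoid T"
  proof (rule monoidI)
    show "\<one>\<^bsub>T\<^esub> \<in> carrier T" using single_closed[OF H.one_closed A.one_closed] by (simp add: single_one)
    fix f assume f: "f \<in> carrier T"
    show "\<one>\<^bsub>T\<^esub> \<otimes>\<^bsub>T\<^esub> f = f"
      unfolding single_one[symmetric]
      using skew_closed[OF f] skew_outside[OF f]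
      by (auto simp: single_mult[OF H.one_closed A.one_closed f] \<phi>_one fun_eq_iff)
    show "f \<otimes>\<^bsub>T\<^esub> \<one>\<^bsub>T\<^esub> = f"
    proof
      fix x
      have e: "inv\<^bsub>H\<^esub> g \<otimes>\<^bsub>H\<^esub> x = \<one>\<^bsub>H\<^esub> \<longleftrightarrow> g = x" if "x \<in> carrier H" "g \<in> carrier H" for g
        using that inv_mult_eq_iff[of g "\<one>\<^bsub>H\<^esub>" x] by auto
      have "(\<Oplus>g\<in>carrier H. f g \<otimes> \<phi> g (single \<one>\<^bsub>H\<^esub> \<one> (inv\<^bsub>H\<^esub> g \<otimes>\<^bsub>H\<^esub> x))) = f x" if x: "x \<in> carrier H"
        using x fin skew_closed[OF f] ring_hom_one[OF \<phi>_hom[OF x]]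
        by (subst A.finsum_single[of _ x]) (auto simp: single_def e \<phi>_zero)
      then show "(f \<otimes>\<^bsub>T\<^esub> \<one>\<^bsub>T\<^esub>) x = f x"
        unfolding single_one[symmetric]
        using skew_outside[OF f] by (simp add: skew_mult[OF f single_closed])
    qed
  qed (fact skew_mult_closed skew_assoc)+
  fix f f' f'' assume f: "f \<in> carrier T" and f': "f' \<in> carrier T" and f'': "f'' \<in> carrier T"
  note c = skew_closed[OF f] skew_closed[OF f'] skew_closed[OF f'']
  have add: "f \<oplus>\<^bsub>T\<^esub> f' \<in> carrier T" if "f \<in> carrier T" "f' \<in> carrier T" for f f' using that by (simp add: skew_simps)
  show "(f \<oplus>\<^bsub>T\<^esub> f') \<otimes>\<^bsub>T\<^esub> f'' = f \<otimes>\<^bsub>T\<^esub> f'' \<oplus>\<^bsub>T\<^esub> f' \<otimes>\<^bsub>T\<^esub> f''"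
  proof
    fix x
    have "(\<Oplus>g\<in>carrier H. (f g \<oplus> f' g) \<otimes> \<phi> g (f'' (inv\<^bsub>H\<^esub> g \<otimes>\<^bsub>H\<^esub> x))) =
        (\<Oplus>g\<in>carrier H. f g \<otimes> \<phi> g (f'' (inv\<^bsub>H\<^esub> g \<otimes>\<^bsub>H\<^esub> x)) \<oplus> f' g \<otimes> \<phi> g (f'' (inv\<^bsub>H\<^esub> g \<otimes>\<^bsub>H\<^esub> x)))"
      using c by (intro A.finsum_cong') (auto simp: A.l_distr \<phi>_closed)
    also have "\<dots> = (\<Oplus>g\<in>carrier H. f g \<otimes> \<phi> g (f'' (inv\<^bsub>H\<^esub> g \<otimes>\<^bsub>H\<^esub> x))) \<oplus>
        (\<Oplus>g\<in>carrier H. f' g \<otimes> \<phi> g (f'' (inv\<^bsub>H\<^esub> g \<otimes>\<^bsub>H\<^esub> x)))"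
      using skew_mult_summand[OF f f''] skew_mult_summand[OF f' f''] by (intro A.finsum_addf) auto
    finally show "((f \<oplus>\<^bsub>T\<^esub> f') \<otimes>\<^bsub>T\<^esub> f'') x = (f \<otimes>\<^bsub>T\<^esub> f'' \<oplus>\<^bsub>T\<^esub> f' \<otimes>\<^bsub>T\<^esub> f'') x"
      by (simp add: skew_mult[OF add[OF f f'] f''] skew_mult[OF f f''] skew_mult[OF f' f''] skew_simps(2))
  qed
  show "f'' \<otimes>\<^bsub>T\<^esub> (f \<oplus>\<^bsub>T\<^esub> f') = f'' \<otimes>\<^bsub>T\<^esub> f \<oplus>\<^bsub>T\<^esub> f'' \<otimes>\<^bsub>T\<^esub> f'"
  proof
    fix x
    have "(\<Oplus>g\<in>carrier H. f'' g \<otimes> \<phi> g (f (inv\<^bsub>H\<^esub> g \<otimes>\<^bsub>H\<^esub> x) \<oplus> f' (inv\<^bsub>H\<^esub> g \<otimes>\<^bsub>H\<^esub> x))) =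
        (\<Oplus>g\<in>carrier H. f'' g \<otimes> \<phi> g (f (inv\<^bsub>H\<^esub> g \<otimes>\<^bsub>H\<^esub> x)) \<oplus> f'' g \<otimes> \<phi> g (f' (inv\<^bsub>H\<^esub> g \<otimes>\<^bsub>H\<^esub> x)))"
      using c by (intro A.finsum_cong') (auto simp: A.r_distr \<phi>_closed \<phi>_add)
    also have "\<dots> = (\<Oplus>g\<in>carrier H. f'' g \<otimes> \<phi> g (f (inv\<^bsub>H\<^esub> g \<otimes>\<^bsub>H\<^esub> x))) \<oplus>
        (\<Oplus>g\<in>carrier H. f'' g \<otimes> \<phi> g (f' (inv\<^bsub>H\<^esub> g \<otimes>\<^bsub>H\<^esub> x)))"
      using skew_mult_summand[OF f'' f] skew_mult_summand[OF f'' f'] by (intro A.finsum_addf) auto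
    finally show "(f'' \<otimes>\<^bsub>T\<^esub> (f \<oplus>\<^bsub>T\<^esub> f')) x = (f'' \<otimes>\<^bsub>T\<^esub> f \<oplus>\<^bsub>T\<^esub> f'' \<otimes>\<^bsub>T\<^esub> f') x"
      by (simp add: skew_mult[OF f'' add[OF f f']] skew_mult[OF f'' f] skew_mult[OF f'' f'] skew_simps(2))
  qed
qed

text \<open>The algebra is free as a left module on the group elements, and the coordinate at
  \<open>g\<close> of an element, encoded as a function, is its value at \<open>g\<close>.\<close>

lemma skew_extension_skew:
  "skew_extension A T H \<phi> (single \<one>\<^bsub>H\<^esub>) (\<lambda>g. single g \<one>) (\<lambda>g f. f g)"
proof (rule skew_extension.intro, goal_cases)
  case 1 show ?case by (rule A)
next
  case 2 show ?case by (rule ring_skew)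
next
  case 3 show ?case by (rule H)
next
  case 4 show ?case by (rule fin)
next
  case 5
  show ?case
  proof (rule ring_hom_memI)
    fix x y assume xy: "x \<in> carrier A" "y \<in> carrier A"
    show "single \<one>\<^bsub>H\<^esub> x \<in> carrier T" by (rule single_closed[OF H.one_closed xy(1)])
    show "single \<one>\<^bsub>H\<^esub> (x \<otimes> y) = single \<one>\<^bsub>H\<^esub> x \<otimes>\<^bsub>T\<^esub> single \<one>\<^bsub>H\<^esub> y"
      using xy by (simp add: single_single \<phi>_one)
    show "single \<one>\<^bsub>H\<^esub> (x \<oplus> y) = single \<one>\<^bsub>H\<^esub> x \<oplus>\<^bsub>T\<^esub> single \<one>\<^bsub>H\<^esub> y"
      using xy by (auto simp: skew_simps fun_eq_iff single_def)
  qed (rule single_one)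
next
  case (6 g x) then show ?case by (rule \<phi>_closed)
next
  case (7 g x) then show ?case by (rule \<phi>_inv)
next
  case (8 g) then show ?case by (simp add: single_closed)
next
  case 9 show ?case by (rule single_one)
next
  case (10 g h) then show ?case by (simp add: single_single ring_hom_one[OF \<phi>_hom])
next
  case (11 g x) then show ?case by (simp add: single_single \<phi>_closed ring_hom_one[OF \<phi>_hom] \<phi>_one)
next
  case (12 g s) then show ?case by (simp add: skew_closed)
next
  case (13 g r s) then show ?case by (simp add: skew_simps)
next
  case (14 g x s) then show ?case by (simp add: single_mult skew_closed \<phi>_one)
next
  \<comment> \<open>Right multiplication by \<open>x\<close> multiplies the coordinate at
    \<open>g\<close> by \<open>\<phi> g x\<close>; at the identity the twist disappears.\<close>
  case (15 x s)
  have e: "inv\<^bsub>H\<^esub> g \<otimes>\<^bsub>H\<^esub> \<one>\<^bsub>H\<^esub> = \<one>\<^bsub>H\<^esub> \<longleftrightarrow> g = \<one>\<^bsub>H\<^esub>" if "g \<in> carrier H" for g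
    using that inv_mult_eq_iff[of g "\<one>\<^bsub>H\<^esub>" "\<one>\<^bsub>H\<^esub>"] by auto
  have "(\<Oplus>g\<in>carrier H. s g \<otimes> \<phi> g (single \<one>\<^bsub>H\<^esub> x (inv\<^bsub>H\<^esub> g \<otimes>\<^bsub>H\<^esub> \<one>\<^bsub>H\<^esub>))) = s \<one>\<^bsub>H\<^esub> \<otimes> x"
    using 15 fin skew_closed by (subst A.finsum_single[of _ "\<one>\<^bsub>H\<^esub>"]) (auto simp: single_def e \<phi>_zero \<phi>_one)
  then show ?case using 15 by (simp add: skew_mult[OF 15(2) single_closed])
next
  case (16 g h) then show ?case by (simp add: single_def)
next
  case (17 s)
  interpret T: ring T by (rule ring_skew)
  have sg: "single \<one>\<^bsub>H\<^esub> (s g) \<otimes>\<^bsub>T\<^esub> single g \<one> = single g (s g)" if "g \<in> carrier H" for g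
    using that skew_closed[OF 17] by (simp add: single_single ring_hom_one[OF \<phi>_hom])
  have sc: "(\<lambda>g. single g (s g)) \<in> carrier H \<rightarrow> carrier T"
    using skew_closed[OF 17] by (auto intro: single_closed)
  have "(\<Oplus>\<^bsub>T\<^esub>g\<in>carrier H. single \<one>\<^bsub>H\<^esub> (s g) \<otimes>\<^bsub>T\<^esub> single g \<one>) = (\<Oplus>\<^bsub>T\<^esub>g\<in>carrier H. single g (s g))"
    using sc by (intro T.finsum_cong' sg refl)
  also have "\<dots> = s"
  proof
    fix x
    have "(\<Oplus>\<^bsub>T\<^esub>g\<in>carrier H. single g (s g)) x = (\<Oplus>g\<in>carrier H. single g (s g) x)"
      using sc skew_closed
      by (intro additive_map_finsum[OF T.abelian_group_axioms A.abelian_group_axioms, where f="\<lambda>f. f x"])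
        (auto simp: skew_simps(2))
    also have "\<dots> = s x"
    proof (cases "x \<in> carrier H")
      case True
      then show ?thesis using fin skew_closed[OF 17] by (subst A.finsum_single[of _ x]) (auto simp: single_def)
    next
      case False
      then have "(\<Oplus>g\<in>carrier H. single g (s g) x) = \<zero>"
        by (intro A.add.finprod_one_eqI) (auto simp: single_def)
      then show ?thesis using skew_outside[OF 17 False] by simp
    qed
    finally show "(\<Oplus>\<^bsub>T\<^esub>g\<in>carrier H. single g (s g)) x = s x" .
  qed
  finally show ?case by simp
qed

section \<open>Free orbits and a central element of trace 1\<close>

lemma free_orbit_idempotent:
  assumes E: "finite E" "E \<subseteq> carrier A" "(\<Oplus>f\<in>E. f) = \<one>"
    and orth: "\<And>f f'. f \<in> E \<Longrightarrow> f' \<in> E \<Longrightarrow> f \<noteq> f' \<Longrightarrow> f \<otimes> f' = \<zero>"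
    and stable: "\<And>g f. g \<in> carrier H \<Longrightarrow> f \<in> E \<Longrightarrow> \<phi> g f \<in> E"
    and free: "\<And>g f. g \<in> carrier H \<Longrightarrow> f \<in> E \<Longrightarrow> \<phi> g f = f \<Longrightarrow> g = \<one>\<^bsub>H\<^esub>"
  shows "\<exists>e\<in>carrier A. (\<Oplus>h\<in>carrier H. \<phi> h e) = \<one> \<and>
    (\<forall>g\<in>carrier H. \<forall>h\<in>carrier H. g \<noteq> h \<longrightarrow> \<phi> g e \<otimes> \<phi> h e = \<zero>)"
proof -
  \<comment> \<open>The predicate depends only on the orbit of \<open>f\<close>, and so does the
    chosen element. This makes \<open>rep\<close> constant on orbits.\<close>
  define rep where "rep f = (SOME f'. \<exists>g\<in>carrier H. f' = \<phi> g f)" for f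
  have rep: "\<exists>g\<in>carrier H. rep f = \<phi> g f" for f
    unfolding rep_def by (rule someI_ex) blast
  have E_closed: "f \<in> carrier A" if "f \<in> E" for f using E that by auto
  have rep_\<phi>: "rep (\<phi> h f) = rep f" if h: "h \<in> carrier H" and f: "f \<in> E" for h f
  proof -
    have "(\<exists>g\<in>carrier H. f' = \<phi> g (\<phi> h f)) \<longleftrightarrow> (\<exists>g\<in>carrier H. f' = \<phi> g f)" for f'
    proof
      assume "\<exists>g\<in>carrier H. f' = \<phi> g (\<phi> h f)"
      then obtain g where "g \<in> carrier H" "f' = \<phi> (g \<otimes>\<^bsub>H\<^esub> h) f" using \<phi>_comp h E_closed[OF f] by auto
      then show "\<exists>g\<in>carrier H. f' = \<phi> g f" using h by blast
    next
      assume "\<exists>g\<in>carrier H. f' = \<phi> g f"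
      then obtain g where g: "g \<in> carrier H" "f' = \<phi> g f" by auto
      have "\<phi> (g \<otimes>\<^bsub>H\<^esub> inv\<^bsub>H\<^esub> h) (\<phi> h f) = \<phi> (g \<otimes>\<^bsub>H\<^esub> inv\<^bsub>H\<^esub> h \<otimes>\<^bsub>H\<^esub> h) f"
        using g h E_closed[OF f] by (intro \<phi>_comp[symmetric]) auto
      also have "g \<otimes>\<^bsub>H\<^esub> inv\<^bsub>H\<^esub> h \<otimes>\<^bsub>H\<^esub> h = g" using g h by (simp add: H.m_assoc)
      finally show "\<exists>g\<in>carrier H. f' = \<phi> g (\<phi> h f)"
        using g h by (intro bexI[of _ "g \<otimes>\<^bsub>H\<^esub> inv\<^bsub>H\<^esub> h"]) auto
    qed
    then show ?thesis by (simp add: rep_def)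
  qed
  define R where "R = rep ` E"
  have R: "R \<subseteq> E"
  proof
    fix f assume "f \<in> R"
    then obtain a where a: "a \<in> E" "f = rep a" by (auto simp: R_def)
    obtain g where "g \<in> carrier H" "rep a = \<phi> g a" using rep by blast
    then show "f \<in> E" using stable[of g a] a by simp
  qed
  have rep_R: "rep f = f" if f: "f \<in> R" for f
  proof -
    obtain a where a: "a \<in> E" "f = rep a" using f by (auto simp: R_def)
    obtain g where "g \<in> carrier H" "rep a = \<phi> g a" using rep by blast
    then show ?thesis using a rep_\<phi>[of g a] by simp
  qed
  \<comment> \<open>Freeness makes the map from pairs \<open>(g, f)\<close> to
    \<open>\<phi> g f\<close> injective on the group times the representatives. Hence
    \<open>E\<close> is enumerated without repetition, and distinct translates of the sum of
    representatives involve different elements of \<open>E\<close>.\<close>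
  have uniq: "g = h \<and> f = f'" if g: "g \<in> carrier H" and h: "h \<in> carrier H" and f: "f \<in> R" and f': "f' \<in> R"
    and eq: "\<phi> g f = \<phi> h f'" for g h f f'
  proof -
    have fE: "f \<in> E" "f' \<in> E" using f f' R by auto
    have ff: "f = f'" using rep_\<phi>[OF g fE(1)] rep_\<phi>[OF h fE(2)] eq rep_R[OF f] rep_R[OF f'] by simp
    have "\<phi> (inv\<^bsub>H\<^esub> h \<otimes>\<^bsub>H\<^esub> g) f = \<phi> (inv\<^bsub>H\<^esub> h) (\<phi> h f)"
      using \<phi>_comp[of "inv\<^bsub>H\<^esub> h" g f] g h E_closed[OF fE(1)] eq ff by simp
    also have "\<dots> = f" using \<phi>_inv[of "inv\<^bsub>H\<^esub> h" f] h E_closed[OF fE(1)] by simp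
    finally have "inv\<^bsub>H\<^esub> h \<otimes>\<^bsub>H\<^esub> g = \<one>\<^bsub>H\<^esub>" using free[of "inv\<^bsub>H\<^esub> h \<otimes>\<^bsub>H\<^esub> g" f] g h fE by simp
    then have "g = h" using inv_mult_eq_iff[of h "\<one>\<^bsub>H\<^esub>" g] g h by simp
    then show ?thesis using ff by simp
  qed
  have finR: "finite R" using E(1) by (simp add: R_def)
  have Rc: "f \<in> carrier A" if "f \<in> R" for f using that R E by auto
  define e where "e = (\<Oplus>f\<in>R. f)"
  have e: "e \<in> carrier A" unfolding e_def using Rc by (intro A.finsum_closed) auto
  have \<phi>e: "\<phi> h e = (\<Oplus>f\<in>R. \<phi> h f)" if "h \<in> carrier H" for h
    unfolding e_def using Rc by (intro \<phi>_finsum[OF that]) auto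
  have \<phi>Rc: "\<phi> h f \<in> carrier A" if "h \<in> carrier H" "f \<in> R" for h f using that Rc \<phi>_closed by auto
  have onto: "(\<lambda>p. \<phi> (fst p) (snd p)) ` (carrier H \<times> R) = E"
  proof (intro equalityI subsetI)
    fix a assume a: "a \<in> E"
    obtain g where g: "g \<in> carrier H" "rep a = \<phi> g a" using rep by blast
    have "a = \<phi> (inv\<^bsub>H\<^esub> g) (rep a)" using g \<phi>_inv[of "inv\<^bsub>H\<^esub> g" a] E_closed[OF a] by simp
    moreover have "(inv\<^bsub>H\<^esub> g, rep a) \<in> carrier H \<times> R" unfolding R_def using H.inv_closed[OF g(1)] a by blast
    ultimately show "a \<in> (\<lambda>p. \<phi> (fst p) (snd p)) ` (carrier H \<times> R)"
      by (intro image_eqI[of _ _ "(inv\<^bsub>H\<^esub> g, rep a)"]) simp_all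
  qed (use stable R in auto)
  have "(\<Oplus>h\<in>carrier H. \<phi> h e) = (\<Oplus>h\<in>carrier H. \<Oplus>f\<in>R. \<phi> h f)"
    using \<phi>Rc by (intro A.finsum_cong' refl \<phi>e) (auto intro!: A.finsum_closed)
  also have "\<dots> = (\<Oplus>p\<in>carrier H \<times> R. \<phi> (fst p) (snd p))"
    using fin finR \<phi>Rc by (intro A.finsum_Sigma) auto
  also have "\<dots> = (\<Oplus>f\<in>(\<lambda>p. \<phi> (fst p) (snd p)) ` (carrier H \<times> R). f)"
    using onto E uniq by (intro A.finsum_reindex[symmetric]) (auto simp: inj_on_def)
  also have "\<dots> = \<one>" unfolding onto by (rule E(3))
  finally have sum: "(\<Oplus>h\<in>carrier H. \<phi> h e) = \<one>" .
  have "\<phi> g e \<otimes> \<phi> h e = \<zero>" if g: "g \<in> carrier H" and h: "h \<in> carrier H" and gh: "g \<noteq> h" for g h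
  proof -
    have "\<phi> g f \<otimes> \<phi> h e = \<zero>" if f: "f \<in> R" for f
    proof -
      have "\<phi> g f \<otimes> \<phi> h e = (\<Oplus>f'\<in>R. \<phi> g f \<otimes> \<phi> h f')"
        unfolding \<phi>e[OF h] using finR \<phi>Rc g h f by (intro A.finsum_rdistr) auto
      also have "\<dots> = \<zero>"
        using uniq[OF g h f] gh g h f R stable by (intro A.add.finprod_one_eqI) (auto intro!: orth)
      finally show ?thesis .
    qed
    moreover have "\<phi> g e \<otimes> \<phi> h e = (\<Oplus>f\<in>R. \<phi> g f \<otimes> \<phi> h e)"
      unfolding \<phi>e[OF g] using finR \<phi>Rc g \<phi>_closed[OF h e] by (intro A.finsum_ldistr) auto
    ultimately show ?thesis by (simp add: A.add.finprod_one_eqI)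
  qed
  with e sum show ?thesis by blast
qed

text \<open>Writing \<open>e\<^sub>h = h(e)\<close>, the element \<open>z = \<Sum>\<^sub>h e\<^sub>h \<pi>(e\<^sub>h) e\<^sub>h\<close> is the component at the identity of the
  element of \<open>End(\<Lambda>\<^sub>S) = \<Lambda>S\<close> that corresponds to \<open>\<pi>\<close>. For \<open>\<mu> = e\<^sub>g \<lambda> e\<^sub>h\<close> the trace \<open>m\<close> of \<open>\<mu>\<close>
  satisfies \<open>e\<^sub>g m = \<mu> = m e\<^sub>h\<close>, so \<open>z \<mu>\<close> and \<open>\<mu> z\<close> are both \<open>e\<^sub>g \<pi>(\<mu>) e\<^sub>h\<close>.\<close>

lemma central_element_of_trace_one:
  assumes e: "e \<in> carrier A" and sum: "(\<Oplus>h\<in>carrier H. \<phi> h e) = \<one>"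
    and orth: "\<And>g h. g \<in> carrier H \<Longrightarrow> h \<in> carrier H \<Longrightarrow> g \<noteq> h \<Longrightarrow> \<phi> g e \<otimes> \<phi> h e = \<zero>"
    and F: "F = {x \<in> carrier A. \<forall>g\<in>carrier H. \<phi> g x = x}"
    and \<pi>: "\<pi> \<in> carrier A \<rightarrow> F"
    and \<pi>_add: "\<And>x y. x \<in> carrier A \<Longrightarrow> y \<in> carrier A \<Longrightarrow> \<pi> (x \<oplus> y) = \<pi> x \<oplus> \<pi> y"
    and \<pi>_left: "\<And>a x. a \<in> F \<Longrightarrow> x \<in> carrier A \<Longrightarrow> \<pi> (a \<otimes> x) = a \<otimes> \<pi> x"
    and \<pi>_right: "\<And>a x. a \<in> F \<Longrightarrow> x \<in> carrier A \<Longrightarrow> \<pi> (x \<otimes> a) = \<pi> x \<otimes> a"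
    and \<pi>_one: "\<pi> \<one> = \<one>"
  shows "\<exists>z\<in>carrier A. (\<forall>x\<in>carrier A. z \<otimes> x = x \<otimes> z) \<and> (\<Oplus>g\<in>carrier H. \<phi> g z) = \<one>"
proof -
  define d where "d h = \<phi> h e" for h
  have d: "d h \<in> carrier A" if "h \<in> carrier H" for h using \<phi>_closed[OF that e] by (simp add: d_def)
  have d_sum: "(\<Oplus>h\<in>carrier H. d h) = \<one>" using sum by (simp add: d_def)
  have d_orth: "d g \<otimes> d h = \<zero>" if "g \<in> carrier H" "h \<in> carrier H" "g \<noteq> h" for g h
    using orth[OF that] by (simp add: d_def)
  have \<phi>d: "\<phi> g (d h) = d (g \<otimes>\<^bsub>H\<^esub> h)" if "g \<in> carrier H" "h \<in> carrier H" for g h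
    using \<phi>_comp[OF that e] by (simp add: d_def)
  \<comment> \<open>Multiplying the decomposition of 1 by \<open>d g\<close> leaves only the square
    of \<open>d g\<close>, by orthogonality.\<close>
  have d_idem: "d g \<otimes> d g = d g" if g: "g \<in> carrier H" for g
  proof -
    have "d g = d g \<otimes> (\<Oplus>h\<in>carrier H. d h)" using d[OF g] by (simp add: d_sum)
    also have "\<dots> = (\<Oplus>h\<in>carrier H. d g \<otimes> d h)" using d d[OF g] fin by (intro A.finsum_rdistr) auto
    also have "\<dots> = d g \<otimes> d g" using fin g d d_orth by (intro A.finsum_single) auto
    finally show ?thesis by simp
  qed
  have \<pi>F: "\<pi> x \<in> F" if "x \<in> carrier A" for x using \<pi> that by auto
  have \<pi>c: "\<pi> x \<in> carrier A" if "x \<in> carrier A" for x using \<pi>F[OF that] by (simp add: F)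
  have \<phi>\<pi>: "\<phi> g (\<pi> x) = \<pi> x" if "g \<in> carrier H" "x \<in> carrier A" for g x using \<pi>F[OF that(2)] that(1) by (simp add: F)
  define w where "w h = d h \<otimes> \<pi> (d h) \<otimes> d h" for h
  have w: "w h \<in> carrier A" if "h \<in> carrier H" for h using d[OF that] \<pi>c by (simp add: w_def)
  define z where "z = (\<Oplus>h\<in>carrier H. w h)"
  have z: "z \<in> carrier A" unfolding z_def using w by (intro A.finsum_closed) auto
  have zd: "z \<otimes> d g = w g" and dz: "d g \<otimes> z = w g" if g: "g \<in> carrier H" for g
  proof -
    have "w h \<otimes> d g = (if h = g then w g else \<zero>)" if h: "h \<in> carrier H" for h
      using d[OF h] d[OF g] \<pi>c d_idem[OF g] d_orth[OF h g] by (simp add: w_def A.m_assoc)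
    then have "(\<Oplus>h\<in>carrier H. w h \<otimes> d g) = w g"
      using fin g w by (subst A.finsum_single[of _ g]) auto
    then show "z \<otimes> d g = w g"
      unfolding z_def using w d[OF g] fin by (subst A.finsum_ldistr) auto
    have "d g \<otimes> w h = (if h = g then w g else \<zero>)" if h: "h \<in> carrier H" for h
      using d[OF h] d[OF g] \<pi>c d_idem[OF g] d_orth[OF g h] by (simp add: w_def A.m_assoc[symmetric])
    then have "(\<Oplus>h\<in>carrier H. d g \<otimes> w h) = w g"
      using fin g w by (subst A.finsum_single[of _ g]) auto
    then show "d g \<otimes> z = w g"
      unfolding z_def using w d[OF g] fin by (subst A.finsum_rdistr) auto
  qed
  \<comment> \<open>Every \<open>x\<close> is the sum of its corners \<open>d g x d h\<close>, so it
    suffices to commute \<open>z\<close> with these.\<close>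
  have corner: "z \<otimes> (d g \<otimes> x \<otimes> d h) = (d g \<otimes> x \<otimes> d h) \<otimes> z"
    if g: "g \<in> carrier H" and h: "h \<in> carrier H" and x: "x \<in> carrier A" for g h x
  proof -
    define \<mu> where "\<mu> = d g \<otimes> x \<otimes> d h"
    have \<mu>: "\<mu> \<in> carrier A" using d[OF g] d[OF h] x by (simp add: \<mu>_def)
    define m where "m = (\<Oplus>k\<in>carrier H. \<phi> k \<mu>)"
    have m: "m \<in> carrier A" unfolding m_def using \<mu> \<phi>_closed by (intro A.finsum_closed) auto
    have "\<phi> k m = m" if k: "k \<in> carrier H" for k
    proof -
      have "\<phi> k m = (\<Oplus>l\<in>carrier H. \<phi> k (\<phi> l \<mu>))"
        unfolding m_def using \<mu> \<phi>_closed by (intro \<phi>_finsum[OF k]) auto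
      also have "\<dots> = (\<Oplus>l\<in>carrier H. \<phi> (k \<otimes>\<^bsub>H\<^esub> l) \<mu>)"
        using \<mu> k \<phi>_closed by (intro A.finsum_cong') (auto simp: \<phi>_comp)
      also have "\<dots> = m"
        unfolding m_def using \<mu> \<phi>_closed by (intro finsum_left_translate[OF A.abelian_group_axioms k]) auto
      finally show ?thesis .
    qed
    then have mF: "m \<in> F" using m by (simp add: F)
    have \<phi>\<mu>: "\<phi> k \<mu> = d (k \<otimes>\<^bsub>H\<^esub> g) \<otimes> \<phi> k x \<otimes> d (k \<otimes>\<^bsub>H\<^esub> h)" if k: "k \<in> carrier H" for k
      using k g h x d by (simp add: \<mu>_def \<phi>_mult \<phi>d)
    have fixg: "k = \<one>\<^bsub>H\<^esub>" if "k \<in> carrier H" "k' \<in> carrier H" "k \<otimes>\<^bsub>H\<^esub> k' = k'" for k k'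
      using that by simp
    have dm: "d g \<otimes> m = \<mu>"
    proof -
      have "d g \<otimes> m = (\<Oplus>k\<in>carrier H. d g \<otimes> \<phi> k \<mu>)"
        unfolding m_def using \<mu> \<phi>_closed d[OF g] fin by (intro A.finsum_rdistr) auto
      also have "\<dots> = d g \<otimes> \<phi> \<one>\<^bsub>H\<^esub> \<mu>"
      proof (rule A.finsum_single[OF fin H.one_closed])
        show "d g \<otimes> \<phi> \<one>\<^bsub>H\<^esub> \<mu> \<in> carrier A" using d[OF g] \<mu> \<phi>_closed by simp
        fix k assume k: "k \<in> carrier H" "k \<noteq> \<one>\<^bsub>H\<^esub>"
        then have "d g \<otimes> d (k \<otimes>\<^bsub>H\<^esub> g) = \<zero>" using g fixg[of k g] by (intro d_orth) auto
        then show "d g \<otimes> \<phi> k \<mu> = \<zero>"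
          using k g h x d \<phi>_closed by (simp add: \<phi>\<mu> A.m_assoc[symmetric])
      qed
      also have "\<dots> = \<mu>"
        using \<mu> d[OF g] d[OF h] x by (simp add: \<phi>_one) (simp add: \<mu>_def A.m_assoc[symmetric] d_idem[OF g])
      finally show ?thesis .
    qed
    have md: "m \<otimes> d h = \<mu>"
    proof -
      have "m \<otimes> d h = (\<Oplus>k\<in>carrier H. \<phi> k \<mu> \<otimes> d h)"
        unfolding m_def using \<mu> \<phi>_closed d[OF h] fin by (intro A.finsum_ldistr) auto
      also have "\<dots> = \<phi> \<one>\<^bsub>H\<^esub> \<mu> \<otimes> d h"
      proof (rule A.finsum_single[OF fin H.one_closed])
        show "\<phi> \<one>\<^bsub>H\<^esub> \<mu> \<otimes> d h \<in> carrier A" using d[OF h] \<mu> \<phi>_closed by simp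
        fix k assume k: "k \<in> carrier H" "k \<noteq> \<one>\<^bsub>H\<^esub>"
        then have "d (k \<otimes>\<^bsub>H\<^esub> h) \<otimes> d h = \<zero>" using h fixg[of k h] by (intro d_orth) auto
        then show "\<phi> k \<mu> \<otimes> d h = \<zero>"
          using k g h x d \<phi>_closed by (simp add: \<phi>\<mu> A.m_assoc)
      qed
      also have "\<dots> = \<mu>"
        using \<mu> d[OF g] d[OF h] x by (simp add: \<phi>_one) (simp add: \<mu>_def A.m_assoc d_idem[OF h])
      finally show ?thesis .
    qed
    have d\<mu>: "d g \<otimes> \<mu> = \<mu>" "\<mu> \<otimes> d h = \<mu>"
      using d[OF g] d[OF h] x d_idem[OF g] d_idem[OF h] by (simp_all add: \<mu>_def A.m_assoc) (simp add: A.m_assoc[symmetric])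
    note cl = d[OF g] d[OF h] \<mu> m z \<pi>c[OF d[OF g]] \<pi>c[OF d[OF h]] \<pi>c[OF \<mu>]
    have "z \<otimes> \<mu> = (z \<otimes> d g) \<otimes> \<mu>" using cl d\<mu>(1) by (simp add: A.m_assoc)
    also have "\<dots> = d g \<otimes> \<pi> (d g) \<otimes> \<mu>" using cl d\<mu>(1) by (simp add: zd[OF g] w_def A.m_assoc)
    also have "\<dots> = d g \<otimes> \<pi> (d g) \<otimes> (m \<otimes> d h)" by (simp add: md)
    also have "\<dots> = d g \<otimes> (\<pi> (d g) \<otimes> m) \<otimes> d h" using cl by (simp add: A.m_assoc)
    also have "\<pi> (d g) \<otimes> m = \<pi> \<mu>" using \<pi>_right[OF mF d[OF g]] dm by simp
    finally have 1: "z \<otimes> \<mu> = d g \<otimes> \<pi> \<mu> \<otimes> d h" .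
    have "\<mu> \<otimes> z = \<mu> \<otimes> (d h \<otimes> z)" using cl d\<mu>(2) by (simp add: A.m_assoc[symmetric])
    also have "\<dots> = \<mu> \<otimes> \<pi> (d h) \<otimes> d h" using cl d\<mu>(2) by (simp add: dz[OF h] w_def A.m_assoc[symmetric])
    also have "\<dots> = d g \<otimes> m \<otimes> \<pi> (d h) \<otimes> d h" by (simp add: dm)
    also have "\<dots> = d g \<otimes> (m \<otimes> \<pi> (d h)) \<otimes> d h" using cl by (simp add: A.m_assoc)
    also have "m \<otimes> \<pi> (d h) = \<pi> \<mu>" using \<pi>_left[OF mF d[OF h]] md by simp
    finally have 2: "\<mu> \<otimes> z = d g \<otimes> \<pi> \<mu> \<otimes> d h" .
    show ?thesis using 1 2 unfolding \<mu>_def by simp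
  qed
  have central: "z \<otimes> x = x \<otimes> z" if x: "x \<in> carrier A" for x
  proof -
    have half: "z \<otimes> (d g \<otimes> x) = (d g \<otimes> x) \<otimes> z" if g: "g \<in> carrier H" for g
    proof -
      have dgx: "d g \<otimes> x \<in> carrier A" using d[OF g] x by simp
      have dx: "d g \<otimes> x = (\<Oplus>h\<in>carrier H. d g \<otimes> x \<otimes> d h)"
        using d dgx fin d_sum by (subst A.finsum_rdistr[symmetric]) auto
      have "z \<otimes> (d g \<otimes> x) = (\<Oplus>h\<in>carrier H. z \<otimes> (d g \<otimes> x \<otimes> d h))"
        using d dgx fin z by (subst dx) (intro A.finsum_rdistr, auto)
      also have "\<dots> = (\<Oplus>h\<in>carrier H. (d g \<otimes> x \<otimes> d h) \<otimes> z)"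
        using d dgx z corner[OF g _ x] by (intro A.finsum_cong') auto
      also have "\<dots> = (d g \<otimes> x) \<otimes> z"
        using d dgx fin z by (subst (2) dx) (intro A.finsum_ldistr[symmetric], auto)
      finally show ?thesis .
    qed
    have xs: "x = (\<Oplus>g\<in>carrier H. d g \<otimes> x)"
      using d x fin d_sum by (subst A.finsum_ldistr[symmetric]) auto
    have "z \<otimes> x = (\<Oplus>g\<in>carrier H. z \<otimes> (d g \<otimes> x))"
      using d x fin z by (subst xs) (intro A.finsum_rdistr, auto)
    also have "\<dots> = (\<Oplus>g\<in>carrier H. (d g \<otimes> x) \<otimes> z)"
      using d x z half by (intro A.finsum_cong') auto
    also have "\<dots> = x \<otimes> z"
      using d x fin z by (subst (2) xs) (intro A.finsum_ldistr[symmetric], auto)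
    finally show ?thesis .
  qed
  have s: "d k \<otimes> \<pi> (d h) \<otimes> d k \<in> carrier A" if "k \<in> carrier H" "h \<in> carrier H" for k h
    using d[OF that(1)] d[OF that(2)] \<pi>c by simp
  \<comment> \<open>With \<open>k = g h\<close> the double sum regroups into terms
    \<open>d k \<pi> (d h) d k\<close>. Summing over \<open>h\<close> first produces
    \<open>\<pi> 1 = 1\<close> in the middle, and the \<open>d k\<close> that remain add up to
    1.\<close>
  have "(\<Oplus>g\<in>carrier H. \<phi> g z) =
      (\<Oplus>g\<in>carrier H. \<Oplus>h\<in>carrier H. d (g \<otimes>\<^bsub>H\<^esub> h) \<otimes> \<pi> (d h) \<otimes> d (g \<otimes>\<^bsub>H\<^esub> h))"
  proof (intro A.finsum_cong' refl)
    fix g assume g: "g \<in> carrier H"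
    have "\<phi> g z = (\<Oplus>h\<in>carrier H. \<phi> g (w h))" unfolding z_def using w by (intro \<phi>_finsum[OF g]) auto
    also have "\<dots> = (\<Oplus>h\<in>carrier H. d (g \<otimes>\<^bsub>H\<^esub> h) \<otimes> \<pi> (d h) \<otimes> d (g \<otimes>\<^bsub>H\<^esub> h))"
      using g d \<pi>c s by (intro A.finsum_cong') (auto simp: w_def \<phi>_mult \<phi>d \<phi>\<pi>)
    finally show "\<phi> g z = (\<Oplus>h\<in>carrier H. d (g \<otimes>\<^bsub>H\<^esub> h) \<otimes> \<pi> (d h) \<otimes> d (g \<otimes>\<^bsub>H\<^esub> h))" .
  qed (use s in \<open>auto intro!: A.finsum_closed\<close>)
  also have "\<dots> = (\<Oplus>h\<in>carrier H. \<Oplus>g\<in>carrier H. d (g \<otimes>\<^bsub>H\<^esub> h) \<otimes> \<pi> (d h) \<otimes> d (g \<otimes>\<^bsub>H\<^esub> h))"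
    using fin s by (intro A.finsum_swap) auto
  also have "\<dots> = (\<Oplus>h\<in>carrier H. \<Oplus>k\<in>carrier H. d k \<otimes> \<pi> (d h) \<otimes> d k)"
  proof (rule A.finsum_cong'[OF refl])
    fix h assume h: "h \<in> carrier H"
    show "(\<Oplus>g\<in>carrier H. d (g \<otimes>\<^bsub>H\<^esub> h) \<otimes> \<pi> (d h) \<otimes> d (g \<otimes>\<^bsub>H\<^esub> h)) =
        (\<Oplus>k\<in>carrier H. d k \<otimes> \<pi> (d h) \<otimes> d k)"
      using s h by (intro finsum_right_translate[OF A.abelian_group_axioms h,
            where f="\<lambda>k. d k \<otimes> \<pi> (d h) \<otimes> d k"]) auto
  qed (use s in \<open>auto intro!: A.finsum_closed\<close>)
  also have "\<dots> = (\<Oplus>k\<in>carrier H. \<Oplus>h\<in>carrier H. d k \<otimes> \<pi> (d h) \<otimes> d k)"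
    using fin s by (intro A.finsum_swap) auto
  also have "\<dots> = (\<Oplus>k\<in>carrier H. d k)"
  proof (intro A.finsum_cong' refl)
    fix k assume k: "k \<in> carrier H"
    have "\<pi> \<in> carrier A \<rightarrow> carrier A" using \<pi>c by auto
    from additive_map_finsum[OF A.abelian_group_axioms A.abelian_group_axioms this \<pi>_add, of d "carrier H"]
    have \<pi>s: "(\<Oplus>h\<in>carrier H. \<pi> (d h)) = \<one>" using d d_sum \<pi>_one by auto
    have "(\<Oplus>h\<in>carrier H. d k \<otimes> \<pi> (d h) \<otimes> d k) = (\<Oplus>h\<in>carrier H. d k \<otimes> \<pi> (d h)) \<otimes> d k"
      using d d[OF k] \<pi>c fin by (intro A.finsum_ldistr[symmetric]) auto
    also have "(\<Oplus>h\<in>carrier H. d k \<otimes> \<pi> (d h)) = d k \<otimes> (\<Oplus>h\<in>carrier H. \<pi> (d h))"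
      using d d[OF k] \<pi>c fin by (intro A.finsum_rdistr[symmetric]) auto
    finally show "(\<Oplus>h\<in>carrier H. d k \<otimes> \<pi> (d h) \<otimes> d k) = d k"
      using d[OF k] d_idem[OF k] by (simp add: \<pi>s)
  qed (use d in auto)
  finally have "(\<Oplus>g\<in>carrier H. \<phi> g z) = \<one>" by (simp add: d_sum)
  then show ?thesis using z central by blast
qed

end

text \<open>The span of a finite generating set is a submodule containing it, hence everything; the
  set then serves as a spanning family indexed by itself.\<close>

lemma fd_over_assoc_algebra:
  assumes K: "field K" and A: "assoc_algebra K A" and fg: "finitely_generated K A"
  shows "\<exists>J. fd_over K A (\<lambda>k. k \<odot>\<^bsub>A\<^esub> \<one>\<^bsub>A\<^esub>) J (\<lambda>b. b)"
proof -
  interpret K: field K by fact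
  interpret A: assoc_algebra K A by fact
  have V: "left_module K A"
    by (intro left_module.intro left_module_axioms.intro K.ring_axioms A.abelian_group_axioms)
      (simp_all add: A.smult_l_distr A.smult_r_distr A.smult_assoc1)
  obtain B where B: "finite B" "B \<subseteq> carrier A" "\<forall>N. submodule N K A \<and> B \<subseteq> N \<longrightarrow> N = carrier A"
    using fg unfolding finitely_generated_def by blast
  have one_mult: "(k \<odot>\<^bsub>A\<^esub> \<one>\<^bsub>A\<^esub>) \<otimes>\<^bsub>A\<^esub> x = k \<odot>\<^bsub>A\<^esub> x" if "k \<in> carrier K" "x \<in> carrier A" for k x
    using A.smult_mult_left[OF that(1) A.one_closed that(2)] that by simp
  have "B \<subseteq> span_set A K B (\<lambda>b. b)"
  proof
    fix b assume b: "b \<in> B"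
    have "(\<Oplus>\<^bsub>A\<^esub>j\<in>B. (if j = b then \<one>\<^bsub>K\<^esub> else \<zero>\<^bsub>K\<^esub>) \<odot>\<^bsub>A\<^esub> j) = b"
      using B(1,2) b by (subst A.M.finsum_single[of _ b]) auto
    then show "b \<in> span_set A K B (\<lambda>b. b)"
      unfolding span_set_def by (intro CollectI exI[of _ "\<lambda>j. if j = b then \<one>\<^bsub>K\<^esub> else \<zero>\<^bsub>K\<^esub>"]) auto
  qed
  moreover have "submodule (span_set A K B (\<lambda>b. b)) K A" by (rule submodule_span_set[OF V]) (use B in auto)
  ultimately have span: "span_set A K B (\<lambda>b. b) = carrier A" using B(3) by blast
  have "\<exists>k\<in>B \<rightarrow> carrier K. x = (\<Oplus>\<^bsub>A\<^esub>i\<in>B. (k i \<odot>\<^bsub>A\<^esub> \<one>\<^bsub>A\<^esub>) \<otimes>\<^bsub>A\<^esub> i)" if x: "x \<in> carrier A" for x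
  proof -
    obtain k where k: "k \<in> B \<rightarrow> carrier K" "x = (\<Oplus>\<^bsub>A\<^esub>i\<in>B. k i \<odot>\<^bsub>A\<^esub> i)"
      using x span unfolding span_set_def by blast
    have "(\<Oplus>\<^bsub>A\<^esub>i\<in>B. (k i \<odot>\<^bsub>A\<^esub> \<one>\<^bsub>A\<^esub>) \<otimes>\<^bsub>A\<^esub> i) = (\<Oplus>\<^bsub>A\<^esub>i\<in>B. k i \<odot>\<^bsub>A\<^esub> i)"
      using k(1) B(2) by (intro A.M.finsum_cong') (auto simp: Pi_iff subset_iff one_mult)
    then show ?thesis using k by (intro bexI[of _ k]) simp_all
  qed
  moreover have "(\<lambda>k. k \<odot>\<^bsub>A\<^esub> \<one>\<^bsub>A\<^esub>) \<in> ring_hom K A"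
    by (rule ring_hom_memI) (simp_all add: one_mult A.smult_l_distr A.smult_assoc1)
  ultimately show ?thesis
    unfolding fd_over_def using K A.ring_axioms B(1,2) by (intro exI[of _ B]) auto
qed

text \<open>An abstract isomorphism with a direct sum does not make the inclusion of
  \<open>F\<close> the split embedding, so the first component may move 1. The preimage
  \<open>c\<close> of \<open>(1, 0)\<close> commutes with \<open>F\<close>: for \<open>a\<close> in
  \<open>F\<close>, both \<open>c a\<close> and \<open>a c\<close> are sent to
  \<open>(a, 0)\<close>. Multiplication by \<open>c\<close> is therefore a bimodule map, and
  following it by the first component yields a projection that fixes 1.\<close>

lemma split_bimodule_projection:
  fixes B :: "('a, 'b) bimodule"
  assumes A: "ring A" and F: "F \<subseteq> carrier A" "\<one>\<^bsub>A\<^esub> \<in> F"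
    and B: "bimodule_over (A\<lparr>carrier := F\<rparr>) B"
    and iso: "bimodule_iso (A\<lparr>carrier := F\<rparr>) (mult_bimodule A)
      (bimodule_sum (mult_bimodule (A\<lparr>carrier := F\<rparr>)) B)"
  shows "\<exists>\<pi>\<in>carrier A \<rightarrow> F. (\<forall>x\<in>carrier A. \<forall>y\<in>carrier A. \<pi> (x \<oplus>\<^bsub>A\<^esub> y) = \<pi> x \<oplus>\<^bsub>A\<^esub> \<pi> y) \<and>
    (\<forall>a\<in>F. \<forall>x\<in>carrier A. \<pi> (a \<otimes>\<^bsub>A\<^esub> x) = a \<otimes>\<^bsub>A\<^esub> \<pi> x \<and> \<pi> (x \<otimes>\<^bsub>A\<^esub> a) = \<pi> x \<otimes>\<^bsub>A\<^esub> a) \<and>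
    \<pi> \<one>\<^bsub>A\<^esub> = \<one>\<^bsub>A\<^esub>"
proof -
  interpret A: ring A by fact
  let ?F = "A\<lparr>carrier := F\<rparr>"
  let ?S = "bimodule_sum (mult_bimodule ?F) B"
  have S: "carrier ?S = F \<times> carrier B" "x \<oplus>\<^bsub>?S\<^esub> y = (fst x \<oplus>\<^bsub>A\<^esub> fst y, snd x \<oplus>\<^bsub>B\<^esub> snd y)"
    "a \<odot>\<^bsub>?S\<^esub> x = (a \<otimes>\<^bsub>A\<^esub> fst x, a \<odot>\<^bsub>B\<^esub> snd x)" "rsmult ?S x a = (fst x \<otimes>\<^bsub>A\<^esub> a, rsmult B (snd x) a)" for x y a
    by (simp_all add: bimodule_sum_def)
  obtain f where f: "f \<in> mod_hom ?F (mult_bimodule A) ?S" and bij: "bij_betw f (carrier A) (F \<times> carrier B)"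
    and right: "\<And>x a. x \<in> carrier A \<Longrightarrow> a \<in> F \<Longrightarrow> f (x \<otimes>\<^bsub>A\<^esub> a) = rsmult ?S (f x) a"
    using iso unfolding bimodule_iso_def S(1) by auto
  have FA: "a \<in> carrier A" if "a \<in> F" for a using that F by auto
  have f_closed: "fst (f x) \<in> F" if "x \<in> carrier A" for x
    using mod_hom_closed[OF f, of x] that by (auto simp: S)
  have f_add: "fst (f (x \<oplus>\<^bsub>A\<^esub> y)) = fst (f x) \<oplus>\<^bsub>A\<^esub> fst (f y)" if "x \<in> carrier A" "y \<in> carrier A" for x y
    using mod_hom_add[OF f, of x y] that by (simp add: S)
  have f_left: "f (a \<otimes>\<^bsub>A\<^esub> x) = (a \<otimes>\<^bsub>A\<^esub> fst (f x), a \<odot>\<^bsub>B\<^esub> snd (f x))" if "a \<in> F" "x \<in> carrier A" for a x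
    using mod_hom_smult[OF f, of a x] that by (simp add: S)
  have f_right: "f (x \<otimes>\<^bsub>A\<^esub> a) = (fst (f x) \<otimes>\<^bsub>A\<^esub> a, rsmult B (snd (f x)) a)" if "a \<in> F" "x \<in> carrier A" for a x
    using right[OF that(2,1)] by (simp add: S)
  have lB: "left_module ?F B" and rB: "\<And>x a. x \<in> carrier B \<Longrightarrow> a \<in> F \<Longrightarrow> rsmult B x a \<in> carrier B"
    and rB_add: "\<And>x y a. x \<in> carrier B \<Longrightarrow> y \<in> carrier B \<Longrightarrow> a \<in> F \<Longrightarrow>
      rsmult B (x \<oplus>\<^bsub>B\<^esub> y) a = rsmult B x a \<oplus>\<^bsub>B\<^esub> rsmult B y a"
    using B unfolding bimodule_over_def by auto
  interpret B: left_module ?F B by (rule lB)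
  have zero_left: "a \<odot>\<^bsub>B\<^esub> \<zero>\<^bsub>B\<^esub> = \<zero>\<^bsub>B\<^esub>" if "a \<in> F" for a using B.lsmult_zero_right[of a] that by simp
  have zero_right: "rsmult B \<zero>\<^bsub>B\<^esub> a = \<zero>\<^bsub>B\<^esub>" if "a \<in> F" for a
    using that rB rB_add
    by (intro additive_map_zero[OF B.abelian_group_self B.abelian_group_self, of "\<lambda>x. rsmult B x a"]) auto
  have "(\<one>\<^bsub>A\<^esub>, \<zero>\<^bsub>B\<^esub>) \<in> f ` carrier A" using bij F(2) by (simp add: bij_betw_def)
  then obtain c where c: "c \<in> carrier A" "f c = (\<one>\<^bsub>A\<^esub>, \<zero>\<^bsub>B\<^esub>)" by auto
  \<comment> \<open>The section sends \<open>1\<close> to \<open>c\<close>, which need not be \<open>1\<close>; it is normalised by multiplying with \<open>c\<close>.\<close>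
  have comm: "c \<otimes>\<^bsub>A\<^esub> a = a \<otimes>\<^bsub>A\<^esub> c" if a: "a \<in> F" for a
  proof -
    have "f (c \<otimes>\<^bsub>A\<^esub> a) = f (a \<otimes>\<^bsub>A\<^esub> c)"
      unfolding f_left[OF a c(1)] f_right[OF a c(1)] using FA[OF a] by (simp add: c(2) zero_left[OF a] zero_right[OF a])
    then show ?thesis using bij_betw_imp_inj_on[OF bij] c(1) FA[OF a] by (auto dest: inj_onD)
  qed
  show ?thesis
  proof (intro bexI[of _ "\<lambda>x. fst (f (c \<otimes>\<^bsub>A\<^esub> x))"] conjI ballI)
    show "(\<lambda>x. fst (f (c \<otimes>\<^bsub>A\<^esub> x))) \<in> carrier A \<rightarrow> F" using f_closed c by auto
    show "fst (f (c \<otimes>\<^bsub>A\<^esub> (x \<oplus>\<^bsub>A\<^esub> y))) = fst (f (c \<otimes>\<^bsub>A\<^esub> x)) \<oplus>\<^bsub>A\<^esub> fst (f (c \<otimes>\<^bsub>A\<^esub> y))"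
      if "x \<in> carrier A" "y \<in> carrier A" for x y using that c by (simp add: A.r_distr f_add)
    show "fst (f (c \<otimes>\<^bsub>A\<^esub> (a \<otimes>\<^bsub>A\<^esub> x))) = a \<otimes>\<^bsub>A\<^esub> fst (f (c \<otimes>\<^bsub>A\<^esub> x))" if a: "a \<in> F" and x: "x \<in> carrier A" for a x
    proof -
      have "c \<otimes>\<^bsub>A\<^esub> (a \<otimes>\<^bsub>A\<^esub> x) = a \<otimes>\<^bsub>A\<^esub> (c \<otimes>\<^bsub>A\<^esub> x)"
        using FA[OF a] c(1) x comm[OF a] by (simp add: A.m_assoc[symmetric])
      then show ?thesis using f_left[OF a, of "c \<otimes>\<^bsub>A\<^esub> x"] c x by simp
    qed
    show "fst (f (c \<otimes>\<^bsub>A\<^esub> (x \<otimes>\<^bsub>A\<^esub> a))) = fst (f (c \<otimes>\<^bsub>A\<^esub> x)) \<otimes>\<^bsub>A\<^esub> a" if a: "a \<in> F" and x: "x \<in> carrier A" for a x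
      using f_right[OF a, of "c \<otimes>\<^bsub>A\<^esub> x"] FA[OF a] c x by (simp add: A.m_assoc[symmetric])
    show "fst (f (c \<otimes>\<^bsub>A\<^esub> \<one>\<^bsub>A\<^esub>)) = \<one>\<^bsub>A\<^esub>" using c by simp
  qed
qed

theorem proposition3p6:
  fixes K :: "'k ring" and \<Lambda> :: "('k, 'a) module" and G :: "'g monoid"
    and \<phi> :: "'g \<Rightarrow> 'a \<Rightarrow> 'a" and p :: nat and S :: "'g set" and E :: "'a set"
    and B :: "('a, 'b) bimodule"
  assumes "algebraically_closed K" and "has_characteristic K p"
    and "assoc_algebra K \<Lambda>" and "finitely_generated K \<Lambda>"
    and "group G" and "finite (carrier G)"
    and "acts_by_automorphisms K \<Lambda> G \<phi>"
    and "sylow_subgroup p S G"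
    and "complete_primitive_idempotents \<Lambda> E"
    and "\<forall>g\<in>S. \<forall>e\<in>E. \<phi> g e \<in> E"
    and "acts_freely_on G S \<phi> E"
    and "bimodule_over (fixed_subalgebra \<Lambda> S \<phi>) B"
    and "bimodule_iso (fixed_subalgebra \<Lambda> S \<phi>) (mult_bimodule \<Lambda>)
           (bimodule_sum (mult_bimodule (fixed_subalgebra \<Lambda> S \<phi>)) B)"
  shows "strong_global_dimension \<Lambda> =
           strong_global_dimension (skew_group_algebra \<Lambda> (G\<lparr>carrier := S\<rparr>) \<phi>)"
proof -
  let ?H = "G\<lparr>carrier := S\<rparr>"
  have K: "field K" using assms(1) by (simp add: algebraically_closed_def)
  interpret \<Lambda>: assoc_algebra K \<Lambda> by fact
  have \<Lambda>: "ring \<Lambda>" by (rule \<Lambda>.ring_axioms)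
  have S: "subgroup S G" using assms(8) by (simp add: sylow_subgroup_def)
  have SG: "S \<subseteq> carrier G" by (rule subgroup.subset[OF S])
  interpret act: group_action G "carrier \<Lambda>" \<phi> using assms(7) by (simp add: acts_by_automorphisms_def)
  interpret ring_action \<Lambda> ?H \<phi>
  proof (rule ring_action.intro)
    show "ring \<Lambda>" by (rule \<Lambda>)
    show "group ?H" by (rule group.subgroup_imp_group[OF assms(5) S])
    show "finite (carrier ?H)" using finite_subset[OF SG assms(6)] by simp
    show "\<phi> g \<in> ring_hom \<Lambda> \<Lambda>" if "g \<in> carrier ?H" for g
      using assms(7) that SG by (auto simp: acts_by_automorphisms_def)
    show "\<phi> \<one>\<^bsub>?H\<^esub> x = x" if "x \<in> carrier \<Lambda>" for x
      using fun_cong[OF act.id_eq_one, of x] that by simp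
    show "\<phi> (g \<otimes>\<^bsub>?H\<^esub> h) x = \<phi> g (\<phi> h x)" if "g \<in> carrier ?H" "h \<in> carrier ?H" "x \<in> carrier \<Lambda>" for g h x
      using act.composition_rule[of x g h] that SG by auto
  qed
  define F where "F = {x \<in> carrier \<Lambda>. \<forall>g\<in>S. \<phi> g x = x}"
  have fixed: "fixed_subalgebra \<Lambda> S \<phi> = \<Lambda>\<lparr>carrier := F\<rparr>" by (simp add: fixed_subalgebra_def F_def)
  have F: "F \<subseteq> carrier \<Lambda>" "\<one>\<^bsub>\<Lambda>\<^esub> \<in> F" using ring_hom_one[OF \<phi>_hom] by (auto simp: F_def)
  have E: "finite E" "E \<subseteq> carrier \<Lambda>" "(\<Oplus>\<^bsub>\<Lambda>\<^esub>f\<in>E. f) = \<one>\<^bsub>\<Lambda>\<^esub>"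
    using assms(9) by (auto simp: complete_primitive_idempotents_def primitive_idempotent_def idempotent_elem_def)
  have orth: "f \<otimes>\<^bsub>\<Lambda>\<^esub> f' = \<zero>\<^bsub>\<Lambda>\<^esub>" if "f \<in> E" "f' \<in> E" "f \<noteq> f'" for f f'
    using assms(9) that by (auto simp: complete_primitive_idempotents_def orthogonal_elems_def)
  have stable: "\<phi> g f \<in> E" if "g \<in> carrier ?H" "f \<in> E" for g f using assms(10) that by simp
  have free: "g = \<one>\<^bsub>?H\<^esub>" if "g \<in> carrier ?H" "f \<in> E" "\<phi> g f = f" for g f
    using assms(11) that unfolding acts_freely_on_def by auto
  have "\<exists>e\<in>carrier \<Lambda>. (\<Oplus>\<^bsub>\<Lambda>\<^esub>h\<in>carrier ?H. \<phi> h e) = \<one>\<^bsub>\<Lambda>\<^esub> \<and>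
      (\<forall>g\<in>carrier ?H. \<forall>h\<in>carrier ?H. g \<noteq> h \<longrightarrow> \<phi> g e \<otimes>\<^bsub>\<Lambda>\<^esub> \<phi> h e = \<zero>\<^bsub>\<Lambda>\<^esub>)"
    by (rule free_orbit_idempotent[OF E]) (fact orth stable free)+
  then obtain e where e: "e \<in> carrier \<Lambda>" "(\<Oplus>\<^bsub>\<Lambda>\<^esub>h\<in>carrier ?H. \<phi> h e) = \<one>\<^bsub>\<Lambda>\<^esub>"
    "\<forall>g\<in>carrier ?H. \<forall>h\<in>carrier ?H. g \<noteq> h \<longrightarrow> \<phi> g e \<otimes>\<^bsub>\<Lambda>\<^esub> \<phi> h e = \<zero>\<^bsub>\<Lambda>\<^esub>"
    by (elim bexE conjE)
  obtain \<pi> where \<pi>: "\<pi> \<in> carrier \<Lambda> \<rightarrow> F"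
    "\<forall>x\<in>carrier \<Lambda>. \<forall>y\<in>carrier \<Lambda>. \<pi> (x \<oplus>\<^bsub>\<Lambda>\<^esub> y) = \<pi> x \<oplus>\<^bsub>\<Lambda>\<^esub> \<pi> y"
    "\<forall>a\<in>F. \<forall>x\<in>carrier \<Lambda>. \<pi> (a \<otimes>\<^bsub>\<Lambda>\<^esub> x) = a \<otimes>\<^bsub>\<Lambda>\<^esub> \<pi> x \<and> \<pi> (x \<otimes>\<^bsub>\<Lambda>\<^esub> a) = \<pi> x \<otimes>\<^bsub>\<Lambda>\<^esub> a"
    "\<pi> \<one>\<^bsub>\<Lambda>\<^esub> = \<one>\<^bsub>\<Lambda>\<^esub>"
    using split_bimodule_projection[OF \<Lambda> F assms(12,13)[unfolded fixed]] by (elim bexE conjE)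
  have F': "F = {x \<in> carrier \<Lambda>. \<forall>g\<in>carrier ?H. \<phi> g x = x}" by (simp add: F_def)
  have "\<exists>z\<in>carrier \<Lambda>. (\<forall>x\<in>carrier \<Lambda>. z \<otimes>\<^bsub>\<Lambda>\<^esub> x = x \<otimes>\<^bsub>\<Lambda>\<^esub> z) \<and> (\<Oplus>\<^bsub>\<Lambda>\<^esub>g\<in>carrier ?H. \<phi> g z) = \<one>\<^bsub>\<Lambda>\<^esub>"
    by (rule central_element_of_trace_one[OF e(1,2) _ F' \<pi>(1) _ _ _ \<pi>(4)]) (use e(3) \<pi>(2,3) in simp_all)
  then obtain z where z: "z \<in> carrier \<Lambda>" "\<forall>x\<in>carrier \<Lambda>. z \<otimes>\<^bsub>\<Lambda>\<^esub> x = x \<otimes>\<^bsub>\<Lambda>\<^esub> z"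
    "(\<Oplus>\<^bsub>\<Lambda>\<^esub>g\<in>carrier ?H. \<phi> g z) = \<one>\<^bsub>\<Lambda>\<^esub>"
    by (elim bexE conjE)
  obtain J where "fd_over K \<Lambda> (\<lambda>k. k \<odot>\<^bsub>\<Lambda>\<^esub> \<one>\<^bsub>\<Lambda>\<^esub>) J (\<lambda>b. b)"
    using fd_over_assoc_algebra[OF K assms(3,4)] by auto
  from skew_extension.strong_global_dimension_extension[OF skew_extension_skew this z(1) _ z(3)] z(2)
  show ?thesis by blast
qed

end
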